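(* Let $q\in[-1,1]$ and let $\varrho(N)$, $N\in\mathbb{N}$, be probability measures on $\hat U(N)$. Assume there is a function $\Psi$ analytic in a neighborhood of $1$ such that for every fixed $r\in\mathbb{N}$ \[ \lim_{N\to\infty}\frac1N\log S_{\varrho(N)}(u_1,\dots,u_r,1^{N-r})=\sum_{i=1}^r\Psi(u_i) \] uniformly in a neighborhood of $1^r$. Then for every $k\in\mathbb{N}$ the $k$-th moment of $m_{N,PP(q)}[\varrho(N)]$ converges in probability as $N\to\infty$ to \[ \sum_{m=0}^{k-1}\frac{k!}{m!\,(m+1)!\,(k-m)!}\frac{d^m}{du^m}\Big(e_q(u)\Psi'(e_q(u))+\frac{e_q(u)}{e_q(u)-1}-\frac1u\Big)^{k-m}\Big|_{u=0}, \] where $e_q(u)=(1-qu)^{-1/q}$ for $q\ne0$ and $e_0(u)=e^u$. Equivalently, the limiting measure $\mu^{(q)}$ has $R$-transform $R_{\mu^{(q)}}(z)=e_q(z)\Psi'(e_q(z))+\frac{e_q(z)}{e_q(z)-1}-\frac1z$ for $|z|$ small.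
   Context: A signature of length $N$ is a tuple $\lambda=(\lambda_1\ge\dots\ge\lambda_N)\in\mathbb{Z}^N$; $\hat U(N)$ denotes the set of signatures of length $N$. For $\lambda\in\hat U(N)$, $\chi^{\lambda}(u_1,\dots,u_N)=\det(u_i^{\lambda_j+N-j})_{i,j}/\prod_{i<j}(u_i-u_j)$ is the rational Schur function. For a probability measure $\varrho(N)$ on $\hat U(N)$, the Schur generating function is $S_{\varrho(N)}(u_1,\dots,u_N)=\sum_{\lambda\in\hat U(N)}\varrho(N)[\lambda]\,\chi^\lambda(u_1,\dots,u_N)/\chi^\lambda(1^N)$, where $1^N=(1,\dots,1)$; it is assumed that this series converges uniformly in a neighborhood of $1^N$. For $q\in[-1,1]$ and $\lambda\in\hat U(N)$ the $q$-deformed Perelomov–Popov measure is \[ m_{N,PP(q)}[\lambda]=\frac1N\sum_{i=1}^N\Big(\prod_{j\ne i}\frac{(\lambda_i-i)-(\lambda_j-j)-q}{(\lambda_i-i)-(\lambda_j-j)}\Big)\delta\Big(\frac{\lambda_i+N-i}{N}\Big), \] and $m_{N,PP(q)}[\varrho(N)]$ denotes the random measure $m_{N,PP(q)}[\lambda]$ with $\lambda$ distributed according to $\varrho(N)$. For a compactly supported probability measure $\mu$ on $\mathbb{R}$, the free cumulants $\kappa_n(\mu)$ are defined by $\int t^k\mu(dt)=\sum_{\pi\in NC(k)}\prod_{V\in\pi}\kappa_{|V|}(\mu)$ for all $k$, where $NC(k)$ is the set of non-crossing partitions of $\{1,\dots,k\}$; the $R$-transform is $R_\mu(z)=\sum_{n\ge1}\kappa_n(\mu)z^{n-1}$.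 *)

theory Defs
  imports "HOL-Complex_Analysis.Complex_Analysis" "HOL-Combinatorics.Permutations"
          "HOL-Probability.Probability_Mass_Function"
begin

definition signatures :: "nat \<Rightarrow> (nat \<Rightarrow> int) set" where
  "signatures N = {l. (\<forall>i j. 1 \<le> i \<longrightarrow> i \<le> j \<longrightarrow> j \<le> N \<longrightarrow> l j \<le> l i)
                      \<and> (\<forall>i. i \<notin> {1..N} \<longrightarrow> l i = 0)}"

definition generic_pts :: "nat \<Rightarrow> (nat \<Rightarrow> complex) set" where
  "generic_pts N = {u. (\<forall>i\<in>{1..N}. u i \<noteq> 0) \<and> (\<forall>i\<in>{1..N}. \<forall>j\<in>{1..N}. i \<noteq> j \<longrightarrow> u i \<noteq> u j)}"

text \<open>The ratio det(u_i^(l_j+N-j)) / prod_(i<j) (u_i - u_j); determinant by the Leibniz formula.\<close>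
definition schur_ratio :: "nat \<Rightarrow> (nat \<Rightarrow> int) \<Rightarrow> (nat \<Rightarrow> complex) \<Rightarrow> complex" where
  "schur_ratio N l u =
     (\<Sum>p | p permutes {1..N}. of_int (sign p) *
        (\<Prod>i\<in>{1..N}. u i powi (l (p i) + int N - int (p i))))
     / (\<Prod>i\<in>{1..N}. \<Prod>j\<in>{i<..N}. (u i - u j))"

text \<open>The rational Schur function, as a function: the ratio at generic points, and its
  continuous (Laurent-polynomial) extension elsewhere.\<close>
definition schur :: "nat \<Rightarrow> (nat \<Rightarrow> int) \<Rightarrow> (nat \<Rightarrow> complex) \<Rightarrow> complex" where
  "schur N l u = (if u \<in> generic_pts N then schur_ratio N l u
                  else Lim (at u within generic_pts N) (schur_ratio N l))"

definition sgf_term :: "nat \<Rightarrow> (nat \<Rightarrow> int) pmf \<Rightarrow> (nat \<Rightarrow> int) \<Rightarrow> (nat \<Rightarrow> complex) \<Rightarrow> complex" where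
  "sgf_term N \<rho> l u = of_real (pmf \<rho> l) * schur N l u / schur N l (\<lambda>_. 1)"

definition sgf :: "nat \<Rightarrow> (nat \<Rightarrow> int) pmf \<Rightarrow> (nat \<Rightarrow> complex) \<Rightarrow> complex" where
  "sgf N \<rho> u = (\<Sum>\<^sub>\<infinity>l\<in>signatures N. sgf_term N \<rho> l u)"

definition polydisc :: "nat \<Rightarrow> real \<Rightarrow> (nat \<Rightarrow> complex) set" where
  "polydisc r d = {u. (\<forall>i\<in>{1..r}. cmod (u i - 1) < d) \<and> (\<forall>i. i \<notin> {1..r} \<longrightarrow> u i = 1)}"

text \<open>Standing assumption: the series defining S converges uniformly in a neighbourhood of 1^N
  (uniform convergence of the net of finite partial sums).\<close>
definition sgf_unif_conv :: "nat \<Rightarrow> (nat \<Rightarrow> int) pmf \<Rightarrow> bool" where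
  "sgf_unif_conv N \<rho> \<longleftrightarrow> (\<exists>d>0. \<forall>e>0. \<exists>F0. finite F0 \<and> F0 \<subseteq> signatures N \<and>
      (\<forall>F. finite F \<and> F0 \<subseteq> F \<and> F \<subseteq> signatures N \<longrightarrow>
         (\<forall>u\<in>polydisc N d. cmod ((\<Sum>l\<in>F. sgf_term N \<rho> l u) - sgf N \<rho> u) < e)))"

definition pp_weight :: "nat \<Rightarrow> real \<Rightarrow> (nat \<Rightarrow> int) \<Rightarrow> nat \<Rightarrow> real" where
  "pp_weight N q l i =
     (\<Prod>j\<in>{1..N} - {i}. (real_of_int ((l i - int i) - (l j - int j)) - q)
                           / real_of_int ((l i - int i) - (l j - int j)))"

text \<open>k-th moment of m_{N,PP(q)}[l] = (1/N) sum_i w_i delta((l_i+N-i)/N).\<close>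
definition pp_moment :: "nat \<Rightarrow> real \<Rightarrow> (nat \<Rightarrow> int) \<Rightarrow> nat \<Rightarrow> real" where
  "pp_moment N q l k =
     (1 / real N) * (\<Sum>i=1..N. pp_weight N q l i * (real_of_int (l i + int N - int i) / real N) ^ k)"

definition e_q :: "real \<Rightarrow> complex \<Rightarrow> complex" where
  "e_q q u = (if q = 0 then exp u else (1 - of_real q * u) powr (- 1 / of_real q))"

definition Rfun :: "(complex \<Rightarrow> complex) \<Rightarrow> real \<Rightarrow> complex \<Rightarrow> complex" where
  "Rfun \<Psi> q u = e_q q u * deriv \<Psi> (e_q q u) + e_q q u / (e_q q u - 1) - 1 / u"

text \<open>Rfun with its removable singularity at 0 filled in.\<close>
definition Rfun_ext :: "(complex \<Rightarrow> complex) \<Rightarrow> real \<Rightarrow> complex \<Rightarrow> complex" where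
  "Rfun_ext \<Psi> q u = (if u = 0 then Lim (at 0) (Rfun \<Psi> q) else Rfun \<Psi> q u)"

definition limit_moment :: "(complex \<Rightarrow> complex) \<Rightarrow> real \<Rightarrow> nat \<Rightarrow> complex" where
  "limit_moment \<Psi> q k =
     (\<Sum>m<k. of_real (fact k / (fact m * fact (m + 1) * fact (k - m)))
             * (deriv ^^ m) (\<lambda>u. Rfun_ext \<Psi> q u ^ (k - m)) 0)"

end

theory Submission
  imports Defs "HOL-Real_Asymp.Real_Asymp"
begin

text \<open>
  Write \<open>x\<^sub>i = \<lambda>\<^sub>i + N - i\<close>. The operator
  \<open>f \<mapsto> V\<^sup>-\<^sup>1 \<Sum>\<^sub>i u\<^sub>i\<^sup>k \<partial>\<^sub>i\<^sup>k (V f)\<close>, with \<open>V\<close> the Vandermonde product, has the Schur functions as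
  eigenfunctions with eigenvalues \<open>\<Sum>\<^sub>i x\<^sub>i (x\<^sub>i - 1) \<cdots> (x\<^sub>i - k + 1)\<close>. Applied to a generating function
  it becomes a sum of divided differences of \<open>u\<^sub>i\<^sup>k \<partial>\<^sub>i\<^bsup>k-m\<^esup> f\<close> over the subsets of size \<open>m + 1\<close> of the
  variables; these are controlled by the maximum principle, and since \<open>\<partial>\<^sub>i S / (N S)\<close> converges to
  \<open>\<Psi>' (u\<^sub>i)\<close>, means and second moments of the normalised factorial power sums converge. Chebyshev's
  inequality then gives convergence in probability, first of the factorial and then of the ordinary
  power sums, to explicit limits.

  The Perelomov-Popov moments \<open>A\<^sub>k\<close> satisfy
  \<open>1 - q \<Sum>\<^sub>k A\<^sub>k t\<^bsup>k+1\<^esup> = \<Prod>\<^sub>j (1 - (x\<^sub>j + q) t) / (1 - x\<^sub>j t)\<close>, whose logarithmic derivative is a recurrence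
  in the power sums, so they converge too. Lagrange inversion identifies the limits: the generating
  series \<open>\<Lambda>\<close> of the limiting power sums and \<open>\<Omega>\<close> of the claimed moments satisfy
  \<open>\<Omega>' = (1 - q \<Omega>) \<Lambda>'\<close>, which is the limiting form of the recurrence.
\<close>

section \<open>Alternants\<close>

text \<open>The hypothesis controls the generating function S only when a bounded number of
  variables leave 1, while the operator differentiates in all N of them. The way out is that each
  divided difference involves at most k + 1 variables. If r variables are already free, it is enough
  to let r + k + 1 of them move over discs whose radius does not depend on N; the others only
  require some radius, which may shrink with N. Divided differences are undefined where variables
  coincide, so they are evaluated at a generic point near the point of interest and compared with it
  afterwards by continuity. The normalisation N^(k+1) splits into N^(k-m) for the k - m derivatives
  falling on the generating function and N^(m+1) for the choice of the subset. The Perelomov-Popov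
  weights are rational functions of the coordinates, not symmetric polynomials; the recurrence
  replaces their moments by power sums, to which the operator applies. Its coefficients contain no
  division by q, so that q = 0 is a regular value.\<close>

definition vdm :: "nat \<Rightarrow> (nat \<Rightarrow> complex) \<Rightarrow> complex" where
  "vdm N u = (\<Prod>i\<in>{1..N}. \<Prod>j\<in>{i<..N}. (u i - u j))"

text \<open>The size n is an ordinary argument, which permits induction on the number of variables;
  the shape is that of the numerator of \<open>schur_ratio\<close>.\<close>

definition ldet :: "nat \<Rightarrow> (nat \<Rightarrow> nat \<Rightarrow> complex) \<Rightarrow> complex" where
  "ldet n M = (\<Sum>p | p permutes {1..n}. of_int (sign p) * (\<Prod>i\<in>{1..n}. M i (p i)))"

lemma ldet_cong:
  assumes "\<And>i j. i \<in> {1..n} \<Longrightarrow> j \<in> {1..n} \<Longrightarrow> M i j = M' i j"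
  shows "ldet n M = ldet n M'"
  unfolding ldet_def
proof (intro sum.cong refl arg_cong2[where f=times] prod.cong)
  fix p i assume "p \<in> {p. p permutes {1..n}}" "i \<in> {1..n}"
  then have "p i \<in> {1..n}" by (metis mem_Collect_eq permutes_in_image)
  then show "M i (p i) = M' i (p i)" using assms \<open>i \<in> {1..n}\<close> by blast
qed

text \<open>Composing every permutation with the transposition of the two columns reverses all signs
  and keeps all products, so the determinant is its own negative.\<close>

lemma ldet_identical_columns:
  assumes "j \<in> {1..n}" "j' \<in> {1..n}" "j \<noteq> j'" "\<And>i. M i j = M i j'"
  shows "ldet n M = 0"
proof -
  let ?t = "Transposition.transpose j j'"
  have t: "?t permutes {1..n}" using assms by (intro permutes_swap_id) auto
  have "ldet n M = (\<Sum>p | p permutes {1..n}. of_int (sign (?t \<circ> p)) * (\<Prod>i\<in>{1..n}. M i ((?t \<circ> p) i)))"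
    unfolding ldet_def
    by (rule setum_permutations_compose_left[OF t])
  also have "\<dots> = (\<Sum>p | p permutes {1..n}. - (of_int (sign p) * (\<Prod>i\<in>{1..n}. M i (p i))))"
  proof (intro sum.cong refl)
    fix p assume "p \<in> {p. p permutes {1..n}}"
    then have p: "p permutes {1..n}" by simp
    have "permutation ?t" "permutation p"
      using t p permutation_permutes by (metis finite_atLeastAtMost)+
    then have s: "sign (?t \<circ> p) = - sign p"
      by (simp add: sign_compose sign_swap_id assms(3))
    have "M i (?t (p i)) = M i (p i)" for i
      using assms(4) by (auto simp: Transposition.transpose_def)
    then show "of_int (sign (?t \<circ> p)) * (\<Prod>i\<in>{1..n}. M i ((?t \<circ> p) i))
        = - (of_int (sign p) * (\<Prod>i\<in>{1..n}. M i (p i)) :: complex)"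
      by (simp add: s)
  qed
  also have "\<dots> = - ldet n M" by (simp add: ldet_def sum_negf)
  finally show ?thesis by simp
qed

text \<open>Linearity in column j splits off a determinant whose columns j and j' agree.\<close>

lemma ldet_column_add:
  assumes "j \<in> {1..n}" "j' \<in> {1..n}" "j \<noteq> j'"
  shows "ldet n (\<lambda>i k. if k = j then M i j + c * M i j' else M i k) = ldet n M"
proof -
  let ?M1 = "\<lambda>i k. if k = j then M i j + c * M i j' else M i k"
  let ?M2 = "\<lambda>i k. if k = j then M i j' else M i k"
  have "ldet n ?M1 = ldet n M + c * ldet n ?M2"
    unfolding ldet_def sum_distrib_left sum.distrib[symmetric]
  proof (intro sum.cong refl)
    fix p assume "p \<in> {p. p permutes {1..n}}"
    then have p: "p permutes {1..n}" by simp
    \<comment> \<open>\<open>i0\<close> is the only row that p sends to column j, so exactly one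
      factor of the product changes.\<close>
    define i0 where "i0 = inv p j"
    have i0: "i0 \<in> {1..n}" "p i0 = j"
      using p assms(1) unfolding i0_def by (meson permutes_in_image permutes_inv) (meson p permutes_inverses(1))
    have ne: "p i \<noteq> j" if "i \<noteq> i0" for i
      using i0(2) that permutes_inj[OF p] by (metis injD)
    have e: "(\<Prod>i\<in>{1..n}. f i (p i)) = f i0 j * (\<Prod>i\<in>{1..n}-{i0}. f i (p i))" for f :: "nat \<Rightarrow> nat \<Rightarrow> complex"
      using prod.remove[of "{1..n}" i0 "\<lambda>i. f i (p i)"] i0 by simp
    have e1: "(\<Prod>i\<in>{1..n}-{i0}. ?M1 i (p i)) = (\<Prod>i\<in>{1..n}-{i0}. M i (p i))"
      by (intro prod.cong) (auto simp: ne)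
    have e2: "(\<Prod>i\<in>{1..n}-{i0}. ?M2 i (p i)) = (\<Prod>i\<in>{1..n}-{i0}. M i (p i))"
      by (intro prod.cong) (auto simp: ne)
    show "of_int (sign p) * (\<Prod>i\<in>{1..n}. ?M1 i (p i)) =
      of_int (sign p) * (\<Prod>i\<in>{1..n}. M i (p i)) + c * (of_int (sign p) * (\<Prod>i\<in>{1..n}. ?M2 i (p i)))"
      unfolding e[of ?M1] e[of ?M2] e[of M] e1 e2 by (simp add: algebra_simps)
  qed
  moreover have "ldet n ?M2 = 0" by (rule ldet_identical_columns[of j n j']) (use assms in auto)
  ultimately show ?thesis by simp
qed

text \<open>Columns are treated from left to right: when column k is changed, column k + 1 still has
  its original entries, so each step is a single column operation. The bound on t keeps column t + 1
  inside the matrix.\<close>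

lemma ldet_bidiagonal_columns:
  assumes "t < n"
  shows "ldet n (\<lambda>i k. if k \<le> t then M i k - c k * M i (Suc k) else M i k) = ldet n M"
  using assms
proof (induction t)
  case 0
  show ?case by (rule ldet_cong) auto
next
  case (Suc t)
  let ?M = "\<lambda>i k. if k \<le> t then M i k - c k * M i (Suc k) else M i k"
  have "ldet n (\<lambda>i k. if k \<le> Suc t then M i k - c k * M i (Suc k) else M i k)
      = ldet n (\<lambda>i k. if k = Suc t then ?M i (Suc t) + (- c (Suc t)) * ?M i (Suc (Suc t)) else ?M i k)"
    by (rule ldet_cong) auto
  also have "\<dots> = ldet n ?M" by (rule ldet_column_add) (use Suc.prems in auto)
  also have "\<dots> = ldet n M" using Suc by simp
  finally show ?case .
qed

text \<open>If only the corner of the last row is nonzero, a permutation contributes only when it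
  fixes n + 1.\<close>

lemma ldet_last_row:
  assumes "\<And>j. j \<in> {1..n} \<Longrightarrow> M (Suc n) j = 0"
  shows "ldet (Suc n) M = M (Suc n) (Suc n) * ldet n M"
proof -
  have "ldet (Suc n) M = (\<Sum>p | p permutes {1..n}. of_int (sign p) * (\<Prod>i\<in>{1..Suc n}. M i (p i)))"
    unfolding ldet_def
  proof (rule sum.mono_neutral_right)
    show "finite {p. p permutes {1..Suc n}}" by (simp add: finite_permutations)
    show "{p. p permutes {1..n}} \<subseteq> {p. p permutes {1..Suc n}}"
      by (auto intro: permutes_subset)
    show "\<forall>p\<in>{p. p permutes {1..Suc n}} - {p. p permutes {1..n}}.
        of_int (sign p) * (\<Prod>i = 1..Suc n. M i (p i)) = 0"
    proof
      fix p assume "p \<in> {p. p permutes {1..Suc n}} - {p. p permutes {1..n}}"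
      then have p: "p permutes {1..Suc n}" "\<not> p permutes {1..n}" by auto
      have "p (Suc n) \<noteq> Suc n"
      proof
        assume "p (Suc n) = Suc n"
        then have "p permutes {1..n}"
          by (intro permutes_superset[OF p(1)]) (auto simp: le_Suc_eq)
        then show False using p by simp
      qed
      moreover have "p (Suc n) \<in> {1..Suc n}" using permutes_in_image[OF p(1)] by simp
      ultimately have "M (Suc n) (p (Suc n)) = 0" using assms by auto
      then show "of_int (sign p) * (\<Prod>i = 1..Suc n. M i (p i)) = 0"
        by simp
    qed
  qed
  also have "\<dots> = M (Suc n) (Suc n) * ldet n M"
    unfolding ldet_def sum_distrib_left
  proof (intro sum.cong refl)
    fix p assume "p \<in> {p. p permutes {1..n}}"
    then have "p (Suc n) = Suc n" by (auto simp: permutes_def)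
    then show "of_int (sign p) * (\<Prod>i\<in>{1..Suc n}. M i (p i)) =
       M (Suc n) (Suc n) * (of_int (sign p) * (\<Prod>i\<in>{1..n}. M i (p i)))"
      by (simp add: mult_ac)
  qed
  finally show ?thesis .
qed

lemma ldet_row_scale: "ldet n (\<lambda>i j. r i * M i j) = (\<Prod>i\<in>{1..n}. r i) * ldet n M"
  unfolding ldet_def sum_distrib_left by (simp add: prod.distrib mult_ac)

text \<open>Multilinearity in all columns at once: a choice function f selects one summand in each
  column.\<close>

lemma ldet_column_sum:
  assumes "\<And>j. finite (S j)"
  shows "ldet n (\<lambda>i j. \<Sum>a\<in>S j. b j a * T i a)
    = (\<Sum>f\<in>Pi\<^sub>E {1..n} S. (\<Prod>j\<in>{1..n}. b j (f j)) * ldet n (\<lambda>i j. T i (f j)))"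
proof -
  have "(\<Prod>i\<in>{1..n}. \<Sum>a\<in>S (p i). b (p i) a * T i a)
      = (\<Sum>f\<in>Pi\<^sub>E {1..n} S. (\<Prod>j\<in>{1..n}. b j (f j)) * (\<Prod>i\<in>{1..n}. T i (f (p i))))"
    if p: "p permutes {1..n}" for p
  proof -
    \<comment> \<open>Rows are renamed by the columns j = p i to which they are sent; the choice
      functions then live on columns and range over a set independent of p.\<close>
    have "(\<Prod>i\<in>{1..n}. \<Sum>a\<in>S (p i). b (p i) a * T i a)
       = (\<Prod>i\<in>{1..n}. \<Sum>a\<in>S (p i). b (p i) a * T (inv p (p i)) a)"
      by (simp add: permutes_inverses(2)[OF p])
    also have "\<dots> = (\<Prod>j\<in>{1..n}. \<Sum>a\<in>S j. b j a * T (inv p j) a)"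
      using prod.permute[OF p, of "\<lambda>j. \<Sum>a\<in>S j. b j a * T (inv p j) a"] by (simp add: comp_def)
    also have "\<dots> = (\<Sum>f\<in>Pi\<^sub>E {1..n} S. \<Prod>j\<in>{1..n}. b j (f j) * T (inv p j) (f j))"
      by (rule prod_sum_PiE) (use assms in auto)
    also have "\<dots> = (\<Sum>f\<in>Pi\<^sub>E {1..n} S. (\<Prod>j\<in>{1..n}. b j (f j)) * (\<Prod>i\<in>{1..n}. T i (f (p i))))"
    proof (intro sum.cong refl)
      fix f
      have "(\<Prod>i\<in>{1..n}. T i (f (p i))) = (\<Prod>i\<in>{1..n}. T (inv p (p i)) (f (p i)))"
        by (simp add: permutes_inverses(2)[OF p])
      also have "\<dots> = (\<Prod>j\<in>{1..n}. T (inv p j) (f j))"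
        using prod.permute[OF p, of "\<lambda>j. T (inv p j) (f j)"] by (simp add: comp_def)
      finally show "(\<Prod>j\<in>{1..n}. b j (f j) * T (inv p j) (f j))
          = (\<Prod>j\<in>{1..n}. b j (f j)) * (\<Prod>i\<in>{1..n}. T i (f (p i)))"
        by (simp add: prod.distrib)
    qed
    finally show ?thesis .
  qed
  then have "ldet n (\<lambda>i j. \<Sum>a\<in>S j. b j a * T i a)
     = (\<Sum>p | p permutes {1..n}. \<Sum>f\<in>Pi\<^sub>E {1..n} S. of_int (sign p) *
          ((\<Prod>j\<in>{1..n}. b j (f j)) * (\<Prod>i\<in>{1..n}. T i (f (p i)))))"
    unfolding ldet_def by (intro sum.cong refl) (simp add: sum_distrib_left)
  also have "\<dots> = (\<Sum>f\<in>Pi\<^sub>E {1..n} S. \<Sum>p | p permutes {1..n}. of_int (sign p) *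
          ((\<Prod>j\<in>{1..n}. b j (f j)) * (\<Prod>i\<in>{1..n}. T i (f (p i)))))"
    by (rule sum.swap)
  also have "\<dots> = (\<Sum>f\<in>Pi\<^sub>E {1..n} S. (\<Prod>j\<in>{1..n}. b j (f j)) * ldet n (\<lambda>i j. T i (f j)))"
    unfolding ldet_def sum_distrib_left by (intro sum.cong refl) (simp add: mult_ac)
  finally show ?thesis .
qed

lemma ldet_permute_rows:
  assumes s: "s permutes {1..n}"
  shows "ldet n (\<lambda>i j. M (s i) j) = of_int (sign s) * ldet n M"
proof -
  have "ldet n (\<lambda>i j. M (s i) j) = (\<Sum>p | p permutes {1..n}. of_int (sign (p \<circ> s)) * (\<Prod>i\<in>{1..n}. M (s i) ((p \<circ> s) i)))"
    unfolding ldet_def by (rule sum_permutations_compose_right[OF s])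
  also have "\<dots> = (\<Sum>p | p permutes {1..n}. of_int (sign s) * (of_int (sign p) * (\<Prod>i\<in>{1..n}. M i (p i))))"
  proof (intro sum.cong refl)
    fix p assume "p \<in> {p. p permutes {1..n}}"
    then have p: "p permutes {1..n}" by simp
    have "permutation s" "permutation p"
      using s p permutation_permutes by (metis finite_atLeastAtMost)+
    then have "sign (p \<circ> s) = sign s * sign p" by (simp add: sign_compose mult_ac)
    moreover have "(\<Prod>i\<in>{1..n}. M (s i) (p (s i))) = (\<Prod>i\<in>{1..n}. M i (p i))"
      using prod.permute[OF s, of "\<lambda>i. M i (p i)"] by (simp add: comp_def)
    ultimately show "of_int (sign (p \<circ> s)) * (\<Prod>i\<in>{1..n}. M (s i) ((p \<circ> s) i))
       = of_int (sign s) * (of_int (sign p) * (\<Prod>i\<in>{1..n}. M i (p i)))"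
      by simp
  qed
  finally show ?thesis by (simp add: ldet_def sum_distrib_left)
qed

section \<open>Branching of alternants and division by the Vandermonde product\<close>

lemma powi_diff_factor:
  fixes u x :: complex
  assumes "u \<noteq> 0" "x \<noteq> 0" "a \<le> b"
  shows "u powi b - x powi (b - a) * u powi a = (u - x) * (\<Sum>e\<in>{a..<b}. x powi (b - 1 - e) * u powi e)"
proof -
  define d where "d = nat (b - a)"
  have b: "b = a + int d" using assms by (simp add: d_def)
  have "(\<Sum>e\<in>{a..<a + int d}. x powi (a + int d - 1 - e) * u powi e) = (\<Sum>i<d. x ^ (d - Suc i) * (u powi a * u ^ i))"
  proof (rule sum.reindex_bij_witness[of _ "\<lambda>i. a + int i" "\<lambda>e. nat (e - a)"])
    fix e assume e: "e \<in> {a..<a + int d}"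
    define i where "i = nat (e - a)"
    have i: "e = a + int i" "i < d" using e by (auto simp: i_def)
    have "a + int d - 1 - e = int (d - Suc i)" using i by auto
    then have "x powi (a + int d - 1 - e) = x ^ (d - Suc i)" by (simp only: power_int_of_nat)
    moreover have "u powi e = u powi a * u ^ i" using assms(1) i by (simp add: power_int_add)
    ultimately show "x ^ (d - Suc (nat (e - a))) * (u powi a * u ^ nat (e - a)) = x powi (a + int d - 1 - e) * u powi e"
      by (simp add: i_def[symmetric])
  qed auto
  also have "\<dots> = u powi a * (\<Sum>i<d. x ^ (d - Suc i) * u ^ i)"
    by (simp add: sum_distrib_left mult_ac)
  finally have "(u - x) * (\<Sum>e\<in>{a..<a + int d}. x powi (a + int d - 1 - e) * u powi e)
     = u powi a * ((u - x) * (\<Sum>i<d. x ^ (d - Suc i) * u ^ i))"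
    by (simp add: mult_ac)
  also have "(u - x) * (\<Sum>i<d. x ^ (d - Suc i) * u ^ i) = u ^ d - x ^ d"
    by (simp add: power_diff_sumr2 mult_ac)
  finally show ?thesis using assms(1) by (simp add: b power_int_add algebra_simps)
qed

text \<open>Branching: column \<open>j\<close> minus \<open>u\<^bsub>N+1\<^esub>\<close>-multiples of column \<open>j+1\<close> clears the last row.\<close>
lemma alternant_branching:
  assumes dec: "\<And>j. j \<in> {1..N} \<Longrightarrow> m (Suc j) < m j" and nz: "\<forall>i\<in>{1..Suc N}. u i \<noteq> (0::complex)"
  defines "x \<equiv> u (Suc N)"
  shows "ldet (Suc N) (\<lambda>i j. u i powi m j) = x powi m (Suc N) * (\<Prod>i\<in>{1..N}. u i - x) *
     (\<Sum>f\<in>Pi\<^sub>E {1..N} (\<lambda>j. {m (Suc j)..<m j}). x powi (\<Sum>j\<in>{1..N}. m j - 1 - f j) *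
        ldet N (\<lambda>i j. u i powi f j))"
proof -
  have x: "x \<noteq> 0" using nz by (simp add: x_def)
  let ?M = "\<lambda>i k. if k \<le> N then u i powi m k - x powi (m k - m (Suc k)) * u i powi m (Suc k) else u i powi m k"
  have "ldet (Suc N) (\<lambda>i j. u i powi m j) = ldet (Suc N) ?M"
    by (rule ldet_bidiagonal_columns[symmetric]) simp
  also have "\<dots> = ?M (Suc N) (Suc N) * ldet N ?M"
  proof (rule ldet_last_row)
    fix j assume "j \<in> {1..N}"
    then show "?M (Suc N) j = 0" using x by (simp add: x_def flip: power_int_add)
  qed
  also have "ldet N ?M = ldet N (\<lambda>i j. (u i - x) * (\<Sum>e\<in>{m (Suc j)..<m j}. x powi (m j - 1 - e) * u i powi e))"
  proof (rule ldet_cong)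
    fix i j assume "i \<in> {1..N}" "j \<in> {1..N}"
    then show "?M i j = (u i - x) * (\<Sum>e\<in>{m (Suc j)..<m j}. x powi (m j - 1 - e) * u i powi e)"
      using powi_diff_factor[of "u i" x "m (Suc j)" "m j"] nz x dec[of j] by simp
  qed
  also have "\<dots> = (\<Prod>i\<in>{1..N}. u i - x) * ldet N (\<lambda>i j. \<Sum>e\<in>{m (Suc j)..<m j}. x powi (m j - 1 - e) * u i powi e)"
    by (rule ldet_row_scale)
  also have "ldet N (\<lambda>i j. \<Sum>e\<in>{m (Suc j)..<m j}. x powi (m j - 1 - e) * u i powi e)
     = (\<Sum>f\<in>Pi\<^sub>E {1..N} (\<lambda>j. {m (Suc j)..<m j}). (\<Prod>j\<in>{1..N}. x powi (m j - 1 - f j)) * ldet N (\<lambda>i j. u i powi f j))"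
    by (rule ldet_column_sum) simp
  also have "(\<lambda>f. (\<Prod>j\<in>{1..N}. x powi (m j - 1 - f j))) = (\<lambda>f. x powi (\<Sum>j\<in>{1..N}. m j - 1 - f j))"
  proof
    fix f :: "nat \<Rightarrow> int"
    have "finite A \<Longrightarrow> (\<Prod>j\<in>A. x powi (m j - 1 - f j)) = x powi (\<Sum>j\<in>A. m j - 1 - f j)" for A
      by (induction A rule: finite_induct) (auto simp: power_int_add x)
    then show "(\<Prod>j\<in>{1..N}. x powi (m j - 1 - f j)) = x powi (\<Sum>j\<in>{1..N}. m j - 1 - f j)" by simp
  qed
  finally show ?thesis by (simp add: x_def mult_ac)
qed

lemma vdm_Suc: "vdm (Suc N) u = vdm N u * (\<Prod>i\<in>{1..N}. u i - u (Suc N))"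
proof -
  have "{i<..Suc N} = insert (Suc N) {i<..N}" if "i \<in> {1..N}" for i using that by auto
  then have "(\<Prod>j\<in>{i<..Suc N}. (u i - u j)) = (\<Prod>j\<in>{i<..N}. (u i - u j)) * (u i - u (Suc N))" if "i \<in> {1..N}" for i
    using that by simp
  then show ?thesis unfolding vdm_def by (simp add: prod.distrib)
qed

lemma PiE_singleton': "Pi\<^sub>E A (\<lambda>j. {f j}) = {restrict f A}"
proof (intro equalityI subsetI)
  fix g assume g: "g \<in> Pi\<^sub>E A (\<lambda>j. {f j})"
  have "g j = restrict f A j" for j using PiE_mem[OF g, of j] PiE_arb[OF g, of j] by (cases "j \<in> A") auto
  then show "g \<in> {restrict f A}" by auto
qed auto

text \<open>For the staircase exponents N + 1 - j the branching interval of column j is the single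
  integer N - j, so branching leads exactly to the staircase in one variable less.\<close>

lemma vdm_alternant:
  assumes "\<forall>i\<in>{1..N}. u i \<noteq> 0"
  shows "ldet N (\<lambda>i j. u i powi (int N - int j)) = vdm N u"
  using assms
proof (induction N)
  case 0
  show ?case by (simp add: ldet_def vdm_def)
next
  case (Suc N)
  have s: "Pi\<^sub>E {1..N} (\<lambda>j. {int (Suc N) - int (Suc j)..<int (Suc N) - int j})
     = {restrict (\<lambda>j. int N - int j) {1..N}}"
  proof -
    have "{int (Suc N) - int (Suc j)..<int (Suc N) - int j} = {int N - int j}" for j by auto
    then have "Pi\<^sub>E {1..N} (\<lambda>j. {int (Suc N) - int (Suc j)..<int (Suc N) - int j}) = Pi\<^sub>E {1..N} (\<lambda>j. {int N - int j})"
      by (simp only:)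
    also have "\<dots> = {restrict (\<lambda>j. int N - int j) {1..N}}"
      by (rule PiE_singleton') 
    finally show ?thesis .
  qed
  have "ldet N (\<lambda>i j. u i powi restrict (\<lambda>j. int N - int j) {1..N} j) = vdm N u"
    using Suc by (subst ldet_cong[where M' = "\<lambda>i j. u i powi (int N - int j)"]) auto
  then show ?case
    using alternant_branching[of N "\<lambda>j. int (Suc N) - int j" u] Suc.prems
    unfolding s vdm_Suc by (simp add: mult_ac)
qed

text \<open>Laurent polynomials with positive integer coefficients, multiplicities arising by
  repeated addition. No rule produces zero, so values at vectors with positive coordinates are
  strictly positive, and norms add there without cancellation.\<close>

inductive poslaurent :: "nat \<Rightarrow> ((nat \<Rightarrow> complex) \<Rightarrow> complex) \<Rightarrow> bool" for N where
  mono: "poslaurent N (\<lambda>u. \<Prod>i\<in>{1..N}. u i powi \<alpha> i)"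
| add: "poslaurent N f \<Longrightarrow> poslaurent N g \<Longrightarrow> poslaurent N (\<lambda>u. f u + g u)"

lemma poslaurent_sum:
  assumes "finite A" "A \<noteq> {}" "\<And>a. a \<in> A \<Longrightarrow> poslaurent N (f a)"
  shows "poslaurent N (\<lambda>u. \<Sum>a\<in>A. f a u)"
  using assms by (induction A rule: finite_ne_induct) (auto intro: poslaurent.add)

lemma poslaurent_extend:
  assumes "poslaurent N f"
  shows "poslaurent (Suc N) (\<lambda>u. u (Suc N) powi e * f u)"
  using assms
proof induction
  case (mono \<alpha>)
  have "(\<Prod>i\<in>{1..Suc N}. u i powi (\<alpha>(Suc N := e)) i) = u (Suc N) powi e * (\<Prod>i\<in>{1..N}. u i powi \<alpha> i)" for u :: "nat \<Rightarrow> complex"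
    by (simp add: mult_ac)
  then show ?case using poslaurent.mono[of "Suc N" "\<alpha>(Suc N := e)"] by (simp only:)
next
  case (add f g)
  then show ?case using poslaurent.add[OF add.IH] by (simp only: distrib_left)
qed

text \<open>Branching introduces no minus signs. The selected exponents h interlace the exponents m
  and hence decrease strictly again, so the quotient in N + 1 variables is a sum of powers of the
  last variable times quotients in N variables. This is the branching rule for Schur
  functions.\<close>

lemma alternant_poslaurent:
  assumes "\<And>i j. 1 \<le> i \<Longrightarrow> i < j \<Longrightarrow> j \<le> N \<Longrightarrow> m j < m i"
  shows "\<exists>f. poslaurent N f \<and> (\<forall>u. (\<forall>i\<in>{1..N}. u i \<noteq> 0) \<longrightarrow> ldet N (\<lambda>i j. u i powi m j) = vdm N u * f u)"
  using assms
proof (induction N arbitrary: m)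
  case 0
  have "poslaurent 0 (\<lambda>u. 1)" using poslaurent.mono[of 0 "\<lambda>_. 0"] by simp
  moreover have "ldet 0 (\<lambda>i j. u i powi m j) = vdm 0 u * 1" for u by (simp add: ldet_def vdm_def)
  ultimately show ?case by blast
next
  case (Suc N)
  let ?P = "Pi\<^sub>E {1..N} (\<lambda>j. {m (Suc j)..<m j})"
  have "\<exists>f. poslaurent N f \<and> (\<forall>u. (\<forall>i\<in>{1..N}. u i \<noteq> 0) \<longrightarrow> ldet N (\<lambda>i j. u i powi h j) = vdm N u * f u)"
    if h: "h \<in> ?P" for h
  proof (rule Suc.IH)
    fix i j assume ij: "1 \<le> i" "i < j" "j \<le> N"
    have "h j < m j" "m (Suc i) \<le> h i" using PiE_mem[OF h, of j] PiE_mem[OF h, of i] ij by auto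
    moreover have "m j \<le> m (Suc i)" using Suc.prems[of "Suc i" j] ij by (cases "j = Suc i") auto
    ultimately show "h j < h i" by simp
  qed
  then have "\<forall>h\<in>?P. \<exists>f. poslaurent N f \<and> (\<forall>u. (\<forall>i\<in>{1..N}. u i \<noteq> 0) \<longrightarrow> ldet N (\<lambda>i j. u i powi h j) = vdm N u * f u)"
    by blast
  from bchoice[OF this] obtain F where F': "\<forall>h\<in>?P. poslaurent N (F h) \<and> (\<forall>u. (\<forall>i\<in>{1..N}. u i \<noteq> 0) \<longrightarrow>
      ldet N (\<lambda>i j. u i powi h j) = vdm N u * F h u)"
    by blast
  have F: "poslaurent N (F h)"
    "(\<forall>i\<in>{1..N}. u i \<noteq> 0) \<Longrightarrow> ldet N (\<lambda>i j. u i powi h j) = vdm N u * F h u" if "h \<in> ?P" for h u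
    using F' that by blast+
  define f where "f = (\<lambda>u. \<Sum>h\<in>?P. u (Suc N) powi (m (Suc N) + (\<Sum>j\<in>{1..N}. m j - 1 - h j)) * F h u)"
  have fin: "finite ?P" by (intro finite_PiE) auto
  \<comment> \<open>Strictly decreasing exponents make every interlacing interval nonempty; an empty
    sum would be zero, which \<open>poslaurent\<close> excludes.\<close>
  have ne: "?P \<noteq> {}"
  proof -
    have "{m (Suc j)..<m j} \<noteq> {}" if "j \<in> {1..N}" for j using Suc.prems[of j "Suc j"] that by simp
    then show ?thesis by (metis (no_types, lifting) PiE_eq_empty_iff)
  qed
  have "poslaurent (Suc N) f" unfolding f_def
    by (rule poslaurent_sum[OF fin ne]) (rule poslaurent_extend, rule F(1))
  moreover have "ldet (Suc N) (\<lambda>i j. u i powi m j) = vdm (Suc N) u * f u" if nz: "\<forall>i\<in>{1..Suc N}. u i \<noteq> 0" for u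
  proof -
    have "ldet (Suc N) (\<lambda>i j. u i powi m j) = u (Suc N) powi m (Suc N) * (\<Prod>i\<in>{1..N}. u i - u (Suc N)) *
     (\<Sum>f\<in>?P. u (Suc N) powi (\<Sum>j\<in>{1..N}. m j - 1 - f j) * ldet N (\<lambda>i j. u i powi f j))"
      by (rule alternant_branching) (use Suc.prems nz in auto)
    also have "(\<Sum>f\<in>?P. u (Suc N) powi (\<Sum>j\<in>{1..N}. m j - 1 - f j) * ldet N (\<lambda>i j. u i powi f j))
       = (\<Sum>f\<in>?P. u (Suc N) powi (\<Sum>j\<in>{1..N}. m j - 1 - f j) * (vdm N u * F f u))"
      by (intro sum.cong refl) (use F(2) nz in auto)
    finally show ?thesis
      using nz unfolding f_def vdm_Suc by (simp add: sum_distrib_left power_int_add mult_ac)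
  qed
  ultimately show ?case by blast
qed

section \<open>Separately holomorphic functions\<close>

text \<open>Vectors are functions on all naturals with the product topology. Joint continuity is
  included because it gives bounds near a point that are uniform in the other coordinates, as the
  Cauchy estimates require.\<close>

definition sephol :: "(nat \<Rightarrow> complex) set \<Rightarrow> ((nat \<Rightarrow> complex) \<Rightarrow> complex) \<Rightarrow> bool" where
  "sephol B f \<longleftrightarrow> continuous_on B f \<and>
     (\<forall>u\<in>B. \<forall>a. (\<lambda>z. f (u(a := z))) field_differentiable (at (u a)))"

definition pd :: "nat \<Rightarrow> ((nat \<Rightarrow> complex) \<Rightarrow> complex) \<Rightarrow> (nat \<Rightarrow> complex) \<Rightarrow> complex" where
  "pd i f u = deriv (\<lambda>z. f (u(i := z))) (u i)"

text \<open>The claim is made at every point z of the slice, since the outer derivative sees the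
  inner ones on the whole slice and not only at \<open>u i\<close>.\<close>

lemma pd_funpow: "(pd i ^^ n) f (u(i := z)) = (deriv ^^ n) (\<lambda>z. f (u(i := z))) z"
proof (induction n arbitrary: z)
  case (Suc n)
  have "(\<lambda>z. (pd i ^^ n) f (u(i := z))) = (deriv ^^ n) (\<lambda>z. f (u(i := z)))" by (rule ext) (rule Suc.IH)
  then show ?case unfolding funpow.simps o_apply pd_def[of i "(pd i ^^ n) f"] fun_upd_upd fun_upd_same by (rule arg_cong)
qed simp

lemma pd_funpow': "(pd i ^^ n) f u = (deriv ^^ n) (\<lambda>z. f (u(i := z))) (u i)"
  using pd_funpow[where i=i and n=n and f=f and u=u and z="u i"] by (simp only: fun_upd_triv)

section \<open>Slices, coordinate changes and closure properties\<close>

lemma continuous_fun_upd_pair: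
  "continuous_on UNIV (\<lambda>p::(nat \<Rightarrow> complex) \<times> complex. (fst p)(i := snd p))"
proof (rule continuous_on_coordinatewise_then_product)
  fix j
  show "continuous_on UNIV (\<lambda>x::(nat \<Rightarrow> complex) \<times> complex. ((fst x)(i := snd x)) j)"
  proof (cases "j = i")
    case True
    then show ?thesis by (auto intro!: continuous_intros)
  next
    case False
    have "continuous_on UNIV (\<lambda>x::(nat \<Rightarrow> complex) \<times> complex. fst x j)"
      by (rule continuous_on_product_then_coordinatewise[of UNIV fst]) (rule continuous_on_fst, rule continuous_on_id)
    then show ?thesis using False by simp
  qed
qed

lemma continuous_coordinate: "continuous_on S (\<lambda>u::nat \<Rightarrow> complex. u i)"
  by (rule continuous_on_product_then_coordinatewise[of S "\<lambda>u. u"]) (rule continuous_on_id)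

lemma continuous_fun_upd: "continuous_on S (\<lambda>z. (u::nat \<Rightarrow> complex)(i := z))"
proof (rule continuous_on_coordinatewise_then_product)
  fix j show "continuous_on S (\<lambda>z. (u(i := z)) j)" by (cases "j = i") (auto intro!: continuous_intros continuous_coordinate)
qed

lemma open_coordinate: "open T \<Longrightarrow> open {u::nat \<Rightarrow> complex. u i \<in> T}"
  using continuous_open_preimage[OF continuous_coordinate[of UNIV i] open_UNIV, of T] by (simp add: vimage_def)

lemma open_slice: "open B \<Longrightarrow> open {z. (u::nat \<Rightarrow> complex)(i := z) \<in> B}"
  using continuous_open_preimage[OF continuous_fun_upd[of UNIV u i] open_UNIV, of B] by (simp add: vimage_def)

lemma sephol_holomorphic_slice:
  assumes "sephol B f"
  shows "(\<lambda>z. f (u(a := z))) holomorphic_on {z. u(a := z) \<in> B}"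
  unfolding holomorphic_on_def
proof
  fix z assume "z \<in> {z. u(a := z) \<in> B}"
  then have "(\<lambda>z'. f ((u(a := z))(a := z'))) field_differentiable (at ((u(a := z)) a))"
    using assms unfolding sephol_def by blast
  then show "(\<lambda>z. f (u(a := z))) field_differentiable at z within {z. u(a := z) \<in> B}"
    by (simp add: field_differentiable_at_within)
qed

lemma sephol_continuous: "sephol B f \<Longrightarrow> continuous_on B f"
  by (simp add: sephol_def)

lemma sephol_subset: "sephol B f \<Longrightarrow> C \<subseteq> B \<Longrightarrow> sephol C f"
  unfolding sephol_def by (meson continuous_on_subset subsetD)

lemma sephol_cong:
  assumes "open B" "sephol B f" "\<And>u. u \<in> B \<Longrightarrow> f u = g u"
  shows "sephol B g"
proof -
  have "continuous_on B g" by (rule continuous_on_eq[OF sephol_continuous[OF assms(2)] assms(3)])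
  moreover have "(\<lambda>z. g (u(a := z))) field_differentiable (at (u a))" if u: "u \<in> B" for u a
  proof -
    have "u a \<in> {z. u(a := z) \<in> B}" using u by simp
    moreover obtain f' where "((\<lambda>z. f (u(a := z))) has_field_derivative f') (at (u a))"
      using assms(2) u unfolding sephol_def field_differentiable_def by blast
    ultimately have "((\<lambda>z. g (u(a := z))) has_field_derivative f') (at (u a))"
      using has_field_derivative_transform_within_open[OF _ open_slice[OF assms(1), of u a],
            where f = "\<lambda>z. f (u(a := z))" and g = "\<lambda>z. g (u(a := z))"] assms(3) by simp
    then show ?thesis unfolding field_differentiable_def by blast
  qed
  ultimately show ?thesis by (simp add: sephol_def)
qed

lemma sephol_const: "sephol B (\<lambda>u. c)"
  by (simp add: sephol_def)

lemma sephol_coord: "sephol B (\<lambda>u. u i)"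
proof -
  have "(\<lambda>z. (u(a := z)) i) field_differentiable (at (u a))" for u :: "nat \<Rightarrow> complex" and a
    by (cases "a = i") auto
  then show ?thesis by (auto simp: sephol_def intro!: continuous_coordinate)
qed

lemma sephol_add: "sephol B f \<Longrightarrow> sephol B g \<Longrightarrow> sephol B (\<lambda>u. f u + g u)"
  unfolding sephol_def by (auto intro!: continuous_intros field_differentiable_add)

lemma sephol_diff: "sephol B f \<Longrightarrow> sephol B g \<Longrightarrow> sephol B (\<lambda>u. f u - g u)"
  unfolding sephol_def by (auto intro!: continuous_intros field_differentiable_diff)

lemma sephol_mult: "sephol B f \<Longrightarrow> sephol B g \<Longrightarrow> sephol B (\<lambda>u. f u * g u)"
  unfolding sephol_def by (auto intro!: continuous_intros field_differentiable_mult)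

lemma sephol_divide:
  "sephol B f \<Longrightarrow> sephol B g \<Longrightarrow> (\<And>u. u \<in> B \<Longrightarrow> g u \<noteq> 0) \<Longrightarrow> sephol B (\<lambda>u. f u / g u)"
  unfolding sephol_def by (auto intro!: continuous_intros field_differentiable_divide)

lemma sephol_sum: "(\<And>a. a \<in> A \<Longrightarrow> sephol B (f a)) \<Longrightarrow> sephol B (\<lambda>u. \<Sum>a\<in>A. f a u)"
  by (induction A rule: infinite_finite_induct) (auto intro: sephol_const sephol_add)

lemma sephol_prod: "(\<And>a. a \<in> A \<Longrightarrow> sephol B (f a)) \<Longrightarrow> sephol B (\<lambda>u. \<Prod>a\<in>A. f a u)"
  by (induction A rule: infinite_finite_induct) (auto intro: sephol_const sephol_mult)

lemma sephol_comp:
  assumes "sephol B f" "g holomorphic_on T" "open T" "\<And>u. u \<in> B \<Longrightarrow> f u \<in> T"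
  shows "sephol B (\<lambda>u. g (f u))"
proof -
  have "continuous_on B (\<lambda>u. g (f u))"
    using continuous_on_compose2[OF holomorphic_on_imp_continuous_on[OF assms(2)] sephol_continuous[OF assms(1)]] assms(4) by blast
  moreover have "(\<lambda>z. g (f (u(a := z)))) field_differentiable (at (u a))" if "u \<in> B" for u a
  proof -
    have 1: "(\<lambda>z. f (u(a := z))) field_differentiable (at (u a))" using assms(1) that by (simp add: sephol_def)
    have "g field_differentiable (at (f (u(a := u a))))"
      using assms(2-4) that by (simp add: holomorphic_on_imp_differentiable_at)
    from field_differentiable_compose[OF 1 this] show ?thesis unfolding o_def .
  qed
  ultimately show ?thesis by (simp add: sephol_def)
qed

lemma sephol_power: "sephol B f \<Longrightarrow> sephol B (\<lambda>u. f u ^ n)"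
  by (induction n) (auto intro: sephol_const sephol_mult)

lemma sephol_restrict_one:
  assumes "sephol C f" "\<And>u. u \<in> B \<Longrightarrow> (\<lambda>i. if i \<in> J then u i else 1) \<in> C"
  shows "sephol B (\<lambda>u. f (\<lambda>i. if i \<in> J then u i else 1))"
proof -
  let ?r = "\<lambda>u::nat \<Rightarrow> complex. \<lambda>i. if i \<in> J then u i else 1"
  have "continuous_on B ?r"
  proof (rule continuous_on_coordinatewise_then_product)
    fix i show "continuous_on B (\<lambda>u. ?r u i)" by (cases "i \<in> J") (auto intro!: continuous_intros continuous_coordinate)
  qed
  then have "continuous_on B (\<lambda>u. f (?r u))"
    by (rule continuous_on_compose2[OF sephol_continuous[OF assms(1)]]) (use assms(2) in auto)
  moreover have "(\<lambda>z. f (?r (u(a := z)))) field_differentiable (at (u a))" if "u \<in> B" for u a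
  proof (cases "a \<in> J")
    case True
    then have "?r (u(a := z)) = (?r u)(a := z)" for z by auto
    moreover have "?r u a = u a" using True by simp
    moreover have "(\<lambda>z. f ((?r u)(a := z))) field_differentiable (at (?r u a))"
      using assms(1) assms(2)[OF that] unfolding sephol_def by blast
    ultimately show ?thesis by (simp only:)
  next
    case False
    then have "?r (u(a := z)) = ?r u" for z by auto
    then show ?thesis by simp
  qed
  ultimately show ?thesis by (simp add: sephol_def)
qed

text \<open>One radius e serves all v near u, because the pairs (v, z) whose updated vector lies in
  B form an open set. One-variable Cauchy estimates thereby become uniform in the other
  variables.\<close>

lemma coordinate_room:
  fixes B :: "(nat \<Rightarrow> complex) set"
  assumes "open B" "u \<in> B"
  obtains W e where "open W" "u \<in> W" "W \<subseteq> B" "e > 0"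
    "\<And>v z. v \<in> W \<Longrightarrow> z \<in> cball (v i) e \<Longrightarrow> v(i := z) \<in> B"
proof -
  let ?P = "{p::(nat \<Rightarrow> complex) \<times> complex. (fst p)(i := snd p) \<in> B}"
  have "open ?P"
    using continuous_open_preimage[OF continuous_fun_upd_pair[of i] open_UNIV assms(1)] by (simp add: vimage_def)
  moreover have "(u, u i) \<in> ?P" using assms by simp
  ultimately obtain W1 W2 where W: "open W1" "open W2" "(u, u i) \<in> W1 \<times> W2" "W1 \<times> W2 \<subseteq> ?P"
    by (rule open_prod_elim)
  obtain e where e: "e > 0" "ball (u i) e \<subseteq> W2" using W open_contains_ball by (metis mem_Sigma_iff)
  define W where "W = W1 \<inter> {v. v i \<in> ball (u i) (e/2)} \<inter> B"
  have "v(i := z) \<in> B" if "v \<in> W" "z \<in> cball (v i) (e/3)" for v z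
  proof -
    have "dist (u i) z \<le> dist (u i) (v i) + dist (v i) z" by (rule dist_triangle)
    then have "z \<in> ball (u i) e" using that e(1) by (auto simp: W_def)
    then have "(v, z) \<in> W1 \<times> W2" using that e by (auto simp: W_def)
    then have "(v, z) \<in> ?P" using W(4) by blast
    then show ?thesis by simp
  qed
  moreover have "open W" unfolding W_def using W assms by (intro open_Int open_coordinate) auto
  moreover have "u \<in> W" "W \<subseteq> B" using W e assms by (auto simp: W_def)
  ultimately show ?thesis using that[of W "e/3"] e by simp
qed

text \<open>The hypothesis of the Weierstrass test in local form: near each point there is a
  summable majorant. The index set is unordered, so convergence is along finite subsets.\<close>

definition locsum :: "(nat \<Rightarrow> complex) set \<Rightarrow> 'l set \<Rightarrow> ('l \<Rightarrow> (nat \<Rightarrow> complex) \<Rightarrow> complex) \<Rightarrow> bool" where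
  "locsum B A h \<longleftrightarrow> (\<forall>l\<in>A. sephol B (h l)) \<and>
     (\<forall>u\<in>B. \<exists>W M. open W \<and> u \<in> W \<and> W \<subseteq> B \<and> M summable_on A \<and> (\<forall>l\<in>A. \<forall>v\<in>W. norm (h l v) \<le> (M l :: real)))"

lemma locsum_summable:
  assumes "locsum B A h" "u \<in> B"
  shows "(\<lambda>l. h l u) summable_on A"
proof -
  obtain W M where "open W" "u \<in> W" "W \<subseteq> B" "M summable_on A" "\<forall>l\<in>A. \<forall>v\<in>W. norm (h l v) \<le> (M l :: real)"
    using assms unfolding locsum_def by meson
  then have "(\<lambda>l. norm (h l u)) summable_on A"
    by (intro summable_on_comparison_test[of M A "\<lambda>l. norm (h l u)"]) auto
  then show ?thesis by (rule abs_summable_summable)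
qed

text \<open>Finite partial sums converge uniformly where the majorant holds; continuity and
  holomorphy of the slices pass to the uniform limit.\<close>

lemma locsum_sephol:
  assumes "open B" "locsum B A h"
  shows "sephol B (\<lambda>u. \<Sum>\<^sub>\<infinity>l\<in>A. h l u)"
proof -
  let ?s = "\<lambda>u. \<Sum>\<^sub>\<infinity>l\<in>A. h l u"
  have loc: "isCont ?s u \<and> (\<forall>a. (\<lambda>z. ?s (u(a := z))) field_differentiable (at (u a)))" if u: "u \<in> B" for u
  proof -
    obtain W M where W: "open W" "u \<in> W" "W \<subseteq> B" "M summable_on A" "\<forall>l\<in>A. \<forall>v\<in>W. norm (h l v) \<le> (M l :: real)"
      using assms(2) u unfolding locsum_def by meson
    have ul: "uniform_limit W (\<lambda>X v. \<Sum>l\<in>X. h l v) ?s (finite_subsets_at_top A)"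
      by (rule Weierstrass_m_test_general[of A W h M]) (use W in auto)
    have ev: "eventually (\<lambda>X. sephol W (\<lambda>v. \<Sum>l\<in>X. h l v)) (finite_subsets_at_top A)"
    proof (rule eventually_finite_subsets_at_top_weakI)
      fix X assume "finite X" "X \<subseteq> A"
      then show "sephol W (\<lambda>v. \<Sum>l\<in>X. h l v)"
        using assms(2) W(3) unfolding locsum_def by (intro sephol_sum) (meson sephol_subset subsetD)
    qed
    have "continuous_on W ?s"
      by (rule uniform_limit_theorem[OF _ ul]) (use ev in \<open>auto elim: eventually_mono simp: sephol_def\<close>)
    then have c: "isCont ?s u" using W continuous_on_eq_continuous_at by blast
    have "(\<lambda>z. ?s (u(a := z))) field_differentiable (at (u a))" for a
    proof -
      have "open {z. u(a := z) \<in> W}" "u a \<in> {z. u(a := z) \<in> W}" using W open_slice by auto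
      then obtain e where e: "e > 0" "cball (u a) e \<subseteq> {z. u(a := z) \<in> W}"
        using open_contains_cball by meson
      have "continuous_on (cball (u a) e) (\<lambda>z. ?s (u(a := z))) \<and> (\<lambda>z. ?s (u(a := z))) holomorphic_on ball (u a) e"
      proof (rule holomorphic_uniform_limit)
        show "\<forall>\<^sub>F X in finite_subsets_at_top A. continuous_on (cball (u a) e) (\<lambda>z. \<Sum>l\<in>X. h l (u(a := z))) \<and>
            (\<lambda>z. \<Sum>l\<in>X. h l (u(a := z))) holomorphic_on ball (u a) e"
          using ev
        proof eventually_elim
          case (elim X)
          have "(\<lambda>z. \<Sum>l\<in>X. h l (u(a := z))) holomorphic_on {z. u(a := z) \<in> W}"
            using sephol_holomorphic_slice[OF elim] .
          then show ?case using e ball_subset_cball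
            by (meson holomorphic_on_imp_continuous_on holomorphic_on_subset order_trans)
        qed
        show "uniform_limit (cball (u a) e) (\<lambda>X z. \<Sum>l\<in>X. h l (u(a := z))) (\<lambda>z. ?s (u(a := z))) (finite_subsets_at_top A)"
          using e(2) by (intro uniform_limit_compose'[OF ul, of "\<lambda>z. u(a := z)"]) auto
      qed auto
      then show ?thesis using e(1) holomorphic_on_imp_differentiable_at[OF _ open_ball, of _ "u a" e "u a"] by simp
    qed
    then show ?thesis using c by blast
  qed
  then show ?thesis unfolding sephol_def using continuous_at_imp_continuous_on by blast
qed

lemma Cauchy_inequality_cball:
  assumes "f holomorphic_on T" "cball z e \<subseteq> T" "e > 0" "\<And>w. w \<in> cball z e \<Longrightarrow> norm (f w) \<le> C"
  shows "norm ((deriv ^^ n) f z) \<le> fact n * C / e ^ n"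
proof (rule Cauchy_inequality)
  show "f holomorphic_on ball z e" using assms(1,2) ball_subset_cball by (meson holomorphic_on_subset order_trans)
  show "continuous_on (cball z e) f" using assms(1,2) by (meson holomorphic_on_imp_continuous_on holomorphic_on_subset)
  show "norm (f x) \<le> C" if "norm (z - x) = e" for x using assms(4) that by (simp add: dist_norm)
qed (use assms in auto)

text \<open>First-order Taylor expansion with Cauchy's bound \<open>2 * C / e^2\<close> for the
  second derivative; the radius 2 e accommodates a disc of radius e around each point within e of z.
  The error depends on f through C alone, which gives uniformity in the other variables.\<close>

lemma difference_quotient_error:
  assumes f: "f holomorphic_on T" "cball z (2*e) \<subseteq> T" and e: "e > 0"
    and C: "\<And>w. w \<in> cball z (2*e) \<Longrightarrow> norm (f w) \<le> C" and h: "h \<noteq> 0" "norm h < e"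
  shows "norm ((f (z + h) - f z) / h - deriv f z) \<le> 2 * C / e\<^sup>2 * norm h"
proof -
  have T': "ball z (2*e) \<subseteq> T" using f(2) ball_subset_cball by blast
  have "norm (f (z + h) - (\<Sum>i\<le>1. (deriv ^^ i) f z * (z + h - z) ^ i / fact i)) \<le> (2 * C / e\<^sup>2) * norm (z + h - z) ^ Suc 1 / fact 1"
  proof (rule complex_Taylor[of "ball z e" 1 "\<lambda>i. (deriv ^^ i) f" _ z "z + h", unfolded funpow_0])
    fix i x assume x: "x \<in> ball z e" 
    have x': "x \<in> ball z (2*e)" using x e by simp
    show "((deriv ^^ i) f has_field_derivative (deriv ^^ Suc i) f x) (at x within ball z e)"
      using has_field_derivative_higher_deriv[OF holomorphic_on_subset[OF f(1) T'] open_ball x', of i]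
      by (rule has_field_derivative_at_within)
  next
    fix x assume x: "x \<in> ball z e"
    have s: "cball x e \<subseteq> cball z (2*e)"
    proof
      fix w assume "w \<in> cball x e"
      then show "w \<in> cball z (2*e)" using dist_triangle[of z w x] x by simp
    qed
    have "norm ((deriv ^^ 2) f x) \<le> fact 2 * C / e ^ 2"
      by (rule Cauchy_inequality_cball[of _ T]) (use f s e C in auto)
    then show "norm ((deriv ^^ Suc 1) f x) \<le> 2 * C / e\<^sup>2" by (simp add: numeral_2_eq_2)
  qed (use e h in \<open>auto simp: dist_norm\<close>)
  then have "norm (f (z + h) - f z - deriv f z * h) \<le> (2 * C / e\<^sup>2) * norm h ^ 2"
    by (simp add: algebra_simps power2_eq_square)
  moreover have "(f (z + h) - f z) / h - deriv f z = (f (z + h) - f z - deriv f z * h) / h"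
    using h by (simp add: field_simps)
  ultimately show ?thesis using h by (simp add: norm_divide divide_le_eq power2_eq_square mult_ac)
qed

text \<open>Locally the partial derivative is a uniform limit of difference quotients. These are
  continuous and holomorphic in each variable, and both properties survive the limit.\<close>

lemma sephol_pd:
  assumes B: "open B" and f: "sephol B f"
  shows "sephol B (pd i f)"
proof -
  have "isCont (pd i f) u \<and> (\<forall>a. (\<lambda>z. pd i f (u(a := z))) field_differentiable (at (u a)))" if u: "u \<in> B" for u
  proof -
    \<comment> \<open>On \<open>B1\<close>, open by continuity, the function stays below the
      constant \<open>C\<close> of the error estimate.\<close>
    define B1 where "B1 = {v\<in>B. norm (f v) < norm (f u) + 1}"
    have B1: "open B1" "u \<in> B1" "B1 \<subseteq> B"
    proof -
      have "open (B \<inter> (\<lambda>v. norm (f v)) -` {..<norm (f u) + 1})"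
        by (rule continuous_open_preimage) (use f B in \<open>auto intro!: continuous_intros simp: sephol_def\<close>)
      moreover have "B1 = B \<inter> (\<lambda>v. norm (f v)) -` {..<norm (f u) + 1}" by (auto simp: B1_def)
      ultimately show "open B1" by simp
    qed (use u in \<open>auto simp: B1_def\<close>)
    obtain W e0 where W: "open W" "u \<in> W" "W \<subseteq> B1" "e0 > 0" 
      "\<And>v z. v \<in> W \<Longrightarrow> z \<in> cball (v i) e0 \<Longrightarrow> v(i := z) \<in> B1"
      by (rule coordinate_room[OF B1(1,2), of i]) blast
    define e where "e = e0 / 2"
    have e: "e > 0" "2 * e = e0" using W by (auto simp: e_def)
    define C where "C = norm (f u) + 1"
    define \<eta> where "\<eta> = (\<lambda>n. of_real (e / (of_nat n + 2)) :: complex)"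
    have "0 < e / (real n + 2)" "e / (real n + 2) < e" for n using e by (auto simp: divide_less_eq mult_less_cancel_left1)
    then have \<eta>: "\<eta> n \<noteq> 0" "norm (\<eta> n) < e" for n
      unfolding \<eta>_def norm_of_real of_real_eq_0_iff by (metis less_irrefl, metis abs_of_pos)
    have \<eta>0: "\<eta> \<longlonglongrightarrow> 0" unfolding \<eta>_def
    proof -
      have "(\<lambda>n. e / (real n + 2)) \<longlonglongrightarrow> 0" by real_asymp
      then have "(\<lambda>n. complex_of_real (e / (real n + 2))) \<longlonglongrightarrow> of_real 0" by (rule tendsto_of_real)
      then show "(\<lambda>n. complex_of_real (e / (real n + 2))) \<longlonglongrightarrow> 0" by simp
    qed
    define q where "q = (\<lambda>n v. (f (v(i := v i + \<eta> n)) - f v) / \<eta> n)"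
    have err: "norm (q n v - pd i f v) \<le> 2 * C / e\<^sup>2 * norm (\<eta> n)" if v: "v \<in> W" for n v
    proof -
      have "norm ((f (v(i := v i + \<eta> n)) - f (v(i := v i))) / \<eta> n - deriv (\<lambda>z. f (v(i := z))) (v i)) \<le> 2 * C / e\<^sup>2 * norm (\<eta> n)"
      proof (rule difference_quotient_error)
        show "(\<lambda>z. f (v(i := z))) holomorphic_on {z. v(i := z) \<in> B}"
          by (rule sephol_holomorphic_slice[OF f])
        show "cball (v i) (2 * e) \<subseteq> {z. v(i := z) \<in> B}" using W(5)[OF v] B1 e by auto
        show "norm (f (v(i := w))) \<le> C" if "w \<in> cball (v i) (2 * e)" for w
          using W(5)[OF v, of w] that e by (auto simp: B1_def C_def)
      qed (use e \<eta> in auto)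
      then show ?thesis by (simp add: q_def pd_def)
    qed
    have ul: "uniform_limit W q (pd i f) sequentially"
    proof (rule uniform_limitI)
      fix d :: real assume "d > 0"
      have "(\<lambda>n. 2 * C / e\<^sup>2 * norm (\<eta> n)) \<longlonglongrightarrow> 2 * C / e\<^sup>2 * norm (0::complex)"
        by (intro tendsto_intros \<eta>0)
      then have "\<forall>\<^sub>F n in sequentially. 2 * C / e\<^sup>2 * norm (\<eta> n) < d"
        using \<open>d > 0\<close> by (simp add: order_tendstoD(2))
      then show "\<forall>\<^sub>F n in sequentially. \<forall>v\<in>W. dist (q n v) (pd i f v) < d"
        by eventually_elim (use err in \<open>auto simp: dist_norm intro: le_less_trans\<close>)
    qed
    have qs: "sephol W (q n)" for n
    proof -
      have inB: "v(i := v i + \<eta> n) \<in> B" if "v \<in> W" for v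
        using W(5)[OF that, of "v i + \<eta> n"] \<eta>(2)[of n] e B1 by (auto simp: dist_norm)
      have ct: "continuous_on W (\<lambda>v. v(i := v i + \<eta> n))"
      proof (rule continuous_on_coordinatewise_then_product)
        fix j show "continuous_on W (\<lambda>v. (v(i := v i + \<eta> n)) j)" by (cases "j = i") (auto intro!: continuous_intros continuous_coordinate)
      qed
      have "sephol W (\<lambda>v. f (v(i := v i + \<eta> n)))"
        unfolding sephol_def
      proof (intro conjI ballI allI)
        show "continuous_on W (\<lambda>v. f (v(i := v i + \<eta> n)))"
          by (rule continuous_on_compose2[OF sephol_continuous[OF f] ct]) (use inB in auto)
        fix v a assume v: "v \<in> W"
        let ?v = "v(i := v i + \<eta> n)"
        have d: "(\<lambda>z. f (?v(a := z))) field_differentiable (at (?v a))"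
          using f inB[OF v] unfolding sephol_def by blast
        show "(\<lambda>z. f ((v(a := z))(i := (v(a := z)) i + \<eta> n))) field_differentiable (at (v a))"
        proof (cases "a = i")
          case True
          have "(\<lambda>z. f (v(i := z))) field_differentiable (at (v i + \<eta> n))"
            using d True by simp
          moreover have "(\<lambda>z. z + \<eta> n) field_differentiable (at (v i))" by (auto intro!: derivative_intros)
          ultimately have "((\<lambda>z. f (v(i := z))) \<circ> (\<lambda>z. z + \<eta> n)) field_differentiable (at (v i))"
            by (intro field_differentiable_compose) auto
          then show ?thesis using True by (simp add: o_def)
        next
          case False
          then have "(v(a := z))(i := (v(a := z)) i + \<eta> n) = ?v(a := z)" for z by (auto simp: fun_eq_iff)
          then show ?thesis using d False by simp
        qed
      qed
      then show ?thesis unfolding q_def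
        using \<eta> sephol_subset[OF f, of W] W(3) B1(3) by (intro sephol_divide sephol_diff sephol_const) auto
    qed
    have "continuous_on W (pd i f)"
      by (rule uniform_limit_theorem[OF _ ul]) (use qs in \<open>auto simp: sephol_def\<close>)
    then have c: "isCont (pd i f) u" using W continuous_on_eq_continuous_at by blast
    have "(\<lambda>z. pd i f (u(a := z))) field_differentiable (at (u a))" for a
    proof -
      have "open {z. u(a := z) \<in> W}" "u a \<in> {z. u(a := z) \<in> W}" using W open_slice by auto
      then obtain r where r: "r > 0" "cball (u a) r \<subseteq> {z. u(a := z) \<in> W}"
        using open_contains_cball by meson
      have "continuous_on (cball (u a) r) (\<lambda>z. pd i f (u(a := z))) \<and> (\<lambda>z. pd i f (u(a := z))) holomorphic_on ball (u a) r"
      proof (rule holomorphic_uniform_limit)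
        show "\<forall>\<^sub>F n in sequentially. continuous_on (cball (u a) r) (\<lambda>z. q n (u(a := z))) \<and>
            (\<lambda>z. q n (u(a := z))) holomorphic_on ball (u a) r"
        proof (rule always_eventually, rule allI)
          fix n
          have "(\<lambda>z. q n (u(a := z))) holomorphic_on {z. u(a := z) \<in> W}"
            using sephol_holomorphic_slice[OF qs] .
          then show "continuous_on (cball (u a) r) (\<lambda>z. q n (u(a := z))) \<and>
            (\<lambda>z. q n (u(a := z))) holomorphic_on ball (u a) r" using r ball_subset_cball
            by (meson holomorphic_on_imp_continuous_on holomorphic_on_subset order_trans)
        qed
        show "uniform_limit (cball (u a) r) (\<lambda>n z. q n (u(a := z))) (\<lambda>z. pd i f (u(a := z))) sequentially"
          using r(2) by (intro uniform_limit_compose'[OF ul, of "\<lambda>z. u(a := z)"]) auto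
      qed auto
      then show ?thesis using r(1) holomorphic_on_imp_differentiable_at[OF _ open_ball, of _ "u a" r "u a"] by simp
    qed
    then show ?thesis using c by blast
  qed
  then show ?thesis unfolding sephol_def using continuous_at_imp_continuous_on by blast
qed

lemma sephol_pd_funpow: "open B \<Longrightarrow> sephol B f \<Longrightarrow> sephol B ((pd i ^^ n) f)"
  by (induction n) (auto intro: sephol_pd)

text \<open>Cauchy's inequality turns the majorant M into M / e on a smaller neighbourhood, so the
  differentiated series satisfies the same condition and the lemma can be iterated.\<close>

lemma locsum_pd:
  assumes B: "open B" and h: "locsum B A h"
  shows "locsum B A (\<lambda>l. pd i (h l))"
    and "\<And>u. u \<in> B \<Longrightarrow> pd i (\<lambda>u. \<Sum>\<^sub>\<infinity>l\<in>A. h l u) u = (\<Sum>\<^sub>\<infinity>l\<in>A. pd i (h l) u)"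
proof -
  show "locsum B A (\<lambda>l. pd i (h l))"
    unfolding locsum_def
  proof (intro conjI ballI)
    show "sephol B (pd i (h l))" if "l \<in> A" for l using that h B by (auto simp: locsum_def intro: sephol_pd)
    fix u assume "u \<in> B"
    then obtain W0 M where W0: "open W0" "u \<in> W0" "W0 \<subseteq> B" "M summable_on A" "\<forall>l\<in>A. \<forall>v\<in>W0. norm (h l v) \<le> (M l :: real)"
      using h unfolding locsum_def by meson
    obtain W e where W: "open W" "u \<in> W" "W \<subseteq> W0" "e > 0"
      "\<And>v z. v \<in> W \<Longrightarrow> z \<in> cball (v i) e \<Longrightarrow> v(i := z) \<in> W0"
      by (rule coordinate_room[OF W0(1,2), of i]) blast
    have "norm (pd i (h l) v) \<le> M l * (1 / e)" if "l \<in> A" "v \<in> W" for l v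
    proof -
      have "norm ((deriv ^^ 1) (\<lambda>z. h l (v(i := z))) (v i)) \<le> fact 1 * M l / e ^ 1"
      proof (rule Cauchy_inequality_cball)
        show "(\<lambda>z. h l (v(i := z))) holomorphic_on {z. v(i := z) \<in> B}"
          using h that by (intro sephol_holomorphic_slice) (auto simp: locsum_def)
      qed (use W W0 that in auto)
      then show ?thesis by (simp add: pd_def)
    qed
    moreover have "(\<lambda>l. M l * (1 / e)) summable_on A" using W0 by (intro summable_on_cmult_left)
    ultimately show "\<exists>W M. open W \<and> u \<in> W \<and> W \<subseteq> B \<and> M summable_on A \<and> (\<forall>l\<in>A. \<forall>v\<in>W. norm (pd i (h l) v) \<le> M l)"
      using W W0 by (intro exI[of _ W] exI[of _ "\<lambda>l. M l * (1 / e)"]) auto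
  qed
  fix u assume u: "u \<in> B"
  then obtain W M where W: "open W" "u \<in> W" "W \<subseteq> B" "M summable_on A" "\<forall>l\<in>A. \<forall>v\<in>W. norm (h l v) \<le> (M l :: real)"
    using h unfolding locsum_def by meson
  let ?T = "{z. u(i := z) \<in> W}"
  have hol: "(\<lambda>z. h l (u(i := z))) holomorphic_on ?T" if "l \<in> A" for l
    using h W that by (intro sephol_holomorphic_slice) (auto simp: locsum_def intro: sephol_subset)
  have T: "open ?T" "u i \<in> ?T" using W open_slice by auto
  have "((\<lambda>X. deriv (\<lambda>z. \<Sum>l\<in>X. h l (u(i := z))) (u i)) \<longlongrightarrow> deriv (\<lambda>z. \<Sum>\<^sub>\<infinity>l\<in>A. h l (u(i := z))) (u i)) (finite_subsets_at_top A)"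
  proof (rule deriv_complex_uniform_limit)
    show "uniform_limit ?T (\<lambda>X z. \<Sum>l\<in>X. h l (u(i := z))) (\<lambda>z. \<Sum>\<^sub>\<infinity>l\<in>A. h l (u(i := z))) (finite_subsets_at_top A)"
      by (rule Weierstrass_m_test_general[of A ?T _ M]) (use W in auto)
    show "\<forall>\<^sub>F X in finite_subsets_at_top A. (\<lambda>z. \<Sum>l\<in>X. h l (u(i := z))) holomorphic_on ?T"
      by (rule eventually_finite_subsets_at_top_weakI) (use hol in \<open>auto intro!: holomorphic_intros\<close>)
  qed (use T in auto)
  moreover have "\<forall>\<^sub>F X in finite_subsets_at_top A. deriv (\<lambda>z. \<Sum>l\<in>X. h l (u(i := z))) (u i) = (\<Sum>l\<in>X. pd i (h l) u)"
  proof (rule eventually_finite_subsets_at_top_weakI)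
    fix X assume X: "finite X" "X \<subseteq> A"
    show "deriv (\<lambda>z. \<Sum>l\<in>X. h l (u(i := z))) (u i) = (\<Sum>l\<in>X. pd i (h l) u)"
      unfolding pd_def
    proof (rule DERIV_imp_deriv, rule DERIV_sum)
      fix l assume "l \<in> X"
      then have "(\<lambda>z. h l (u(i := z))) field_differentiable at (u i)"
        using X hol T holomorphic_on_imp_differentiable_at by blast
      then show "((\<lambda>z. h l (u(i := z))) has_field_derivative deriv (\<lambda>z. h l (u(i := z))) (u i)) (at (u i))"
        by (simp add: DERIV_deriv_iff_field_differentiable)
    qed
  qed
  ultimately have "((\<lambda>X. \<Sum>l\<in>X. pd i (h l) u) \<longlongrightarrow> deriv (\<lambda>z. \<Sum>\<^sub>\<infinity>l\<in>A. h l (u(i := z))) (u i)) (finite_subsets_at_top A)"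
    by (rule Lim_transform_eventually)
  then have "((\<lambda>l. pd i (h l) u) has_sum pd i (\<lambda>u. \<Sum>\<^sub>\<infinity>l\<in>A. h l u) u) A"
    unfolding has_sum_def by (simp add: pd_def)
  then show "pd i (\<lambda>u. \<Sum>\<^sub>\<infinity>l\<in>A. h l u) u = (\<Sum>\<^sub>\<infinity>l\<in>A. pd i (h l) u)"
    by (rule infsumI[symmetric])
qed

lemma pd_cong_open:
  assumes "open B" "u \<in> B" "\<And>v. v \<in> B \<Longrightarrow> f v = g v"
  shows "pd i f u = pd i g u"
  unfolding pd_def
proof (rule deriv_cong_ev)
  have "open {z. u(i := z) \<in> B}" "u i \<in> {z. u(i := z) \<in> B}" using assms open_slice by auto
  then have "\<forall>\<^sub>F z in nhds (u i). z \<in> {z. u(i := z) \<in> B}" by (rule eventually_nhds_in_open)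
  then show "\<forall>\<^sub>F z in nhds (u i). f (u(i := z)) = g (u(i := z))"
    by eventually_elim (use assms(3) in auto)
qed simp

lemma pd_funpow_cong_open:
  assumes "open B" "u \<in> B" "\<And>v. v \<in> B \<Longrightarrow> f v = g v"
  shows "(pd i ^^ n) f u = (pd i ^^ n) g u"
  using assms(2)
proof (induction n arbitrary: u)
  case (Suc n)
  then show ?case by (simp, intro pd_cong_open[OF assms(1)]) auto
qed (use assms in auto)

lemma locsum_pd_funpow:
  assumes "open B" "locsum B A h"
  shows "locsum B A (\<lambda>l. (pd i ^^ n) (h l)) \<and>
    (\<forall>u\<in>B. (pd i ^^ n) (\<lambda>u. \<Sum>\<^sub>\<infinity>l\<in>A. h l u) u = (\<Sum>\<^sub>\<infinity>l\<in>A. (pd i ^^ n) (h l) u))"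
proof (induction n)
  case (Suc n)
  have "(pd i ^^ Suc n) (\<lambda>u. \<Sum>\<^sub>\<infinity>l\<in>A. h l u) u = (\<Sum>\<^sub>\<infinity>l\<in>A. (pd i ^^ Suc n) (h l) u)" if "u \<in> B" for u
  proof -
    have "(pd i ^^ Suc n) (\<lambda>u. \<Sum>\<^sub>\<infinity>l\<in>A. h l u) u = pd i (\<lambda>u. \<Sum>\<^sub>\<infinity>l\<in>A. (pd i ^^ n) (h l) u) u"
      using Suc that assms(1) by (simp, intro pd_cong_open[OF assms(1)]) auto
    also have "\<dots> = (\<Sum>\<^sub>\<infinity>l\<in>A. (pd i ^^ Suc n) (h l) u)"
      using locsum_pd(2)[OF assms(1), of A "\<lambda>l. (pd i ^^ n) (h l)" u i] Suc that by simp
    finally show ?thesis .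
  qed
  then show ?case using Suc locsum_pd(1)[OF assms(1), of A "\<lambda>l. (pd i ^^ n) (h l)" i] by simp
qed (use assms in auto)

lemma locsum_mult:
  assumes "open B" "locsum B A h" "sephol B g"
  shows "locsum B A (\<lambda>l u. g u * h l u)"
  unfolding locsum_def
proof (intro conjI ballI)
  show "sephol B (\<lambda>u. g u * h l u)" if "l \<in> A" for l using assms that by (auto simp: locsum_def intro: sephol_mult)
  fix u assume u: "u \<in> B"
  then obtain W M where W: "open W" "u \<in> W" "W \<subseteq> B" "M summable_on A" "\<forall>l\<in>A. \<forall>v\<in>W. norm (h l v) \<le> (M l :: real)"
    using assms(2) unfolding locsum_def by meson
  define W' where "W' = W \<inter> (\<lambda>v. norm (g v)) -` {..<norm (g u) + 1}"
  have "open W'" unfolding W'_def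
    by (rule continuous_open_preimage) (use assms W in \<open>auto intro!: continuous_intros intro: continuous_on_subset simp: sephol_def\<close>)
  moreover have "norm (g v * h l v) \<le> (norm (g u) + 1) * M l" if "l \<in> A" "v \<in> W'" for l v
    unfolding norm_mult using that W by (intro mult_mono) (auto simp: W'_def)
  moreover have "(\<lambda>l. (norm (g u) + 1) * M l) summable_on A" using W by (intro summable_on_cmult_right)
  ultimately show "\<exists>W M. open W \<and> u \<in> W \<and> W \<subseteq> B \<and> M summable_on A \<and> (\<forall>l\<in>A. \<forall>v\<in>W. norm (g v * h l v) \<le> M l)"
    using W by (intro exI[of _ W'] exI[of _ "\<lambda>l. (norm (g u) + 1) * M l"]) (auto simp: W'_def)
qed

section \<open>Normalised Schur functions\<close>

definition nzset :: "nat \<Rightarrow> (nat \<Rightarrow> complex) set" where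
  "nzset N = {u. \<forall>i\<in>{1..N}. u i \<noteq> 0}"

abbreviation (input) cvec :: "(nat \<Rightarrow> real) \<Rightarrow> nat \<Rightarrow> complex" where
  "cvec x \<equiv> (\<lambda>i. of_real (x i))"

section \<open>Positivity, domination and convexity of Laurent polynomials\<close>

lemma open_nzset: "open (nzset N)"
proof -
  have "nzset N = (\<Inter>i\<in>{1..N}. {u. u i \<in> - {0}})" by (auto simp: nzset_def)
  moreover have "open (\<Inter>i\<in>{1..N}. {u::nat \<Rightarrow> complex. u i \<in> - {0}})"
    by (intro open_INT ballI open_coordinate) auto
  ultimately show ?thesis by simp
qed

lemma poslaurent_sephol: "poslaurent N f \<Longrightarrow> sephol (nzset N) f"
proof (induction rule: poslaurent.induct)
  case (mono \<alpha>)
  show ?case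
  proof (rule sephol_prod)
    fix i assume i: "i \<in> {1..N}"
    show "sephol (nzset N) (\<lambda>u. u i powi \<alpha> i)"
      by (rule sephol_comp[OF sephol_coord, of "\<lambda>z. z powi \<alpha> i" "-{0}"])
         (use i in \<open>auto simp: nzset_def intro!: holomorphic_intros\<close>)
  qed
qed (rule sephol_add)

lemma poslaurent_local: "poslaurent N f \<Longrightarrow> (\<And>i. i \<in> {1..N} \<Longrightarrow> u i = v i) \<Longrightarrow> f u = f v"
  by (induction rule: poslaurent.induct) simp_all

lemma poslaurent_real_pos:
  assumes "poslaurent N f" "\<And>i. i \<in> {1..N} \<Longrightarrow> x i > 0"
  shows "\<exists>r>0. f (cvec x) = of_real r"
  using assms(1)
proof (induction rule: poslaurent.induct)
  case (mono \<alpha>)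
  show ?case
    by (rule exI[of _ "\<Prod>i\<in>{1..N}. x i powi \<alpha> i"]) (use assms(2) in \<open>auto intro!: prod_pos zero_less_power_int\<close>)
next
  case (add f g)
  then obtain r s where "r > 0" "s > 0" "f (cvec x) = of_real r" "g (cvec x) = of_real s" by blast
  then show ?case by (intro exI[of _ "r + s"]) auto
qed

lemma poslaurent_norm_add:
  assumes "poslaurent N f" "poslaurent N g" "\<And>i. i \<in> {1..N} \<Longrightarrow> x i > 0"
  shows "norm (f (cvec x) + g (cvec x)) = norm (f (cvec x)) + norm (g (cvec x))"
proof -
  obtain r s where "r > 0" "s > 0" "f (cvec x) = of_real r" "g (cvec x) = of_real s"
    using poslaurent_real_pos[OF assms(1), of x] poslaurent_real_pos[OF assms(2), of x] assms(3) by blast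
  then show ?thesis by (simp flip: of_real_add)
qed

text \<open>At the vector of moduli all monomials are positive, so the triangle inequality is an
  equality there.\<close>

lemma poslaurent_norm_le:
  assumes "poslaurent N f" "u \<in> nzset N"
  shows "norm (f u) \<le> norm (f (cvec (\<lambda>i. norm (u i))))"
  using assms(1)
proof (induction rule: poslaurent.induct)
  case (mono \<alpha>)
  show ?case by (simp add: prod_norm[symmetric] norm_power_int)
next
  case (add f g)
  have "norm (f u + g u) \<le> norm (f u) + norm (g u)" by (rule norm_triangle_ineq)
  also have "\<dots> \<le> norm (f (cvec (\<lambda>i. norm (u i)))) + norm (g (cvec (\<lambda>i. norm (u i))))"
    using add by simp
  also have "\<dots> = norm (f (cvec (\<lambda>i. norm (u i))) + g (cvec (\<lambda>i. norm (u i))))"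
    by (rule poslaurent_norm_add[symmetric]) (use add assms in \<open>auto simp: nzset_def\<close>)
  finally show ?case .
qed

text \<open>A power is increasing or decreasing according to the sign of n; summing over both
  endpoints gives one bound for both signs.\<close>

lemma powi_corner:
  fixes x a b :: real
  assumes "0 < a" "a \<le> x" "x \<le> b"
  shows "x powi n \<le> (\<Sum>y\<in>{a,b}. y powi n)"
proof (cases "n \<ge> 0")
  case True
  have "x powi n \<le> b powi n" using assms True by (intro power_int_mono) auto
  also have "\<dots> \<le> (\<Sum>y\<in>{a,b}. y powi n)" using assms by (intro member_le_sum) auto
  finally show ?thesis .
next
  case False
  have "x powi n \<le> a powi n" using assms False by (intro power_int_antimono) auto
  also have "\<dots> \<le> (\<Sum>y\<in>{a,b}. y powi n)" using assms by (intro member_le_sum) auto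
  finally show ?thesis .
qed

text \<open>For a monomial the coordinatewise endpoint bounds multiply out to a sum over the corners
  of the box. The bound is additive because norms add at positive vectors.\<close>

lemma poslaurent_corner:
  assumes "poslaurent N f" "\<And>i. i \<in> {1..N} \<Longrightarrow> 0 < a i \<and> a i \<le> x i \<and> x i \<le> b i"
  shows "norm (f (cvec x)) \<le> (\<Sum>y\<in>Pi\<^sub>E {1..N} (\<lambda>i. {a i, b i}). norm (f (cvec y)))"
  using assms(1)
proof (induction rule: poslaurent.induct)
  case (mono \<alpha>)
  have pos: "y i > 0" if "y \<in> Pi\<^sub>E {1..N} (\<lambda>i. {a i, b i})" "i \<in> {1..N}" for y i
    using PiE_mem[OF that] assms(2)[OF that(2)] by auto
  have n: "norm (\<Prod>i\<in>{1..N}. cvec y i powi \<alpha> i) = (\<Prod>i\<in>{1..N}. y i powi \<alpha> i)"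
    if "\<And>i. i \<in> {1..N} \<Longrightarrow> y i > 0" for y
  proof -
    have "norm (\<Prod>i\<in>{1..N}. cvec y i powi \<alpha> i) = (\<Prod>i\<in>{1..N}. \<bar>y i\<bar> powi \<alpha> i)"
      by (simp add: prod_norm[symmetric] norm_power_int)
    also have "\<dots> = (\<Prod>i\<in>{1..N}. y i powi \<alpha> i)" by (intro prod.cong refl) (use that in \<open>simp add: abs_of_pos\<close>)
    finally show ?thesis .
  qed
  have "norm (\<Prod>i\<in>{1..N}. cvec x i powi \<alpha> i) = (\<Prod>i\<in>{1..N}. x i powi \<alpha> i)"
    by (rule n) (use assms(2) in force)
  also have "\<dots> \<le> (\<Prod>i\<in>{1..N}. \<Sum>y\<in>{a i, b i}. y powi \<alpha> i)"
    by (intro prod_mono conjI powi_corner) (use assms(2) in \<open>force intro: zero_le_power_int\<close>)+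
  also have "\<dots> = (\<Sum>y\<in>Pi\<^sub>E {1..N} (\<lambda>i. {a i, b i}). \<Prod>i\<in>{1..N}. y i powi \<alpha> i)"
    by (rule prod_sum_PiE) auto
  also have "\<dots> = (\<Sum>y\<in>Pi\<^sub>E {1..N} (\<lambda>i. {a i, b i}). norm (\<Prod>i\<in>{1..N}. cvec y i powi \<alpha> i))"
    by (intro sum.cong refl n[symmetric] pos)
  finally show ?case .
next
  case (add f g)
  have "norm (f (cvec x) + g (cvec x)) \<le> norm (f (cvec x)) + norm (g (cvec x))" by (rule norm_triangle_ineq)
  also have "\<dots> \<le> (\<Sum>y\<in>Pi\<^sub>E {1..N} (\<lambda>i. {a i, b i}). norm (f (cvec y)) + norm (g (cvec y)))"
    using add by (simp add: sum.distrib)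
  also have "\<dots> = (\<Sum>y\<in>Pi\<^sub>E {1..N} (\<lambda>i. {a i, b i}). norm (f (cvec y) + g (cvec y)))"
  proof (intro sum.cong refl poslaurent_norm_add[symmetric])
    fix y i assume "y \<in> Pi\<^sub>E {1..N} (\<lambda>i. {a i, b i})" "i \<in> {1..N}"
    then show "y i > 0" using PiE_mem[of y "{1..N}" "\<lambda>i. {a i, b i}" i] assms(2)[of i] by auto
  qed (use add in auto)
  finally show ?case .
qed

text \<open>Monomials are multiplicative, so for them the claim is
  \<open>X * Z \<le> (X\<^sup>2 + Z\<^sup>2) / 2\<close>; positivity extends it to sums.\<close>

lemma poslaurent_log_convex:
  assumes "poslaurent N f" "\<And>i. i \<in> {1..N} \<Longrightarrow> x i > 0 \<and> z i > 0"
  shows "norm (f (cvec (\<lambda>i. x i * z i))) \<le> (norm (f (cvec (\<lambda>i. (x i)\<^sup>2))) + norm (f (cvec (\<lambda>i. (z i)\<^sup>2)))) / 2"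
  using assms(1)
proof (induction rule: poslaurent.induct)
  case (mono \<alpha>)
  define X where "X = (\<Prod>i\<in>{1..N}. \<bar>x i\<bar> powi \<alpha> i)"
  define Z where "Z = (\<Prod>i\<in>{1..N}. \<bar>z i\<bar> powi \<alpha> i)"
  have "norm (\<Prod>i\<in>{1..N}. cvec (\<lambda>i. x i * z i) i powi \<alpha> i) = X * Z"
    by (simp add: X_def Z_def prod_norm[symmetric] norm_power_int norm_mult power_int_mult_distrib prod.distrib)
  moreover have "norm (\<Prod>i\<in>{1..N}. cvec (\<lambda>i. (x i)\<^sup>2) i powi \<alpha> i) = X\<^sup>2"
    by (simp add: X_def prod_norm[symmetric] norm_power_int norm_power power2_eq_square norm_mult power_int_mult_distrib prod.distrib)
  moreover have "norm (\<Prod>i\<in>{1..N}. cvec (\<lambda>i. (z i)\<^sup>2) i powi \<alpha> i) = Z\<^sup>2"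
    by (simp add: Z_def prod_norm[symmetric] norm_power_int norm_power power2_eq_square norm_mult power_int_mult_distrib prod.distrib)
  moreover have "X * Z \<le> (X\<^sup>2 + Z\<^sup>2) / 2" using sum_squares_bound[of X Z] by simp
  ultimately show ?case by simp
next
  case (add f g)
  have nz: "0 < (x i)\<^sup>2" "0 < (z i)\<^sup>2" if "i \<in> {1..N}" for i using assms(2)[OF that] by auto
  have e1: "norm (f (cvec (\<lambda>i. (x i)\<^sup>2)) + g (cvec (\<lambda>i. (x i)\<^sup>2))) = norm (f (cvec (\<lambda>i. (x i)\<^sup>2))) + norm (g (cvec (\<lambda>i. (x i)\<^sup>2)))"
    by (rule poslaurent_norm_add[OF add.hyps]) (use nz in blast)
  have e2: "norm (f (cvec (\<lambda>i. (z i)\<^sup>2)) + g (cvec (\<lambda>i. (z i)\<^sup>2))) = norm (f (cvec (\<lambda>i. (z i)\<^sup>2))) + norm (g (cvec (\<lambda>i. (z i)\<^sup>2)))"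
    by (rule poslaurent_norm_add[OF add.hyps]) (use nz in blast)
  have "norm (f (cvec (\<lambda>i. x i * z i)) + g (cvec (\<lambda>i. x i * z i)))
     \<le> (norm (f (cvec (\<lambda>i. (x i)\<^sup>2))) + norm (f (cvec (\<lambda>i. (z i)\<^sup>2)))) / 2 +
        (norm (g (cvec (\<lambda>i. (x i)\<^sup>2))) + norm (g (cvec (\<lambda>i. (z i)\<^sup>2)))) / 2"
    by (rule order_trans[OF norm_triangle_ineq add_mono[OF add.IH]])
  then show ?case unfolding e1 e2 by (simp add: add_divide_distrib)
qed

lemma generic_subset_nzset: "generic_pts N \<subseteq> nzset N"
  by (auto simp: generic_pts_def nzset_def)

lemma vdm_nonzero: "u \<in> generic_pts N \<Longrightarrow> vdm N u \<noteq> 0"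
  unfolding vdm_def generic_pts_def by (simp add: prod_zero_iff)

text \<open>Along the line that adds t * i to coordinate i, each forbidden equation excludes one
  value of t, whereas a nonempty open set of t is infinite.\<close>

lemma generic_dense:
  assumes "u \<in> nzset N" "open T" "u \<in> T"
  obtains v where "v \<in> T" "v \<in> generic_pts N"
proof -
  define c where "c = (\<lambda>t::complex. \<lambda>i. if i \<in> {1..N} then u i + t * of_nat i else u i)"
  have cc: "continuous_on UNIV c" unfolding c_def
  proof (rule continuous_on_coordinatewise_then_product)
    fix i show "continuous_on UNIV (\<lambda>t::complex. if i \<in> {1..N} then u i + t * of_nat i else u i)"
      by (cases "i \<in> {1..N}") (auto intro!: continuous_intros)
  qed
  have op: "open (c -` T)" using continuous_open_preimage[OF cc open_UNIV assms(2)] by simp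
  have "c 0 = u" by (auto simp: c_def)
  then have ne: "c -` T \<noteq> {}" using assms(3) by auto
  define Bad where "Bad = (\<Union>i\<in>{1..N}. {- u i / of_nat i}) \<union>
     (\<Union>i\<in>{1..N}. \<Union>j\<in>{1..N}-{i}. {(u j - u i) / (of_nat i - of_nat j)})"
  have "finite Bad" by (simp add: Bad_def)
  then have "\<not> c -` T \<subseteq> Bad" using finite_imp_not_open[of "c -` T"] op ne finite_subset by blast
  then obtain t where t: "c t \<in> T" "t \<notin> Bad" by auto
  have "c t \<in> generic_pts N"
    unfolding generic_pts_def
  proof (intro CollectI conjI ballI impI)
    fix i assume i: "i \<in> {1..N}"
    have "t \<noteq> - u i / of_nat i" using t i by (auto simp: Bad_def)
    moreover have "(of_nat i :: complex) \<noteq> 0" using i by simp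
    ultimately have "u i + t * of_nat i \<noteq> 0" by (simp add: field_simps add_eq_0_iff)
    then show "c t i \<noteq> 0" using i by (simp add: c_def)
    fix j assume j: "j \<in> {1..N}" "i \<noteq> j"
    have "t \<noteq> (u j - u i) / (of_nat i - of_nat j)" using t i j by (auto simp: Bad_def)
    moreover have "(of_nat i - of_nat j :: complex) \<noteq> 0" using j by simp
    ultimately have "t * (of_nat i - of_nat j) \<noteq> u j - u i" by (simp add: field_simps)
    then have "u i + t * of_nat i \<noteq> u j + t * of_nat j" by (simp add: algebra_simps)
    then show "c t i \<noteq> c t j" using i j by (simp add: c_def)
  qed
  then show ?thesis using t that by blast
qed

text \<open>At generic points the ratio is the Laurent polynomial f. Since f is continuous and
  generic points are dense, the \<open>Lim\<close> in the definition of \<open>schur\<close> is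
  determined and equals f elsewhere as well.\<close>

lemma schur_poslaurent:
  assumes "l \<in> signatures N"
  shows "\<exists>f. poslaurent N f \<and> (\<forall>u\<in>nzset N. schur N l u = f u) \<and>
    (\<forall>u\<in>nzset N. ldet N (\<lambda>i j. u i powi (l j + int N - int j)) = vdm N u * f u)"
proof -
  have "\<exists>f. poslaurent N f \<and> (\<forall>u. (\<forall>i\<in>{1..N}. u i \<noteq> 0) \<longrightarrow> ldet N (\<lambda>i j. u i powi (l j + int N - int j)) = vdm N u * f u)"
  proof (rule alternant_poslaurent)
    fix i j assume "1 \<le> i" "i < j" "j \<le> N"
    then have "l j \<le> l i" using assms by (simp add: signatures_def)
    then show "l j + int N - int j < l i + int N - int i" using \<open>i < j\<close> by simp
  qed
  then obtain f where "poslaurent N f \<and> (\<forall>u. (\<forall>i\<in>{1..N}. u i \<noteq> 0) \<longrightarrow> ldet N (\<lambda>i j. u i powi (l j + int N - int j)) = vdm N u * f u)"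
    by (elim exE)
  then have f: "poslaurent N f" "\<And>u. u \<in> nzset N \<Longrightarrow> ldet N (\<lambda>i j. u i powi (l j + int N - int j)) = vdm N u * f u"
    unfolding nzset_def by simp_all
  have r: "schur_ratio N l u = f u" if u: "u \<in> generic_pts N" for u
  proof -
    have "schur_ratio N l u = ldet N (\<lambda>i j. u i powi (l j + int N - int j)) / vdm N u"
      by (simp add: schur_ratio_def ldet_def vdm_def)
    then show ?thesis using f(2)[of u] u vdm_nonzero[OF u] subsetD[OF generic_subset_nzset u] by simp
  qed
  have "schur N l u = f u" if u: "u \<in> nzset N" for u
  proof (cases "u \<in> generic_pts N")
    case True
    then show ?thesis using r by (simp add: schur_def)
  next
    case False
    have "continuous_on (nzset N) f" using poslaurent_sephol[OF f(1)] by (rule sephol_continuous)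
    then have "isCont f u" using u open_nzset continuous_on_eq_continuous_at by blast
    then have "(f \<longlongrightarrow> f u) (at u within generic_pts N)" 
      using continuous_at_imp_continuous_at_within[of u f] by (simp add: continuous_within)
    then have "(schur_ratio N l \<longlongrightarrow> f u) (at u within generic_pts N)"
      by (rule Lim_transform_eventually) (use r in \<open>auto simp: eventually_at_filter intro: always_eventually\<close>)
    moreover have "\<not> trivial_limit (at u within generic_pts N)"
      unfolding trivial_limit_within not_not islimpt_def
    proof (intro allI impI)
      fix T assume "u \<in> T" "open T"
      then obtain v where "v \<in> T" "v \<in> generic_pts N" using generic_dense[OF u] by blast
      then show "\<exists>y\<in>generic_pts N. y \<in> T \<and> y \<noteq> u" using False by blast
    qed
    ultimately show ?thesis using False by (simp add: schur_def tendsto_Lim)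
  qed
  then show ?thesis using f by (intro exI[of _ f]) simp
qed

definition nschur :: "nat \<Rightarrow> (nat \<Rightarrow> int) \<Rightarrow> (nat \<Rightarrow> complex) \<Rightarrow> complex" where
  "nschur N l u = schur N l u / schur N l (\<lambda>_. 1)"

text \<open>Keeps the Schur polynomial f together with its value c at the all-ones vector, the
  dimension of the corresponding representation of the unitary group, and with the alternant
  identity.\<close>

definition nschur_rep :: "nat \<Rightarrow> (nat \<Rightarrow> int) \<Rightarrow> ((nat \<Rightarrow> complex) \<Rightarrow> complex) \<Rightarrow> real \<Rightarrow> bool" where
  "nschur_rep N l f c \<longleftrightarrow> poslaurent N f \<and> c > 0 \<and> (\<forall>u\<in>nzset N. nschur N l u = f u / of_real c) \<and> f (\<lambda>_. 1) = of_real c \<and>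
    (\<forall>u\<in>nzset N. ldet N (\<lambda>i j. u i powi (l j + int N - int j)) = vdm N u * f u)"

lemma nschur_repD:
  assumes "nschur_rep N l f c"
  shows "poslaurent N f" "c > 0" "\<And>u. u \<in> nzset N \<Longrightarrow> nschur N l u = f u / of_real c"
    "f (\<lambda>_. 1) = of_real c" "\<And>u. u \<in> nzset N \<Longrightarrow> ldet N (\<lambda>i j. u i powi (l j + int N - int j)) = vdm N u * f u"
  using assms by (simp_all add: nschur_rep_def)

lemma nschur_rep_exists:
  assumes "l \<in> signatures N"
  shows "\<exists>f c. nschur_rep N l f c"
proof -
  from schur_poslaurent[OF assms] obtain f where
    "poslaurent N f \<and> (\<forall>u\<in>nzset N. schur N l u = f u) \<and>
    (\<forall>u\<in>nzset N. ldet N (\<lambda>i j. u i powi (l j + int N - int j)) = vdm N u * f u)"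
    by (elim exE)
  then have f: "poslaurent N f" "\<forall>u\<in>nzset N. schur N l u = f u"
     "\<forall>u\<in>nzset N. ldet N (\<lambda>i j. u i powi (l j + int N - int j)) = vdm N u * f u" by simp_all
  obtain c where "c > 0" "f (cvec (\<lambda>_. 1)) = of_real c" using poslaurent_real_pos[OF f(1), of "\<lambda>_. 1"] by auto
  moreover have "schur N l (\<lambda>_. 1) = f (\<lambda>_. 1)" using f(2) by (simp add: nzset_def)
  ultimately have "nschur_rep N l f c" unfolding nschur_rep_def using f by (simp add: nschur_def)
  then show ?thesis by blast
qed

lemma nschur_sephol:
  assumes "l \<in> signatures N" shows "sephol (nzset N) (nschur N l)"
proof -
  from nschur_rep_exists[OF assms] obtain f c where "nschur_rep N l f c" by blast
  note f = nschur_repD[OF this]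
  have "sephol (nzset N) (\<lambda>u. f u / of_real c)"
    using f by (intro sephol_divide sephol_const poslaurent_sephol) auto
  then show ?thesis by (rule sephol_cong[OF open_nzset]) (simp add: f(3))
qed

lemma nschur_one: "l \<in> signatures N \<Longrightarrow> nschur N l (\<lambda>_. 1) = 1"
proof -
  assume l: "l \<in> signatures N"
  from nschur_rep_exists[OF l] obtain f c where "nschur_rep N l f c" by blast
  note f = nschur_repD[OF this]
  then show ?thesis by (auto simp: nzset_def)
qed

lemma nschur_local:
  assumes "l \<in> signatures N" "u \<in> nzset N" "\<And>i. i \<in> {1..N} \<Longrightarrow> u i = v i"
  shows "nschur N l u = nschur N l v"
proof -
  from nschur_rep_exists[OF assms(1)] obtain f c where "nschur_rep N l f c" by blast
  note f = nschur_repD[OF this]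
  have "v \<in> nzset N" using assms(2,3) by (auto simp: nzset_def)
  then show ?thesis using f(3) assms(2) poslaurent_local[OF f(1), of u v] assms(3) by simp
qed

lemma cvec_nzset: "(\<And>i. i \<in> {1..N} \<Longrightarrow> x i > 0) \<Longrightarrow> cvec x \<in> nzset N"
  using less_imp_neq by (fastforce simp: nzset_def)

lemma nschur_norm_le:
  assumes "l \<in> signatures N" "u \<in> nzset N"
  shows "norm (nschur N l u) \<le> norm (nschur N l (cvec (\<lambda>i. norm (u i))))"
proof -
  from nschur_rep_exists[OF assms(1)] obtain f c where "nschur_rep N l f c" by blast
  note f = nschur_repD[OF this]
  have "cvec (\<lambda>i. norm (u i)) \<in> nzset N" using assms(2) by (auto simp: nzset_def)
  then show ?thesis using f assms(2) poslaurent_norm_le[OF f(1) assms(2)] by (simp add: norm_divide divide_right_mono)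
qed

lemma nschur_corner:
  assumes "l \<in> signatures N" "\<And>i. i \<in> {1..N} \<Longrightarrow> 0 < a i \<and> a i \<le> x i \<and> x i \<le> b i"
  shows "norm (nschur N l (cvec x)) \<le> (\<Sum>y\<in>Pi\<^sub>E {1..N} (\<lambda>i. {a i, b i}). norm (nschur N l (cvec y)))"
proof -
  from nschur_rep_exists[OF assms(1)] obtain f c where "nschur_rep N l f c" by blast
  note f = nschur_repD[OF this]
  have x: "cvec x \<in> nzset N" using assms(2) by (intro cvec_nzset) force
  have y: "cvec y \<in> nzset N" if "y \<in> Pi\<^sub>E {1..N} (\<lambda>i. {a i, b i})" for y
  proof (rule cvec_nzset)
    fix i assume "i \<in> {1..N}"
    then show "y i > 0" using PiE_mem[OF that, of i] assms(2)[of i] by auto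
  qed
  have "(\<Sum>y\<in>Pi\<^sub>E {1..N} (\<lambda>i. {a i, b i}). norm (nschur N l (cvec y))) = (\<Sum>y\<in>Pi\<^sub>E {1..N} (\<lambda>i. {a i, b i}). norm (f (cvec y))) / c"
    unfolding sum_divide_distrib using f y by (intro sum.cong refl) (simp add: norm_divide)
  then show ?thesis using poslaurent_corner[OF f(1) assms(2)] f x by (simp add: norm_divide divide_right_mono)
qed

lemma nschur_log_convex:
  assumes "l \<in> signatures N" "\<And>i. i \<in> {1..N} \<Longrightarrow> x i > 0 \<and> z i > 0"
  shows "norm (nschur N l (cvec (\<lambda>i. x i * z i))) \<le> (norm (nschur N l (cvec (\<lambda>i. (x i)\<^sup>2))) + norm (nschur N l (cvec (\<lambda>i. (z i)\<^sup>2)))) / 2"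
proof -
  from nschur_rep_exists[OF assms(1)] obtain f c where "nschur_rep N l f c" by blast
  note f = nschur_repD[OF this]
  have "cvec (\<lambda>i. x i * z i) \<in> nzset N" "cvec (\<lambda>i. (x i)\<^sup>2) \<in> nzset N" "cvec (\<lambda>i. (z i)\<^sup>2) \<in> nzset N"
    using assms(2) by (force intro!: cvec_nzset)+
  then have "nschur N l (cvec (\<lambda>i. x i * z i)) = f (cvec (\<lambda>i. x i * z i)) / of_real c"
     "nschur N l (cvec (\<lambda>i. (x i)\<^sup>2)) = f (cvec (\<lambda>i. (x i)\<^sup>2)) / of_real c"
     "nschur N l (cvec (\<lambda>i. (z i)\<^sup>2)) = f (cvec (\<lambda>i. (z i)\<^sup>2)) / of_real c" using f(3) by blast+
  moreover have "norm (f (cvec (\<lambda>i. x i * z i))) / c \<le> ((norm (f (cvec (\<lambda>i. (x i)\<^sup>2))) + norm (f (cvec (\<lambda>i. (z i)\<^sup>2)))) / 2) / c"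
    using poslaurent_log_convex[OF f(1) assms(2)] f(2) by (intro divide_right_mono) auto
  ultimately show ?thesis using f(2) by (simp add: norm_divide add_divide_distrib)
qed

lemma continuous_permute: "continuous_on S (\<lambda>u::nat \<Rightarrow> complex. u \<circ> s)"
proof (rule continuous_on_coordinatewise_then_product)
  fix i show "continuous_on S (\<lambda>u::nat \<Rightarrow> complex. (u \<circ> s) i)" by (simp add: continuous_coordinate)
qed

lemma permute_nzset: "s permutes {1..N} \<Longrightarrow> u \<in> nzset N \<Longrightarrow> u \<circ> s \<in> nzset N"
  using permutes_in_image[of s "{1..N}"] by (simp add: nzset_def)

text \<open>Alternant and Vandermonde product both change by the sign of the permutation, so the
  quotient is symmetric at generic points. A failure elsewhere would be an open condition and would
  therefore also occur at a generic point.\<close>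

lemma nschur_symmetric:
  assumes l: "l \<in> signatures N" and s: "s permutes {1..N}" and u: "u \<in> nzset N"
  shows "nschur N l (u \<circ> s) = nschur N l u"
proof (rule ccontr)
  assume ne: "nschur N l (u \<circ> s) \<noteq> nschur N l u"
  from nschur_rep_exists[OF l] obtain f c where "nschur_rep N l f c" by blast
  note f = nschur_repD[OF this]
  have cont: "continuous_on (nzset N) (nschur N l)" using nschur_sephol[OF l] by (rule sephol_continuous)
  have "continuous_on (nzset N) (\<lambda>v. nschur N l (v \<circ> s) - nschur N l v)"
    by (intro continuous_on_diff cont continuous_on_compose2[OF cont continuous_permute])
       (use permute_nzset[OF s] in auto)
  from continuous_open_preimage[OF this open_nzset, of "-{0}", OF open_Compl[OF closed_singleton]]
  have "open (nzset N \<inter> (\<lambda>v. nschur N l (v \<circ> s) - nschur N l v) -` (-{0}))" by blast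
  moreover have "u \<in> nzset N \<inter> (\<lambda>v. nschur N l (v \<circ> s) - nschur N l v) -` (-{0})" using ne u by simp
  ultimately obtain v where "v \<in> nzset N \<inter> (\<lambda>v. nschur N l (v \<circ> s) - nschur N l v) -` (-{0})" "v \<in> generic_pts N"
    using generic_dense[OF u] by blast
  then have v: "v \<in> nzset N" "nschur N l (v \<circ> s) \<noteq> nschur N l v" "v \<in> generic_pts N" by auto
  have vs: "v \<circ> s \<in> nzset N" by (rule permute_nzset[OF s v(1)])
  have "vdm N (v \<circ> s) = of_int (sign s) * vdm N v"
    using vdm_alternant[of N "v \<circ> s"] vdm_alternant[of N v] v(1) vs ldet_permute_rows[OF s, of "\<lambda>i j. v i powi (int N - int j)"]
    by (simp add: nzset_def)
  moreover have "vdm N (v \<circ> s) * f (v \<circ> s) = of_int (sign s) * (vdm N v * f v)"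
    using f(5)[OF vs] f(5)[OF v(1)] ldet_permute_rows[OF s, of "\<lambda>i j. v i powi (l j + int N - int j)"] by simp
  ultimately have "f (v \<circ> s) = f v" using vdm_nonzero[OF v(3)] by (auto simp: sign_def split: if_splits)
  then show False using v f(2,3) vs by simp
qed

section \<open>Divided differences\<close>

lemma lagrange_interpolation:
  fixes x :: "'i \<Rightarrow> 'a::field"
  assumes I: "finite I" "inj_on x I" and p: "degree p < card I"
  shows "p = (\<Sum>i\<in>I. smult (poly p (x i) / (\<Prod>j\<in>I-{i}. x i - x j)) (\<Prod>j\<in>I-{i}. [:- x j, 1:]))" (is "p = ?q")
proof (rule poly_eqI_degree[of "x ` I"])
  fix y assume "y \<in> x ` I"
  then obtain k where k: "k \<in> I" "y = x k" by blast
  have z: "(\<Prod>j\<in>I-{i}. x k - x j) = 0" if "i \<in> I" "i \<noteq> k" for i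
    using that k I(1) by (intro prod_zero) auto
  have nz: "(\<Prod>j\<in>I-{k}. x k - x j) \<noteq> 0"
    using I k by (auto simp: inj_on_def)
  have "poly ?q y = (\<Sum>i\<in>I. poly p (x i) / (\<Prod>j\<in>I-{i}. x i - x j) * (\<Prod>j\<in>I-{i}. x k - x j))"
    by (simp add: poly_sum poly_prod k)
  also have "\<dots> = (\<Sum>i\<in>{k}. poly p (x i) / (\<Prod>j\<in>I-{i}. x i - x j) * (\<Prod>j\<in>I-{i}. x k - x j))"
    using z k I(1) by (intro sum.mono_neutral_right) auto
  also have "\<dots> = poly p y" using nz k by simp
  finally show "poly p y = poly ?q y" by simp
next
  have c: "card (x ` I) = card I" using I by (simp add: card_image)
  show "degree p < card (x ` I)" using p c by simp
  have "degree (smult c (\<Prod>j\<in>I-{i}. [:- x j, 1:])) \<le> card I - 1" if "i \<in> I" for i c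
  proof -
    have "degree (\<Prod>j\<in>I-{i}. [:- x j, 1:]) = card (I - {i})"
      by (subst degree_prod_sum_eq) auto
    then show ?thesis using that I(1) by (simp add: degree_smult_eq)
  qed
  then have "degree ?q \<le> card I - 1" by (rule degree_sum_le[OF I(1)])
  then show "degree ?q < card (x ` I)" using c p by simp
qed

text \<open>Comparison of the coefficients of degree \<open>card I - 1\<close> in Lagrange
  interpolation, whose basis products are monic of that degree.\<close>

lemma divided_difference_poly:
  fixes x :: "'i \<Rightarrow> 'a::field"
  assumes I: "finite I" "inj_on x I" and p: "degree p < card I"
  shows "(\<Sum>i\<in>I. poly p (x i) / (\<Prod>j\<in>I-{i}. x i - x j)) = coeff p (card I - 1)"
proof -
  have "coeff (\<Prod>j\<in>I-{i}. [:- x j, 1:]) (card I - 1) = 1" if "i \<in> I" for i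
  proof -
    have "degree (\<Prod>j\<in>I-{i}. [:- x j, 1:]) = card I - 1"
      using that I(1) by (subst degree_prod_sum_eq) auto
    then show ?thesis using lead_coeff_prod[of "\<lambda>j. [:- x j, 1:]" "I - {i}"] by simp
  qed
  then show ?thesis
    by (subst (2) lagrange_interpolation[OF assms]) (simp add: coeff_sum)
qed

text \<open>If f i u is \<phi> (u i), this is the classical divided difference of \<phi> at the
  nodes u i. Letting f i depend on the whole vector allows partial derivatives of a function of N
  variables.\<close>

definition ddiff :: "nat set \<Rightarrow> (nat \<Rightarrow> (nat \<Rightarrow> complex) \<Rightarrow> complex) \<Rightarrow> (nat \<Rightarrow> complex) \<Rightarrow> complex" where
  "ddiff I f u = (\<Sum>i\<in>I. f i u / (\<Prod>j\<in>I-{i}. u i - u j))"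

text \<open>Roots are removed one at a time: the difference quotient at p, completed by the
  derivative, stays holomorphic.\<close>

lemma holomorphic_divide_roots:
  assumes "open S" "finite P" "W holomorphic_on S" "P \<subseteq> S" "\<And>p. p \<in> P \<Longrightarrow> W p = 0"
  shows "\<exists>h. h holomorphic_on S \<and> (\<forall>z\<in>S. W z = h z * (\<Prod>p\<in>P. z - p))"
  using assms(2,4,5)
proof (induction P rule: finite_induct)
  case empty
  then show ?case using assms(3) by (intro exI[of _ W]) auto
next
  case (insert p P)
  then obtain h where h: "h holomorphic_on S" "\<forall>z\<in>S. W z = h z * (\<Prod>p\<in>P. z - p)" by auto
  have "h p * (\<Prod>q\<in>P. p - q) = 0" using h(2) insert.prems by force
  then have hp: "h p = 0" using insert.hyps by auto
  let ?k = "\<lambda>z. if z = p then deriv h p else (h z - h p) / (z - p)"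
  have "?k holomorphic_on S" by (rule pole_lemma_open[OF h(1) assms(1)])
  moreover have "W z = ?k z * (\<Prod>q\<in>insert p P. z - q)" if "z \<in> S" for z
    using h(2) that hp insert.hyps by (cases "z = p") auto
  ultimately show ?case by (intro exI[of _ ?k]) blast
qed

text \<open>On the diagonal \<open>u i = u j\<close> the poles of the two summands cancel, so the divided difference is
  holomorphic in each variable and the maximum principle applies one variable at a time.\<close>
lemma ddiff_max_modulus:
  assumes I: "finite I" and B: "open B"
    and hol: "\<And>i. i \<in> I \<Longrightarrow> sephol B (f i)"
    and sym: "\<And>i j v. i \<in> I \<Longrightarrow> j \<in> I \<Longrightarrow> v \<in> B \<Longrightarrow> v i = v j \<Longrightarrow> f i v = f j v"
    and dom: "\<And>v. (\<And>a. a \<in> I \<Longrightarrow> norm (v a - 1) \<le> t) \<Longrightarrow> (\<And>a. a \<notin> I \<Longrightarrow> v a = u a) \<Longrightarrow> v \<in> B"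
    and \<tau>: "inj_on \<tau> I" "\<And>i. i \<in> I \<Longrightarrow> \<sigma> \<le> \<tau> i \<and> \<tau> i \<le> t" and \<sigma>: "\<sigma> > 0"
    and bd: "\<And>v. (\<And>a. a \<in> I \<Longrightarrow> norm (v a - 1) = \<tau> a) \<Longrightarrow> (\<And>a. a \<notin> I \<Longrightarrow> v a = u a) \<Longrightarrow> norm (ddiff I f v) \<le> C"
    and u: "\<And>a. a \<in> I \<Longrightarrow> norm (u a - 1) < \<sigma>" "inj_on u I"
  shows "norm (ddiff I f u) \<le> C"
proof -
  \<comment> \<open>T collects the variables still inside the small disc; the others lie on their
    circles. Each induction step moves one variable out to its circle.\<close>
  have claim: "norm (ddiff I f v) \<le> C"
    if "finite T" "T \<subseteq> I" "\<forall>a\<in>I-T. norm (v a - 1) = \<tau> a" "\<forall>a\<in>T. norm (v a - 1) < \<sigma>" "\<forall>a. a \<notin> I \<longrightarrow> v a = u a" "inj_on v I" for T v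
    using that
  proof (induction T arbitrary: v rule: finite_induct)
    case empty
    then show ?case by (intro bd) auto
  next
    case (insert a T)
    note IH = insert.IH and v = insert.prems
    have a: "a \<in> I" "a \<notin> T" using insert by auto
    define S where "S = {z. v(a := z) \<in> B}"
    have S: "open S" unfolding S_def by (rule open_slice[OF B])
    have vt: "norm (v b - 1) \<le> t" if "b \<in> I" for b
      using v(2,3) \<tau>(2)[OF that] that by (cases "b \<in> insert a T") force+
    have inS: "z \<in> S" if "norm (z - 1) \<le> t" for z
      unfolding S_def mem_Collect_eq by (rule dom) (use that vt v(4) a in auto)
    define P where "P = v ` (I - {a})"
    have P: "finite P" "P \<subseteq> S" using I inS vt by (auto simp: P_def)
    have injv: "inj_on v (I - {a})" using v(5) by (rule inj_on_subset) auto
    have prodP: "(\<Prod>p\<in>P. z - p) = (\<Prod>j\<in>I-{a}. z - v j)" for z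
      unfolding P_def by (subst prod.reindex[OF injv]) simp
    \<comment> \<open>W subtracts from \<open>f a\<close> the Lagrange interpolant through the other
      nodes. It is the numerator of the divided difference over the common denominator \<Prod>(z - v
      j), and \<open>sym\<close> makes it vanish at each node.\<close>
    define W where "W = (\<lambda>z. f a (v(a := z)) - (\<Sum>i\<in>I-{a}. f i (v(a := z)) * ((\<Prod>j\<in>I-{a}-{i}. z - v j) / (\<Prod>j\<in>I-{a}-{i}. v i - v j))))"
    have slice: "(\<lambda>z. f i (v(a := z))) holomorphic_on S" if "i \<in> I" for i
      unfolding S_def by (rule sephol_holomorphic_slice[OF hol[OF that]])
    have nzp: "(\<Prod>j\<in>I-{a}-{i}. v i - v j) \<noteq> 0" if "i \<in> I - {a}" for i
      using that I injv by (auto simp: inj_on_def)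
    have "W holomorphic_on S" unfolding W_def
    proof (intro holomorphic_on_diff holomorphic_on_sum holomorphic_on_mult holomorphic_on_divide)
      show "(\<lambda>z. f a (v(a := z))) holomorphic_on S" by (rule slice[OF a(1)])
      fix i assume i: "i \<in> I - {a}"
      show "(\<lambda>z. f i (v(a := z))) holomorphic_on S" using slice i by blast
      show "(\<lambda>z. \<Prod>j\<in>I-{a}-{i}. z - v j) holomorphic_on S" by (intro holomorphic_intros)
    qed (use nzp in \<open>auto intro: holomorphic_intros\<close>)
    moreover have "W p = 0" if pP: "p \<in> P" for p
    proof -
      obtain b where b: "b \<in> I - {a}" "p = v b" using pP by (auto simp: P_def)
      have z: "(\<Prod>j\<in>I-{a}-{i}. p - v j) = 0" if "i \<in> I - {a}" "i \<noteq> b" for i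
        using that b I by (intro prod_zero) auto
      have "(\<Sum>i\<in>I-{a}. f i (v(a := p)) * ((\<Prod>j\<in>I-{a}-{i}. p - v j) / (\<Prod>j\<in>I-{a}-{i}. v i - v j)))
        = (\<Sum>i\<in>{b}. f i (v(a := p)) * ((\<Prod>j\<in>I-{a}-{i}. p - v j) / (\<Prod>j\<in>I-{a}-{i}. v i - v j)))"
        using z b I by (intro sum.mono_neutral_right) auto
      also have "\<dots> = f b (v(a := p))" using nzp[OF b(1)] b by simp
      also have "\<dots> = f a (v(a := p))"
        by (rule sym) (use a b P pP in \<open>auto simp: S_def\<close>)
      finally show ?thesis by (simp add: W_def)
    qed
    ultimately obtain h where h: "h holomorphic_on S" "\<forall>z\<in>S. W z = h z * (\<Prod>p\<in>P. z - p)"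
      using holomorphic_divide_roots[OF S P(1) _ P(2)] by blast
    have eq: "ddiff I f (v(a := z)) = h z" if z: "z \<in> S" "z \<notin> P" for z
    proof -
      have zne: "z \<noteq> v j" if "j \<in> I - {a}" for j using z(2) that by (auto simp: P_def)
      have pn: "(\<Prod>j\<in>I-{a}. z - v j) \<noteq> 0" using zne I by auto
      let ?v = "v(a := z)"
      have "ddiff I f ?v = f a ?v / (\<Prod>j\<in>I-{a}. ?v a - ?v j) + (\<Sum>i\<in>I-{a}. f i ?v / (\<Prod>j\<in>I-{i}. ?v i - ?v j))"
        unfolding ddiff_def by (rule sum.remove[OF I a(1)])
      also have "(\<Prod>j\<in>I-{a}. ?v a - ?v j) = (\<Prod>j\<in>I-{a}. z - v j)" by (intro prod.cong) auto
      also have "(\<Sum>i\<in>I-{a}. f i ?v / (\<Prod>j\<in>I-{i}. ?v i - ?v j)) =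
         (\<Sum>i\<in>I-{a}. - (f i ?v * ((\<Prod>j\<in>I-{a}-{i}. z - v j) / (\<Prod>j\<in>I-{a}-{i}. v i - v j))) / (\<Prod>j\<in>I-{a}. z - v j))"
      proof (intro sum.cong refl)
        fix i assume i: "i \<in> I - {a}"
        have "(\<Prod>j\<in>I-{i}. ?v i - ?v j) = (?v i - ?v a) * (\<Prod>j\<in>I-{i}-{a}. ?v i - ?v j)"
          by (rule prod.remove) (use I i a in auto)
        also have "(\<Prod>j\<in>I-{i}-{a}. ?v i - ?v j) = (\<Prod>j\<in>I-{a}-{i}. v i - v j)"
          using i by (intro prod.cong) auto
        finally have e1: "(\<Prod>j\<in>I-{i}. ?v i - ?v j) = (v i - z) * (\<Prod>j\<in>I-{a}-{i}. v i - v j)" using i by simp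
        have e2: "(\<Prod>j\<in>I-{a}. z - v j) = (z - v i) * (\<Prod>j\<in>I-{a}-{i}. z - v j)"
          by (rule prod.remove) (use I i in auto)
        have n1: "z - v i \<noteq> 0" using zne[OF i] by simp
        have n2: "(\<Prod>j\<in>I-{a}-{i}. z - v j) \<noteq> 0" using pn e2 by auto
        have "v i - z = - (z - v i)" by simp
        then show "f i ?v / (\<Prod>j\<in>I-{i}. ?v i - ?v j) =
          - (f i ?v * ((\<Prod>j\<in>I-{a}-{i}. z - v j) / (\<Prod>j\<in>I-{a}-{i}. v i - v j))) / (\<Prod>j\<in>I-{a}. z - v j)"
          unfolding e1 e2 using n1 n2 nzp[OF i] by (simp add: field_simps)
      qed
      also have "f a ?v / (\<Prod>j\<in>I-{a}. z - v j) + \<dots> = W z / (\<Prod>j\<in>I-{a}. z - v j)"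
        unfolding W_def by (simp add: sum_divide_distrib sum_negf diff_divide_distrib)
      also have "\<dots> = h z" using h(2) z(1) prodP pn by simp
      finally show ?thesis .
    qed
    have ta: "\<sigma> \<le> \<tau> a" "\<tau> a \<le> t" using \<tau>(2)[OF a(1)] by auto
    have cb: "cball 1 (\<tau> a) \<subseteq> S" using inS ta by (auto simp: dist_norm norm_minus_commute)
    have va: "norm (v a - 1) < \<sigma>" using v(3) by simp
    have "norm (h (v a)) \<le> C"
    proof (rule maximum_modulus_frontier[of h "cball 1 (\<tau> a)"])
      show "h holomorphic_on interior (cball 1 (\<tau> a))"
        using h(1) cb interior_subset by (meson holomorphic_on_subset order_trans)
      show "continuous_on (closure (cball 1 (\<tau> a))) h"
        using h(1) cb by (simp add: holomorphic_on_imp_continuous_on holomorphic_on_subset)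
      show "v a \<in> cball 1 (\<tau> a)" using va ta by (simp add: dist_norm norm_minus_commute)
      fix z :: complex assume "z \<in> frontier (cball 1 (\<tau> a))"
      then have z: "norm (z - 1) = \<tau> a" using ta \<sigma> by (simp add: dist_norm norm_minus_commute frontier_cball)
      \<comment> \<open>Distinct radii, all at least \<sigma>, keep the moved node apart from the
        nodes on other circles and from those still inside.\<close>
      have zP: "z \<noteq> v j" if j: "j \<in> I" "j \<noteq> a" for j
      proof (cases "j \<in> T")
        case True
        then have "norm (v j - 1) < \<tau> a" using v(3) ta by force
        then show ?thesis using z by auto
      next
        case False
        then have "norm (v j - 1) = \<tau> j" using v(2) j by auto
        moreover have "\<tau> j \<noteq> \<tau> a" using \<tau>(1) j a by (auto simp: inj_on_def)
        ultimately show ?thesis using z by auto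
      qed
      have "norm (ddiff I f (v(a := z))) \<le> C"
      proof (rule IH)
        show "inj_on (v(a := z)) I" using v(5) zP unfolding inj_on_def by (metis fun_upd_apply)
        show "T \<subseteq> I" using v(1) by auto
        show "\<forall>b\<in>I - T. norm ((v(a := z)) b - 1) = \<tau> b" using v(2) z by auto
        show "\<forall>b\<in>T. norm ((v(a := z)) b - 1) < \<sigma>" using v(3) a by auto
        show "\<forall>b. b \<notin> I \<longrightarrow> (v(a := z)) b = u b" using v(4) a by auto
      qed
      moreover have "z \<notin> P" using zP by (auto simp: P_def)
      ultimately show "norm (h z) \<le> C" using eq inS z ta by metis
    qed simp
    moreover have "v a \<notin> P" using v(5) a by (auto simp: P_def inj_on_def)
    ultimately show ?case using eq[of "v a"] inS[of "v a"] vt[OF a(1)] by simp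
  qed
  show ?thesis by (rule claim[of I u]) (use I u in auto)
qed

lemma ddiff_norm_le:
  assumes "finite I" "\<And>i. i \<in> I \<Longrightarrow> norm (f i v) \<le> E" "\<kappa> > 0"
    "\<And>i j. i \<in> I \<Longrightarrow> j \<in> I \<Longrightarrow> i \<noteq> j \<Longrightarrow> \<kappa> \<le> norm (v i - v j)"
  shows "norm (ddiff I f v) \<le> real (card I) * (E / \<kappa> ^ (card I - 1))"
proof -
  have "norm (f i v / (\<Prod>j\<in>I-{i}. v i - v j)) \<le> E / \<kappa> ^ (card I - 1)" if i: "i \<in> I" for i
  proof -
    have "(\<Prod>j\<in>I-{i}. \<kappa>) \<le> (\<Prod>j\<in>I-{i}. norm (v i - v j))"
      using assms(3,4) i by (intro prod_mono) auto
    then have "\<kappa> ^ (card I - 1) \<le> norm (\<Prod>j\<in>I-{i}. v i - v j)" using i assms(1) by (simp add: prod_norm)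
    moreover have "0 \<le> E" using assms(2)[OF i] norm_ge_zero order_trans by blast
    ultimately show ?thesis unfolding norm_divide using assms(2)[OF i] assms(3)
      by (intro frac_le) auto
  qed
  then have "norm (ddiff I f v) \<le> of_nat (card I) * (E / \<kappa> ^ (card I - 1))"
    unfolding ddiff_def by (rule sum_norm_bound)
  then show ?thesis by simp
qed

text \<open>The radii are s (1 + r / (m + 1)) with r from 0 to m. They lie between s and 2 s with
  gaps of s / (m + 1), and points on two circles about 1 are at least as far apart as the
  radii.\<close>

lemma separated_radii:
  assumes "finite I" "card I = Suc m" "s > 0"
  obtains \<tau> where "inj_on \<tau> I" "\<And>i. i \<in> I \<Longrightarrow> s \<le> \<tau> i \<and> \<tau> i \<le> 2 * s"
    "\<And>i j (v::nat \<Rightarrow> complex). i \<in> I \<Longrightarrow> j \<in> I \<Longrightarrow> i \<noteq> j \<Longrightarrow> norm (v i - 1) = \<tau> i \<Longrightarrow> norm (v j - 1) = \<tau> j \<Longrightarrow>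
       s / (real m + 1) \<le> norm (v i - v j)"
proof -
  obtain r where r: "bij_betw r I {0..<Suc m}" using ex_bij_betw_finite_nat[OF assms(1)] assms(2) by metis
  define \<tau> where "\<tau> = (\<lambda>i. s * (1 + real (r i) / (real m + 1)))"
  have r1: "r i \<le> m" if "i \<in> I" for i using bij_betwE[OF r] that by (simp add: less_Suc_eq_le)
  have r2: "r i \<noteq> r j" if "i \<in> I" "j \<in> I" "i \<noteq> j" for i j using r that by (auto simp: bij_betw_def inj_on_def)
  have sep: "s / (real m + 1) \<le> \<bar>\<tau> i - \<tau> j\<bar>" if "i \<in> I" "j \<in> I" "i \<noteq> j" for i j
  proof -
    have "1 \<le> \<bar>real (r i) - real (r j)\<bar>" using r2[OF that] by linarith
    then have "s / (real m + 1) * 1 \<le> s / (real m + 1) * \<bar>real (r i) - real (r j)\<bar>" using assms by (intro mult_left_mono) auto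
    also have "\<dots> = \<bar>\<tau> i - \<tau> j\<bar>"
    proof -
      have "\<tau> i - \<tau> j = s / (real m + 1) * (real (r i) - real (r j))" 
      proof -
        define c where "c = real m + 1"
        have "c > 0" by (simp add: c_def)
        then show ?thesis unfolding \<tau>_def c_def[symmetric] by (simp add: field_simps)
      qed
      then show ?thesis using assms by (simp add: abs_mult)
    qed
    finally show ?thesis by simp
  qed
  show ?thesis
  proof (rule that[of \<tau>])
    have p: "s / (real m + 1) > 0" using assms by simp
    show "inj_on \<tau> I"
    proof (rule inj_onI, rule ccontr)
      fix i j assume "i \<in> I" "j \<in> I" "\<tau> i = \<tau> j" "i \<noteq> j"
      then show False using sep[of i j] p by simp
    qed
    fix i assume i: "i \<in> I"
    have "real (r i) / (real m + 1) \<le> 1" using r1[OF i] by simp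
    then have "s * (1 + real (r i) / (real m + 1)) \<le> s * 2" using assms by (intro mult_left_mono) auto
    then show "s \<le> \<tau> i \<and> \<tau> i \<le> 2 * s" using assms by (auto simp: \<tau>_def algebra_simps)
    fix j and v :: "nat \<Rightarrow> complex" assume j: "j \<in> I" "i \<noteq> j" "norm (v i - 1) = \<tau> i" "norm (v j - 1) = \<tau> j"
    have "\<bar>norm (v i - 1) - norm (v j - 1)\<bar> \<le> norm ((v i - 1) - (v j - 1))" by (rule norm_triangle_ineq3)
    then show "s / (real m + 1) \<le> norm (v i - v j)" using sep[OF i j(1,2)] j by simp
  qed
qed

text \<open>On separated circles each of the m + 1 summands has m denominator factors of size at
  least s / (m + 1), whence the constant. The maximum principle carries the bound to nodes that
  nearly coincide, where single summands can be arbitrarily large.\<close>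

lemma ddiff_bound:
  assumes I: "finite I" "card I = Suc m" and B: "open B" and s: "s > 0"
    and hol: "\<And>i. i \<in> I \<Longrightarrow> sephol B (f i)"
    and sym: "\<And>i j v. i \<in> I \<Longrightarrow> j \<in> I \<Longrightarrow> v \<in> B \<Longrightarrow> v i = v j \<Longrightarrow> f i v = f j v"
    and dom: "\<And>v. (\<And>a. a \<in> I \<Longrightarrow> norm (v a - 1) \<le> 2 * s) \<Longrightarrow> (\<And>a. a \<notin> I \<Longrightarrow> v a = u a) \<Longrightarrow> v \<in> B"
    and bd: "\<And>v i. (\<And>a. a \<in> I \<Longrightarrow> norm (v a - 1) \<le> 2 * s) \<Longrightarrow> (\<And>a. a \<notin> I \<Longrightarrow> v a = u a) \<Longrightarrow> i \<in> I \<Longrightarrow> norm (f i v) \<le> E"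
    and u: "\<And>a. a \<in> I \<Longrightarrow> norm (u a - 1) < s" "inj_on u I"
  shows "norm (ddiff I f u) \<le> (real m + 1) ^ Suc m * E / s ^ m"
proof -
  obtain \<tau> where \<tau>: "inj_on \<tau> I" "\<And>i. i \<in> I \<Longrightarrow> s \<le> \<tau> i \<and> \<tau> i \<le> 2 * s"
    "\<And>i j (v::nat \<Rightarrow> complex). i \<in> I \<Longrightarrow> j \<in> I \<Longrightarrow> i \<noteq> j \<Longrightarrow> norm (v i - 1) = \<tau> i \<Longrightarrow> norm (v j - 1) = \<tau> j \<Longrightarrow>
       s / (real m + 1) \<le> norm (v i - v j)"
    using separated_radii[OF I s] by metis
  show ?thesis
  proof (rule ddiff_max_modulus[OF I(1) B hol sym dom \<tau>(1,2) s _ u])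
    fix v assume v: "\<And>a. a \<in> I \<Longrightarrow> norm (v a - 1) = \<tau> a" "\<And>a. a \<notin> I \<Longrightarrow> v a = u a"
    have "norm (ddiff I f v) \<le> real (card I) * (E / (s / (real m + 1)) ^ (card I - 1))"
    proof (rule ddiff_norm_le[OF I(1)])
      show "norm (f i v) \<le> E" if "i \<in> I" for i by (rule bd) (use v \<tau>(2) that in auto)
      show "s / (real m + 1) \<le> norm (v i - v j)" if "i \<in> I" "j \<in> I" "i \<noteq> j" for i j
        using \<tau>(3)[OF that] v that by auto
    qed (use s in auto)
    also have "\<dots> = (real m + 1) ^ Suc m * E / s ^ m"
      using I s by (simp add: field_simps power_divide)
    finally show "norm (ddiff I f v) \<le> (real m + 1) ^ Suc m * E / s ^ m" .
  qed
qed

lemma sephol_coord_comp: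
  assumes "\<phi> holomorphic_on T" "open T"
  shows "sephol {v. v i \<in> T} (\<lambda>v. \<phi> (v i))"
  by (rule sephol_comp[OF sephol_coord assms]) simp

lemma ddiff_one_variable_bound:
  assumes I: "finite I" "card I = Suc m" and s: "s > 0"
    and \<phi>: "\<phi> holomorphic_on T" "open T" "cball 1 (2 * s) \<subseteq> T" "\<And>z. z \<in> cball 1 (2 * s) \<Longrightarrow> norm (\<phi> z) \<le> E"
    and u: "\<And>a. a \<in> I \<Longrightarrow> norm (u a - 1) < s" "inj_on u I"
  shows "norm (ddiff I (\<lambda>i v. \<phi> (v i)) u) \<le> (real m + 1) ^ Suc m * E / s ^ m"
proof (rule ddiff_bound[OF I, where B = "\<Inter>i\<in>I. {v. v i \<in> T}"])
  show "open (\<Inter>i\<in>I. {v::nat \<Rightarrow> complex. v i \<in> T})" using I(1) \<phi>(2) by (intro open_INT ballI open_coordinate) auto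
  show "sephol (\<Inter>i\<in>I. {v. v i \<in> T}) (\<lambda>v. \<phi> (v i))" if "i \<in> I" for i
    by (rule sephol_subset[OF sephol_coord_comp[OF \<phi>(1,2)]]) (use that in auto)
  fix v :: "nat \<Rightarrow> complex" assume v: "\<And>a. a \<in> I \<Longrightarrow> norm (v a - 1) \<le> 2 * s"
  then have c: "v a \<in> cball 1 (2 * s)" if "a \<in> I" for a using that by (auto simp: dist_norm norm_minus_commute)
  then show "v \<in> (\<Inter>i\<in>I. {v. v i \<in> T})" using \<phi>(3) by blast
  show "norm (\<phi> (v i)) \<le> E" if "i \<in> I" for i using c[OF that] by (rule \<phi>(4))
qed (use s u in auto)

text \<open>Subtract the Taylor polynomial p of order m at 1. Its divided difference is exactly its
  top coefficient. The remainder is of order d^(m+1) on the disc of radius 2 d, and the factor 1 /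
  d^m of the bound leaves order d, for all node sets at once.\<close>

lemma ddiff_tendsto_deriv:
  assumes \<phi>: "\<phi> holomorphic_on T" "open T" "1 \<in> T" and e: "e > 0"
  obtains d where "d > 0" "\<And>I u. finite I \<Longrightarrow> card I = Suc m \<Longrightarrow> (\<And>a. a \<in> I \<Longrightarrow> norm (u a - 1) < d) \<Longrightarrow> inj_on u I \<Longrightarrow>
     norm (ddiff I (\<lambda>i v. \<phi> (v i)) u - (deriv ^^ m) \<phi> 1 / fact m) < e"
proof -
  obtain t where t: "t > 0" "cball 1 t \<subseteq> T" using \<phi> open_contains_cball by metis
  have T': "ball 1 t \<subseteq> T" using t ball_subset_cball by blast
  have "continuous_on (cball 1 t) ((deriv ^^ Suc m) \<phi>)"
    using holomorphic_higher_deriv[OF \<phi>(1,2), of "Suc m"] t(2) by (meson holomorphic_on_imp_continuous_on holomorphic_on_subset)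
  then have "bounded ((deriv ^^ Suc m) \<phi> ` cball 1 t)" using compact_continuous_image compact_imp_bounded compact_cball by blast
  then obtain K where K: "K > 0" "\<And>z. z \<in> cball 1 t \<Longrightarrow> norm ((deriv ^^ Suc m) \<phi> z) \<le> K"
    unfolding bounded_pos by auto
  define p where "p = (\<Sum>i\<le>m. smult ((deriv ^^ i) \<phi> 1 / fact i) ([:-1, 1:] ^ i))"
  have polyp: "poly p z = (\<Sum>i\<le>m. (deriv ^^ i) \<phi> 1 * (z - 1) ^ i / fact i)" for z
    by (simp add: p_def poly_sum)
  have degp: "degree p < Suc m" unfolding p_def
    by (intro order.strict_trans1[OF degree_sum_le[of _ _ m]]) (auto simp: degree_linear_power intro: order_trans[OF degree_smult_le])
  have cp: "coeff p m = (deriv ^^ m) \<phi> 1 / fact m"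
  proof -
    have "coeff p m = (\<Sum>i\<le>m. (deriv ^^ i) \<phi> 1 / fact i * coeff ([:-1, 1:] ^ i) m)" by (simp add: p_def coeff_sum)
    also have "\<dots> = (\<Sum>i\<in>{m}. (deriv ^^ i) \<phi> 1 / fact i * coeff ([:-1, 1:] ^ i) m)"
      by (intro sum.mono_neutral_right) (auto simp: coeff_eq_0 degree_linear_power)
    also have "\<dots> = (deriv ^^ m) \<phi> 1 / fact m"
      using lead_coeff_power[of "[:-1, 1::complex:]" m] by (simp add: degree_linear_power)
    finally show ?thesis .
  qed
  have rem: "norm (\<phi> z - poly p z) \<le> K * norm (z - 1) ^ Suc m" if z: "z \<in> ball 1 t" for z
  proof -
    have "norm (\<phi> z - (\<Sum>i\<le>m. (deriv ^^ i) \<phi> 1 * (z - 1) ^ i / fact i)) \<le> K * norm (z - 1) ^ Suc m / fact m"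
    proof (rule complex_Taylor[of "ball 1 t" m "\<lambda>i. (deriv ^^ i) \<phi>" K 1 z, unfolded funpow_0])
      fix i and x :: complex assume "x \<in> ball 1 t"
      from has_field_derivative_higher_deriv[OF holomorphic_on_subset[OF \<phi>(1) T'] open_ball this, of i]
      show "((deriv ^^ i) \<phi> has_field_derivative (deriv ^^ Suc i) \<phi> x) (at x within ball 1 t)"
        by (rule has_field_derivative_at_within)
    qed (use K z t in auto)
    also have "\<dots> \<le> K * norm (z - 1) ^ Suc m / 1"
      using K by (intro divide_left_mono) (auto simp: fact_ge_1)
    finally show ?thesis by (simp add: polyp)
  qed
  define A where "A = (real m + 1) ^ Suc m * K * 2 ^ Suc m"
  have A: "A > 0" using K by (simp add: A_def)
  define d where "d = min (t / 3) (e / (2 * A))"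
  have d: "d > 0" "2 * d < t" "A * d < e" using t e A by (auto simp: d_def min_def field_simps)
  show ?thesis
  proof (rule that[of d])
    fix I :: "nat set" and u :: "nat \<Rightarrow> complex" assume I: "finite I" "card I = Suc m" and u: "\<And>a. a \<in> I \<Longrightarrow> norm (u a - 1) < d" "inj_on u I"
    have "norm (ddiff I (\<lambda>i v. \<phi> (v i) - poly p (v i)) u) \<le> (real m + 1) ^ Suc m * (K * (2 * d) ^ Suc m) / d ^ m"
    proof (rule ddiff_one_variable_bound[OF I d(1) _ open_ball, where \<phi> = "\<lambda>z. \<phi> z - poly p z"])
      show "(\<lambda>z. \<phi> z - poly p z) holomorphic_on ball 1 t"
        by (intro holomorphic_intros holomorphic_on_subset[OF \<phi>(1) T'])
      show "cball 1 (2 * d) \<subseteq> ball 1 t" using d by auto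
      fix z :: complex assume z: "z \<in> cball 1 (2 * d)"
      have "norm (\<phi> z - poly p z) \<le> K * norm (z - 1) ^ Suc m" by (rule rem) (use z d in auto)
      also have "\<dots> \<le> K * (2 * d) ^ Suc m"
        using K z by (intro mult_left_mono power_mono) (auto simp: dist_norm norm_minus_commute)
      finally show "norm (\<phi> z - poly p z) \<le> K * (2 * d) ^ Suc m" .
    qed (use u in auto)
    also have "\<dots> = A * d" using d(1) by (simp add: A_def power_mult_distrib field_simps)
    finally have b: "norm (ddiff I (\<lambda>i v. \<phi> (v i) - poly p (v i)) u) < e" using d by simp
    have "ddiff I (\<lambda>i v. poly p (v i)) u = coeff p m"
      unfolding ddiff_def using divided_difference_poly[OF I(1) u(2), of p] degp I by simp
    moreover have "ddiff I (\<lambda>i v. \<phi> (v i) - poly p (v i)) u = ddiff I (\<lambda>i v. \<phi> (v i)) u - ddiff I (\<lambda>i v. poly p (v i)) u"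
      by (simp add: ddiff_def diff_divide_distrib sum_subtractf)
    ultimately show "norm (ddiff I (\<lambda>i v. \<phi> (v i)) u - (deriv ^^ m) \<phi> 1 / fact m) < e"
      using b cp by simp
  qed (use d in auto)
qed

section \<open>The Euler operator on generating functions\<close>

definition ell :: "nat \<Rightarrow> (nat \<Rightarrow> int) \<Rightarrow> nat \<Rightarrow> int" where
  "ell N l i = l i + int N - int i"

definition fallfac :: "nat \<Rightarrow> int \<Rightarrow> real" where
  "fallfac k x = (\<Prod>t<k. real_of_int x - real t)"

definition ek :: "nat \<Rightarrow> nat \<Rightarrow> (nat \<Rightarrow> int) \<Rightarrow> real" where
  "ek N k l = (\<Sum>i\<in>{1..N}. fallfac k (ell N l i))"

section \<open>Higher derivatives of powers and of products over roots\<close>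

lemma higher_deriv_powi:
  assumes "z \<noteq> 0"
  shows "(deriv ^^ k) (\<lambda>z::complex. z powi n) z = of_real (fallfac k n) * z powi (n - int k)"
  using assms
proof (induction k arbitrary: z)
  case (Suc k)
  have "(deriv ^^ Suc k) (\<lambda>z. z powi n) z = deriv (\<lambda>z. of_real (fallfac k n) * z powi (n - int k)) z"
    unfolding funpow.simps o_apply
  proof (rule deriv_cong_ev)
    have "\<forall>\<^sub>F x in nhds z. x \<in> -{0}" using Suc.prems by (intro eventually_nhds_in_open) auto
    then show "\<forall>\<^sub>F x in nhds z. (deriv ^^ k) (\<lambda>z. z powi n) x = of_real (fallfac k n) * x powi (n - int k)"
      by eventually_elim (rule Suc.IH, simp)
  qed simp
  also have "\<dots> = of_real (fallfac k n) * (of_int (n - int k) * z powi (n - int k - 1))"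
    using Suc.prems by (intro DERIV_imp_deriv) (auto intro!: derivative_eq_intros)
  finally show ?case by (simp add: fallfac_def algebra_simps)
qed (simp add: fallfac_def)

lemma higher_deriv_shifted_power:
  "(deriv ^^ m) (\<lambda>z::complex. (z - a) ^ n) z = (\<Prod>t<m. of_nat n - of_nat t) * (z - a) ^ (n - m)"
proof (induction m arbitrary: z)
  case (Suc m)
  have "(deriv ^^ Suc m) (\<lambda>z::complex. (z - a) ^ n) z = deriv (\<lambda>z. (\<Prod>t<m. of_nat n - of_nat t) * (z - a) ^ (n - m)) z"
    unfolding funpow.simps o_apply by (rule arg_cong[where f = "\<lambda>f. deriv f z"]) (rule ext, rule Suc.IH)
  also have "\<dots> = (\<Prod>t<m. of_nat n - of_nat t) * (of_nat (n - m) * (z - a) ^ (n - m - 1))"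
    by (intro DERIV_imp_deriv) (auto intro!: derivative_eq_intros)
  also have "\<dots> = (\<Prod>t<Suc m. of_nat n - of_nat t) * (z - a) ^ (n - Suc m)"
    by (cases "m \<le> n") (auto simp: of_nat_diff)
  finally show ?case .
qed simp

lemma higher_deriv_shifted_power_at:
  "(deriv ^^ m) (\<lambda>z::complex. (z - a) ^ n) a = (if n = m then fact m else 0)"
proof -
  consider "n < m" | "n = m" | "n > m" by linarith
  then show ?thesis
  proof cases
    case 1
    then have "(\<Prod>t<m. of_nat n - of_nat t :: complex) = 0" by (intro prod_zero) auto
    then show ?thesis using 1 by (simp add: higher_deriv_shifted_power)
  next
    case 2
    have "(\<Prod>t<m. of_nat m - of_nat t :: complex) = (\<Prod>t<m. of_nat (m - t))"
      by (intro prod.cong) (auto simp: of_nat_diff)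
    also have "\<dots> = fact m" unfolding fact_prod_rev by (simp add: atLeast0LessThan)
    finally show ?thesis using 2 by (simp add: higher_deriv_shifted_power)
  next
    case 3
    then show ?thesis by (simp add: higher_deriv_shifted_power power_0_left)
  qed
qed

lemma higher_deriv_sum:
  assumes "open S" "z \<in> S" "finite A" "\<And>a. a \<in> A \<Longrightarrow> f a holomorphic_on S"
  shows "(deriv ^^ n) (\<lambda>z. \<Sum>a\<in>A. f a z) z = (\<Sum>a\<in>A. (deriv ^^ n) (f a) z)"
  using assms(3,4)
proof (induction A rule: finite_induct)
  case (insert a A)
  have "(deriv ^^ n) (\<lambda>z. f a z + (\<Sum>a\<in>A. f a z)) z = (deriv ^^ n) (f a) z + (deriv ^^ n) (\<lambda>z. \<Sum>a\<in>A. f a z) z"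
    using insert assms by (intro higher_deriv_add[of _ S]) (auto intro!: holomorphic_on_sum)
  then show ?case using insert by simp
qed (simp add: higher_deriv_const)

text \<open>Each factor is written as (z - z0) + (z0 - u j). The set J of factors contributing z -
  z0 must have exactly m elements for the term to survive m derivatives at z0.\<close>

lemma higher_deriv_root_product:
  assumes "finite B"
  shows "(deriv ^^ m) (\<lambda>z::complex. \<Prod>j\<in>B. z - u j) z0 = fact m * (\<Sum>J | J \<subseteq> B \<and> card J = m. \<Prod>j\<in>B-J. z0 - u j)"
proof -
  have "(\<lambda>z. \<Prod>j\<in>B. z - u j) = (\<lambda>z. \<Sum>J\<in>Pow B. (\<Prod>j\<in>B-J. z0 - u j) * (z - z0) ^ card J)"
  proof
    fix z
    have "(\<Prod>j\<in>B. z - u j) = (\<Prod>j\<in>B. (z - z0) + (z0 - u j))" by simp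
    also have "\<dots> = (\<Sum>J\<in>Pow B. (\<Prod>j\<in>J. z - z0) * (\<Prod>j\<in>B-J. z0 - u j))" by (rule prod_add[OF assms])
    finally show "(\<Prod>j\<in>B. z - u j) = (\<Sum>J\<in>Pow B. (\<Prod>j\<in>B-J. z0 - u j) * (z - z0) ^ card J)"
      by (simp add: mult_ac)
  qed
  then have "(deriv ^^ m) (\<lambda>z::complex. \<Prod>j\<in>B. z - u j) z0 = (deriv ^^ m) (\<lambda>z. \<Sum>J\<in>Pow B. (\<Prod>j\<in>B-J. z0 - u j) * (z - z0) ^ card J) z0"
    by (simp only:)
  also have "\<dots> = (\<Sum>J\<in>Pow B. (deriv ^^ m) (\<lambda>z. (\<Prod>j\<in>B-J. z0 - u j) * (z - z0) ^ card J) z0)"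
    using assms by (intro higher_deriv_sum[of UNIV]) (auto intro!: holomorphic_intros)
  also have "\<dots> = (\<Sum>J\<in>Pow B. (\<Prod>j\<in>B-J. z0 - u j) * (deriv ^^ m) (\<lambda>z. (z - z0) ^ card J) z0)"
    by (intro sum.cong refl higher_deriv_cmult[of _ UNIV]) (auto intro!: holomorphic_intros)
  also have "\<dots> = (\<Sum>J\<in>Pow B. (\<Prod>j\<in>B-J. z0 - u j) * (if card J = m then fact m else 0))"
    by (simp only: higher_deriv_shifted_power_at)
  also have "\<dots> = (\<Sum>J | J \<subseteq> B \<and> card J = m. (\<Prod>j\<in>B-J. z0 - u j) * fact m)"
    using assms by (intro sum.mono_neutral_cong_right) auto
  finally show ?thesis by (simp add: sum_distrib_left mult_ac)
qed

text \<open>In one variable the Vandermonde product is a multiple of the polynomial whose roots are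
  the other variables. K is eliminated later by evaluation at z = u i.\<close>

lemma vdm_slice:
  assumes "i \<in> {1..N}"
  shows "\<exists>K. \<forall>z. vdm N (u(i := z)) = K * (\<Prod>j\<in>{1..N}-{i}. z - u j)"
  using assms
proof (induction N)
  case (Suc N)
  show ?case
  proof (cases "i = Suc N")
    case True
    have "vdm (Suc N) (u(i := z)) = (vdm N u * (-1) ^ N) * (\<Prod>j\<in>{1..Suc N}-{i}. z - u j)" for z
    proof -
      have "vdm N (u(i := z)) = vdm N u" unfolding vdm_def using True by (intro prod.cong refl) auto
      moreover have "(\<Prod>j\<in>{1..N}. (u(i := z)) j - (u(i := z)) (Suc N)) = (\<Prod>j\<in>{1..N}. (-1) * (z - u j))"
        using True by (intro prod.cong refl) auto
      moreover have "{1..Suc N} - {i} = {1..N}" using True by auto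
      moreover have "(\<Prod>j\<in>{1..N}. (-1) * (z - u j)) = (-1) ^ N * (\<Prod>j\<in>{1..N}. z - u j)"
        by (simp only: prod.distrib prod_constant card_atLeastAtMost diff_Suc_1)
      ultimately show ?thesis unfolding vdm_Suc by (simp only: mult.assoc)
    qed
    then show ?thesis by blast
  next
    case False
    then have i: "i \<in> {1..N}" using Suc.prems by auto
    then obtain K where K: "\<And>z. vdm N (u(i := z)) = K * (\<Prod>j\<in>{1..N}-{i}. z - u j)" using Suc.IH by blast
    have "vdm (Suc N) (u(i := z)) = (K * (\<Prod>j\<in>{1..N}-{i}. u j - u (Suc N))) * (\<Prod>j\<in>{1..Suc N}-{i}. z - u j)" for z
    proof -
      have "(\<Prod>j\<in>{1..N}. (u(i := z)) j - (u(i := z)) (Suc N)) = (z - u (Suc N)) * (\<Prod>j\<in>{1..N}-{i}. (u(i := z)) j - (u(i := z)) (Suc N))"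
        using i False by (subst prod.remove[of _ i]) auto
      also have "(\<Prod>j\<in>{1..N}-{i}. (u(i := z)) j - (u(i := z)) (Suc N)) = (\<Prod>j\<in>{1..N}-{i}. u j - u (Suc N))"
        using False by (intro prod.cong refl) auto
      finally have e: "(\<Prod>j\<in>{1..N}. (u(i := z)) j - (u(i := z)) (Suc N)) = (z - u (Suc N)) * (\<Prod>j\<in>{1..N}-{i}. u j - u (Suc N))" .
      have "{1..Suc N} - {i} = insert (Suc N) ({1..N} - {i})" using False by auto
      then have "(\<Prod>j\<in>{1..Suc N}-{i}. z - u j) = (z - u (Suc N)) * (\<Prod>j\<in>{1..N}-{i}. z - u j)" by simp
      then show ?thesis unfolding vdm_Suc K e by simp
    qed
    then show ?thesis by blast
  qed
qed simp

text \<open>Each monomial is an eigenfunction of \<open>u i ^ k\<close> times the k-th derivative,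
  the eigenvalue being the falling factorial of the exponent of u i. Summed over i, the eigenvalue
  is the same for all permutations p and factors out.\<close>

lemma sum_monomials_euler:
  fixes c :: "(nat \<Rightarrow> nat) \<Rightarrow> complex"
  assumes u: "u \<in> nzset N"
  shows "(\<Sum>i\<in>{1..N}. u i ^ k * (pd i ^^ k) (\<lambda>u. \<Sum>p | p permutes {1..N}. c p * (\<Prod>i\<in>{1..N}. u i powi m (p i))) u)
     = of_real (\<Sum>j\<in>{1..N}. fallfac k (m j)) * (\<Sum>p | p permutes {1..N}. c p * (\<Prod>i\<in>{1..N}. u i powi m (p i)))"
proof -
  let ?P = "{p. p permutes {1..N}}"
  have "u i ^ k * (pd i ^^ k) (\<lambda>u. \<Sum>p\<in>?P. c p * (\<Prod>i\<in>{1..N}. u i powi m (p i))) u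
     = (\<Sum>p\<in>?P. of_real (fallfac k (m (p i))) * (c p * (\<Prod>i\<in>{1..N}. u i powi m (p i))))" if i: "i \<in> {1..N}" for i
  proof -
    have ui: "u i \<noteq> 0" using u i by (simp add: nzset_def)
    have e: "(\<lambda>z. \<Sum>p\<in>?P. c p * (\<Prod>i'\<in>{1..N}. (u(i := z)) i' powi m (p i')))
       = (\<lambda>z. \<Sum>p\<in>?P. (c p * (\<Prod>i'\<in>{1..N}-{i}. u i' powi m (p i'))) * z powi m (p i))"
    proof (intro ext sum.cong refl)
      fix z p
      have "(\<Prod>i'\<in>{1..N}. (u(i := z)) i' powi m (p i')) = z powi m (p i) * (\<Prod>i'\<in>{1..N}-{i}. (u(i := z)) i' powi m (p i'))"
        using i by (subst prod.remove[of _ i]) auto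
      also have "(\<Prod>i'\<in>{1..N}-{i}. (u(i := z)) i' powi m (p i')) = (\<Prod>i'\<in>{1..N}-{i}. u i' powi m (p i'))"
        by (intro prod.cong) auto
      finally show "c p * (\<Prod>i'\<in>{1..N}. (u(i := z)) i' powi m (p i')) = c p * (\<Prod>i'\<in>{1..N}-{i}. u i' powi m (p i')) * z powi m (p i)"
        by (simp add: mult_ac)
    qed
    have "(pd i ^^ k) (\<lambda>u. \<Sum>p\<in>?P. c p * (\<Prod>i\<in>{1..N}. u i powi m (p i))) u
      = (deriv ^^ k) (\<lambda>z. \<Sum>p\<in>?P. (c p * (\<Prod>i'\<in>{1..N}-{i}. u i' powi m (p i'))) * z powi m (p i)) (u i)"
      unfolding pd_funpow' e ..
    also have "\<dots> = (\<Sum>p\<in>?P. (deriv ^^ k) (\<lambda>z. (c p * (\<Prod>i'\<in>{1..N}-{i}. u i' powi m (p i'))) * z powi m (p i)) (u i))"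
      using ui by (intro higher_deriv_sum[of "-{0}"]) (auto intro!: holomorphic_intros finite_permutations)
    also have "\<dots> = (\<Sum>p\<in>?P. (c p * (\<Prod>i'\<in>{1..N}-{i}. u i' powi m (p i'))) * (of_real (fallfac k (m (p i))) * u i powi (m (p i) - int k)))"
    proof (intro sum.cong refl)
      fix p
      have "(deriv ^^ k) (\<lambda>z. (c p * (\<Prod>i'\<in>{1..N}-{i}. u i' powi m (p i'))) * z powi m (p i)) (u i)
         = (c p * (\<Prod>i'\<in>{1..N}-{i}. u i' powi m (p i'))) * (deriv ^^ k) (\<lambda>z. z powi m (p i)) (u i)"
        using ui by (intro higher_deriv_cmult[of _ "-{0}"]) (auto intro!: holomorphic_intros)
      then show "(deriv ^^ k) (\<lambda>z. (c p * (\<Prod>i'\<in>{1..N}-{i}. u i' powi m (p i'))) * z powi m (p i)) (u i)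
         = (c p * (\<Prod>i'\<in>{1..N}-{i}. u i' powi m (p i'))) * (of_real (fallfac k (m (p i))) * u i powi (m (p i) - int k))"
        by (simp only: higher_deriv_powi[OF ui])
    qed
    finally have "u i ^ k * (pd i ^^ k) (\<lambda>u. \<Sum>p\<in>?P. c p * (\<Prod>i\<in>{1..N}. u i powi m (p i))) u
      = (\<Sum>p\<in>?P. u i ^ k * ((c p * (\<Prod>i'\<in>{1..N}-{i}. u i' powi m (p i'))) * (of_real (fallfac k (m (p i))) * u i powi (m (p i) - int k))))"
      by (simp only: sum_distrib_left)
    also have "\<dots> = (\<Sum>p\<in>?P. of_real (fallfac k (m (p i))) * (c p * (\<Prod>i\<in>{1..N}. u i powi m (p i))))"
    proof (intro sum.cong refl)
      fix p
      have "(\<Prod>i\<in>{1..N}. u i powi m (p i)) = u i powi m (p i) * (\<Prod>i'\<in>{1..N}-{i}. u i' powi m (p i'))"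
        by (rule prod.remove) (use i in auto)
      moreover have "u i powi m (p i) = u i ^ k * u i powi (m (p i) - int k)"
        using ui by (simp add: power_int_diff)
      ultimately have e2: "(\<Prod>i\<in>{1..N}. u i powi m (p i)) = u i ^ k * u i powi (m (p i) - int k) * (\<Prod>i'\<in>{1..N}-{i}. u i' powi m (p i'))"
        by (simp only:)
      show "u i ^ k * ((c p * (\<Prod>i'\<in>{1..N}-{i}. u i' powi m (p i'))) * (of_real (fallfac k (m (p i))) * u i powi (m (p i) - int k)))
        = of_real (fallfac k (m (p i))) * (c p * (\<Prod>i\<in>{1..N}. u i powi m (p i)))"
        unfolding e2 by (simp only: mult_ac)
    qed
    finally show ?thesis .
  qed
  then have "(\<Sum>i\<in>{1..N}. u i ^ k * (pd i ^^ k) (\<lambda>u. \<Sum>p\<in>?P. c p * (\<Prod>i\<in>{1..N}. u i powi m (p i))) u)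
    = (\<Sum>i\<in>{1..N}. \<Sum>p\<in>?P. of_real (fallfac k (m (p i))) * (c p * (\<Prod>i\<in>{1..N}. u i powi m (p i))))"
    by (intro sum.cong) auto
  also have "\<dots> = (\<Sum>p\<in>?P. (\<Sum>i\<in>{1..N}. of_real (fallfac k (m (p i)))) * (c p * (\<Prod>i\<in>{1..N}. u i powi m (p i))))"
    by (subst sum.swap) (simp add: sum_distrib_right)
  also have "\<dots> = (\<Sum>p\<in>?P. of_real (\<Sum>j\<in>{1..N}. fallfac k (m j)) * (c p * (\<Prod>i\<in>{1..N}. u i powi m (p i))))"
  proof (intro sum.cong refl)
    fix p assume "p \<in> ?P"
    then have "(\<Sum>i\<in>{1..N}. fallfac k (m (p i))) = (\<Sum>j\<in>{1..N}. fallfac k (m j))"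
      using sum.permute[of p "{1..N}" "\<lambda>j. fallfac k (m j)"] by (simp add: o_def)
    then show "(\<Sum>i\<in>{1..N}. of_real (fallfac k (m (p i)))) * (c p * (\<Prod>i\<in>{1..N}. u i powi m (p i)))
      = of_real (\<Sum>j\<in>{1..N}. fallfac k (m j)) * (c p * (\<Prod>i\<in>{1..N}. u i powi m (p i)))"
      by (simp flip: of_real_sum)
  qed
  finally show ?thesis by (simp only: sum_distrib_left)
qed

lemma nschur_euler:
  assumes l: "l \<in> signatures N" and u: "u \<in> nzset N"
  shows "(\<Sum>i\<in>{1..N}. u i ^ k * (pd i ^^ k) (\<lambda>u. vdm N u * (w * nschur N l u)) u) = of_real (ek N k l) * (vdm N u * (w * nschur N l u))"
proof -
  from nschur_rep_exists[OF l] obtain f c where "nschur_rep N l f c" by blast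
  note f = nschur_repD[OF this]
  let ?g = "\<lambda>u. \<Sum>p | p permutes {1..N}. (w / of_real c * of_int (sign p)) * (\<Prod>i\<in>{1..N}. u i powi ell N l (p i))"
  have e: "vdm N u * (w * nschur N l u) = ?g u" if "u \<in> nzset N" for u
  proof -
    have "vdm N u * (w * nschur N l u) = w / of_real c * ldet N (\<lambda>i j. u i powi (l j + int N - int j))"
      using f(3,5)[OF that] by simp
    then show ?thesis by (simp add: ldet_def sum_distrib_left ell_def mult_ac)
  qed
  have "(pd i ^^ k) (\<lambda>u. vdm N u * (w * nschur N l u)) u = (pd i ^^ k) ?g u" for i
    by (rule pd_funpow_cong_open[OF open_nzset u e])
  then show ?thesis using sum_monomials_euler[OF u, of k "\<lambda>p. w / of_real c * of_int (sign p)" "ell N l"] e[OF u] by (simp add: ek_def)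
qed

lemma has_sum_finite_sum:
  fixes f :: "'a \<Rightarrow> 'b \<Rightarrow> complex"
  assumes "finite A" "\<And>a. a \<in> A \<Longrightarrow> (f a has_sum s a) X"
  shows "((\<lambda>x. \<Sum>a\<in>A. f a x) has_sum (\<Sum>a\<in>A. s a)) X"
  using assms by (induction A rule: finite_induct) (auto intro: has_sum_add)

lemma sephol_vdm: "sephol B (vdm N)"
  unfolding vdm_def[abs_def] by (intro sephol_prod sephol_diff sephol_coord)

text \<open>Termwise differentiation turns the eigenvalue relation of each signature into one for
  the series: inserting \<open>ek\<close> into the weights is the same as applying the
  operator.\<close>

lemma generating_euler:
  assumes B: "open B" "B \<subseteq> nzset N" and u: "u \<in> B"
    and G: "locsum B (signatures N) (\<lambda>l u. w l * nschur N l u)"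
  shows "vdm N u * (\<Sum>\<^sub>\<infinity>l\<in>signatures N. of_real (ek N k l) * w l * nschur N l u)
     = (\<Sum>i\<in>{1..N}. u i ^ k * (pd i ^^ k) (\<lambda>u. vdm N u * (\<Sum>\<^sub>\<infinity>l\<in>signatures N. w l * nschur N l u)) u)"
proof -
  let ?h = "\<lambda>l u. vdm N u * (w l * nschur N l u)"
  have ls: "locsum B (signatures N) ?h" by (rule locsum_mult[OF B(1) G sephol_vdm])
  have eq: "(\<lambda>u. vdm N u * (\<Sum>\<^sub>\<infinity>l\<in>signatures N. w l * nschur N l u)) = (\<lambda>u. \<Sum>\<^sub>\<infinity>l\<in>signatures N. ?h l u)"
    by (simp add: infsum_cmult_right')
  have "((\<lambda>l. u i ^ k * (pd i ^^ k) (?h l) u) has_sum (u i ^ k * (pd i ^^ k) (\<lambda>u. \<Sum>\<^sub>\<infinity>l\<in>signatures N. ?h l u) u)) (signatures N)" for i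
  proof -
    have "locsum B (signatures N) (\<lambda>l. (pd i ^^ k) (?h l))"
       and p: "(pd i ^^ k) (\<lambda>u. \<Sum>\<^sub>\<infinity>l\<in>signatures N. ?h l u) u = (\<Sum>\<^sub>\<infinity>l\<in>signatures N. (pd i ^^ k) (?h l) u)"
      using locsum_pd_funpow[OF B(1) ls, where i=i and n=k] u by auto
    from locsum_summable[OF this(1) u] show ?thesis unfolding p by (intro has_sum_cmult_right has_sum_infsum)
  qed
  then have hs: "((\<lambda>l. \<Sum>i\<in>{1..N}. u i ^ k * (pd i ^^ k) (?h l) u) has_sum
      (\<Sum>i\<in>{1..N}. u i ^ k * (pd i ^^ k) (\<lambda>u. \<Sum>\<^sub>\<infinity>l\<in>signatures N. ?h l u) u)) (signatures N)"
    by (intro has_sum_finite_sum) auto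
  have "(\<Sum>\<^sub>\<infinity>l\<in>signatures N. vdm N u * (of_real (ek N k l) * w l * nschur N l u))
    = (\<Sum>\<^sub>\<infinity>l\<in>signatures N. \<Sum>i\<in>{1..N}. u i ^ k * (pd i ^^ k) (?h l) u)"
  proof (rule infsum_cong)
    fix l assume l: "l \<in> signatures N"
    show "vdm N u * (of_real (ek N k l) * w l * nschur N l u) = (\<Sum>i\<in>{1..N}. u i ^ k * (pd i ^^ k) (?h l) u)"
      using nschur_euler[OF l subsetD[OF B(2) u], of k "w l"] by (simp add: mult_ac)
  qed
  also have "\<dots> = (\<Sum>i\<in>{1..N}. u i ^ k * (pd i ^^ k) (\<lambda>u. \<Sum>\<^sub>\<infinity>l\<in>signatures N. ?h l u) u)"
    using hs by (rule infsumI)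
  finally show ?thesis unfolding eq by (simp only: infsum_cmult_right')
qed

text \<open>The pair (i, J) is the set I = J \<union> {i} with the marked element i.\<close>

lemma sum_pairs_reindex:
  fixes F :: "nat \<Rightarrow> nat set \<Rightarrow> complex"
  shows "(\<Sum>i\<in>{1..N}. \<Sum>J | J \<subseteq> {1..N}-{i} \<and> card J = m. F i J) = (\<Sum>I | I \<subseteq> {1..N} \<and> card I = Suc m. \<Sum>i\<in>I. F i (I - {i}))"
proof -
  have fin: "finite {J. J \<subseteq> A \<and> card J = n}" if "finite A" for A :: "nat set" and n
    using that by (auto intro: finite_subset[of _ "Pow A"])
  have "(\<Sum>i\<in>{1..N}. \<Sum>J | J \<subseteq> {1..N}-{i} \<and> card J = m. F i J) = (\<Sum>(i,J)\<in>Sigma {1..N} (\<lambda>i. {J. J \<subseteq> {1..N}-{i} \<and> card J = m}). F i J)"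
    using fin by (subst sum.Sigma) auto
  also have "\<dots> = (\<Sum>(I,i)\<in>Sigma {I. I \<subseteq> {1..N} \<and> card I = Suc m} (\<lambda>I. I). F i (I - {i}))"
  proof (rule sum.reindex_bij_witness[of _ "\<lambda>(I,i). (i, I - {i})" "\<lambda>(i,J). (insert i J, i)"])
    fix a assume "a \<in> Sigma {1..N} (\<lambda>i. {J. J \<subseteq> {1..N}-{i} \<and> card J = m})"
    then obtain i J where a: "a = (i, J)" "i \<in> {1..N}" "J \<subseteq> {1..N}-{i}" "card J = m" by auto
    have "finite J" using a finite_subset by blast
    moreover have "i \<notin> J" using a by auto
    ultimately have "card (insert i J) = Suc m" using a by simp
    then show "(case a of (i, J) \<Rightarrow> (insert i J, i)) \<in> Sigma {I. I \<subseteq> {1..N} \<and> card I = Suc m} (\<lambda>I. I)" using a by auto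
    show "(case case a of (i, J) \<Rightarrow> (insert i J, i) of (I, i) \<Rightarrow> (i, I - {i})) = a" using a \<open>i \<notin> J\<close> by auto
    show "(case case a of (i, J) \<Rightarrow> (insert i J, i) of (I, i) \<Rightarrow> F i (I - {i})) = (case a of (i, J) \<Rightarrow> F i J)" using a \<open>i \<notin> J\<close> by auto
  next
    fix b assume "b \<in> Sigma {I. I \<subseteq> {1..N} \<and> card I = Suc m} (\<lambda>I. I)"
    then obtain I i where b: "b = (I, i)" "I \<subseteq> {1..N}" "card I = Suc m" "i \<in> I" by auto
    have "finite I" using b finite_subset by blast
    then have "card (I - {i}) = m" using b by simp
    then show "(case b of (I, i) \<Rightarrow> (i, I - {i})) \<in> Sigma {1..N} (\<lambda>i. {J. J \<subseteq> {1..N}-{i} \<and> card J = m})" using b by auto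
    show "(case case b of (I, i) \<Rightarrow> (i, I - {i}) of (i, J) \<Rightarrow> (insert i J, i)) = b" using b by auto
  qed
  also have "\<dots> = (\<Sum>I | I \<subseteq> {1..N} \<and> card I = Suc m. \<Sum>i\<in>I. F i (I - {i}))"
  proof (rule sum.Sigma[symmetric])
    show "finite {I. I \<subseteq> {1..N} \<and> card I = Suc m}" by (rule fin) simp
    show "\<forall>I\<in>{I. I \<subseteq> {1..N} \<and> card I = Suc m}. finite I" using finite_subset[of _ "{1..N}"] by blast
  qed
  finally show ?thesis .
qed

text \<open>By Leibniz, m derivatives on the Vandermonde product give m! times a sum over sets J of
  m variables of the reciprocals of \<Prod>(u i - u j). The binomial coefficient and m! combine to
  k! / (k - m)!, and collecting the pairs (i, J) by their union I produces divided
  differences.\<close>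

lemma euler_expansion:
  assumes B: "open B" and u: "u \<in> B" "u \<in> generic_pts N" and G: "sephol B G"
  shows "(\<Sum>i\<in>{1..N}. u i ^ k * (pd i ^^ k) (\<lambda>u. vdm N u * G u) u)
     = vdm N u * (\<Sum>m\<le>k. of_real (fact k / fact (k - m)) * (\<Sum>I | I \<subseteq> {1..N} \<and> card I = Suc m. ddiff I (\<lambda>i u. u i ^ k * (pd i ^^ (k - m)) G u) u))"
proof -
  define F where "F = (\<lambda>m i J. u i ^ k * (pd i ^^ (k - m)) G u / (\<Prod>j\<in>J. u i - u j))"
  have "u i ^ k * (pd i ^^ k) (\<lambda>u. vdm N u * G u) u
     = vdm N u * (\<Sum>m\<le>k. of_real (fact k / fact (k - m)) * (\<Sum>J | J \<subseteq> {1..N}-{i} \<and> card J = m. F m i J))" if i: "i \<in> {1..N}" for i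
  proof -
    let ?S = "{z. u(i := z) \<in> B}"
    obtain K where K: "\<And>z. vdm N (u(i := z)) = K * (\<Prod>j\<in>{1..N}-{i}. z - u j)" using vdm_slice[OF i] by blast
    have S: "open ?S" "u i \<in> ?S" using open_slice[OF B] u by auto
    have Vd: "(deriv ^^ m) (\<lambda>z. vdm N (u(i := z))) (u i) = vdm N u * (fact m * (\<Sum>J | J \<subseteq> {1..N}-{i} \<and> card J = m. 1 / (\<Prod>j\<in>J. u i - u j)))" for m
    proof -
      have "(deriv ^^ m) (\<lambda>z. vdm N (u(i := z))) (u i) = K * (deriv ^^ m) (\<lambda>z. \<Prod>j\<in>{1..N}-{i}. z - u j) (u i)"
        unfolding K by (rule higher_deriv_cmult[of _ UNIV]) (auto intro!: holomorphic_intros)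
      also have "\<dots> = K * (fact m * (\<Sum>J | J \<subseteq> {1..N}-{i} \<and> card J = m. \<Prod>j\<in>{1..N}-{i}-J. u i - u j))"
        by (simp add: higher_deriv_root_product)
      also have "(\<Sum>J | J \<subseteq> {1..N}-{i} \<and> card J = m. \<Prod>j\<in>{1..N}-{i}-J. u i - u j)
         = (\<Sum>J | J \<subseteq> {1..N}-{i} \<and> card J = m. (\<Prod>j\<in>{1..N}-{i}. u i - u j) * (1 / (\<Prod>j\<in>J. u i - u j)))"
      proof (intro sum.cong refl)
        fix J assume J: "J \<in> {J. J \<subseteq> {1..N}-{i} \<and> card J = m}"
        then have "(\<Prod>j\<in>{1..N}-{i}. u i - u j) = (\<Prod>j\<in>{1..N}-{i}-J. u i - u j) * (\<Prod>j\<in>J. u i - u j)"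
          by (intro prod.subset_diff) auto
        moreover have "(\<Prod>j\<in>J. u i - u j) \<noteq> 0"
        proof -
          have "finite J" using J finite_subset by blast
          moreover have "u i \<noteq> u j" if "j \<in> J" for j
          proof -
            have "j \<in> {1..N}" "i \<noteq> j" using J that by auto
            then show ?thesis using i u(2) unfolding generic_pts_def by blast
          qed
          ultimately show ?thesis by simp
        qed
        ultimately show "(\<Prod>j\<in>{1..N}-{i}-J. u i - u j) = (\<Prod>j\<in>{1..N}-{i}. u i - u j) * (1 / (\<Prod>j\<in>J. u i - u j))" by simp
      qed
      also have "K * (fact m * \<dots>) = (K * (\<Prod>j\<in>{1..N}-{i}. u i - u j)) * (fact m * (\<Sum>J | J \<subseteq> {1..N}-{i} \<and> card J = m. 1 / (\<Prod>j\<in>J. u i - u j)))"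
        unfolding sum_distrib_left[symmetric] by (simp only: mult_ac)
      also have "K * (\<Prod>j\<in>{1..N}-{i}. u i - u j) = vdm N u" using K[of "u i"] by simp
      finally show ?thesis .
    qed
    have "(pd i ^^ k) (\<lambda>u. vdm N u * G u) u = (\<Sum>m = 0..k. of_nat (k choose m) * (deriv ^^ m) (\<lambda>z. vdm N (u(i := z))) (u i) * (deriv ^^ (k - m)) (\<lambda>z. G (u(i := z))) (u i))"
      unfolding pd_funpow'
    proof (rule higher_deriv_mult[OF _ _ S])
      show "(\<lambda>z. vdm N (u(i := z))) holomorphic_on ?S" by (rule sephol_holomorphic_slice[OF sephol_vdm])
      show "(\<lambda>z. G (u(i := z))) holomorphic_on ?S" by (rule sephol_holomorphic_slice[OF G])
    qed
    also have "\<dots> = (\<Sum>m\<le>k. vdm N u * (of_real (fact k / fact (k - m)) * ((\<Sum>J | J \<subseteq> {1..N}-{i} \<and> card J = m. 1 / (\<Prod>j\<in>J. u i - u j)) * (pd i ^^ (k - m)) G u)))"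
      unfolding atMost_atLeast0
    proof (intro sum.cong refl)
      fix m assume "m \<in> {0..k}"
      then have b: "(of_nat (k choose m) * fact m :: complex) = of_real (fact k / fact (k - m))"
        by (simp add: binomial_fact)
      have "of_nat (k choose m) * (deriv ^^ m) (\<lambda>z. vdm N (u(i := z))) (u i) * (deriv ^^ (k - m)) (\<lambda>z. G (u(i := z))) (u i)
        = vdm N u * ((of_nat (k choose m) * fact m) * ((\<Sum>J | J \<subseteq> {1..N}-{i} \<and> card J = m. 1 / (\<Prod>j\<in>J. u i - u j)) * (pd i ^^ (k - m)) G u))"
        unfolding Vd pd_funpow' by (simp only: mult_ac)
      then show "of_nat (k choose m) * (deriv ^^ m) (\<lambda>z. vdm N (u(i := z))) (u i) * (deriv ^^ (k - m)) (\<lambda>z. G (u(i := z))) (u i)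
        = vdm N u * (of_real (fact k / fact (k - m)) * ((\<Sum>J | J \<subseteq> {1..N}-{i} \<and> card J = m. 1 / (\<Prod>j\<in>J. u i - u j)) * (pd i ^^ (k - m)) G u))"
        unfolding b .
    qed
    finally have "u i ^ k * (pd i ^^ k) (\<lambda>u. vdm N u * G u) u = (\<Sum>m\<le>k. vdm N u * (of_real (fact k / fact (k - m)) * (\<Sum>J | J \<subseteq> {1..N}-{i} \<and> card J = m. F m i J)))"
      unfolding F_def by (simp add: sum_distrib_left sum_distrib_right mult_ac)
    then show ?thesis by (simp only: sum_distrib_left)
  qed
  then have "(\<Sum>i\<in>{1..N}. u i ^ k * (pd i ^^ k) (\<lambda>u. vdm N u * G u) u)
     = (\<Sum>i\<in>{1..N}. vdm N u * (\<Sum>m\<le>k. of_real (fact k / fact (k - m)) * (\<Sum>J | J \<subseteq> {1..N}-{i} \<and> card J = m. F m i J)))"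
    by (intro sum.cong) auto
  also have "\<dots> = vdm N u * (\<Sum>m\<le>k. of_real (fact k / fact (k - m)) * (\<Sum>i\<in>{1..N}. \<Sum>J | J \<subseteq> {1..N}-{i} \<and> card J = m. F m i J))"
    unfolding sum_distrib_left[symmetric] by (subst sum.swap) (simp only: sum_distrib_left)
  also have "(\<lambda>m. \<Sum>i\<in>{1..N}. \<Sum>J | J \<subseteq> {1..N}-{i} \<and> card J = m. F m i J)
     = (\<lambda>m. \<Sum>I | I \<subseteq> {1..N} \<and> card I = Suc m. ddiff I (\<lambda>i u. u i ^ k * (pd i ^^ (k - m)) G u) u)"
    unfolding sum_pairs_reindex by (simp add: F_def ddiff_def)
  finally show ?thesis .
qed

section \<open>Absolutely convergent generating functions\<close>

definition gf :: "nat \<Rightarrow> ((nat \<Rightarrow> int) \<Rightarrow> real) \<Rightarrow> (nat \<Rightarrow> complex) \<Rightarrow> complex" where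
  "gf N w u = (\<Sum>\<^sub>\<infinity>l\<in>signatures N. of_real (w l) * nschur N l u)"

definition pbox :: "nat \<Rightarrow> (nat \<Rightarrow> real) \<Rightarrow> (nat \<Rightarrow> complex) set" where
  "pbox N d = {u. \<forall>i\<in>{1..N}. norm (u i - 1) < d i}"

definition corners :: "nat \<Rightarrow> (nat \<Rightarrow> real) \<Rightarrow> (nat \<Rightarrow> real) set" where
  "corners N d = Pi\<^sub>E {1..N} (\<lambda>i. {1 - d i, 1 + d i})"

text \<open>Schur functions are bounded on a polydisc by their sum over the corners, so summability at the
  corners is a domination condition.\<close>
definition absconv :: "nat \<Rightarrow> ((nat \<Rightarrow> int) \<Rightarrow> real) \<Rightarrow> (nat \<Rightarrow> real) \<Rightarrow> bool" where
  "absconv N w d \<longleftrightarrow> (\<forall>y\<in>corners N d. (\<lambda>l. \<bar>w l\<bar> * norm (nschur N l (cvec y))) summable_on signatures N)"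

lemma open_pbox: "open (pbox N d)"
proof -
  have "pbox N d = (\<Inter>i\<in>{1..N}. {u. u i \<in> ball 1 (d i)})" by (auto simp: pbox_def dist_norm norm_minus_commute)
  moreover have "open (\<Inter>i\<in>{1..N}. {u::nat \<Rightarrow> complex. u i \<in> ball 1 (d i)})"
    by (intro open_INT ballI open_coordinate) auto
  ultimately show ?thesis by simp
qed

lemma finite_corners: "finite (corners N d)"
  unfolding corners_def by (intro finite_PiE) auto

lemma near_one_bounds:
  assumes "norm (z - 1) \<le> (d::real)"
  shows "1 - d \<le> norm (z::complex)" "norm z \<le> 1 + d"
  using assms norm_triangle_ineq2[of 1 "1 - z"] norm_triangle_ineq[of "z - 1" 1] by (auto simp: norm_minus_commute)

lemma nschur_corner_bound:
  assumes l: "l \<in> signatures N" and d: "\<And>i. i \<in> {1..N} \<Longrightarrow> 0 < d i \<and> d i < 1"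
    and u: "\<And>i. i \<in> {1..N} \<Longrightarrow> norm (u i - 1) \<le> d i"
  shows "norm (nschur N l u) \<le> (\<Sum>y\<in>corners N d. norm (nschur N l (cvec y)))"
proof -
  have "u \<in> nzset N" unfolding nzset_def
  proof (intro CollectI ballI)
    fix i assume i: "i \<in> {1..N}"
    show "u i \<noteq> 0" using near_one_bounds(1)[OF u[OF i]] d[OF i] by auto
  qed
  then have "norm (nschur N l u) \<le> norm (nschur N l (cvec (\<lambda>i. norm (u i))))" by (rule nschur_norm_le[OF l])
  also have "\<dots> \<le> (\<Sum>y\<in>Pi\<^sub>E {1..N} (\<lambda>i. {1 - d i, 1 + d i}). norm (nschur N l (cvec y)))"
  proof (rule nschur_corner[OF l])
    fix i assume i: "i \<in> {1..N}"
    show "0 < 1 - d i \<and> 1 - d i \<le> norm (u i) \<and> norm (u i) \<le> 1 + d i"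
      using near_one_bounds[OF u[OF i]] d[OF i] by auto
  qed
  finally show ?thesis by (simp add: corners_def)
qed

lemma summable_on_finite_sum:
  fixes f :: "'a \<Rightarrow> 'b \<Rightarrow> real"
  assumes "finite A" "\<And>a. a \<in> A \<Longrightarrow> f a summable_on X"
  shows "(\<lambda>x. \<Sum>a\<in>A. f a x) summable_on X"
  using assms by (induction A rule: finite_induct) (auto intro: summable_on_add)

lemma absconv_majorant:
  assumes "absconv N w d"
  shows "(\<lambda>l. \<bar>w l\<bar> * (\<Sum>y\<in>corners N d. norm (nschur N l (cvec y)))) summable_on signatures N"
proof -
  have "(\<lambda>l. \<Sum>y\<in>corners N d. \<bar>w l\<bar> * norm (nschur N l (cvec y))) summable_on signatures N"
    using assms finite_corners[of N d] unfolding absconv_def by (intro summable_on_finite_sum) auto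
  then show ?thesis by (simp add: sum_distrib_left)
qed

lemma pbox_subset_nzset:
  assumes "\<And>i. i \<in> {1..N} \<Longrightarrow> d i \<le> 1"
  shows "pbox N d \<subseteq> nzset N"
  unfolding nzset_def pbox_def
proof (intro subsetI CollectI ballI)
  fix u :: "nat \<Rightarrow> complex" and i assume "u \<in> {u. \<forall>i\<in>{1..N}. norm (u i - 1) < d i}" and i: "i \<in> {1..N}"
  then have "norm (u i - 1) < 1" using assms[OF i] by force
  then show "u i \<noteq> 0" by auto
qed

lemma absconv_locsum:
  assumes "absconv N w d" and d: "\<And>i. i \<in> {1..N} \<Longrightarrow> 0 < d i \<and> d i < 1"
  shows "locsum (pbox N d) (signatures N) (\<lambda>l u. of_real (w l) * nschur N l u)"
  unfolding locsum_def
proof (intro conjI ballI)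
  have sub: "pbox N d \<subseteq> nzset N" by (rule pbox_subset_nzset) (use d in force)
  show "sephol (pbox N d) (\<lambda>u. of_real (w l) * nschur N l u)" if "l \<in> signatures N" for l
    by (intro sephol_mult sephol_const sephol_subset[OF nschur_sephol[OF that] sub])
  fix u assume u: "u \<in> pbox N d"
  have "norm (of_real (w l) * nschur N l v) \<le> \<bar>w l\<bar> * (\<Sum>y\<in>corners N d. norm (nschur N l (cvec y)))"
    if "l \<in> signatures N" "v \<in> pbox N d" for l v
    unfolding norm_mult norm_of_real
    by (intro mult_left_mono nschur_corner_bound[OF that(1) d]) (use that in \<open>auto simp: pbox_def less_imp_le\<close>)
  then show "\<exists>W M. open W \<and> u \<in> W \<and> W \<subseteq> pbox N d \<and> M summable_on signatures N \<and>
      (\<forall>l\<in>signatures N. \<forall>v\<in>W. norm (of_real (w l) * nschur N l v) \<le> M l)"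
    using u open_pbox absconv_majorant[OF assms(1)] by (intro exI[of _ "pbox N d"] exI[of _ "\<lambda>l. \<bar>w l\<bar> * (\<Sum>y\<in>corners N d. norm (nschur N l (cvec y)))"]) auto
qed

lemma absconv_sephol:
  assumes "absconv N w d" "\<And>i. i \<in> {1..N} \<Longrightarrow> 0 < d i \<and> d i < 1"
  shows "sephol (pbox N d) (gf N w)"
  unfolding gf_def[abs_def] by (rule locsum_sephol[OF open_pbox absconv_locsum[OF assms]])

lemma absconv_dominated:
  assumes "absconv N w d" "\<And>i. i \<in> {1..N} \<Longrightarrow> 0 < d i \<and> d i < 1"
    and C: "\<And>l y. l \<in> signatures N \<Longrightarrow> y \<in> corners N d' \<Longrightarrow>
       \<bar>w' l\<bar> * norm (nschur N l (cvec y)) \<le> C * (\<bar>w l\<bar> * (\<Sum>y\<in>corners N d. norm (nschur N l (cvec y))))"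
  shows "absconv N w' d'"
  unfolding absconv_def
proof
  fix y assume y: "y \<in> corners N d'"
  show "(\<lambda>l. \<bar>w' l\<bar> * norm (nschur N l (cvec y))) summable_on signatures N"
    by (rule summable_on_comparison_test[OF summable_on_cmult_right[OF absconv_majorant[OF assms(1)], of C]])
       (use C y in auto)
qed

lemma corners_near_one:
  assumes "y \<in> corners N d" "i \<in> {1..N}" "d i > 0"
  shows "norm (cvec y i - 1) = d i"
proof -
  have "y i = 1 - d i \<or> y i = 1 + d i" using PiE_mem[OF assms(1)[unfolded corners_def] assms(2)] by auto
  then have "y i - 1 = - d i \<or> y i - 1 = d i" by auto
  then have "\<bar>y i - 1\<bar> = d i" using assms(3) by auto
  then show ?thesis by (metis norm_of_real of_real_1 of_real_diff)
qed

lemma absconv_mono: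
  assumes "absconv N w d" "\<And>i. i \<in> {1..N} \<Longrightarrow> 0 < d i \<and> d i < 1" "\<And>i. i \<in> {1..N} \<Longrightarrow> 0 < d' i \<and> d' i \<le> d i"
  shows "absconv N w d'"
proof (rule absconv_dominated[OF assms(1,2), where C = 1])
  fix l y assume l: "l \<in> signatures N" and y: "y \<in> corners N d'"
  have "norm (nschur N l (cvec y)) \<le> (\<Sum>y\<in>corners N d. norm (nschur N l (cvec y)))"
  proof (rule nschur_corner_bound[OF l assms(2)])
    fix i assume i: "i \<in> {1..N}"
    show "norm (cvec y i - 1) \<le> d i" using corners_near_one[OF y i] assms(3)[OF i] by simp
  qed
  then show "\<bar>w l\<bar> * norm (nschur N l (cvec y)) \<le> 1 * (\<bar>w l\<bar> * (\<Sum>y\<in>corners N d. norm (nschur N l (cvec y))))"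
    by (simp add: mult_left_mono)
qed auto

text \<open>Variables are moved one at a time to their boundary circles, so a bound on the product
  of the circles suffices.\<close>

lemma polydisc_max_modulus:
  assumes I: "finite I" and B: "open B" and hol: "sephol B f"
    and dom: "\<And>v. (\<And>a. a \<in> I \<Longrightarrow> norm (v a - 1) \<le> \<tau> a) \<Longrightarrow> (\<And>a. a \<notin> I \<Longrightarrow> v a = u a) \<Longrightarrow> v \<in> B"
    and \<tau>: "\<And>a. a \<in> I \<Longrightarrow> \<tau> a > 0"
    and bd: "\<And>v. (\<And>a. a \<in> I \<Longrightarrow> norm (v a - 1) = \<tau> a) \<Longrightarrow> (\<And>a. a \<notin> I \<Longrightarrow> v a = u a) \<Longrightarrow> norm (f v) \<le> C"
    and u: "\<And>a. a \<in> I \<Longrightarrow> norm (u a - 1) \<le> \<tau> a"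
  shows "norm (f u) \<le> C"
proof -
  have claim: "norm (f v) \<le> C"
    if "finite T" "T \<subseteq> I" "\<forall>a\<in>I-T. norm (v a - 1) = \<tau> a" "\<forall>a\<in>T. norm (v a - 1) \<le> \<tau> a" "\<forall>a. a \<notin> I \<longrightarrow> v a = u a" for T v
    using that
  proof (induction T arbitrary: v rule: finite_induct)
    case empty
    then show ?case by (intro bd) auto
  next
    case (insert a T)
    note v = insert.prems
    let ?S = "{z. v(a := z) \<in> B}"
    have h: "(\<lambda>z. f (v(a := z))) holomorphic_on ?S" by (rule sephol_holomorphic_slice[OF hol])
    have cb: "cball 1 (\<tau> a) \<subseteq> ?S"
    proof (intro subsetI CollectI dom)
      fix z :: complex and b assume z: "z \<in> cball 1 (\<tau> a)"
      show "norm ((v(a := z)) b - 1) \<le> \<tau> b" if "b \<in> I"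
        using z v(2,3) that by (cases "b = a"; cases "b \<in> T") (auto simp: dist_norm norm_minus_commute)
      show "(v(a := z)) b = u b" if "b \<notin> I" using v(1,4) that by auto
    qed
    have "norm (f (v(a := v a))) \<le> C"
    proof (rule maximum_modulus_frontier[of "\<lambda>z. f (v(a := z))" "cball 1 (\<tau> a)"])
      show "(\<lambda>z. f (v(a := z))) holomorphic_on interior (cball 1 (\<tau> a))"
        using h cb interior_subset by (meson holomorphic_on_subset order_trans)
      show "continuous_on (closure (cball 1 (\<tau> a))) (\<lambda>z. f (v(a := z)))"
        using holomorphic_on_imp_continuous_on[OF holomorphic_on_subset[OF h cb]] by simp
      show "v a \<in> cball 1 (\<tau> a)" using v(3) by (simp add: dist_norm norm_minus_commute)
      fix z :: complex assume "z \<in> frontier (cball 1 (\<tau> a))"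
      then have z: "norm (z - 1) = \<tau> a" using \<tau>[of a] v(1) by (simp add: dist_norm norm_minus_commute frontier_cball)
      show "norm (f (v(a := z))) \<le> C"
        by (rule insert.IH) (use v z insert.hyps in auto)
    qed simp
    then show ?case by simp
  qed
  show ?thesis by (rule claim[of I u]) (use I u in auto)
qed

lemma distinct_choice:
  fixes a b :: "nat \<Rightarrow> real"
  assumes "finite A" "\<And>i. i \<in> A \<Longrightarrow> a i < b i"
  shows "\<exists>\<tau>. inj_on \<tau> A \<and> (\<forall>i\<in>A. a i < \<tau> i \<and> \<tau> i < b i)"
  using assms
proof (induction A rule: finite_induct)
  case (insert x A)
  then obtain \<tau> where \<tau>: "inj_on \<tau> A" "\<forall>i\<in>A. a i < \<tau> i \<and> \<tau> i < b i" by auto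
  have "infinite {a x<..<b x}" using insert.prems by (simp add: infinite_Ioo)
  then obtain y where y: "y \<in> {a x<..<b x}" "y \<notin> \<tau> ` A" using insert.hyps(1)
    by (meson finite_imageI finite_subset subsetI)
  have "inj_on (\<tau>(x := y)) (insert x A)"
    using \<tau>(1) y(2) insert.hyps(2) by (auto simp: inj_on_def)
  moreover have "\<forall>i\<in>insert x A. a i < (\<tau>(x := y)) i \<and> (\<tau>(x := y)) i < b i" using \<tau>(2) y insert.hyps by auto
  ultimately show ?case by blast
qed auto

text \<open>The eigenvalue relation bounds \<open>ek * nschur\<close> by Cauchy estimates for the
  operator, up to division by the Vandermonde product. That product is bounded below on a torus with
  distinct radii, and the maximum principle carries the bound inside. The constant C depends on N,
  which is harmless since summability concerns a fixed N.\<close>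

lemma absconv_ek:
  assumes w: "absconv N w d" and d: "\<And>i. i \<in> {1..N} \<Longrightarrow> 0 < d i \<and> d i < 1"
  shows "absconv N (\<lambda>l. w l * ek N k l) (\<lambda>i. d i / 2)"
proof -
  \<comment> \<open>Radii above d / 2 put the target polydisc inside the torus; radii below 3/4 d
    leave room for Cauchy discs of radius d / 4 within radius d.\<close>
  obtain \<tau> where \<tau>: "inj_on \<tau> {1..N}" "\<forall>i\<in>{1..N}. d i / 2 < \<tau> i \<and> \<tau> i < 3/4 * d i"
    using distinct_choice[of "{1..N}" "\<lambda>i. d i / 2" "\<lambda>i. 3/4 * d i"] d by auto
  define c0 where "c0 = (\<Prod>i\<in>{1..N}. \<Prod>j\<in>{i<..N}. \<bar>\<tau> i - \<tau> j\<bar>)"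
  have c0: "c0 > 0" unfolding c0_def
  proof (intro prod_pos ballI)
    fix i j assume "i \<in> {1..N}" "j \<in> {i<..N}"
    then have "i \<in> {1..N}" "j \<in> {1..N}" "i \<noteq> j" by auto
    then have "\<tau> i \<noteq> \<tau> j" using inj_onD[OF \<tau>(1)] by blast
    then show "0 < \<bar>\<tau> i - \<tau> j\<bar>" by simp
  qed
  define VB :: real where "VB = (\<Prod>i\<in>{1..N}. \<Prod>j\<in>{i<..N}. 2)"
  have VB: "norm (vdm N u) \<le> VB" if "\<And>i. i \<in> {1..N} \<Longrightarrow> norm (u i - 1) \<le> d i" for u
    unfolding vdm_def VB_def prod_norm[symmetric]
  proof (intro prod_mono conjI prod_nonneg ballI norm_ge_zero)
    fix i j assume ij: "i \<in> {1..N}" "j \<in> {i<..N}"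
    have "u i - u j = (u i - 1) - (u j - 1)" by simp
    then have "norm (u i - u j) \<le> norm (u i - 1) + norm (u j - 1)" by (metis norm_triangle_ineq4)
    also have "\<dots> \<le> 1 + 1"
    proof (rule add_mono)
      show "norm (u i - 1) \<le> 1" using that[OF ij(1)] d[OF ij(1)] by linarith
      have j: "j \<in> {1..N}" using ij by auto
      show "norm (u j - 1) \<le> 1" using that[OF j] d[OF j] by linarith
    qed
    finally show "norm (u i - u j) \<le> 2" by simp
  qed
  have VB0: "VB \<ge> 0" by (auto simp: VB_def intro!: prod_nonneg)
  define m where "m = (\<lambda>l. \<Sum>y\<in>corners N d. norm (nschur N l (cvec y)))"
  have m0: "m l \<ge> 0" for l by (auto simp: m_def intro!: sum_nonneg)
  define C where "C = (\<Sum>i\<in>{1..N}. 2 ^ k * (fact k * VB / (d i / 4) ^ k)) / c0"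
  have sub: "pbox N d \<subseteq> nzset N" by (rule pbox_subset_nzset) (use d in force)
  have key: "norm (of_real (ek N k l) * nschur N l u) \<le> C * m l"
    if l: "l \<in> signatures N" and u: "\<And>i. i \<in> {1..N} \<Longrightarrow> norm (u i - 1) \<le> d i / 2" for l u
  proof (rule polydisc_max_modulus[where I = "{1..N}" and B = "pbox N d" and \<tau> = \<tau> and u = u and f = "\<lambda>u. of_real (ek N k l) * nschur N l u"])
    show "sephol (pbox N d) (\<lambda>u. of_real (ek N k l) * nschur N l u)"
      by (intro sephol_mult sephol_const sephol_subset[OF nschur_sephol[OF l] sub])
    show "v \<in> pbox N d" if v: "\<And>a. a \<in> {1..N} \<Longrightarrow> norm (v a - 1) \<le> \<tau> a" for v
      unfolding pbox_def
    proof (intro CollectI ballI)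
      fix i assume i: "i \<in> {1..N}"
      then show "norm (v i - 1) < d i" using v[OF i] \<tau>(2) d[OF i] by force
    qed
    show "\<tau> a > 0" if "a \<in> {1..N}" for a using that \<tau>(2) d[OF that] by force
    show "norm (u a - 1) \<le> \<tau> a" if "a \<in> {1..N}" for a using u[OF that] that \<tau>(2) by force
    fix v :: "nat \<Rightarrow> complex" assume v: "\<And>a. a \<in> {1..N} \<Longrightarrow> norm (v a - 1) = \<tau> a"
    have vbox: "v \<in> pbox N d" unfolding pbox_def
    proof (intro CollectI ballI)
      fix i assume i: "i \<in> {1..N}"
      then show "norm (v i - 1) < d i" using v[OF i] \<tau>(2) d[OF i] by force
    qed
    have V: "c0 \<le> norm (vdm N v)" unfolding c0_def vdm_def prod_norm[symmetric]
    proof (intro prod_mono conjI prod_nonneg ballI abs_ge_zero)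
      fix i j assume ij: "i \<in> {1..N}" "j \<in> {i<..N}"
      have j: "j \<in> {1..N}" using ij by auto
      have "\<bar>norm (v i - 1) - norm (v j - 1)\<bar> \<le> norm ((v i - 1) - (v j - 1))" by (rule norm_triangle_ineq3)
      then show "\<bar>\<tau> i - \<tau> j\<bar> \<le> norm (v i - v j)" using v[OF ij(1)] v[OF j] by simp
    qed
    let ?f = "\<lambda>u. vdm N u * (1 * nschur N l u)"
    have term_bound: "norm (v i ^ k * (pd i ^^ k) ?f v) \<le> 2 ^ k * (fact k * (VB * m l) / (d i / 4) ^ k)" if i: "i \<in> {1..N}" for i
    proof -
      have di: "d i > 0" using d[OF i] by simp
      have in_ball: "norm ((v(i := z)) a - 1) \<le> d a" if "z \<in> cball (v i) (d i / 4)" "a \<in> {1..N}" for z a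
      proof (cases "a = i")
        case True
        have "norm (z - 1) \<le> norm (z - v i) + norm (v i - 1)" using norm_triangle_ineq[of "z - v i" "v i - 1"] by simp
        also have "\<dots> \<le> d i / 4 + 3/4 * d i" using that(1) v[OF i] \<tau>(2) i by (intro add_mono) (auto simp: dist_norm norm_minus_commute less_imp_le)
        finally show ?thesis using True by simp
      next
        case False
        then show ?thesis using v[OF that(2)] \<tau>(2) d[OF that(2)] that(2) by force
      qed
      have "norm ((deriv ^^ k) (\<lambda>z. ?f (v(i := z))) (v i)) \<le> fact k * (VB * m l) / (d i / 4) ^ k"
      proof (rule Cauchy_inequality_cball[where T = "{z. v(i := z) \<in> nzset N}"])
        show "(\<lambda>z. ?f (v(i := z))) holomorphic_on {z. v(i := z) \<in> nzset N}"
          by (rule sephol_holomorphic_slice) (intro sephol_mult sephol_const sephol_vdm nschur_sephol[OF l])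
        show "cball (v i) (d i / 4) \<subseteq> {z. v(i := z) \<in> nzset N}"
          unfolding nzset_def
        proof (intro subsetI CollectI ballI)
          fix z a assume z: "z \<in> cball (v i) (d i / 4)" and a: "a \<in> {1..N}"
          have "norm ((v(i := z)) a - 1) < 1" using in_ball[OF z a] d[OF a] by linarith
          then show "(v(i := z)) a \<noteq> 0" by auto
        qed
        fix z assume z: "z \<in> cball (v i) (d i / 4)"
        show "norm (?f (v(i := z))) \<le> VB * m l"
          unfolding norm_mult m_def norm_one mult_1_left
          by (intro mult_mono VB nschur_corner_bound[OF l d] VB0 norm_ge_zero) (use in_ball[OF z] in auto)
      qed (use di in auto)
      moreover have "norm (v i) ^ k \<le> 2 ^ k"
      proof (intro power_mono)
        have "norm (v i) \<le> norm (v i - 1) + 1" using norm_triangle_ineq[of "v i - 1" 1] by simp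
        then show "norm (v i) \<le> 2" using v[OF i] \<tau>(2) i d[OF i] by force
      qed simp
      ultimately show ?thesis unfolding norm_mult norm_power pd_funpow' by (intro mult_mono) auto
    qed
    have "norm (of_real (ek N k l) * ?f v) = norm (\<Sum>i\<in>{1..N}. v i ^ k * (pd i ^^ k) ?f v)"
      using nschur_euler[OF l subsetD[OF sub vbox], of k 1] by simp
    also have "\<dots> \<le> (\<Sum>i\<in>{1..N}. 2 ^ k * (fact k * (VB * m l) / (d i / 4) ^ k))"
      by (intro sum_norm_le term_bound)
    also have "\<dots> = (\<Sum>i\<in>{1..N}. 2 ^ k * (fact k * VB / (d i / 4) ^ k)) * m l"
      unfolding sum_distrib_right by (intro sum.cong refl) (simp add: mult_ac)
    also have "\<dots> = C * c0 * m l" using c0 by (simp add: C_def)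
    finally have "norm (of_real (ek N k l) * nschur N l v) * norm (vdm N v) \<le> C * m l * c0"
      by (simp add: norm_mult mult_ac)
    moreover have "norm (of_real (ek N k l) * nschur N l v) * c0 \<le> norm (of_real (ek N k l) * nschur N l v) * norm (vdm N v)"
      by (intro mult_left_mono V norm_ge_zero)
    ultimately have "norm (of_real (ek N k l) * nschur N l v) * c0 \<le> C * m l * c0" by linarith
    then show "norm (of_real (ek N k l) * nschur N l v) \<le> C * m l" using c0 by simp
  qed (auto simp: open_pbox)
  show ?thesis
  proof (rule absconv_dominated[OF w d, where C = C])
    fix l y assume l: "l \<in> signatures N" and y: "y \<in> corners N (\<lambda>i. d i / 2)"
    have "norm (of_real (ek N k l) * nschur N l (cvec y)) \<le> C * m l"
    proof (rule key[OF l])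
      fix i assume i: "i \<in> {1..N}"
      show "norm (cvec y i - 1) \<le> d i / 2" using corners_near_one[OF y i] d[OF i] by simp
    qed
    then have "\<bar>w l\<bar> * (\<bar>ek N k l\<bar> * norm (nschur N l (cvec y))) \<le> \<bar>w l\<bar> * (C * m l)"
      by (intro mult_left_mono) (auto simp: norm_mult)
    then show "\<bar>w l * ek N k l\<bar> * norm (nschur N l (cvec y)) \<le> C * (\<bar>w l\<bar> * (\<Sum>y\<in>corners N d. norm (nschur N l (cvec y))))"
      by (simp add: abs_mult m_def mult_ac)
  qed
qed

lemma gf_symmetric:
  assumes "s permutes {1..N}" "u \<in> nzset N"
  shows "gf N w (u \<circ> s) = gf N w u"
  unfolding gf_def using nschur_symmetric[OF _ assms] by (intro infsum_cong) simp

lemma gf_expansion: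
  assumes w: "absconv N w d" and d: "\<And>i. i \<in> {1..N} \<Longrightarrow> 0 < d i \<and> d i < 1"
    and u: "u \<in> pbox N d" "u \<in> generic_pts N"
  shows "gf N (\<lambda>l. w l * ek N k l) u = (\<Sum>m\<le>k. of_real (fact k / fact (k - m)) *
     (\<Sum>I | I \<subseteq> {1..N} \<and> card I = Suc m. ddiff I (\<lambda>i u. u i ^ k * (pd i ^^ (k - m)) (gf N w) u) u))"
proof -
  have sub: "pbox N d \<subseteq> nzset N" by (rule pbox_subset_nzset) (use d in force)
  have "vdm N u * gf N (\<lambda>l. w l * ek N k l) u = vdm N u * (\<Sum>\<^sub>\<infinity>l\<in>signatures N. of_real (ek N k l) * of_real (w l) * nschur N l u)"
    by (simp add: gf_def mult_ac)
  also have "\<dots> = (\<Sum>i\<in>{1..N}. u i ^ k * (pd i ^^ k) (\<lambda>u. vdm N u * gf N w u) u)"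
    unfolding gf_def by (rule generating_euler[OF open_pbox sub u(1) absconv_locsum[OF w d]])
  also have "\<dots> = vdm N u * (\<Sum>m\<le>k. of_real (fact k / fact (k - m)) *
     (\<Sum>I | I \<subseteq> {1..N} \<and> card I = Suc m. ddiff I (\<lambda>i u. u i ^ k * (pd i ^^ (k - m)) (gf N w) u) u))"
    by (rule euler_expansion[OF open_pbox u absconv_sephol[OF w d]])
  finally show ?thesis using vdm_nonzero[OF u(2)] by simp
qed

text \<open>If v i = v j, the transposition of i and j exchanges the slices in these two directions,
  and the generating function is symmetric. This is the condition under which the poles of a divided
  difference cancel.\<close>

lemma pd_gf_diagonal:
  assumes w: "absconv N w d" and d: "\<And>i. i \<in> {1..N} \<Longrightarrow> 0 < d i \<and> d i < 1"
    and v: "v \<in> pbox N d" "i \<in> {1..N}" "j \<in> {1..N}" "v i = v j"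
  shows "(pd i ^^ n) (gf N w) v = (pd j ^^ n) (gf N w) v"
proof (cases "i = j")
  case False
  let ?S = "{z. v(i := z) \<in> pbox N d} \<inter> {z. v(j := z) \<in> pbox N d}"
  have sub: "pbox N d \<subseteq> nzset N" by (rule pbox_subset_nzset) (use d in force)
  have h: "(\<lambda>z. gf N w (v(i := z))) holomorphic_on ?S" "(\<lambda>z. gf N w (v(j := z))) holomorphic_on ?S"
    using sephol_holomorphic_slice[OF absconv_sephol[OF w d]] by (meson holomorphic_on_subset inf_le1 inf_le2)+
  have "(deriv ^^ n) (\<lambda>z. gf N w (v(i := z))) (v i) = (deriv ^^ n) (\<lambda>z. gf N w (v(j := z))) (v i)"
  proof (rule higher_deriv_transform_within_open[OF h])
    show "open ?S" by (intro open_Int open_slice open_pbox)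
    have "v(i := v i) = v" "v(j := v i) = v" using v(4) by auto
    then show "v i \<in> ?S" using v(1) by simp
    fix z assume z: "z \<in> ?S"
    have "v(j := z) = v(i := z) \<circ> Transposition.transpose i j"
      using v(4) False by (auto simp: fun_eq_iff Transposition.transpose_def)
    moreover have "Transposition.transpose i j permutes {1..N}" using v by (intro permutes_swap_id) auto
    ultimately show "gf N w (v(i := z)) = gf N w (v(j := z))"
      using gf_symmetric[of "Transposition.transpose i j" N "v(i := z)" w] z sub by auto
  qed
  then show ?thesis unfolding pd_funpow' using v(4) by simp
qed simp

section \<open>Consequences of the hypothesis on the Schur generating function\<close>

definition pdj :: "nat set \<Rightarrow> real \<Rightarrow> (nat \<Rightarrow> complex) set" where
  "pdj J \<delta> = {u. (\<forall>i\<in>J. norm (u i - 1) < \<delta>) \<and> (\<forall>i. i \<notin> J \<longrightarrow> u i = 1)}"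

definition dvec :: "nat set \<Rightarrow> real \<Rightarrow> real \<Rightarrow> nat \<Rightarrow> real" where
  "dvec J \<delta> \<eta> = (\<lambda>i. if i \<in> J then \<delta> else \<eta>)"

text \<open>The order of quantifiers matters: the R variables in J have a radius \<delta> fixed for
  all N, the others a radius \<eta> that may depend on N. The latter only provides an open
  neighbourhood in all N variables.\<close>

definition absconv_ev :: "(nat \<Rightarrow> (nat \<Rightarrow> int) \<Rightarrow> real) \<Rightarrow> nat \<Rightarrow> real \<Rightarrow> bool" where
  "absconv_ev w R \<delta> \<longleftrightarrow> (\<forall>\<^sub>F N in sequentially. \<exists>\<eta>. 0 < \<eta> \<and> \<eta> < 1 \<and>
     (\<forall>J. J \<subseteq> {1..N} \<longrightarrow> card J = R \<longrightarrow> absconv N (w N) (dvec J \<delta> \<eta>)))"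

text \<open>The threshold for N is common to all J, because J will vary with the summand in a sum
  over subsets.\<close>

definition unif_ev :: "nat \<Rightarrow> real \<Rightarrow> (nat \<Rightarrow> nat set \<Rightarrow> (nat \<Rightarrow> complex) \<Rightarrow> bool) \<Rightarrow> bool" where
  "unif_ev R \<delta> P \<longleftrightarrow> (\<forall>\<^sub>F N in sequentially. \<forall>J. J \<subseteq> {1..N} \<longrightarrow> card J = R \<longrightarrow> (\<forall>u\<in>pdj J \<delta>. P N J u))"

lemma pdj_nzset: "\<delta> \<le> 1 \<Longrightarrow> u \<in> pdj J \<delta> \<Longrightarrow> u \<in> nzset N"
proof -
  assume \<delta>: "\<delta> \<le> 1" and u: "u \<in> pdj J \<delta>"
  have "u i \<noteq> 0" for i
  proof
    assume "u i = 0"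
    then show False using \<delta> u unfolding pdj_def by (cases "i \<in> J") force+
  qed
  then show ?thesis by (simp add: nzset_def)
qed

lemma pdj_pbox: "J \<subseteq> {1..N} \<Longrightarrow> \<eta> > 0 \<Longrightarrow> u \<in> pdj J \<delta> \<Longrightarrow> u \<in> pbox N (dvec J \<delta> \<eta>)"
  unfolding pbox_def pdj_def dvec_def by auto

lemma pdj_mono: "\<delta> \<le> \<delta>' \<Longrightarrow> pdj J \<delta> \<subseteq> pdj J \<delta>'"
  unfolding pdj_def by force

lemma unif_ev_mono: "unif_ev R \<delta>' P \<Longrightarrow> \<delta> \<le> \<delta>' \<Longrightarrow> unif_ev R \<delta> P"
  unfolding unif_ev_def using pdj_mono[of \<delta> \<delta>'] by (auto elim!: eventually_mono)

lemma dvec_bounds: "0 < \<delta> \<Longrightarrow> \<delta> < 1 \<Longrightarrow> 0 < \<eta> \<Longrightarrow> \<eta> < 1 \<Longrightarrow> 0 < dvec J \<delta> \<eta> i \<and> dvec J \<delta> \<eta> i < 1"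
  by (simp add: dvec_def)

lemma absconv_ev_mono:
  assumes "absconv_ev w R \<delta>'" "0 < \<delta>" "\<delta> \<le> \<delta>'" "\<delta>' < 1"
  shows "absconv_ev w R \<delta>"
  using assms(1) unfolding absconv_ev_def
proof eventually_elim
  case (elim N)
  then obtain \<eta> where \<eta>: "0 < \<eta>" "\<eta> < 1" "\<forall>J. J \<subseteq> {1..N} \<longrightarrow> card J = R \<longrightarrow> absconv N (w N) (dvec J \<delta>' \<eta>)" by blast
  have "absconv N (w N) (dvec J \<delta> \<eta>)" if "J \<subseteq> {1..N}" "card J = R" for J
    by (rule absconv_mono[of N "w N" "dvec J \<delta>' \<eta>"]) (use \<eta> that assms in \<open>auto simp: dvec_def\<close>)
  then show ?case using \<eta> by blast
qed

lemma sgf_eq_gf: "sgf N \<rho> u = gf N (pmf \<rho>) u"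
  by (simp add: sgf_def gf_def sgf_term_def nschur_def)

text \<open>The hypothesis of the theorem speaks of the first R variables; symmetry together with
  such a permutation transports it to any set J of R variables.\<close>

lemma exists_permutation_onto:
  assumes "J \<subseteq> {1..N}" "card J = R"
  obtains s where "s permutes {1..N}" "s ` {1..R} = J"
proof -
  have RN: "R \<le> N" using assms card_mono[of "{1..N}" J] by simp
  have fJ: "finite J" using assms finite_subset by blast
  obtain f where f: "bij_betw f {1..R} J" using finite_same_card_bij[of "{1..R}" J] fJ assms by auto
  have "card ({1..N} - {1..R}) = card ({1..N} - J)"
    using assms RN fJ by (simp add: card_Diff_subset)
  then obtain g where g: "bij_betw g ({1..N} - {1..R}) ({1..N} - J)"
    using finite_same_card_bij[of "{1..N} - {1..R}" "{1..N} - J"] by auto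
  define s where "s = (\<lambda>i. if i \<in> {1..R} then f i else if i \<in> {1..N} then g i else i)"
  have 1: "bij_betw s {1..R} J" using f by (rule bij_betw_cong[THEN iffD1, rotated]) (auto simp: s_def)
  have 2: "bij_betw s ({1..N} - {1..R}) ({1..N} - J)" using g by (rule bij_betw_cong[THEN iffD1, rotated]) (auto simp: s_def)
  have "bij_betw s ({1..R} \<union> ({1..N} - {1..R})) (J \<union> ({1..N} - J))"
    using 1 2 by (rule bij_betw_combine) auto
  moreover have "{1..R} \<union> ({1..N} - {1..R}) = {1..N}" using RN by auto
  moreover have "J \<union> ({1..N} - J) = {1..N}" using assms by auto
  ultimately have "s permutes {1..N}" by (intro bij_imp_permutes) (auto simp: s_def)
  moreover have "s ` {1..R} = J" using 1 by (simp add: bij_betw_def)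
  ultimately show ?thesis using that by blast
qed

lemma permute_pdj:
  assumes s: "s permutes {1..N}" "s ` {1..R} = J" and u: "u \<in> pdj J \<delta>"
  shows "u \<circ> s \<in> polydisc R \<delta>"
  unfolding polydisc_def
proof (intro CollectI conjI ballI allI impI)
  fix i assume "i \<in> {1..R}"
  then have "s i \<in> J" using s(2) by blast
  then show "cmod ((u \<circ> s) i - 1) < \<delta>" using u by (simp add: pdj_def)
next
  fix i assume "i \<notin> {1..R}"
  then have "s i \<notin> s ` {1..R}" using permutes_inj[OF s(1)] by (simp add: inj_image_mem_iff)
  then show "(u \<circ> s) i = 1" using u s(2) by (simp add: pdj_def)
qed

section \<open>Absolute convergence on polydiscs and logarithmic derivatives\<close>

lemma nschur_weight_summable:
  assumes "(\<lambda>l. sgf_term N \<rho> l u) summable_on signatures N"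
  shows "(\<lambda>l. \<bar>pmf \<rho> l\<bar> * norm (nschur N l u)) summable_on signatures N"
proof -
  have "(\<lambda>l. norm (sgf_term N \<rho> l u)) summable_on signatures N"
    using assms summable_on_iff_abs_summable_on_complex[THEN iffD1] by auto
  then show ?thesis by (simp add: sgf_term_def nschur_def norm_mult norm_divide)
qed

lemma unif_conv_summable:
  assumes "sgf_unif_conv N \<rho>"
  obtains d where "d > 0" "\<And>u. u \<in> polydisc N d \<Longrightarrow> (\<lambda>l. sgf_term N \<rho> l u) summable_on signatures N"
proof -
  obtain d where d: "d > 0" "\<forall>e>0. \<exists>F0. finite F0 \<and> F0 \<subseteq> signatures N \<and>
      (\<forall>F. finite F \<and> F0 \<subseteq> F \<and> F \<subseteq> signatures N \<longrightarrow>
         (\<forall>u\<in>polydisc N d. cmod ((\<Sum>l\<in>F. sgf_term N \<rho> l u) - sgf N \<rho> u) < e))"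
    using assms unfolding sgf_unif_conv_def by (elim exE conjE)
  have "((\<lambda>l. sgf_term N \<rho> l u) has_sum sgf N \<rho> u) (signatures N)" if u: "u \<in> polydisc N d" for u
    unfolding has_sum_def tendsto_iff eventually_finite_subsets_at_top
  proof (intro allI impI)
    fix e :: real assume "e > 0"
    then obtain F0 where F0: "finite F0" "F0 \<subseteq> signatures N" "\<forall>F. finite F \<and> F0 \<subseteq> F \<and> F \<subseteq> signatures N \<longrightarrow>
         (\<forall>u\<in>polydisc N d. cmod ((\<Sum>l\<in>F. sgf_term N \<rho> l u) - sgf N \<rho> u) < e)" using d(2)[rule_format] by meson
    show "\<exists>X. finite X \<and> X \<subseteq> signatures N \<and> (\<forall>Y. finite Y \<and> X \<subseteq> Y \<and> Y \<subseteq> signatures N \<longrightarrow>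
        dist (\<Sum>l\<in>Y. sgf_term N \<rho> l u) (sgf N \<rho> u) < e)"
      using F0 u by (intro exI[of _ F0]) (auto simp: dist_norm)
  qed
  then show ?thesis using that[of d] d(1) by (auto simp: summable_on_def)
qed

text \<open>A corner is \<open>y = x z\<close> with \<open>x\<^sup>2\<close> in the wide and \<open>z\<^sup>2\<close> in the narrow polydisc, and
  log-convexity of a Laurent polynomial with nonnegative coefficients bounds its value at \<open>y\<close>
  by those at \<open>x\<^sup>2\<close> and \<open>z\<^sup>2\<close>.\<close>
lemma absconv_interpolate:
  assumes J: "J \<subseteq> {1..N}" and \<delta>: "0 < \<delta>" "\<delta> < 1" and \<eta>: "0 < \<eta>" "\<eta> < 1"
    and wide: "\<And>u. u \<in> pdj J (3 * \<delta>) \<Longrightarrow> u \<in> nzset N \<Longrightarrow> (\<lambda>l. \<bar>w l\<bar> * norm (nschur N l u)) summable_on signatures N"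
    and narrow: "\<And>u. u \<in> polydisc N (3 * \<eta>) \<Longrightarrow> (\<lambda>l. \<bar>w l\<bar> * norm (nschur N l u)) summable_on signatures N"
  shows "absconv N w (dvec J \<delta> \<eta>)"
  unfolding absconv_def
proof
  fix y assume y: "y \<in> corners N (dvec J \<delta> \<eta>)"
  have yi: "(i \<in> J \<longrightarrow> y i = 1 - \<delta> \<or> y i = 1 + \<delta>) \<and> (i \<notin> J \<longrightarrow> y i = 1 - \<eta> \<or> y i = 1 + \<eta>)" if "i \<in> {1..N}" for i
    using PiE_mem[OF y[unfolded corners_def] that] by (auto simp: dvec_def)
  define x where "x = (\<lambda>i. if i \<in> J then y i else 1)"
  define z where "z = (\<lambda>i. if i \<in> {1..N} - J then y i else 1)"
  \<comment> \<open>Squaring a coordinate 1 - e or 1 + e moves it to a distance below 3 e from 1;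
    this is the factor 3 in both hypotheses.\<close>
  have sq: "norm (of_real (t\<^sup>2) - 1 :: complex) < 3 * e" if "t = 1 - e \<or> t = 1 + e" "0 < e" "e < 1" for t e :: real
  proof -
    have "e * e < e * 1" using that by (intro mult_strict_left_mono) auto
    moreover have "0 < e * e" using that by simp
    moreover have "t\<^sup>2 - 1 = e * e - 2 * e \<or> t\<^sup>2 - 1 = e * e + 2 * e"
    proof -
      have "(1 - e)\<^sup>2 - 1 = e * e - 2 * e" "(1 + e)\<^sup>2 - 1 = e * e + 2 * e" by (simp_all add: power2_eq_square algebra_simps)
      then show ?thesis using that(1) by blast
    qed
    ultimately have "\<bar>t\<^sup>2 - 1\<bar> < 3 * e" using that(2) by linarith
    then show ?thesis by (metis norm_of_real of_real_1 of_real_diff)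
  qed
  have pos: "x i > 0 \<and> z i > 0" if "i \<in> {1..N}" for i using yi[OF that] \<delta> \<eta> by (auto simp: x_def z_def)
  have x2: "cvec (\<lambda>i. (x i)\<^sup>2) \<in> pdj J (3 * \<delta>)" unfolding pdj_def
  proof (intro CollectI conjI ballI allI impI)
    fix i assume "i \<in> J"
    then show "norm (cvec (\<lambda>i. (x i)\<^sup>2) i - 1) < 3 * \<delta>" using yi[of i] J \<delta> sq[of "y i" \<delta>] by (auto simp: x_def)
  qed (auto simp: x_def)
  have z2: "cvec (\<lambda>i. (z i)\<^sup>2) \<in> polydisc N (3 * \<eta>)" unfolding polydisc_def
  proof (intro CollectI conjI ballI allI impI)
    fix i assume i: "i \<in> {1..N}"
    show "norm (cvec (\<lambda>i. (z i)\<^sup>2) i - 1) < 3 * \<eta>" using yi[OF i] i \<eta> sq[of "y i" \<eta>] by (cases "i \<in> J") (auto simp: z_def)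
  qed (auto simp: z_def)
  have "cvec (\<lambda>i. (x i)\<^sup>2) \<in> nzset N" by (intro cvec_nzset) (use pos in force)
  then have s: "(\<lambda>l. \<bar>w l\<bar> * norm (nschur N l (cvec (\<lambda>i. (x i)\<^sup>2))) + \<bar>w l\<bar> * norm (nschur N l (cvec (\<lambda>i. (z i)\<^sup>2)))) summable_on signatures N"
    by (intro summable_on_add wide narrow x2 z2)
  show "(\<lambda>l. \<bar>w l\<bar> * norm (nschur N l (cvec y))) summable_on signatures N"
  proof (rule summable_on_comparison_test[OF s])
    fix l assume l: "l \<in> signatures N"
    have "nschur N l (cvec y) = nschur N l (cvec (\<lambda>i. x i * z i))"
    proof (rule nschur_local[OF l])
      show "cvec y \<in> nzset N" by (intro cvec_nzset) (use yi \<delta> \<eta> in force)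
      show "cvec y i = cvec (\<lambda>i. x i * z i) i" if "i \<in> {1..N}" for i using that by (auto simp: x_def z_def)
    qed
    then have "norm (nschur N l (cvec y)) \<le> (norm (nschur N l (cvec (\<lambda>i. (x i)\<^sup>2))) + norm (nschur N l (cvec (\<lambda>i. (z i)\<^sup>2)))) / 2"
      using nschur_log_convex[OF l pos] by (simp only:)
    also have "\<dots> \<le> norm (nschur N l (cvec (\<lambda>i. (x i)\<^sup>2))) + norm (nschur N l (cvec (\<lambda>i. (z i)\<^sup>2)))"
      by (simp add: field_simps)
    finally have "\<bar>w l\<bar> * norm (nschur N l (cvec y)) \<le> \<bar>w l\<bar> * (norm (nschur N l (cvec (\<lambda>i. (x i)\<^sup>2))) + norm (nschur N l (cvec (\<lambda>i. (z i)\<^sup>2))))"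
      by (intro mult_left_mono) auto
    then show "\<bar>w l\<bar> * norm (nschur N l (cvec y)) \<le> \<bar>w l\<bar> * norm (nschur N l (cvec (\<lambda>i. (x i)\<^sup>2))) + \<bar>w l\<bar> * norm (nschur N l (cvec (\<lambda>i. (z i)\<^sup>2)))"
      by (simp only: distrib_left)
  qed auto
qed

text \<open>The logarithm \<open>lg\<close> is only assumed continuous. Near z0 it is a shifted
  principal branch: values less than 1 apart differ by a number in the strip where
  \<open>Ln (exp w) = w\<close>.\<close>

lemma continuous_log_deriv:
  assumes T: "open T" and g: "g holomorphic_on T" and lg: "continuous_on T lg" "\<And>z. z \<in> T \<Longrightarrow> exp (lg z) = g z" and z0: "z0 \<in> T"
  shows "(lg has_field_derivative (deriv g z0 / g z0)) (at z0)"
proof -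
  have gn: "g z \<noteq> 0" if "z \<in> T" for z using lg(2)[OF that] exp_not_eq_zero by metis
  define T' where "T' = T \<inter> (\<lambda>z. lg z - lg z0) -` ball 0 1"
  have T': "open T'" unfolding T'_def
    by (rule continuous_open_preimage[OF _ T open_ball]) (intro continuous_intros lg(1))
  have z0': "z0 \<in> T'" using z0 by (simp add: T'_def)
  have dg: "(g has_field_derivative deriv g z0) (at z0)" using g T z0 by (simp add: holomorphic_derivI)
  have "((\<lambda>z. lg z0 + Ln (g z / g z0)) has_field_derivative (deriv g z0 / g z0)) (at z0)"
    using gn[OF z0] dg by (auto intro!: derivative_eq_intros simp: field_simps)
  then show ?thesis
  proof (rule has_field_derivative_transform_within_open[OF _ T' z0'])
    fix z assume z: "z \<in> T'"
    then have zT: "z \<in> T" and n: "norm (lg z - lg z0) < 1" by (auto simp: T'_def)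
    have "\<bar>Im (lg z - lg z0)\<bar> < 1" using n abs_Im_le_cmod order_le_less_trans by blast
    moreover have "1 < pi" using pi_gt3 by simp
    ultimately have "Ln (exp (lg z - lg z0)) = lg z - lg z0" by (intro Ln_exp) auto
    moreover have "exp (lg z - lg z0) = g z / g z0" using lg(2)[OF zT] lg(2)[OF z0] by (simp add: exp_diff)
    ultimately show "lg z0 + Ln (g z / g z0) = lg z" by simp
  qed
qed

lemma pmf_has_sum: "(pmf p has_sum measure_pmf.prob p A) A"
proof -
  have "(\<lambda>x. norm (pmf p x)) summable_on A"
    using pmf_abs_summable[of p A] by (simp only: abs_summable_equivalent)
  then have "pmf p summable_on A" by (rule abs_summable_summable)
  moreover have "infsum (pmf p) A = measure_pmf.prob p A"
    by (simp add: measure_pmf_conv_infsetsum infsetsum_infsum[OF pmf_abs_summable])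
  ultimately show ?thesis using has_sum_infsum by metis
qed

locale schur_lln =
  fixes \<rho> :: "nat \<Rightarrow> (nat \<Rightarrow> int) pmf" and \<Psi> :: "complex \<Rightarrow> complex"
  assumes supp: "\<And>N. set_pmf (\<rho> N) \<subseteq> signatures N"
    and conv: "\<And>N. N \<ge> 1 \<Longrightarrow> sgf_unif_conv N (\<rho> N)"
    and anal: "\<Psi> analytic_on {1}"
    and hyp: "\<And>r. r \<ge> 1 \<Longrightarrow> \<exists>d>0. \<exists>L :: nat \<Rightarrow> (nat \<Rightarrow> complex) \<Rightarrow> complex.
               (\<forall>\<^sub>F N in sequentially. continuous_on (polydisc r d) (L N) \<and> L N (\<lambda>_. 1) = 0 \<and>
                   (\<forall>u\<in>polydisc r d. exp (L N u) = sgf N (\<rho> N) u)) \<and>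
               (\<forall>e>0. \<forall>\<^sub>F N in sequentially. \<forall>u\<in>polydisc r d.
                   cmod (L N u / of_nat N - (\<Sum>i=1..r. \<Psi> (u i))) < e)"
begin

abbreviation S :: "nat \<Rightarrow> (nat \<Rightarrow> complex) \<Rightarrow> complex" where
  "S N \<equiv> gf N (pmf (\<rho> N))"

lemma S_one: "S N (\<lambda>_. 1) = 1"
proof -
  have "((\<lambda>l. of_real (pmf (\<rho> N) l)) has_sum (of_real (measure_pmf.prob (\<rho> N) (signatures N)) :: complex)) (signatures N)"
    by (rule has_sum_of_real[OF pmf_has_sum])
  moreover have "measure_pmf.prob (\<rho> N) (signatures N) = 1"
    using supp[of N] by (simp add: measure_pmf.prob_eq_1 AE_measure_pmf_iff subset_eq)
  moreover have "S N (\<lambda>_. 1) = (\<Sum>\<^sub>\<infinity>l\<in>signatures N. of_real (pmf (\<rho> N) l))"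
    unfolding gf_def by (intro infsum_cong) (simp add: nschur_one)
  ultimately show ?thesis by (simp add: infsumI)
qed

text \<open>Uniform convergence of \<open>L N / N\<close> on a disc in one variable gives
  convergence of its derivative by Cauchy's inequality, and the derivative of a continuous logarithm
  of S is \<open>pd i S / S\<close>.\<close>

lemma S_ratio_tendsto:
  assumes R: "R \<ge> 1"
  obtains \<delta> where "0 < \<delta>" "\<delta> < 1" "\<Psi> holomorphic_on ball 1 (3 * \<delta>)" "absconv_ev (\<lambda>N. pmf (\<rho> N)) R \<delta>"
    "unif_ev R \<delta> (\<lambda>N J u. S N u \<noteq> 0)"
    "\<And>\<epsilon>. \<epsilon> > 0 \<Longrightarrow> unif_ev R \<delta> (\<lambda>N J u. \<forall>i\<in>J. norm (pd i (S N) u / (of_nat N * S N u) - deriv \<Psi> (u i)) < \<epsilon>)"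
proof -
  obtain d L where d: "d > 0" and ev: "\<forall>\<^sub>F N in sequentially. continuous_on (polydisc R d) (L N) \<and> L N (\<lambda>_. 1) = (0::complex) \<and>
                   (\<forall>u\<in>polydisc R d. exp (L N u) = sgf N (\<rho> N) u)"
     and lim: "\<forall>e>0. \<forall>\<^sub>F N in sequentially. \<forall>u\<in>polydisc R d. cmod (L N u / of_nat N - (\<Sum>i=1..R. \<Psi> (u i))) < e"
    using hyp[OF R] by (elim exE conjE)
  obtain d1 where d1: "d1 > 0" "\<Psi> holomorphic_on ball 1 d1" using anal unfolding analytic_on_def by auto
  \<comment> \<open>The factor 3 is the widening demanded by \<open>absconv_interpolate\<close>. The
    bound 1 / 4 keeps 3 * \<delta> below 1, so no coordinate vanishes.\<close>
  define \<delta> where "\<delta> = min (min (d / 3) (d1 / 3)) (1 / 4)"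
  have \<delta>: "0 < \<delta>" "\<delta> < 1" "3 * \<delta> \<le> d" "3 * \<delta> \<le> d1" "3 * \<delta> \<le> 1" using d d1 by (auto simp: \<delta>_def)
  have hol\<Psi>: "\<Psi> holomorphic_on ball 1 (3 * \<delta>)" using d1(2) \<delta>(4) by (meson holomorphic_on_subset subset_ball)
  have to_pd: "u \<circ> s \<in> polydisc R d" if "s permutes {1..N}" "s ` {1..R} = J" "u \<in> pdj J (3 * \<delta>)" for s N J u
    using permute_pdj[OF that(1,2), of u d] that(3) pdj_mono[OF \<delta>(3)] by blast
  have ac: "absconv_ev (\<lambda>N. pmf (\<rho> N)) R \<delta>"
    unfolding absconv_ev_def using ev eventually_ge_at_top[of 1]
  proof eventually_elim
    case (elim N)
    obtain dN where dN: "dN > 0" "\<And>u. u \<in> polydisc N dN \<Longrightarrow> (\<lambda>l. sgf_term N (\<rho> N) l u) summable_on signatures N"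
      using unif_conv_summable[OF conv[of N]] elim by blast
    define \<eta> where "\<eta> = min (dN / 3) (1 / 2)"
    have \<eta>: "0 < \<eta>" "\<eta> < 1" "3 * \<eta> \<le> dN" using dN by (auto simp: \<eta>_def)
    have "absconv N (pmf (\<rho> N)) (dvec J \<delta> \<eta>)" if J: "J \<subseteq> {1..N}" "card J = R" for J
    proof (rule absconv_interpolate[OF J(1) \<delta>(1,2) \<eta>(1,2)])
      fix u assume "u \<in> polydisc N (3 * \<eta>)"
      then have "u \<in> polydisc N dN" using \<eta>(3) by (force simp: polydisc_def)
      then show "(\<lambda>l. \<bar>pmf (\<rho> N) l\<bar> * norm (nschur N l u)) summable_on signatures N"
        by (intro nschur_weight_summable dN(2))
    next
      fix u assume u: "u \<in> pdj J (3 * \<delta>)" "u \<in> nzset N"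
      obtain s where s: "s permutes {1..N}" "s ` {1..R} = J" using exists_permutation_onto[OF J] by blast
      have "sgf N (\<rho> N) (u \<circ> s) = exp (L N (u \<circ> s))" using elim to_pd[OF s u(1)] by simp
      then have "sgf N (\<rho> N) (u \<circ> s) \<noteq> 0" by simp
      \<comment> \<open>By convention an infinite sum that does not converge is 0, so the nonzero
        value proves summability at this point.\<close>
      then have "(\<lambda>l. sgf_term N (\<rho> N) l (u \<circ> s)) summable_on signatures N"
        unfolding sgf_def using infsum_not_exists by blast
      from nschur_weight_summable[OF this]
      show "(\<lambda>l. \<bar>pmf (\<rho> N) l\<bar> * norm (nschur N l u)) summable_on signatures N"
        by (rule summable_on_cong[THEN iffD1, rotated]) (simp add: nschur_symmetric[OF _ s(1) u(2)])
    qed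
    then show ?case using \<eta> by blast
  qed
  have SL: "\<forall>\<^sub>F N in sequentially. continuous_on (polydisc R d) (L N) \<and>
     (\<forall>J s u. s permutes {1..N} \<longrightarrow> s ` {1..R} = J \<longrightarrow> u \<in> pdj J (3 * \<delta>) \<longrightarrow> exp (L N (u \<circ> s)) = S N u)"
    using ev
  proof eventually_elim
    case (elim N)
    have "exp (L N (u \<circ> s)) = S N u" if s: "s permutes {1..N}" "s ` {1..R} = J" "u \<in> pdj J (3 * \<delta>)" for J s u
    proof -
      have "exp (L N (u \<circ> s)) = S N (u \<circ> s)" using elim to_pd[OF s] by (simp add: sgf_eq_gf)
      also have "\<dots> = S N u" by (rule gf_symmetric[OF s(1) pdj_nzset[OF \<delta>(5) s(3)]])
      finally show ?thesis .
    qed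
    then show ?case using elim by blast
  qed
  have nz: "unif_ev R \<delta> (\<lambda>N J u. S N u \<noteq> 0)"
    unfolding unif_ev_def using SL
  proof eventually_elim
    case (elim N)
    show ?case
    proof (intro allI impI ballI)
      fix J u assume J: "J \<subseteq> {1..N}" "card J = R" and u: "u \<in> pdj J \<delta>"
      obtain s where s: "s permutes {1..N}" "s ` {1..R} = J" using exists_permutation_onto[OF J] by blast
      have "u \<in> pdj J (3 * \<delta>)" using u pdj_mono[of \<delta> "3 * \<delta>"] \<delta>(1) by auto
      then have "exp (L N (u \<circ> s)) = S N u" using elim s by blast
      then show "S N u \<noteq> 0" by (metis exp_not_eq_zero)
    qed
  qed
  have main: "unif_ev R (\<delta> / 2) (\<lambda>N J u. \<forall>i\<in>J. norm (pd i (S N) u / (of_nat N * S N u) - deriv \<Psi> (u i)) < \<epsilon>)" if \<epsilon>: "\<epsilon> > 0" for \<epsilon>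
  proof -
    \<comment> \<open>Cauchy's inequality on discs of radius \<delta> / 4 multiplies the error by 4
      / \<delta>, which leaves \<epsilon> / 2.\<close>
    define \<epsilon>' where "\<epsilon>' = \<epsilon> * \<delta> / 8"
    have \<epsilon>': "\<epsilon>' > 0" using \<epsilon> \<delta> by (simp add: \<epsilon>'_def)
    from lim[rule_format, OF \<epsilon>'] SL ac eventually_ge_at_top[of 1] show ?thesis
      unfolding unif_ev_def absconv_ev_def
    proof eventually_elim
      case (elim N)
      show ?case
      proof (intro allI impI ballI)
        fix J u i assume J: "J \<subseteq> {1..N}" "card J = R" and u: "u \<in> pdj J (\<delta> / 2)" and i: "i \<in> J"
        obtain s where s: "s permutes {1..N}" "s ` {1..R} = J" using exists_permutation_onto[OF J] by blast
        obtain \<eta> where \<eta>: "0 < \<eta>" "\<eta> < 1" "absconv N (pmf (\<rho> N)) (dvec J \<delta> \<eta>)" using elim(3) J by blast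
        obtain t0 where t0: "t0 \<in> {1..R}" "s t0 = i" using s(2) i by blast
        let ?T = "ball (1::complex) \<delta>"
        have uz: "u(i := z) \<in> pdj J \<delta>" if "z \<in> ?T" for z
          using u i that \<delta>(1) unfolding pdj_def by (auto simp: dist_norm norm_minus_commute intro: less_trans[of _ "\<delta> / 2"])
        have uz3: "u(i := z) \<in> pdj J (3 * \<delta>)" if "z \<in> ?T" for z
          using uz[OF that] pdj_mono[of \<delta> "3 * \<delta>"] \<delta>(1) by auto
        define g where "g = (\<lambda>z. S N (u(i := z)))"
        define lg where "lg = (\<lambda>z. L N (u(i := z) \<circ> s))"
        have g: "g holomorphic_on ?T"
        proof -
          have "(\<lambda>z. S N (u(i := z))) holomorphic_on {z. u(i := z) \<in> pbox N (dvec J \<delta> \<eta>)}"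
            by (rule sephol_holomorphic_slice[OF absconv_sephol[OF \<eta>(3)]]) (use dvec_bounds \<delta> \<eta> in blast)
          moreover have "?T \<subseteq> {z. u(i := z) \<in> pbox N (dvec J \<delta> \<eta>)}" using pdj_pbox[OF J(1) \<eta>(1) uz] by blast
          ultimately show ?thesis unfolding g_def by (rule holomorphic_on_subset)
        qed
        have lgc: "continuous_on ?T lg"
        proof -
          have c1: "continuous_on ?T (\<lambda>z. u(i := z) \<circ> s)"
          proof (rule continuous_on_coordinatewise_then_product)
            fix j show "continuous_on ?T (\<lambda>z. (u(i := z) \<circ> s) j)" by (cases "s j = i") auto
          qed
          have c2: "continuous_on (polydisc R d) (L N)" using elim by blast
          show ?thesis unfolding lg_def
            by (rule continuous_on_compose2[OF c2 c1]) (use to_pd[OF s uz3] in blast)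
        qed
        have lgg: "exp (lg z) = g z" if "z \<in> ?T" for z
          unfolding lg_def g_def using elim(2) s uz3[OF that] by blast
        have dlg: "(lg has_field_derivative (deriv g z / g z)) (at z)" if "z \<in> ?T" for z
          by (rule continuous_log_deriv[OF open_ball g lgc lgg that])
        define c where "c = (\<Sum>t\<in>{1..R}-{t0}. \<Psi> (u (s t)))"
        define f where "f = (\<lambda>z. lg z / of_nat N - (\<Psi> z + c))"
        have f_eq: "f z = L N (u(i := z) \<circ> s) / of_nat N - (\<Sum>t=1..R. \<Psi> ((u(i := z) \<circ> s) t))" for z
        proof -
          have "(\<Sum>t=1..R. \<Psi> ((u(i := z) \<circ> s) t)) = \<Psi> ((u(i := z) \<circ> s) t0) + (\<Sum>t\<in>{1..R}-{t0}. \<Psi> ((u(i := z) \<circ> s) t))"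
            by (rule sum.remove) (use t0 in auto)
          also have "(\<Sum>t\<in>{1..R}-{t0}. \<Psi> ((u(i := z) \<circ> s) t)) = c"
            unfolding c_def
          proof (intro sum.cong refl)
            fix t assume "t \<in> {1..R} - {t0}"
            then have "s t \<noteq> i" using t0 permutes_inj[OF s(1)] by (auto dest: injD)
            then show "\<Psi> ((u(i := z) \<circ> s) t) = \<Psi> (u (s t))" by simp
          qed
          finally show ?thesis using t0 by (simp add: f_def lg_def)
        qed
        have d\<Psi>: "(\<Psi> has_field_derivative deriv \<Psi> z) (at z)" if "z \<in> ?T" for z
          using hol\<Psi> that \<delta>(1) by (intro holomorphic_derivI[of _ "ball 1 (3 * \<delta>)"]) auto
        have df: "(f has_field_derivative (deriv g z / g z / of_nat N - deriv \<Psi> z)) (at z)" if "z \<in> ?T" for z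
          unfolding f_def using dlg[OF that] d\<Psi>[OF that] elim(4) by (auto intro!: derivative_eq_intros)
        then have fh: "f holomorphic_on ?T" using holomorphic_on_open open_ball by blast
        have ui: "norm (u i - 1) < \<delta> / 2" using u i by (simp add: pdj_def)
        have cb: "cball (u i) (\<delta> / 4) \<subseteq> ?T"
        proof
          fix z assume "z \<in> cball (u i) (\<delta> / 4)"
          then have "norm (z - u i) \<le> \<delta> / 4" by (simp add: dist_norm norm_minus_commute)
          then have "norm (z - 1) < \<delta>" using norm_triangle_ineq[of "z - u i" "u i - 1"] ui \<delta>(1) by simp
          then show "z \<in> ?T" by (simp add: dist_norm norm_minus_commute)
        qed
        have "norm ((deriv ^^ 1) f (u i)) \<le> fact 1 * \<epsilon>' / (\<delta> / 4) ^ 1"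
        proof (rule Cauchy_inequality_cball[OF fh cb])
          fix z assume "z \<in> cball (u i) (\<delta> / 4)"
          then have "z \<in> ?T" using cb by blast
          then show "norm (f z) \<le> \<epsilon>'" unfolding f_eq using elim(1) to_pd[OF s uz3] by (meson less_imp_le)
        qed (use \<delta> in auto)
        also have "\<dots> < \<epsilon>" using \<delta> \<epsilon> by (simp add: \<epsilon>'_def)
        finally have "norm (deriv f (u i)) < \<epsilon>" by simp
        moreover have "u i \<in> ?T" using ui \<delta>(1) by (simp add: dist_norm norm_minus_commute)
        moreover have "deriv g (u i) = pd i (S N) u" "g (u i) = S N u" by (simp_all add: g_def pd_def)
        ultimately show "norm (pd i (S N) u / (of_nat N * S N u) - deriv \<Psi> (u i)) < \<epsilon>"
          using DERIV_imp_deriv[OF df[of "u i"]] by (simp add: mult.commute)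
      qed
    qed
  qed
  show ?thesis
  proof (rule that[of "\<delta> / 2"])
    show "\<Psi> holomorphic_on ball 1 (3 * (\<delta> / 2))" using hol\<Psi> \<delta>(1) by (elim holomorphic_on_subset) (intro subset_ball, simp)
    show "absconv_ev (\<lambda>N. pmf (\<rho> N)) R (\<delta> / 2)" by (rule absconv_ev_mono[OF ac]) (use \<delta> in auto)
    show "unif_ev R (\<delta> / 2) (\<lambda>N J u. S N u \<noteq> 0)" by (rule unif_ev_mono[OF nz]) (use \<delta> in auto)
  qed (use \<delta> main in auto)
qed

end

section \<open>Asymptotics of derivatives\<close>

text \<open>Tychonoff's theorem, in the form in which it supplies the compact set over which a
  continuity estimate becomes uniform.\<close>

lemma compact_product_fun:
  fixes C :: "nat \<Rightarrow> complex set"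
  assumes "\<And>a. compact (C a)"
  shows "compact {x. \<forall>a. x a \<in> C a}"
proof -
  have "compactin (product_topology (\<lambda>_::nat. euclidean) UNIV) (Pi\<^sub>E UNIV C)"
    using assms by (simp add: compactin_PiE)
  moreover have "Pi\<^sub>E UNIV C = {x. \<forall>a. x a \<in> C a}" by (auto simp: PiE_def)
  ultimately show ?thesis by (simp add: euclidean_product_topology)
qed

context schur_lln begin

text \<open>The induction invariant: starting from the weights \<open>\<rho> N\<close>, multiplying by a normalised
  factorial moment of \<open>\<lambda>\<^sub>i + N - i\<close> multiplies the limit \<open>c\<close> by a constant. Using it once gives
  the limits of means, using it twice those of second moments.\<close>
definition good :: "(nat \<Rightarrow> (nat \<Rightarrow> int) \<Rightarrow> real) \<Rightarrow> complex \<Rightarrow> bool" where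
  "good w c \<longleftrightarrow> (\<forall>R\<ge>1. \<exists>\<delta>. 0 < \<delta> \<and> \<delta> < 1 \<and> absconv_ev w R \<delta> \<and>
     (\<forall>\<epsilon>>0. unif_ev R \<delta> (\<lambda>N J u. norm (gf N (w N) u / S N u - c) < \<epsilon>)))"

text \<open>Here t stands for a value of \<Psi>', p for its approximation at finite N, and Q0, Q1
  for the normalised derivatives of orders n and n + 1. The error splits into that of Q0 times p,
  that of p, and a term of order 1 / N.\<close>

lemma ratio_step:
  fixes Q0 Q1 p t c d :: complex
  assumes "Q1 = d / of_nat N + Q0 * p" "norm (Q0 - c * t ^ n) < e1" "norm (p - t) < e2" "e2 \<le> 1"
    "norm t \<le> K" "norm d \<le> B" "N \<ge> 1"
  shows "norm (Q1 - c * t ^ Suc n) \<le> B / N + e1 * (K + 1) + norm c * K ^ n * e2"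
proof -
  have "Q1 - c * t ^ Suc n = d / of_nat N + ((Q0 - c * t ^ n) * p + c * t ^ n * (p - t))"
    using assms(1) by (simp add: algebra_simps)
  also have "norm \<dots> \<le> norm (d / of_nat N) + (norm ((Q0 - c * t ^ n) * p) + norm (c * t ^ n * (p - t)))"
    by (intro norm_triangle_le add_mono order_refl norm_triangle_ineq)
  also have "\<dots> \<le> B / N + (e1 * (K + 1) + norm c * K ^ n * e2)"
  proof (intro add_mono)
    show "norm (d / of_nat N) \<le> B / N" using assms by (simp add: norm_divide divide_right_mono)
    have "norm p \<le> norm t + norm (p - t)" using norm_triangle_ineq[of t "p - t"] by simp
    then have "norm p \<le> K + 1" using assms by linarith
    then show "norm ((Q0 - c * t ^ n) * p) \<le> e1 * (K + 1)"
      unfolding norm_mult using assms(2) order_trans[OF norm_ge_zero less_imp_le[OF assms(2)]] by (intro mult_mono) auto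
    show "norm (c * t ^ n * (p - t)) \<le> norm c * K ^ n * e2"
      unfolding norm_mult norm_power using assms order_trans[OF norm_ge_zero assms(5)]
      by (intro mult_mono power_mono) auto
  qed
  finally show ?thesis by simp
qed

text \<open>The quotient rule for g / (a h), solved for g'.\<close>

lemma quotient_derivative_identity:
  fixes N a h g' g h' :: complex
  assumes "N \<noteq> 0" "a \<noteq> 0" "h \<noteq> 0"
  shows "g' / (N * a * h) = (g' * (a * h) - g * (a * h')) / ((a * h) * (a * h)) / N + g / (a * h) * (h' / (N * h))"
  using assms by (simp add: field_simps)

text \<open>D is the derivative in variable i of the ratio of order n, bounded by Cauchy's
  inequality on a disc of radius d / 4. Hence, up to order 1 / N, one more derivative multiplies the
  ratio by \<open>pd i S / (N S)\<close>.\<close>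

lemma ratio_derivative:
  assumes J: "J \<subseteq> {1..N}" and b: "0 < \<delta>0" "\<delta>0 < 1" "0 < \<eta>" "\<eta> < 1"
    and w: "absconv N w (dvec J \<delta>0 \<eta>)" and sw: "absconv N (pmf (\<rho> N)) (dvec J \<delta>0 \<eta>)"
    and nz: "\<forall>u\<in>pdj J \<delta>0. S N u \<noteq> 0" and d: "0 < d" "d \<le> \<delta>0"
    and bd: "\<forall>u\<in>pdj J d. norm ((pd i ^^ n) (gf N w) u / (of_nat N ^ n * S N u)) \<le> B"
    and i: "i \<in> J" and u: "u \<in> pdj J (d / 2)" and N: "N \<ge> 1"
  shows "\<exists>D. norm D \<le> B / (d / 4) \<and> (pd i ^^ Suc n) (gf N w) u / (of_nat N ^ Suc n * S N u) =
     D / of_nat N + (pd i ^^ n) (gf N w) u / (of_nat N ^ n * S N u) * (pd i (S N) u / (of_nat N * S N u))"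
proof -
  let ?T = "ball (1::complex) d"
  let ?box = "pbox N (dvec J \<delta>0 \<eta>)"
  have uz: "u(i := z) \<in> pdj J d" if "z \<in> ?T" for z
    using u i that d(1) unfolding pdj_def by (auto simp: dist_norm norm_minus_commute intro: less_trans[of _ "d / 2"])
  have uz0: "u(i := z) \<in> pdj J \<delta>0" if "z \<in> ?T" for z
    using uz[OF that] pdj_mono[OF d(2)] by blast
  have Tb: "?T \<subseteq> {z. u(i := z) \<in> ?box}" using pdj_pbox[OF J b(3) uz0] by blast
  have dv: "0 < dvec J \<delta>0 \<eta> a \<and> dvec J \<delta>0 \<eta> a < 1" for a by (rule dvec_bounds[OF b])
  define g where "g = (\<lambda>z. (pd i ^^ n) (gf N w) (u(i := z)))"
  define h where "h = (\<lambda>z. S N (u(i := z)))"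
  have g: "g holomorphic_on ?T" unfolding g_def
    using sephol_holomorphic_slice[OF sephol_pd_funpow[OF open_pbox absconv_sephol[OF w dv]]] Tb by (rule holomorphic_on_subset)
  have h: "h holomorphic_on ?T" unfolding h_def
    using sephol_holomorphic_slice[OF absconv_sephol[OF sw dv]] Tb by (rule holomorphic_on_subset)
  have hn: "h z \<noteq> 0" if "z \<in> ?T" for z using nz uz0[OF that] by (simp add: h_def)
  have ui: "norm (u i - 1) < d / 2" using u i by (simp add: pdj_def)
  have uiT: "u i \<in> ?T" using ui d(1) by (simp add: dist_norm norm_minus_commute)
  have cb: "cball (u i) (d / 4) \<subseteq> ?T"
  proof
    fix z assume "z \<in> cball (u i) (d / 4)"
    then have "norm (z - u i) \<le> d / 4" by (simp add: dist_norm norm_minus_commute)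
    then have "norm (z - 1) < d" using norm_triangle_ineq[of "z - u i" "u i - 1"] ui d(1) by simp
    then show "z \<in> ?T" by (simp add: dist_norm norm_minus_commute)
  qed
  let ?f = "\<lambda>z. g z / (of_nat N ^ n * h z)"
  have f: "?f holomorphic_on ?T" using g h hn N by (intro holomorphic_intros) auto
  have "norm ((deriv ^^ 1) ?f (u i)) \<le> fact 1 * B / (d / 4) ^ 1"
  proof (rule Cauchy_inequality_cball[OF f cb])
    show "norm (?f z) \<le> B" if "z \<in> cball (u i) (d / 4)" for z
    proof -
      have "u(i := z) \<in> pdj J d" using that cb uz by blast
      then show ?thesis using bd unfolding g_def h_def by blast
    qed
  qed (use d in auto)
  then have D: "norm (deriv ?f (u i)) \<le> B / (d / 4)" by simp
  have dg: "(g has_field_derivative deriv g (u i)) (at (u i))" using g uiT by (intro holomorphic_derivI[of _ ?T]) auto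
  have dh: "(h has_field_derivative deriv h (u i)) (at (u i))" using h uiT by (intro holomorphic_derivI[of _ ?T]) auto
  have gv: "g (u i) = (pd i ^^ n) (gf N w) u" "h (u i) = S N u" by (simp_all add: g_def h_def)
  have gd: "deriv g (u i) = (pd i ^^ Suc n) (gf N w) u" "deriv h (u i) = pd i (S N) u"
    by (simp_all add: g_def h_def pd_def[of i "(pd i ^^ n) (gf N w)"] pd_def[of i "S N"])
  have Nn: "(of_nat N :: complex) \<noteq> 0" using N by simp
  have "(?f has_field_derivative (deriv g (u i) * (of_nat N ^ n * h (u i)) - g (u i) * (of_nat N ^ n * deriv h (u i))) / ((of_nat N ^ n * h (u i)) * (of_nat N ^ n * h (u i)))) (at (u i))"
    using hn[OF uiT] Nn by (intro DERIV_divide dg DERIV_cmult dh) auto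
  then have "deriv ?f (u i) = (deriv g (u i) * (of_nat N ^ n * h (u i)) - g (u i) * (of_nat N ^ n * deriv h (u i))) / ((of_nat N ^ n * h (u i)) * (of_nat N ^ n * h (u i)))"
    by (rule DERIV_imp_deriv)
  then have "deriv g (u i) / (of_nat N ^ Suc n * h (u i)) = deriv ?f (u i) / of_nat N + g (u i) / (of_nat N ^ n * h (u i)) * (deriv h (u i) / (of_nat N * h (u i)))"
    using quotient_derivative_identity[of "of_nat N" "of_nat N ^ n" "h (u i)" "deriv g (u i)" "g (u i)" "deriv h (u i)"] hn[OF uiT] Nn
    by simp
  then show ?thesis using D unfolding gv gd by blast
qed

text \<open>Induction on the order. Each Cauchy estimate costs half of the radius, so the orders up
  to k share the radius \<open>\<delta>0 / 2 ^ k\<close>.\<close>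

lemma good_derivatives:
  assumes good: "good w c" and R: "R \<ge> 1"
  obtains \<delta> where "0 < \<delta>" "\<delta> < 1" "\<Psi> holomorphic_on ball 1 (3 * \<delta>)" "absconv_ev w R \<delta>" "absconv_ev (\<lambda>N. pmf (\<rho> N)) R \<delta>"
    "unif_ev R \<delta> (\<lambda>N J u. S N u \<noteq> 0)"
    "\<And>n \<epsilon>. n \<le> k \<Longrightarrow> \<epsilon> > 0 \<Longrightarrow> unif_ev R \<delta> (\<lambda>N J u. \<forall>i\<in>J. norm ((pd i ^^ n) (gf N (w N)) u / (of_nat N ^ n * S N u) - c * deriv \<Psi> (u i) ^ n) < \<epsilon>)"
proof -
  obtain \<delta>1 where \<delta>1: "0 < \<delta>1" "\<delta>1 < 1" "absconv_ev w R \<delta>1"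
     "\<forall>\<epsilon>>0. unif_ev R \<delta>1 (\<lambda>N J u. norm (gf N (w N) u / S N u - c) < \<epsilon>)"
  proof -
    have "\<exists>\<delta>. 0 < \<delta> \<and> \<delta> < 1 \<and> absconv_ev w R \<delta> \<and>
       (\<forall>\<epsilon>>0. unif_ev R \<delta> (\<lambda>N J u. norm (gf N (w N) u / S N u - c) < \<epsilon>))"
      using good R unfolding good_def by blast
    then show ?thesis using that by (elim exE conjE)
  qed
  show ?thesis
  proof (rule S_ratio_tendsto[OF R])
    fix \<delta>2 assume \<delta>2: "0 < \<delta>2" "\<delta>2 < 1" "\<Psi> holomorphic_on ball 1 (3 * \<delta>2)" "absconv_ev (\<lambda>N. pmf (\<rho> N)) R \<delta>2"
      "unif_ev R \<delta>2 (\<lambda>N J u. S N u \<noteq> 0)"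
      and lim2: "\<And>\<epsilon>. \<epsilon> > 0 \<Longrightarrow> unif_ev R \<delta>2 (\<lambda>N J u. \<forall>i\<in>J. norm (pd i (S N) u / (of_nat N * S N u) - deriv \<Psi> (u i)) < \<epsilon>)"
    define \<delta>0 where "\<delta>0 = min \<delta>1 \<delta>2"
    have \<delta>0: "0 < \<delta>0" "\<delta>0 < 1" "\<delta>0 \<le> \<delta>1" "\<delta>0 \<le> \<delta>2" using \<delta>1 \<delta>2 by (auto simp: \<delta>0_def)
    have acw: "absconv_ev w R \<delta>0" by (rule absconv_ev_mono[OF \<delta>1(3)]) (use \<delta>0 \<delta>1 in auto)
    have acs: "absconv_ev (\<lambda>N. pmf (\<rho> N)) R \<delta>0" by (rule absconv_ev_mono[OF \<delta>2(4)]) (use \<delta>0 \<delta>2 in auto)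
    have nz: "unif_ev R \<delta>0 (\<lambda>N J u. S N u \<noteq> 0)" by (rule unif_ev_mono[OF \<delta>2(5)]) (use \<delta>0 in auto)
    have lim0: "unif_ev R \<delta>0 (\<lambda>N J u. \<forall>i\<in>J. norm (pd i (S N) u / (of_nat N * S N u) - deriv \<Psi> (u i)) < \<epsilon>)" if "\<epsilon> > 0" for \<epsilon>
      by (rule unif_ev_mono[OF lim2[OF that]]) (use \<delta>0 in auto)
    have hol: "\<Psi> holomorphic_on ball 1 (3 * \<delta>0)"
      by (rule holomorphic_on_subset[OF \<delta>2(3)]) (use \<delta>0 in \<open>intro subset_ball, simp\<close>)
    have "continuous_on (cball 1 \<delta>0) (deriv \<Psi>)"
      by (rule holomorphic_on_imp_continuous_on[OF holomorphic_on_subset[OF holomorphic_deriv[OF hol open_ball]]]) (use \<delta>0 in auto)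
    then have "bounded (deriv \<Psi> ` cball 1 \<delta>0)" using compact_continuous_image compact_imp_bounded compact_cball by blast
    then obtain K where K: "K > 0" "\<And>z. z \<in> cball 1 \<delta>0 \<Longrightarrow> norm (deriv \<Psi> z) \<le> K" unfolding bounded_pos by auto
    have Ku: "norm (deriv \<Psi> (u i)) \<le> K" if "u \<in> pdj J \<delta>0" "i \<in> J" for u J i
      using that by (intro K(2)) (auto simp: pdj_def dist_norm norm_minus_commute less_imp_le)
    have main: "unif_ev R (\<delta>0 / 2 ^ n) (\<lambda>N J u. \<forall>i\<in>J. norm ((pd i ^^ n) (gf N (w N)) u / (of_nat N ^ n * S N u) - c * deriv \<Psi> (u i) ^ n) < \<epsilon>)"
      if "\<epsilon> > 0" for n \<epsilon>
      using that
    proof (induction n arbitrary: \<epsilon>)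
      case 0
      have "unif_ev R \<delta>0 (\<lambda>N J u. norm (gf N (w N) u / S N u - c) < \<epsilon>)"
        by (rule unif_ev_mono[of R \<delta>1]) (use \<delta>1 0 \<delta>0 in auto)
      then show ?case unfolding unif_ev_def by (auto elim!: eventually_mono)
    next
      case (Suc n)
      define d where "d = \<delta>0 / 2 ^ n"
      have d: "0 < d" "d \<le> \<delta>0" "\<delta>0 / 2 ^ Suc n = d / 2" using \<delta>0 by (auto simp: d_def divide_le_eq)
      define B where "B = norm c * K ^ n + 1"
      have B: "B > 0" using K by (auto simp: B_def intro: add_nonneg_pos)
      define e1 where "e1 = min 1 (\<epsilon> / (4 * (K + 1)))"
      define e2 where "e2 = min 1 (\<epsilon> / (4 * B))"
      have e1: "0 < e1" "e1 \<le> 1" "e1 * (K + 1) \<le> \<epsilon> / 4"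
      proof -
        have "e1 * (K + 1) \<le> \<epsilon> / (4 * (K + 1)) * (K + 1)" unfolding e1_def using K by (intro mult_right_mono) auto
        also have "\<dots> = \<epsilon> / 4" using K by (simp add: field_simps)
        finally show "e1 * (K + 1) \<le> \<epsilon> / 4" .
      qed (use Suc.prems K in \<open>auto simp: e1_def\<close>)
      have e2: "0 < e2" "e2 \<le> 1" "norm c * K ^ n * e2 \<le> \<epsilon> / 4"
      proof -
        have "norm c * K ^ n * e2 \<le> B * (\<epsilon> / (4 * B))" unfolding e2_def using K B Suc.prems by (intro mult_mono) (auto simp: B_def)
        also have "\<dots> = \<epsilon> / 4" using B by simp
        finally show "norm c * K ^ n * e2 \<le> \<epsilon> / 4" .
      qed (use Suc.prems B in \<open>auto simp: e2_def\<close>)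
      have "(\<lambda>N. B / (d / 4) / real N) \<longlonglongrightarrow> 0" by real_asymp
      then have evN: "\<forall>\<^sub>F N in sequentially. B / (d / 4) / real N < \<epsilon> / 4" by (rule order_tendstoD(2)) (use Suc.prems in simp)
      from Suc.IH[OF e1(1)] lim0[OF e2(1)] nz acw acs evN eventually_ge_at_top[of 1] show ?case
        unfolding unif_ev_def absconv_ev_def d(3) d_def[symmetric]
      proof eventually_elim
        case (elim N)
        show ?case
        proof (intro allI impI ballI)
          fix J u i assume J: "J \<subseteq> {1..N}" "card J = R" and u: "u \<in> pdj J (d / 2)" and i: "i \<in> J"
          obtain \<eta>1 where \<eta>1: "0 < \<eta>1" "\<eta>1 < 1" "absconv N (w N) (dvec J \<delta>0 \<eta>1)" using elim(4) J by blast
          obtain \<eta>2 where \<eta>2: "0 < \<eta>2" "\<eta>2 < 1" "absconv N (pmf (\<rho> N)) (dvec J \<delta>0 \<eta>2)" using elim(5) J by blast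
          define \<eta> where "\<eta> = min \<eta>1 \<eta>2"
          have \<eta>: "0 < \<eta>" "\<eta> < 1" using \<eta>1 \<eta>2 by (auto simp: \<eta>_def)
          have w: "absconv N (w N) (dvec J \<delta>0 \<eta>)"
            by (rule absconv_mono[OF \<eta>1(3)]) (use \<delta>0 \<eta>1 \<eta>2 in \<open>auto simp: dvec_def \<eta>_def\<close>)
          have sw: "absconv N (pmf (\<rho> N)) (dvec J \<delta>0 \<eta>)"
            by (rule absconv_mono[OF \<eta>2(3)]) (use \<delta>0 \<eta>1 \<eta>2 in \<open>auto simp: dvec_def \<eta>_def\<close>)
          have ud: "u \<in> pdj J d" using u pdj_mono[of "d / 2" d] d by auto
          have ud0: "u \<in> pdj J \<delta>0" using ud pdj_mono[OF d(2)] by blast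
          have bd: "\<forall>v\<in>pdj J d. norm ((pd i ^^ n) (gf N (w N)) v / (of_nat N ^ n * S N v)) \<le> B"
          proof
            fix v assume v: "v \<in> pdj J d"
            then have v0: "v \<in> pdj J \<delta>0" using pdj_mono[OF d(2)] by blast
            have "norm ((pd i ^^ n) (gf N (w N)) v / (of_nat N ^ n * S N v) - c * deriv \<Psi> (v i) ^ n) < e1"
              using elim(1) J v i by blast
            then have 1: "norm ((pd i ^^ n) (gf N (w N)) v / (of_nat N ^ n * S N v) - c * deriv \<Psi> (v i) ^ n) < 1"
              using e1(2) by linarith
            have 2: "norm (c * deriv \<Psi> (v i) ^ n) \<le> norm c * K ^ n"
              unfolding norm_mult norm_power using Ku[OF v0 i] by (intro mult_left_mono power_mono) auto
            show "norm ((pd i ^^ n) (gf N (w N)) v / (of_nat N ^ n * S N v)) \<le> B"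
              using 1 2 norm_triangle_ineq2[of "(pd i ^^ n) (gf N (w N)) v / (of_nat N ^ n * S N v)" "c * deriv \<Psi> (v i) ^ n"]
              unfolding B_def by linarith
          qed
          have nzJ: "\<forall>u\<in>pdj J \<delta>0. S N u \<noteq> 0" using elim(3) J by blast
          obtain D where D: "norm D \<le> B / (d / 4)" "(pd i ^^ Suc n) (gf N (w N)) u / (of_nat N ^ Suc n * S N u) =
             D / of_nat N + (pd i ^^ n) (gf N (w N)) u / (of_nat N ^ n * S N u) * (pd i (S N) u / (of_nat N * S N u))"
            using ratio_derivative[OF J(1) \<delta>0(1,2) \<eta> w sw nzJ d(1,2) bd i u elim(7)] by blast
          have "norm ((pd i ^^ Suc n) (gf N (w N)) u / (of_nat N ^ Suc n * S N u) - c * deriv \<Psi> (u i) ^ Suc n)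
             \<le> B / (d / 4) / real N + e1 * (K + 1) + norm c * K ^ n * e2"
          proof (rule ratio_step[OF D(2) _ _ e2(2) Ku[OF ud0 i] D(1) elim(7)])
            show "norm ((pd i ^^ n) (gf N (w N)) u / (of_nat N ^ n * S N u) - c * deriv \<Psi> (u i) ^ n) < e1"
              using elim(1) J ud i by blast
            show "norm (pd i (S N) u / (of_nat N * S N u) - deriv \<Psi> (u i)) < e2" using elim(2) J ud0 i by blast
          qed
          also have "\<dots> < \<epsilon>" using e1(3) e2(3) elim(6) Suc.prems by linarith
          finally show "norm ((pd i ^^ Suc n) (gf N (w N)) u / (of_nat N ^ Suc n * S N u) - c * deriv \<Psi> (u i) ^ Suc n) < \<epsilon>" .
        qed
      qed
    qed
    define \<delta> where "\<delta> = \<delta>0 / 2 ^ k"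
    have \<delta>: "0 < \<delta>" "\<delta> \<le> \<delta>0" using \<delta>0 by (auto simp: \<delta>_def divide_le_eq)
    show ?thesis
    proof (rule that[of \<delta>])
      show "0 < \<delta>" "\<delta> < 1" using \<delta> \<delta>0 by auto
      show "\<Psi> holomorphic_on ball 1 (3 * \<delta>)" by (rule holomorphic_on_subset[OF hol]) (use \<delta> in \<open>intro subset_ball, simp\<close>)
      show "absconv_ev w R \<delta>" by (rule absconv_ev_mono[OF acw \<delta> \<delta>0(2)])
      show "absconv_ev (\<lambda>N. pmf (\<rho> N)) R \<delta>" by (rule absconv_ev_mono[OF acs \<delta> \<delta>0(2)])
      show "unif_ev R \<delta> (\<lambda>N J u. S N u \<noteq> 0)" by (rule unif_ev_mono[OF nz \<delta>(2)])
      fix n \<epsilon> assume "n \<le> k" "(\<epsilon>::real) > 0"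
      have "\<delta> \<le> \<delta>0 / 2 ^ n" unfolding \<delta>_def using \<delta>0 \<open>n \<le> k\<close> by (intro divide_left_mono power_increasing) auto
      then show "unif_ev R \<delta> (\<lambda>N J u. \<forall>i\<in>J. norm ((pd i ^^ n) (gf N (w N)) u / (of_nat N ^ n * S N u) - c * deriv \<Psi> (u i) ^ n) < \<epsilon>)"
        by (rule unif_ev_mono[OF main[OF \<open>\<epsilon> > 0\<close>]])
    qed
  qed
qed

end

section \<open>Inserting a factorial moment\<close>

lemma pdj_superset:
  assumes "J0 \<subseteq> J" "0 < \<delta>"
  shows "pdj J0 \<delta> \<subseteq> pdj J \<delta>"
proof
  fix u assume u: "u \<in> pdj J0 \<delta>"
  have "norm (u i - 1) < \<delta>" for i using u assms(2) by (cases "i \<in> J0") (auto simp: pdj_def)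
  then show "u \<in> pdj J \<delta>" using u assms(1) by (auto simp: pdj_def)
qed

lemma card_subsets_le: "card {I. I \<subseteq> {1..N} \<and> card I = m} \<le> N ^ m"
proof -
  have "card {I. I \<subseteq> {1..N} \<and> card I = m} = N choose m" by (simp add: n_subsets)
  also have "\<dots> \<le> N ^ m" by (cases "m \<le> N") (auto simp: binomial_le_pow binomial_eq_0)
  finally show ?thesis .
qed

text \<open>Choose the common element with J0 first, then the m others.\<close>

lemma card_subsets_meeting_le:
  assumes J0: "J0 \<subseteq> {1..N}"
  shows "card {I. I \<subseteq> {1..N} \<and> card I = Suc m \<and> I \<inter> J0 \<noteq> {}} \<le> card J0 * N ^ m"
proof -
  let ?A = "{I. I \<subseteq> {1..N} \<and> card I = m}"
  have fin: "finite ?A" by (rule finite_subset[of _ "Pow {1..N}"]) auto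
  have fJ: "finite J0" using J0 finite_subset by blast
  have "{I. I \<subseteq> {1..N} \<and> card I = Suc m \<and> I \<inter> J0 \<noteq> {}} \<subseteq> (\<Union>j\<in>J0. insert j ` ?A)"
  proof
    fix I assume "I \<in> {I. I \<subseteq> {1..N} \<and> card I = Suc m \<and> I \<inter> J0 \<noteq> {}}"
    then obtain j where j: "j \<in> J0" "j \<in> I" "I \<subseteq> {1..N}" "card I = Suc m" by blast
    have "finite I" using j finite_subset by blast
    then have "I - {j} \<in> ?A" using j by auto
    moreover have "I = insert j (I - {j})" using j by auto
    ultimately show "I \<in> (\<Union>j\<in>J0. insert j ` ?A)" using j(1) by blast
  qed
  then have "card {I. I \<subseteq> {1..N} \<and> card I = Suc m \<and> I \<inter> J0 \<noteq> {}} \<le> card (\<Union>j\<in>J0. insert j ` ?A)"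
    using fin fJ by (intro card_mono) auto
  also have "\<dots> \<le> (\<Sum>j\<in>J0. card (insert j ` ?A))" by (rule card_UN_le[OF fJ])
  also have "\<dots> \<le> (\<Sum>j\<in>J0. N ^ m)"
    by (intro sum_mono order_trans[OF card_image_le[OF fin] card_subsets_le])
  finally show ?thesis by simp
qed

lemma binomial_ratio_tendsto: "(\<lambda>N. real (N choose m) / real N ^ m) \<longlonglongrightarrow> 1 / fact m"
proof -
  have "(\<lambda>N. (\<Prod>i<m. (real N - real i) / real N) / fact m) \<longlonglongrightarrow> (\<Prod>i<m. 1) / fact m"
    by (intro tendsto_intros tendsto_prod) (real_asymp, simp)
  moreover have "(\<Prod>i<m. (real N - real i) / real N) / fact m = real (N choose m) / real N ^ m" for N
    by (simp add: binomial_gbinomial gbinomial_prod_rev prod_dividef atLeast0LessThan)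
  ultimately show ?thesis by simp
qed

lemma gf_scale: "gf N (\<lambda>l. w l / a) u = gf N w u / of_real a"
proof -
  have "gf N (\<lambda>l. w l / a) u = (\<Sum>\<^sub>\<infinity>l\<in>signatures N. (of_real (w l) * nschur N l u) * (1 / of_real a))"
    unfolding gf_def by (intro infsum_cong) simp
  also have "\<dots> = gf N w u * (1 / of_real a)" unfolding gf_def by (rule infsum_cmult_left')
  finally show ?thesis by simp
qed

lemma absconv_scale: "absconv N w d \<Longrightarrow> absconv N (\<lambda>l. w l / a) d"
  unfolding absconv_def
proof
  fix y assume "\<forall>y\<in>corners N d. (\<lambda>l. \<bar>w l\<bar> * norm (nschur N l (cvec y))) summable_on signatures N" "y \<in> corners N d"
  then have "(\<lambda>l. (\<bar>w l\<bar> * norm (nschur N l (cvec y))) * (1 / \<bar>a\<bar>)) summable_on signatures N"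
    by (intro summable_on_cmult_left) blast
  then show "(\<lambda>l. \<bar>w l / a\<bar> * norm (nschur N l (cvec y))) summable_on signatures N"
    by (simp add: abs_divide)
qed

context schur_lln begin

text \<open>The hypothesis \<open>close\<close> holds only where the variables outside J equal 1,
  which generic vectors violate. Continuity at u0, uniform while the variables in I run through full
  discs of radius 2 s, carries it over to vectors near u0; then \<open>ddiff_bound\<close> applies
  to the error.\<close>

lemma local_estimate:
  assumes J: "J \<subseteq> {1..N}" "J0 \<subseteq> J" "I \<subseteq> J" "card I = Suc m" and mk: "m \<le> k"
    and b: "0 < s" "4 * s < 1" "0 < \<eta>" "\<eta> < 1" and hol: "\<Psi> holomorphic_on ball 1 (4 * s)"
    and w: "absconv N w (dvec J (4 * s) \<eta>)" and sw: "absconv N (pmf (\<rho> N)) (dvec J (4 * s) \<eta>)"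
    and nz: "\<forall>u\<in>pdj J (4 * s). S N u \<noteq> 0" and N: "N \<ge> 1" and e: "0 < e" "e \<le> 1"
    and close: "\<forall>u\<in>pdj J (4 * s). \<forall>i\<in>J. norm ((pd i ^^ (k - m)) (gf N w) u / (of_nat N ^ (k - m) * S N u) - c * deriv \<Psi> (u i) ^ (k - m)) < e"
    and F: "\<And>z. z \<in> cball 1 (2 * s) \<Longrightarrow> norm (z ^ k * deriv \<Psi> z ^ (k - m)) \<le> F"
    and u0: "u0 \<in> pdj J0 s"
  obtains U where "open U" "u0 \<in> U"
    "\<And>u. u \<in> U \<Longrightarrow> u \<in> generic_pts N \<Longrightarrow>
       norm (ddiff I (\<lambda>i u. u i ^ k * (pd i ^^ (k - m)) (gf N w) u) u / of_nat N ^ (k - m)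
          - c * S N u0 * ddiff I (\<lambda>i u. u i ^ k * deriv \<Psi> (u i) ^ (k - m)) u)
       \<le> norm (S N u0) * (e * ((real m + 1) ^ Suc m / s ^ m * (4 * 2 ^ k + norm c * F)))"
    "\<And>u. u \<in> U \<Longrightarrow> u \<in> generic_pts N \<Longrightarrow>
       norm (ddiff I (\<lambda>i u. u i ^ k * deriv \<Psi> (u i) ^ (k - m)) u) \<le> (real m + 1) ^ Suc m * F / s ^ m"
proof -
  define n where "n = k - m"
  let ?box = "pbox N (dvec J (4 * s) \<eta>)"
  let ?r = "\<lambda>u::nat \<Rightarrow> complex. \<lambda>i. if i \<in> J then u i else 1"
  let ?T = "ball (1::complex) (4 * s)"
  have finJ: "finite J" "finite I" using J finite_subset by (blast, meson finite_atLeastAtMost finite_subset)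
  have s4: "0 < 4 * s" using b by simp
  have dv: "0 < dvec J (4 * s) \<eta> a \<and> dvec J (4 * s) \<eta> a < 1" for a by (rule dvec_bounds[OF s4 b(2-4)])
  have rbox: "?r u \<in> pdj J (4 * s)" if "u \<in> ?box" for u
    unfolding pdj_def
  proof (intro CollectI conjI ballI allI impI)
    fix i assume i: "i \<in> J"
    then have "i \<in> {1..N}" using J by blast
    then have "norm (u i - 1) < dvec J (4 * s) \<eta> i" using that by (simp add: pbox_def)
    then show "norm (?r u i - 1) < 4 * s" using i by (simp add: dvec_def)
  qed auto
  have rbox': "?r u \<in> ?box" if "u \<in> ?box" for u by (rule pdj_pbox[OF J(1) b(3) rbox[OF that]])
  have coordT: "u i \<in> ?T" if "u \<in> ?box" "i \<in> J" for u i
    using rbox[OF that(1)] that(2) by (simp add: pdj_def dist_norm norm_minus_commute)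
  have SJ: "sephol ?box (\<lambda>u. S N (?r u))" by (rule sephol_restrict_one[OF absconv_sephol[OF sw dv] rbox'])
  have SJn: "S N (?r u) \<noteq> 0" if "u \<in> ?box" for u using nz rbox[OF that] by blast
  have d\<Psi>: "deriv \<Psi> holomorphic_on ?T" by (rule holomorphic_deriv[OF hol open_ball])
  \<comment> \<open>S is taken with the coordinates outside J frozen at 1, where it is nonzero. This
    normalisation does not depend on i and can be pulled out of the divided difference.\<close>
  define f where "f = (\<lambda>i v. v i ^ k * ((pd i ^^ n) (gf N w) v / (of_nat N ^ n * S N (?r v)) - c * deriv \<Psi> (v i) ^ n))"
  have fh: "sephol ?box (f i)" if "i \<in> I" for i
    unfolding f_def
  proof (intro sephol_mult sephol_diff sephol_power sephol_coord sephol_const sephol_divide)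
    show "sephol ?box ((pd i ^^ n) (gf N w))" by (rule sephol_pd_funpow[OF open_pbox absconv_sephol[OF w dv]])
    show "sephol ?box (\<lambda>u. S N (?r u))" by (rule SJ)
    show "sephol ?box (\<lambda>u. deriv \<Psi> (u i))"
      by (rule sephol_comp[OF sephol_coord d\<Psi> open_ball]) (use coordT that J in blast)
    show "of_nat N ^ n * S N (?r u) \<noteq> 0" if "u \<in> ?box" for u using SJn[OF that] N by simp
  qed
  have fsym: "f i v = f j v" if "i \<in> I" "j \<in> I" "v \<in> ?box" "v i = v j" for i j v
  proof -
    have "i \<in> {1..N}" "j \<in> {1..N}" using that J by blast+
    then have "(pd i ^^ n) (gf N w) v = (pd j ^^ n) (gf N w) v" by (rule pd_gf_diagonal[OF w dv that(3) _ _ that(4)])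
    then show ?thesis using that(4) by (simp add: f_def)
  qed
  \<comment> \<open>\<open>ov u x\<close> takes the coordinates in I from x, which runs through the
    compact set K, and all others from u.\<close>
  define ov where "ov = (\<lambda>(u::nat \<Rightarrow> complex) (x::nat \<Rightarrow> complex) a. if a \<in> I then x a else u a)"
  define K where "K = {x. \<forall>a. x a \<in> (if a \<in> I then cball 1 (2 * s) else {1::complex})}"
  have "compact K" unfolding K_def by (rule compact_product_fun) auto
  have ovbox: "ov u x \<in> ?box" if "u \<in> ?box" "\<And>a. a \<in> I \<Longrightarrow> norm (x a - 1) \<le> 2 * s" for u x
    unfolding pbox_def
  proof (intro CollectI ballI)
    fix a assume a: "a \<in> {1..N}"
    show "norm (ov u x a - 1) < dvec J (4 * s) \<eta> a"
    proof (cases "a \<in> I")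
      case True
      then have "a \<in> J" using J by blast
      then show ?thesis using True that(2)[OF True] b(1) by (simp add: ov_def dvec_def)
    next
      case False
      then show ?thesis using that(1) a by (simp add: ov_def pbox_def)
    qed
  qed
  have u0J: "u0 \<in> pdj J s" using pdj_superset[OF J(2) b(1)] u0 by blast
  have u0b: "u0 \<in> ?box" by (rule pdj_pbox[OF J(1) b(3)]) (use u0J pdj_mono[of s "4 * s"] b in auto)
  have ru0: "?r u0 = u0" using u0J by (auto simp: pdj_def)
  have cont: "continuous_on (?box \<times> K) (\<lambda>p. f i (ov (fst p) (snd p)))" if "i \<in> I" for i
  proof (rule continuous_on_compose2[OF sephol_continuous[OF fh[OF that]]])
    show "continuous_on (?box \<times> K) (\<lambda>p. ov (fst p) (snd p))"
    proof (rule continuous_on_coordinatewise_then_product)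
      fix a
      have "continuous_on (?box \<times> K) (\<lambda>p. fst p a)" "continuous_on (?box \<times> K) (\<lambda>p. snd p a)"
        by (rule continuous_on_product_then_coordinatewise[OF continuous_on_fst[OF continuous_on_id]],
            rule continuous_on_product_then_coordinatewise[OF continuous_on_snd[OF continuous_on_id]])
      then show "continuous_on (?box \<times> K) (\<lambda>p. ov (fst p) (snd p) a)" by (cases "a \<in> I") (simp_all add: ov_def)
    qed
    have nK: "norm (x a - 1) \<le> 2 * s" if "x \<in> K" "a \<in> I" for x a
    proof -
      have "x a \<in> (if a \<in> I then cball 1 (2 * s) else {1})" using that(1) unfolding K_def by blast
      then have "x a \<in> cball 1 (2 * s)" using that(2) by simp
      then show ?thesis by (simp add: dist_norm norm_minus_commute)
    qed
    show "(\<lambda>p. ov (fst p) (snd p)) ` (?box \<times> K) \<subseteq> ?box" using ovbox nK by auto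
  qed
  have "\<exists>X. u0 \<in> X \<and> open X \<and> (\<forall>u\<in>X \<inter> ?box. \<forall>x\<in>K. dist (f i (ov u x)) (f i (ov u0 x)) \<le> e)" if "i \<in> I" for i
  proof (rule continuous_on_prod_compactE[OF cont[OF that] \<open>compact K\<close> u0b e(1)])
    fix X assume "u0 \<in> X" "open X"
      "\<forall>x\<in>X \<inter> ?box. \<forall>t\<in>K. dist (f i (ov (fst (x, t)) (snd (x, t)))) (f i (ov (fst (u0, t)) (snd (u0, t)))) \<le> e"
    then show ?thesis by (intro exI[of _ X]) simp
  qed
  then have "\<forall>i\<in>I. \<exists>X. u0 \<in> X \<and> open X \<and> (\<forall>u\<in>X \<inter> ?box. \<forall>x\<in>K. dist (f i (ov u x)) (f i (ov u0 x)) \<le> e)" by blast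
  from bchoice[OF this] obtain X where X': "\<forall>i\<in>I. u0 \<in> X i \<and> open (X i) \<and> (\<forall>u\<in>X i \<inter> ?box. \<forall>x\<in>K. dist (f i (ov u x)) (f i (ov u0 x)) \<le> e)"
    by (elim exE)
  have X: "u0 \<in> X i \<and> open (X i) \<and> (\<forall>u\<in>X i \<inter> ?box. \<forall>x\<in>K. dist (f i (ov u x)) (f i (ov u0 x)) \<le> e)" if "i \<in> I" for i
    using X' that by blast
  have S0: "S N u0 \<noteq> 0" using SJn[OF u0b] ru0 by simp
  \<comment> \<open>Three demands on u: f changes by at most e, S by at most the fraction e of its
    value, and the nodes in I stay within s of 1.\<close>
  define U where "U = (\<Inter>i\<in>I. X i) \<inter> (?box \<inter> (\<lambda>u. S N (?r u)) -` ball (S N u0) (e * norm (S N u0))) \<inter> (\<Inter>i\<in>I. {u. u i \<in> ball 1 s})"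
  have U: "open U" unfolding U_def
    by (intro open_Int open_INT finJ(2) ballI continuous_open_preimage[OF sephol_continuous[OF SJ] open_pbox open_ball] open_coordinate)
       (use X in auto)
  have u0U: "u0 \<in> U"
  proof -
    have "u0 i \<in> ball 1 s" if "i \<in> I" for i
    proof -
      have "i \<in> J" using that J by blast
      then show ?thesis using u0J by (simp add: pdj_def dist_norm norm_minus_commute)
    qed
    moreover have "S N (?r u0) \<in> ball (S N u0) (e * norm (S N u0))" unfolding ru0 using S0 e by simp
    ultimately show ?thesis unfolding U_def using X u0b by blast
  qed
  have inj: "inj_on u I" if "u \<in> generic_pts N" for u
  proof (rule inj_onI)
    fix i j assume "i \<in> I" "j \<in> I" "u i = u j"
    moreover have "i \<in> {1..N}" "j \<in> {1..N}" using \<open>i \<in> I\<close> \<open>j \<in> I\<close> J by blast+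
    ultimately show "i = j" using that unfolding generic_pts_def by blast
  qed
  have uI: "norm (u a - 1) < s" if "u \<in> U" "a \<in> I" for u a
    using that by (auto simp: U_def dist_norm norm_minus_commute)
  define Cm where "Cm = (real m + 1) ^ Suc m / s ^ m"
  have Cm: "Cm \<ge> 0" using b by (simp add: Cm_def)
  have cb: "cball (1::complex) (2 * s) \<subseteq> ?T" using b(1) by auto
  have D: "norm (ddiff I (\<lambda>i u. u i ^ k * deriv \<Psi> (u i) ^ n) u) \<le> (real m + 1) ^ Suc m * F / s ^ m"
    if u: "u \<in> U" "u \<in> generic_pts N" for u
    by (rule ddiff_one_variable_bound[OF finJ(2) J(4) b(1), where \<phi> = "\<lambda>z. z ^ k * deriv \<Psi> z ^ n" and T = ?T])
       (use d\<Psi> cb F uI[OF u(1)] inj[OF u(2)] in \<open>auto intro!: holomorphic_intros simp: n_def\<close>)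
  show ?thesis
  proof (rule that[OF U u0U])
    fix u assume u: "u \<in> U" "u \<in> generic_pts N"
    have ub: "u \<in> ?box" using u(1) by (simp add: U_def)
    \<comment> \<open>At u0 the closeness contributes \<open>2 ^ k * e\<close>, as coordinates have
      modulus at most 2; passing from u0 to u contributes another e.\<close>
    have fb: "norm (f i v) \<le> 2 * 2 ^ k * e" if v: "\<And>a. a \<in> I \<Longrightarrow> norm (v a - 1) \<le> 2 * s" "\<And>a. a \<notin> I \<Longrightarrow> v a = u a" and i: "i \<in> I" for v i
    proof -
      define x where "x = (\<lambda>a. if a \<in> I then v a else 1)"
      have xK: "x \<in> K" using v(1) by (auto simp: K_def x_def dist_norm norm_minus_commute)
      have ovu: "ov u x = v" using v(2) by (auto simp: ov_def x_def)
      have d1: "dist (f i (ov u x)) (f i (ov u0 x)) \<le> e" using X[OF i] u(1) ub xK i by (auto simp: U_def)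
      have v0: "ov u0 x \<in> pdj J (4 * s)" unfolding pdj_def
      proof (intro CollectI conjI ballI allI impI)
        fix a assume a: "a \<in> J"
        show "norm (ov u0 x a - 1) < 4 * s"
        proof (cases "a \<in> I")
          case True
          then show ?thesis using v(1)[OF True] b(1) by (simp add: ov_def x_def)
        next
          case False
          have "norm (u0 a - 1) < s" using u0J a by (simp add: pdj_def)
          then show ?thesis using False b(1) by (simp add: ov_def)
        qed
      next
        fix a assume a: "a \<notin> J"
        then have "a \<notin> I" using J by blast
        then show "ov u0 x a = 1" using u0J a by (simp add: ov_def pdj_def)
      qed
      then have r0: "?r (ov u0 x) = ov u0 x" by (auto simp: pdj_def)
      have iJ: "i \<in> J" using i J by blast
      have c1: "norm ((pd i ^^ n) (gf N w) (ov u0 x) / (of_nat N ^ n * S N (ov u0 x)) - c * deriv \<Psi> (ov u0 x i) ^ n) < e"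
        using close v0 iJ unfolding n_def by blast
      have "norm (ov u0 x i) \<le> 2"
      proof -
        have "norm (ov u0 x i - 1) < 4 * s" using v0 iJ by (simp add: pdj_def)
        then show ?thesis using norm_triangle_ineq[of "ov u0 x i - 1" 1] b(2) by simp
      qed
      then have "norm (f i (ov u0 x)) \<le> 2 ^ k * e"
        unfolding f_def r0 norm_mult norm_power using c1 by (intro mult_mono power_mono) auto
      moreover have "norm (f i v) \<le> norm (f i (ov u0 x)) + dist (f i (ov u x)) (f i (ov u0 x))"
        unfolding ovu dist_norm using norm_triangle_ineq[of "f i (ov u0 x)" "f i v - f i (ov u0 x)"] by simp
      moreover have "1 * e \<le> 2 ^ k * e" using e by (intro mult_right_mono) auto
      ultimately show ?thesis using d1 by linarith
    qed
    have "norm (ddiff I f u) \<le> (real m + 1) ^ Suc m * (2 * 2 ^ k * e) / s ^ m"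
    proof (rule ddiff_bound[OF finJ(2) J(4) open_pbox b(1) fh fsym])
      show "v \<in> ?box" if "\<And>a. a \<in> I \<Longrightarrow> norm (v a - 1) \<le> 2 * s" "\<And>a. a \<notin> I \<Longrightarrow> v a = u a" for v
      proof -
        have "ov u v = v" using that(2) by (auto simp: ov_def)
        then show ?thesis using ovbox[OF ub, of v] that(1) by simp
      qed
    qed (use fb uI[OF u(1)] inj[OF u(2)] in auto)
    then have df: "norm (ddiff I f u) \<le> Cm * (2 * 2 ^ k * e)" by (simp add: Cm_def)
    define SJu where "SJu = S N (?r u)"
    define X0 where "X0 = ddiff I (\<lambda>i u. u i ^ k * (pd i ^^ n) (gf N w) u) u"
    define D0 where "D0 = ddiff I (\<lambda>i u. u i ^ k * deriv \<Psi> (u i) ^ n) u"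
    have SJu: "SJu \<noteq> 0" using SJn[OF ub] by (simp add: SJu_def)
    have dS: "norm (SJu - S N u0) \<le> e * norm (S N u0)"
      using u(1) by (simp add: U_def SJu_def dist_norm norm_minus_commute)
    have "ddiff I f u = X0 / (of_nat N ^ n * SJu) - c * D0"
    proof -
      have "f i u / P = (u i ^ k * (pd i ^^ n) (gf N w) u / P) / (of_nat N ^ n * SJu) - c * (u i ^ k * deriv \<Psi> (u i) ^ n / P)" for i P
        unfolding f_def SJu_def[symmetric] by (simp add: diff_divide_distrib right_diff_distrib mult_ac)
      then show ?thesis unfolding ddiff_def X0_def D0_def by (simp add: sum_subtractf sum_divide_distrib sum_distrib_left)
    qed
    then have "X0 / of_nat N ^ n = SJu * (ddiff I f u + c * D0)" using SJu N by (simp add: field_simps)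
    then have "X0 / of_nat N ^ n - c * S N u0 * D0 = SJu * ddiff I f u + (SJu - S N u0) * (c * D0)"
      by (simp add: algebra_simps)
    then have "norm (X0 / of_nat N ^ n - c * S N u0 * D0) \<le> norm SJu * norm (ddiff I f u) + norm (SJu - S N u0) * (norm c * norm D0)"
      by (metis norm_mult norm_triangle_ineq)
    also have "\<dots> \<le> (2 * norm (S N u0)) * (Cm * (2 * 2 ^ k * e)) + (e * norm (S N u0)) * (norm c * (Cm * F))"
    proof (intro add_mono mult_mono order_refl norm_ge_zero)
      have "norm SJu \<le> norm (S N u0) + norm (SJu - S N u0)" using norm_triangle_ineq[of "S N u0" "SJu - S N u0"] by simp
      moreover have "e * norm (S N u0) \<le> 1 * norm (S N u0)" using e by (intro mult_right_mono) auto
      ultimately show "norm SJu \<le> 2 * norm (S N u0)" using dS by linarith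
      show "norm D0 \<le> Cm * F" using D[OF u] by (simp add: D0_def Cm_def)
    qed (use df dS e in auto)
    also have "\<dots> = norm (S N u0) * (e * (Cm * (4 * 2 ^ k + norm c * F)))" by (simp add: algebra_simps)
    finally show "norm (ddiff I (\<lambda>i u. u i ^ k * (pd i ^^ (k - m)) (gf N w) u) u / of_nat N ^ (k - m)
          - c * S N u0 * ddiff I (\<lambda>i u. u i ^ k * deriv \<Psi> (u i) ^ (k - m)) u)
       \<le> norm (S N u0) * (e * ((real m + 1) ^ Suc m / s ^ m * (4 * 2 ^ k + norm c * F)))"
      by (simp add: X0_def D0_def n_def Cm_def)
  next
    fix u assume "u \<in> U" "u \<in> generic_pts N"
    from D[OF this] show "norm (ddiff I (\<lambda>i u. u i ^ k * deriv \<Psi> (u i) ^ (k - m)) u) \<le> (real m + 1) ^ Suc m * F / s ^ m"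
      by (simp add: n_def)
  qed
qed

text \<open>The limit of the factorial power sum divided by N^(k+1): the factor k! / (k - m)! comes
  from the Leibniz rule, 1 / m! from the limit of a divided difference, and 1 / (m + 1)! from the
  number of subsets relative to N^(m+1).\<close>

definition Mlim :: "nat \<Rightarrow> complex" where
  "Mlim k = (\<Sum>m\<le>k. of_real (fact k / fact (k - m)) *
     ((deriv ^^ m) (\<lambda>z. z ^ k * deriv \<Psi> z ^ (k - m)) 1 / fact m / of_real (fact (Suc m))))"

text \<open>For subsets disjoint from J0 the summand is close to A. Those meeting J0 number at most
  \<open>card J0 * N ^ m\<close>, a vanishing proportion of \<open>N ^ Suc m\<close>, so boundedness
  is enough for them.\<close>

lemma average_estimate:
  fixes D :: "nat set \<Rightarrow> complex"
  assumes J0: "J0 \<subseteq> {1..N}" and N: "N \<ge> 1" and e: "0 < e" and B: "0 \<le> B"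
    and bd: "\<And>I. I \<subseteq> {1..N} \<Longrightarrow> card I = Suc m \<Longrightarrow> norm (D I) \<le> B"
    and cl: "\<And>I. I \<subseteq> {1..N} \<Longrightarrow> card I = Suc m \<Longrightarrow> I \<inter> J0 = {} \<Longrightarrow> norm (D I - A) \<le> e"
    and r: "real (card J0) / real N \<le> e"
    and bin: "\<bar>real (N choose Suc m) / real N ^ Suc m - 1 / fact (Suc m)\<bar> \<le> e"
  shows "norm ((\<Sum>I | I \<subseteq> {1..N} \<and> card I = Suc m. D I) / of_nat N ^ Suc m - A / of_real (fact (Suc m))) \<le> e * (1 + B + 2 * norm A)"
proof -
  let ?P = "{I. I \<subseteq> {1..N} \<and> card I = Suc m}"
  let ?P1 = "{I. I \<subseteq> {1..N} \<and> card I = Suc m \<and> I \<inter> J0 \<noteq> {}}"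
  have fin: "finite ?P" by (rule finite_subset[of _ "Pow {1..N}"]) auto
  have sub: "?P1 \<subseteq> ?P" by auto
  have cP: "card ?P = N choose Suc m" by (simp add: n_subsets)
  have Np: "real N ^ Suc m > 0" using N by simp
  have "norm (\<Sum>I\<in>?P. D I - A) \<le> (\<Sum>I\<in>?P. norm (D I - A))" by (rule norm_sum)
  also have "\<dots> = (\<Sum>I\<in>?P - ?P1. norm (D I - A)) + (\<Sum>I\<in>?P1. norm (D I - A))"
    by (rule sum.subset_diff[OF sub fin])
  also have "\<dots> \<le> (\<Sum>I\<in>?P - ?P1. e) + (\<Sum>I\<in>?P1. B + norm A)"
  proof (intro add_mono sum_mono)
    fix I assume "I \<in> ?P - ?P1"
    then show "norm (D I - A) \<le> e" by (intro cl) auto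
  next
    fix I assume "I \<in> ?P1"
    then have "norm (D I) \<le> B" by (intro bd) auto
    then show "norm (D I - A) \<le> B + norm A" using norm_triangle_ineq4[of "D I" A] by linarith
  qed
  also have "\<dots> \<le> real N ^ Suc m * e + real (card J0) * real N ^ m * (B + norm A)"
  proof (intro add_mono)
    have "card (?P - ?P1) \<le> N ^ Suc m" using card_mono[OF fin, of "?P - ?P1"] card_subsets_le[of N "Suc m"] by auto
    then have "real (card (?P - ?P1)) \<le> real N ^ Suc m" using of_nat_mono[of "card (?P - ?P1)" "N ^ Suc m", where 'a = real] by simp
    then have "real (card (?P - ?P1)) * e \<le> real N ^ Suc m * e" using e by (intro mult_right_mono) auto
    then show "(\<Sum>I\<in>?P - ?P1. e) \<le> real N ^ Suc m * e" by (simp only: sum_constant)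
    have "real (card ?P1) \<le> real (card J0) * real N ^ m"
      using of_nat_mono[OF card_subsets_meeting_le[OF J0, of m], where 'a = real] by simp
    then show "(\<Sum>I\<in>?P1. B + norm A) \<le> real (card J0) * real N ^ m * (B + norm A)"
      unfolding sum_constant using B by (intro mult_right_mono) auto
  qed
  finally have "norm (\<Sum>I\<in>?P. D I - A) / real N ^ Suc m \<le> (real N ^ Suc m * e + real (card J0) * real N ^ m * (B + norm A)) / real N ^ Suc m"
    using Np by (intro divide_right_mono) auto
  also have "\<dots> = e + real (card J0) / real N * (B + norm A)" using N by (simp add: field_simps)
  also have "\<dots> \<le> e + e * (B + norm A)" using r B by (intro add_left_mono mult_right_mono) auto
  finally have 1: "norm ((\<Sum>I\<in>?P. D I - A) / of_nat N ^ Suc m) \<le> e + e * (B + norm A)"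
    by (simp only: norm_divide norm_power norm_of_nat)
  have 2: "norm (A * of_real (real (N choose Suc m) / real N ^ Suc m - 1 / fact (Suc m))) \<le> norm A * e"
    unfolding norm_mult norm_of_real using bin by (intro mult_left_mono) auto
  have "(\<Sum>I\<in>?P. D I) / of_nat N ^ Suc m - A / of_real (fact (Suc m)) =
     (\<Sum>I\<in>?P. D I - A) / of_nat N ^ Suc m + A * of_real (real (N choose Suc m) / real N ^ Suc m - 1 / fact (Suc m))"
  proof -
    have 1: "(\<Sum>I\<in>?P. D I - A) = (\<Sum>I\<in>?P. D I) - of_nat (N choose Suc m) * A"
      by (simp only: sum_subtractf sum_constant cP)
    have 2: "(of_real (real (N choose Suc m) / real N ^ Suc m - 1 / fact (Suc m)) :: complex)
       = of_nat (N choose Suc m) / of_nat N ^ Suc m - 1 / of_real (fact (Suc m))"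
      by (simp only: of_real_diff of_real_divide of_real_power of_real_of_nat_eq of_real_1)
    show ?thesis unfolding 1 2 by (simp only: diff_divide_distrib right_diff_distrib times_divide_eq_right mult_1_right mult.commute[of A]) simp
  qed
  then have "norm ((\<Sum>I\<in>?P. D I) / of_nat N ^ Suc m - A / of_real (fact (Suc m))) \<le>
     norm ((\<Sum>I\<in>?P. D I - A) / of_nat N ^ Suc m) + norm (A * of_real (real (N choose Suc m) / real N ^ Suc m - 1 / fact (Suc m)))"
    using norm_triangle_ineq by (simp only:)
  also have "\<dots> \<le> e + e * (B + norm A) + norm A * e" using 1 2 by (rule add_mono)
  also have "\<dots> = e * (1 + B + 2 * norm A)" by (simp add: algebra_simps)
  finally show ?thesis .
qed

lemma superset_of_card:
  assumes "J0 \<subseteq> {1..N}" "I \<subseteq> {1..N}" "card J0 + card I \<le> R" "R \<le> N"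
  obtains J where "J \<subseteq> {1..N}" "card J = R" "J0 \<subseteq> J" "I \<subseteq> J"
proof -
  have "card (J0 \<union> I) \<le> R" using card_Un_le[of J0 I] assms(3) by linarith
  moreover have "R \<le> card {1..N}" "J0 \<union> I \<subseteq> {1..N}" "finite {1..N}" using assms by auto
  ultimately obtain J where "J0 \<union> I \<subseteq> J" "J \<subseteq> {1..N}" "card J = R" using exists_subset_between by meson
  then show ?thesis using that by blast
qed

lemma open_near_one_off: "open {u::nat \<Rightarrow> complex. \<forall>a\<in>{1..N} - J0. norm (u a - 1) < d}"
proof -
  have "{u::nat \<Rightarrow> complex. \<forall>a\<in>{1..N} - J0. norm (u a - 1) < d} = (\<Inter>a\<in>{1..N} - J0. {u. u a \<in> ball 1 d})"
    by (auto simp: dist_norm norm_minus_commute)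
  moreover have "open (\<Inter>a\<in>{1..N} - J0. {u::nat \<Rightarrow> complex. u a \<in> ball 1 d})"
    by (intro open_INT ballI open_coordinate) auto
  ultimately show ?thesis by simp
qed

text \<open>The information on w with r + k + 1 free variables yields the conclusion with r: the
  free variables J0 and any node set I of at most k + 1 elements fit into one J. Since
  \<open>good\<close> quantifies over every number of variables, the step can be repeated.\<close>

lemma good_step:
  assumes good: "good w c"
  shows "good (\<lambda>N l. w N l * ek N k l / real N ^ Suc k) (c * Mlim k)"
  unfolding good_def
proof (intro allI impI)
  fix r :: nat assume r: "r \<ge> 1"
  define R where "R = r + Suc k"
  have R1: "R \<ge> 1" by (simp add: R_def)
  show "\<exists>\<delta>. 0 < \<delta> \<and> \<delta> < 1 \<and> absconv_ev (\<lambda>N l. w N l * ek N k l / real N ^ Suc k) r \<delta> \<and>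
     (\<forall>\<epsilon>>0. unif_ev r \<delta> (\<lambda>N J u. norm (gf N (\<lambda>l. w N l * ek N k l / real N ^ Suc k) u / S N u - c * Mlim k) < \<epsilon>))"
  proof (rule good_derivatives[OF good R1, where k = k])
    fix \<delta> assume \<delta>: "0 < \<delta>" "\<delta> < 1" "\<Psi> holomorphic_on ball 1 (3 * \<delta>)" and acw: "absconv_ev w R \<delta>"
      and acs: "absconv_ev (\<lambda>N. pmf (\<rho> N)) R \<delta>" and nz: "unif_ev R \<delta> (\<lambda>N J u. S N u \<noteq> 0)"
      and lim: "\<And>n \<epsilon>. n \<le> k \<Longrightarrow> \<epsilon> > 0 \<Longrightarrow> unif_ev R \<delta> (\<lambda>N J u. \<forall>i\<in>J. norm ((pd i ^^ n) (gf N (w N)) u / (of_nat N ^ n * S N u) - c * deriv \<Psi> (u i) ^ n) < \<epsilon>)"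
    \<comment> \<open>The local estimate uses radius s for the points, 2 s for the circles and 4 s
      for the domain.\<close>
    define s where "s = \<delta> / 4"
    have s: "0 < s" "4 * s < 1" "4 * s = \<delta>" "s < 1" using \<delta> by (auto simp: s_def)
    have hol: "\<Psi> holomorphic_on ball 1 (4 * s)" by (rule holomorphic_on_subset[OF \<delta>(3)]) (use s \<delta> in \<open>intro subset_ball, simp\<close>)
    have ac: "absconv_ev (\<lambda>N l. w N l * ek N k l / real N ^ Suc k) r s"
      unfolding absconv_ev_def using acw[unfolded absconv_ev_def] eventually_ge_at_top[of R]
    proof eventually_elim
      case (elim N)
      obtain \<eta> where \<eta>: "0 < \<eta>" "\<eta> < 1" "\<forall>J. J \<subseteq> {1..N} \<longrightarrow> card J = R \<longrightarrow> absconv N (w N) (dvec J \<delta> \<eta>)" using elim(1) by blast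
      \<comment> \<open>\<open>absconv_ek\<close> halves every radius, and the variables in J
        outside J0 now count among the narrow ones; \<open>\<eta>'\<close> must lie below both
        halved radii.\<close>
      define \<eta>' where "\<eta>' = min (\<eta> / 2) s"
      have \<eta>': "0 < \<eta>'" "\<eta>' < 1" "\<eta>' \<le> \<eta> / 2" "\<eta>' \<le> \<delta> / 2" using \<eta> s \<delta> by (auto simp: \<eta>'_def)
      have "absconv N (\<lambda>l. w N l * ek N k l / real N ^ Suc k) (dvec J0 s \<eta>')" if J0: "J0 \<subseteq> {1..N}" "card J0 = r" for J0
      proof -
        obtain J where J: "J \<subseteq> {1..N}" "card J = R" "J0 \<subseteq> J"
          by (rule superset_of_card[of J0 N "{}" R]) (use J0 elim(2) in \<open>auto simp: R_def\<close>)
        have dv: "0 < dvec J \<delta> \<eta> a \<and> dvec J \<delta> \<eta> a < 1" for a by (rule dvec_bounds[OF \<delta>(1,2) \<eta>(1,2)])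
        have "absconv N (w N) (dvec J \<delta> \<eta>)" using \<eta>(3) J by blast
        from absconv_ek[OF this dv, of k] have "absconv N (\<lambda>l. w N l * ek N k l) (\<lambda>i. dvec J \<delta> \<eta> i / 2)" .
        then have "absconv N (\<lambda>l. w N l * ek N k l) (dvec J0 s \<eta>')"
        proof (rule absconv_mono)
          fix i
          show "0 < dvec J \<delta> \<eta> i / 2 \<and> dvec J \<delta> \<eta> i / 2 < 1" using dv[of i] by simp
          show "0 < dvec J0 s \<eta>' i \<and> dvec J0 s \<eta>' i \<le> dvec J \<delta> \<eta> i / 2"
            using J(3) s \<eta>' \<delta> by (auto simp: dvec_def)
        qed
        then show ?thesis by (rule absconv_scale)
      qed
      then show ?case using \<eta>' by blast
    qed
    define \<phi> where "\<phi> = (\<lambda>m z. z ^ k * deriv \<Psi> z ^ (k - m))"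
    have \<phi>h: "\<phi> m holomorphic_on ball 1 (4 * s)" for m
      unfolding \<phi>_def by (intro holomorphic_intros holomorphic_deriv[OF hol open_ball])
    have "\<exists>F>0. \<forall>z\<in>cball 1 (2 * s). norm (\<phi> m z) \<le> F" for m
    proof -
      have "continuous_on (cball 1 (2 * s)) (\<phi> m)"
        by (rule holomorphic_on_imp_continuous_on[OF holomorphic_on_subset[OF \<phi>h]]) (use s in auto)
      then have "bounded (\<phi> m ` cball 1 (2 * s))" using compact_continuous_image compact_imp_bounded compact_cball by blast
      then show ?thesis unfolding bounded_pos by auto
    qed
    then obtain F where F: "\<And>m. F m > 0" "\<And>m z. z \<in> cball 1 (2 * s) \<Longrightarrow> norm (\<phi> m z) \<le> F m" by metis
    define A where "A = (\<lambda>m. (deriv ^^ m) (\<phi> m) 1 / fact m)"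
    define Cm where "Cm = (\<lambda>m. (real m + 1) ^ Suc m / s ^ m)"
    have Cm: "Cm m \<ge> 0" for m using s by (simp add: Cm_def)
    \<comment> \<open>The error for order m in units of e: the first part is that of
      \<open>local_estimate\<close>, the second that of \<open>average_estimate\<close>.\<close>
    define Gm where "Gm = (\<lambda>m. Cm m * (4 * 2 ^ k + norm c * F m) + norm c * (1 + Cm m * F m + 2 * norm (A m)))"
    have Gm: "Gm m \<ge> 0" for m unfolding Gm_def using Cm F(1)[of m] by (intro add_nonneg_nonneg mult_nonneg_nonneg) auto
    define q where "q = (\<lambda>m. fact k / fact (k - m) :: real)"
    have q: "q m \<ge> 0" for m by (simp add: q_def)
    define Kt where "Kt = (\<Sum>m\<le>k. q m * Gm m)"
    have Kt: "Kt \<ge> 0" unfolding Kt_def by (intro sum_nonneg mult_nonneg_nonneg q Gm)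
    have main: "unif_ev r s (\<lambda>N J u. norm (gf N (\<lambda>l. w N l * ek N k l / real N ^ Suc k) u / S N u - c * Mlim k) < \<epsilon>)" if \<epsilon>: "\<epsilon> > 0" for \<epsilon>
    proof -
      \<comment> \<open>The 1 in \<open>Kt + 1\<close> pays for the final replacement of the generic
        point u by u0.\<close>
      define e where "e = min 1 (\<epsilon> / (2 * (Kt + 1)))"
      have e: "0 < e" "e \<le> 1" "e * (Kt + 1) < \<epsilon>"
      proof -
        have "e * (Kt + 1) \<le> \<epsilon> / (2 * (Kt + 1)) * (Kt + 1)" unfolding e_def using Kt by (intro mult_right_mono) auto
        also have "\<dots> = \<epsilon> / 2" using Kt by (simp add: field_simps)
        finally show "e * (Kt + 1) < \<epsilon>" using \<epsilon> by simp
      qed (use \<epsilon> Kt in \<open>auto simp: e_def\<close>)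
      have evlim: "\<forall>\<^sub>F N in sequentially. \<forall>m\<in>{..k}. \<forall>J. J \<subseteq> {1..N} \<longrightarrow> card J = R \<longrightarrow> (\<forall>u\<in>pdj J \<delta>. \<forall>i\<in>J.
          norm ((pd i ^^ (k - m)) (gf N (w N)) u / (of_nat N ^ (k - m) * S N u) - c * deriv \<Psi> (u i) ^ (k - m)) < e)"
        by (rule eventually_ball_finite) (use lim[unfolded unif_ev_def] e in auto)
      have evbin: "\<forall>\<^sub>F N in sequentially. \<forall>m\<in>{..k}. \<bar>real (N choose Suc m) / real N ^ Suc m - 1 / fact (Suc m)\<bar> \<le> e"
      proof (rule eventually_ball_finite)
        show "\<forall>m\<in>{..k}. \<forall>\<^sub>F N in sequentially. \<bar>real (N choose Suc m) / real N ^ Suc m - 1 / fact (Suc m)\<bar> \<le> e"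
        proof
          fix m
          have "\<forall>\<^sub>F N in sequentially. dist (real (N choose Suc m) / real N ^ Suc m) (1 / fact (Suc m)) < e"
            using binomial_ratio_tendsto[of "Suc m"] e(1) by (rule tendstoD)
          then show "\<forall>\<^sub>F N in sequentially. \<bar>real (N choose Suc m) / real N ^ Suc m - 1 / fact (Suc m)\<bar> \<le> e"
            by eventually_elim (simp add: dist_real_def)
        qed
      qed simp
      have "(\<lambda>N. real r / real N) \<longlonglongrightarrow> 0" by real_asymp
      then have evr: "\<forall>\<^sub>F N in sequentially. real r / real N < e" by (rule order_tendstoD(2)) (rule e(1))
      show ?thesis
        unfolding unif_ev_def using evlim evbin evr acw[unfolded absconv_ev_def] acs[unfolded absconv_ev_def]
          nz[unfolded unif_ev_def] ac[unfolded absconv_ev_def] eventually_ge_at_top[of R]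
      proof eventually_elim
        case (elim N)
        have N: "N \<ge> 1" using elim(8) R1 by simp
        obtain \<eta>1 where \<eta>1: "0 < \<eta>1" "\<eta>1 < 1" "\<forall>J. J \<subseteq> {1..N} \<longrightarrow> card J = R \<longrightarrow> absconv N (w N) (dvec J \<delta> \<eta>1)" using elim(4) by blast
        obtain \<eta>2 where \<eta>2: "0 < \<eta>2" "\<eta>2 < 1" "\<forall>J. J \<subseteq> {1..N} \<longrightarrow> card J = R \<longrightarrow> absconv N (pmf (\<rho> N)) (dvec J \<delta> \<eta>2)" using elim(5) by blast
        define \<eta> where "\<eta> = min \<eta>1 \<eta>2"
        have \<eta>: "0 < \<eta>" "\<eta> < 1" using \<eta>1 \<eta>2 by (auto simp: \<eta>_def)
        have wJ: "absconv N (w N) (dvec J (4 * s) \<eta>)" and sJ: "absconv N (pmf (\<rho> N)) (dvec J (4 * s) \<eta>)" if "J \<subseteq> {1..N}" "card J = R" for J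
        proof -
          show "absconv N (w N) (dvec J (4 * s) \<eta>)"
            by (rule absconv_mono[of N "w N" "dvec J \<delta> \<eta>1"]) (use that \<delta> \<eta>1 \<eta>2 s in \<open>auto simp: dvec_def \<eta>_def\<close>)
          show "absconv N (pmf (\<rho> N)) (dvec J (4 * s) \<eta>)"
            by (rule absconv_mono[of N "pmf (\<rho> N)" "dvec J \<delta> \<eta>2"]) (use that \<delta> \<eta>1 \<eta>2 s in \<open>auto simp: dvec_def \<eta>_def\<close>)
        qed
        show ?case
        proof (intro allI impI ballI)
          fix J0 u0 assume J0: "J0 \<subseteq> {1..N}" "card J0 = r" and u0: "u0 \<in> pdj J0 s"
          define H where "H = gf N (\<lambda>l. w N l * ek N k l)"
          define P where "P = (\<lambda>m. {I. I \<subseteq> {1..N} \<and> card I = Suc m})"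
          have finP: "finite (P m)" for m unfolding P_def by (rule finite_subset[of _ "Pow {1..N}"]) auto
          define X where "X = (\<lambda>m I u. ddiff I (\<lambda>i u. u i ^ k * (pd i ^^ (k - m)) (gf N (w N)) u) u)"
          define D where "D = (\<lambda>m I u. ddiff I (\<lambda>i u. \<phi> m (u i)) u)"
          define good_at where "good_at = (\<lambda>m I u. norm (X m I u / of_nat N ^ (k - m) - c * S N u0 * D m I u) \<le> norm (S N u0) * (e * (Cm m * (4 * 2 ^ k + norm c * F m))) \<and> norm (D m I u) \<le> Cm m * F m)"
          \<comment> \<open>The neighbourhood depends on m and I, but N is fixed here and there are
            finitely many pairs, so the intersection is still a neighbourhood of u0.\<close>
          have loc: "\<exists>U. open U \<and> u0 \<in> U \<and> (\<forall>u\<in>U. u \<in> generic_pts N \<longrightarrow> good_at m I u)" if m: "m \<le> k" and I: "I \<in> P m" for m I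
          proof -
            obtain J where J: "J \<subseteq> {1..N}" "card J = R" "J0 \<subseteq> J" "I \<subseteq> J"
              by (rule superset_of_card[of J0 N I R]) (use J0 I m elim(8) in \<open>auto simp: R_def P_def\<close>)
            have cI: "card I = Suc m" using I by (simp add: P_def)
            have nzJ: "\<forall>u\<in>pdj J (4 * s). S N u \<noteq> 0" using elim(6) J unfolding s(3) by blast
            have close: "\<forall>u\<in>pdj J (4 * s). \<forall>i\<in>J. norm ((pd i ^^ (k - m)) (gf N (w N)) u / (of_nat N ^ (k - m) * S N u) - c * deriv \<Psi> (u i) ^ (k - m)) < e"
              using elim(1) J m unfolding s(3) by blast
            have Fm: "norm (z ^ k * deriv \<Psi> z ^ (k - m)) \<le> F m" if "z \<in> cball 1 (2 * s)" for z using F(2)[OF that, of m] by (simp add: \<phi>_def)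
            show ?thesis
            proof (rule local_estimate[OF J(1,3,4) cI m s(1,2) \<eta> hol wJ[OF J(1,2)] sJ[OF J(1,2)] nzJ N e(1,2) close Fm u0])
              fix U assume U: "open U" "u0 \<in> U" 
                and U1: "\<And>u. u \<in> U \<Longrightarrow> u \<in> generic_pts N \<Longrightarrow>
                 norm (ddiff I (\<lambda>i u. u i ^ k * (pd i ^^ (k - m)) (gf N (w N)) u) u / of_nat N ^ (k - m)
                    - c * S N u0 * ddiff I (\<lambda>i u. u i ^ k * deriv \<Psi> (u i) ^ (k - m)) u)
                 \<le> norm (S N u0) * (e * ((real m + 1) ^ Suc m / s ^ m * (4 * 2 ^ k + norm c * F m)))"
                and U2: "\<And>u. u \<in> U \<Longrightarrow> u \<in> generic_pts N \<Longrightarrow>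
                 norm (ddiff I (\<lambda>i u. u i ^ k * deriv \<Psi> (u i) ^ (k - m)) u) \<le> (real m + 1) ^ Suc m * F m / s ^ m"
              have "good_at m I u" if "u \<in> U" "u \<in> generic_pts N" for u
                using U1[OF that] U2[OF that] unfolding good_at_def X_def D_def \<phi>_def Cm_def by (simp add: mult_ac)
              then show ?thesis using U by blast
            qed
          qed
          then have "\<forall>p\<in>Sigma {..k} P. \<exists>U. open U \<and> u0 \<in> U \<and> (\<forall>u\<in>U. u \<in> generic_pts N \<longrightarrow> good_at (fst p) (snd p) u)"
            by auto
          from bchoice[OF this] obtain U where U': "\<forall>p\<in>Sigma {..k} P. open (U p) \<and> u0 \<in> U p \<and> (\<forall>u\<in>U p. u \<in> generic_pts N \<longrightarrow> good_at (fst p) (snd p) u)"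
            by (elim exE)
          have "\<exists>d>0. \<forall>I u. finite I \<longrightarrow> card I = Suc m \<longrightarrow> (\<forall>a\<in>I. norm (u a - 1) < d) \<longrightarrow> inj_on u I \<longrightarrow> norm (D m I u - A m) < e" for m
          proof (rule ddiff_tendsto_deriv[OF \<phi>h[of m] open_ball _ e(1), where m = m])
            fix d assume "d > 0" "\<And>I u. finite I \<Longrightarrow> card I = Suc m \<Longrightarrow> (\<And>a. a \<in> I \<Longrightarrow> norm (u a - 1) < d) \<Longrightarrow> inj_on u I \<Longrightarrow>
              norm (ddiff I (\<lambda>i v. \<phi> m (v i)) u - (deriv ^^ m) (\<phi> m) 1 / fact m) < e"
            then show ?thesis unfolding D_def A_def by (intro exI[of _ d]) blast
          qed (use s in simp)
          then obtain d where d: "\<And>m. d m > 0" "\<And>m I u. finite I \<Longrightarrow> card I = Suc m \<Longrightarrow> (\<forall>a\<in>I. norm (u a - 1) < d m) \<Longrightarrow> inj_on u I \<Longrightarrow> norm (D m I u - A m) < e"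
            by metis
          obtain J where J: "J \<subseteq> {1..N}" "card J = R" "J0 \<subseteq> J"
            by (rule superset_of_card[of J0 N "{}" R]) (use J0 elim(8) in \<open>auto simp: R_def\<close>)
          have dv: "0 < dvec J (4 * s) \<eta> a \<and> dvec J (4 * s) \<eta> a < 1" for a by (rule dvec_bounds) (use s \<eta> in auto)
          have dv2: "0 < dvec J (4 * s) \<eta> a / 2 \<and> dvec J (4 * s) \<eta> a / 2 < 1" for a using dv[of a] by simp
          let ?box = "pbox N (\<lambda>i. dvec J (4 * s) \<eta> i / 2)"
          have Hs: "sephol ?box H" unfolding H_def
            by (rule absconv_sephol[OF absconv_ek[OF wJ[OF J(1,2)] dv] dv2])
          have boxsub: "?box \<subseteq> pbox N (dvec J (4 * s) \<eta>)" unfolding pbox_def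
          proof (intro subsetI CollectI ballI)
            fix v i assume "v \<in> {u. \<forall>i\<in>{1..N}. norm (u i - 1) < dvec J (4 * s) \<eta> i / 2}" and i: "i \<in> {1..N}"
            then have "norm (v i - 1) < dvec J (4 * s) \<eta> i / 2" by blast
            then show "norm (v i - 1) < dvec J (4 * s) \<eta> i" using dv[of i] by simp
          qed
          have u0b: "u0 \<in> ?box" unfolding pbox_def
          proof (intro CollectI ballI)
            fix i assume "i \<in> {1..N}"
            show "norm (u0 i - 1) < dvec J (4 * s) \<eta> i / 2"
            proof (cases "i \<in> J0")
              case True
              then have "norm (u0 i - 1) < s" "i \<in> J" using u0 J(3) by (auto simp: pdj_def)
              then show ?thesis using s by (simp add: dvec_def)
            next
              case False
              then show ?thesis using u0 dv[of i] by (simp add: pdj_def)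
            qed
          qed
          have u0J: "u0 \<in> pdj J \<delta>" using pdj_superset[OF J(3) s(1)] pdj_mono[of s \<delta> J] u0 s by auto
          have S0: "S N u0 \<noteq> 0" using elim(6) J u0J by blast
          \<comment> \<open>A generic point of V meets all demands at once: every local estimate,
            nodes off J0 close to 1, and H close to its value at u0.\<close>
          define V where "V = (\<Inter>p\<in>Sigma {..k} P. U p) \<inter> (\<Inter>m\<in>{..k}. {u. \<forall>a\<in>{1..N} - J0. norm (u a - 1) < d m}) \<inter>
             (?box \<inter> H -` ball (H u0) (e * norm (S N u0) * real N ^ Suc k))"
          have Vo: "open V" unfolding V_def
            by (intro open_Int open_INT ballI finite_SigmaI finP open_near_one_off continuous_open_preimage[OF sephol_continuous[OF Hs] open_pbox open_ball])
               (use U' in auto)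
          have u0V: "u0 \<in> V"
          proof -
            have "H u0 \<in> ball (H u0) (e * norm (S N u0) * real N ^ Suc k)" using e S0 N by simp
            moreover have "norm (u0 a - 1) < d m" if "a \<in> {1..N} - J0" for a m using that u0 d(1)[of m] by (simp add: pdj_def)
            ultimately show ?thesis unfolding V_def using U' u0b by blast
          qed
          have "u0 \<in> nzset N" by (rule pdj_nzset[OF _ u0]) (use s in simp)
          then obtain u where uV: "u \<in> V" and ug: "u \<in> generic_pts N" using generic_dense[OF _ Vo u0V] by blast
          have ub: "u \<in> ?box" using uV by (simp add: V_def)
          have ga: "good_at m I u" if "m \<le> k" "I \<in> P m" for m I
          proof -
            have "(m, I) \<in> Sigma {..k} P" using that by simp
            then show ?thesis using U' uV ug unfolding V_def by fastforce
          qed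
          have injI: "inj_on u I" if "I \<in> P m" for I m
          proof (rule inj_onI)
            fix i j assume "i \<in> I" "j \<in> I" "u i = u j"
            moreover have "i \<in> {1..N}" "j \<in> {1..N}" using \<open>i \<in> I\<close> \<open>j \<in> I\<close> that unfolding P_def by blast+
            ultimately show "i = j" using ug unfolding generic_pts_def by blast
          qed
          have Hu: "H u / of_nat N ^ Suc k = (\<Sum>m\<le>k. of_real (q m) * ((\<Sum>I\<in>P m. X m I u / of_nat N ^ (k - m)) / of_nat N ^ Suc m))"
          proof -
            have "H u = (\<Sum>m\<le>k. of_real (q m) * (\<Sum>I\<in>P m. X m I u))"
              unfolding H_def q_def X_def P_def
              by (rule gf_expansion[OF wJ[OF J(1,2)] dv _ ug]) (use ub boxsub in blast)
            then have "H u / of_nat N ^ Suc k = (\<Sum>m\<le>k. of_real (q m) * (\<Sum>I\<in>P m. X m I u) / of_nat N ^ Suc k)"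
              by (simp only: sum_divide_distrib)
            also have "\<dots> = (\<Sum>m\<le>k. of_real (q m) * ((\<Sum>I\<in>P m. X m I u / of_nat N ^ (k - m)) / of_nat N ^ Suc m))"
            proof (intro sum.cong refl)
              fix m assume "m \<in> {..k}"
              then have "Suc k = (k - m) + Suc m" by simp
              then have "(of_nat N :: complex) ^ Suc k = of_nat N ^ (k - m) * of_nat N ^ Suc m" by (metis power_add)
              then show "of_real (q m) * (\<Sum>I\<in>P m. X m I u) / of_nat N ^ Suc k = of_real (q m) * ((\<Sum>I\<in>P m. X m I u / of_nat N ^ (k - m)) / of_nat N ^ Suc m)"
                by (simp add: sum_divide_distrib[symmetric])
            qed
            finally show ?thesis .
          qed
          have Meq: "Mlim k = (\<Sum>m\<le>k. of_real (q m) * (A m / of_real (fact (Suc m))))"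
            by (simp add: Mlim_def q_def A_def \<phi>_def)
          have term_le: "norm ((\<Sum>I\<in>P m. X m I u / of_nat N ^ (k - m)) / of_nat N ^ Suc m - c * S N u0 * (A m / of_real (fact (Suc m)))) \<le> norm (S N u0) * e * Gm m"
            if m: "m \<le> k" for m
          proof -
            define X1 where "X1 = (\<Sum>I\<in>P m. X m I u / of_nat N ^ (k - m)) / of_nat N ^ Suc m"
            define D1 where "D1 = (\<Sum>I\<in>P m. D m I u) / of_nat N ^ Suc m"
            have Np: "real N ^ Suc m > 0" using N by simp
            have "norm (X1 - c * S N u0 * D1) \<le> norm (S N u0) * (e * (Cm m * (4 * 2 ^ k + norm c * F m)))"
            proof -
              let ?b = "norm (S N u0) * (e * (Cm m * (4 * 2 ^ k + norm c * F m)))"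
              have b0: "?b \<ge> 0" using Cm[of m] F(1)[of m] e by (intro mult_nonneg_nonneg add_nonneg_nonneg) auto
              have "X1 - c * S N u0 * D1 = (\<Sum>I\<in>P m. X m I u / of_nat N ^ (k - m) - c * S N u0 * D m I u) / of_nat N ^ Suc m"
                unfolding X1_def D1_def by (simp add: sum_subtractf diff_divide_distrib sum_distrib_left)
              also have "norm \<dots> = norm (\<Sum>I\<in>P m. X m I u / of_nat N ^ (k - m) - c * S N u0 * D m I u) / real N ^ Suc m"
                by (simp only: norm_divide norm_power norm_of_nat)
              also have "\<dots> \<le> (real (card (P m)) * ?b) / real N ^ Suc m"
              proof (intro divide_right_mono)
                show "norm (\<Sum>I\<in>P m. X m I u / of_nat N ^ (k - m) - c * S N u0 * D m I u) \<le> real (card (P m)) * ?b"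
                  by (rule sum_norm_bound) (use ga[OF m] in \<open>auto simp: good_at_def\<close>)
              qed simp
              also have "\<dots> \<le> (real N ^ Suc m * ?b) / real N ^ Suc m"
              proof (intro divide_right_mono mult_right_mono b0)
                show "real (card (P m)) \<le> real N ^ Suc m" using of_nat_mono[OF card_subsets_le[of N "Suc m"], where 'a = real] by (simp add: P_def)
              qed simp
              also have "\<dots> = ?b" using N by simp
              finally show ?thesis .
            qed
            moreover have "norm (D1 - A m / of_real (fact (Suc m))) \<le> e * (1 + Cm m * F m + 2 * norm (A m))"
              unfolding D1_def P_def
            proof (rule average_estimate[OF J0(1) N e(1)])
              show "0 \<le> Cm m * F m" using Cm[of m] F(1)[of m] by simp
              show "norm (D m I u) \<le> Cm m * F m" if "I \<subseteq> {1..N}" "card I = Suc m" for I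
                using ga[OF m, of I] that by (simp add: P_def good_at_def)
              show "norm (D m I u - A m) \<le> e" if I: "I \<subseteq> {1..N}" "card I = Suc m" "I \<inter> J0 = {}" for I
              proof (rule less_imp_le, rule d(2))
                show "finite I" using I finite_subset by blast
                show "\<forall>a\<in>I. norm (u a - 1) < d m"
                proof
                  fix a assume "a \<in> I"
                  then have "a \<in> {1..N} - J0" using I by blast
                  then show "norm (u a - 1) < d m" using uV m unfolding V_def by blast
                qed
                show "inj_on u I" using injI[of I m] I by (simp add: P_def)
              qed (use I in auto)
              show "real (card J0) / real N \<le> e" using elim(3) J0 by simp
              show "\<bar>real (N choose Suc m) / real N ^ Suc m - 1 / fact (Suc m)\<bar> \<le> e" using elim(2) m by blast
            qed
            then have "norm (c * S N u0 * (D1 - A m / of_real (fact (Suc m)))) \<le> norm c * norm (S N u0) * (e * (1 + Cm m * F m + 2 * norm (A m)))"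
              unfolding norm_mult by (intro mult_left_mono) auto
            moreover have "norm (X1 - c * S N u0 * (A m / of_real (fact (Suc m)))) \<le> norm (X1 - c * S N u0 * D1) + norm (c * S N u0 * (D1 - A m / of_real (fact (Suc m))))"
              using norm_triangle_ineq[of "X1 - c * S N u0 * D1" "c * S N u0 * (D1 - A m / of_real (fact (Suc m)))"] by (simp add: right_diff_distrib)
            ultimately have "norm (X1 - c * S N u0 * (A m / of_real (fact (Suc m)))) \<le>
               norm (S N u0) * (e * (Cm m * (4 * 2 ^ k + norm c * F m))) + norm c * norm (S N u0) * (e * (1 + Cm m * F m + 2 * norm (A m)))"
              by linarith
            also have "\<dots> = norm (S N u0) * e * Gm m" by (simp add: Gm_def algebra_simps)
            finally show ?thesis by (simp only: X1_def)
          qed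
          have "norm (H u / of_nat N ^ Suc k - c * S N u0 * Mlim k) \<le> (\<Sum>m\<le>k. norm (of_real (q m) * ((\<Sum>I\<in>P m. X m I u / of_nat N ^ (k - m)) / of_nat N ^ Suc m - c * S N u0 * (A m / of_real (fact (Suc m))))))"
          proof -
            have "H u / of_nat N ^ Suc k - c * S N u0 * Mlim k = (\<Sum>m\<le>k. of_real (q m) * ((\<Sum>I\<in>P m. X m I u / of_nat N ^ (k - m)) / of_nat N ^ Suc m - c * S N u0 * (A m / of_real (fact (Suc m)))))"
              unfolding Hu Meq sum_distrib_left sum_subtractf[symmetric] by (intro sum.cong refl) (simp only: right_diff_distrib mult_ac)
            then show ?thesis by (simp only: norm_sum)
          qed
          also have "\<dots> \<le> (\<Sum>m\<le>k. q m * (norm (S N u0) * e * Gm m))"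
          proof (intro sum_mono)
            fix m assume "m \<in> {..k}"
            then show "norm (of_real (q m) * ((\<Sum>I\<in>P m. X m I u / of_nat N ^ (k - m)) / of_nat N ^ Suc m - c * S N u0 * (A m / of_real (fact (Suc m))))) \<le> q m * (norm (S N u0) * e * Gm m)"
              unfolding norm_mult norm_of_real abs_of_nonneg[OF q] using q term_le by (intro mult_left_mono) auto
          qed
          also have "\<dots> = norm (S N u0) * e * Kt" unfolding Kt_def sum_distrib_left by (intro sum.cong refl) (simp only: mult_ac)
          finally have 1: "norm (H u / of_nat N ^ Suc k - c * S N u0 * Mlim k) \<le> norm (S N u0) * e * Kt" .
          have "norm (H u0 - H u) < e * norm (S N u0) * real N ^ Suc k" using uV by (simp add: V_def dist_norm)
          then have "norm (H u0 - H u) / real N ^ Suc k \<le> (e * norm (S N u0) * real N ^ Suc k) / real N ^ Suc k"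
            by (intro divide_right_mono) auto
          then have "norm ((H u0 - H u) / of_nat N ^ Suc k) \<le> e * norm (S N u0)"
            using N by (simp add: norm_divide norm_power norm_mult)
          then have 2: "norm (H u0 / of_nat N ^ Suc k - H u / of_nat N ^ Suc k) \<le> e * norm (S N u0)"
            by (simp only: diff_divide_distrib)
          have "norm (H u0 / of_nat N ^ Suc k - c * S N u0 * Mlim k) \<le> norm (S N u0) * (e * (Kt + 1))"
            using norm_triangle_ineq[of "H u0 / of_nat N ^ Suc k - H u / of_nat N ^ Suc k" "H u / of_nat N ^ Suc k - c * S N u0 * Mlim k"] 1 2
            by (simp add: algebra_simps)
          also have "\<dots> < norm (S N u0) * \<epsilon>" using e(3) S0 by (intro mult_strict_left_mono) auto
          finally have 3: "norm (H u0 / of_nat N ^ Suc k - c * S N u0 * Mlim k) < norm (S N u0) * \<epsilon>" .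
          have "gf N (\<lambda>l. w N l * ek N k l / real N ^ Suc k) u0 = H u0 / of_nat N ^ Suc k"
            unfolding H_def gf_scale by simp
          then have "gf N (\<lambda>l. w N l * ek N k l / real N ^ Suc k) u0 / S N u0 - c * Mlim k = (H u0 / of_nat N ^ Suc k - c * S N u0 * Mlim k) / S N u0"
            using S0 by (simp add: diff_divide_distrib)
          then show "norm (gf N (\<lambda>l. w N l * ek N k l / real N ^ Suc k) u0 / S N u0 - c * Mlim k) < \<epsilon>"
            using 3 S0 by (simp add: norm_divide divide_less_eq mult.commute)
        qed
      qed
    qed
    show ?thesis using s ac main by (intro exI[of _ s]) blast
  qed
qed

end

section \<open>Convergence in probability\<close>

context schur_lln begin

lemma good_base: "good (\<lambda>N. pmf (\<rho> N)) 1"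
  unfolding good_def
proof (intro allI impI)
  fix R :: nat assume R: "R \<ge> 1"
  show "\<exists>\<delta>. 0 < \<delta> \<and> \<delta> < 1 \<and> absconv_ev (\<lambda>N. pmf (\<rho> N)) R \<delta> \<and>
     (\<forall>\<epsilon>>0. unif_ev R \<delta> (\<lambda>N J u. norm (S N u / S N u - 1) < \<epsilon>))"
  proof (rule S_ratio_tendsto[OF R])
    fix \<delta> assume d: "0 < \<delta>" "\<delta> < 1" "absconv_ev (\<lambda>N. pmf (\<rho> N)) R \<delta>" "unif_ev R \<delta> (\<lambda>N J u. S N u \<noteq> 0)"
    have "unif_ev R \<delta> (\<lambda>N J u. norm (S N u / S N u - 1) < \<epsilon>)" if "\<epsilon> > 0" for \<epsilon>
      using d(4) unfolding unif_ev_def by eventually_elim (use that in auto)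
    then show ?thesis using d by blast
  qed
qed

text \<open>At the all-ones vector the normalised Schur functions and S equal 1, so the generating
  function is the sum of the weights; one free variable in \<open>good\<close> is enough.\<close>

lemma good_expectation:
  assumes "good w c"
  shows "\<forall>\<^sub>F N in sequentially. w N summable_on signatures N"
    and "(\<lambda>N. of_real (\<Sum>\<^sub>\<infinity>l\<in>signatures N. w N l)) \<longlonglongrightarrow> c"
proof -
  obtain \<delta> where \<delta>: "0 < \<delta>" "\<delta> < 1" "absconv_ev w 1 \<delta>"
     "\<forall>\<epsilon>>0. unif_ev 1 \<delta> (\<lambda>N J u. norm (gf N (w N) u / S N u - c) < \<epsilon>)"
  proof -
    have "\<exists>\<delta>. 0 < \<delta> \<and> \<delta> < 1 \<and> absconv_ev w 1 \<delta> \<and>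
       (\<forall>\<epsilon>>0. unif_ev 1 \<delta> (\<lambda>N J u. norm (gf N (w N) u / S N u - c) < \<epsilon>))"
      using assms unfolding good_def by blast
    then show ?thesis using that by (elim exE conjE)
  qed
  have gf1: "gf N (w N) (\<lambda>_. 1) = (\<Sum>\<^sub>\<infinity>l\<in>signatures N. of_real (w N l))" for N
    unfolding gf_def by (intro infsum_cong) (simp add: nschur_one)
  have sm: "\<forall>\<^sub>F N in sequentially. w N summable_on signatures N"
    using \<delta>(3)[unfolded absconv_ev_def] eventually_ge_at_top[of 1]
  proof eventually_elim
    case (elim N)
    then obtain \<eta> where \<eta>: "0 < \<eta>" "\<eta> < 1" "absconv N (w N) (dvec {1} \<delta> \<eta>)" by force
    have dv: "0 < dvec {1} \<delta> \<eta> a \<and> dvec {1} \<delta> \<eta> a < 1" for a by (rule dvec_bounds[OF \<delta>(1,2) \<eta>(1,2)])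
    have "(\<lambda>l. of_real (w N l) * nschur N l (\<lambda>_. 1)) summable_on signatures N"
      by (rule locsum_summable[OF absconv_locsum[OF \<eta>(3) dv]]) (use dv in \<open>auto simp: pbox_def\<close>)
    then have "(\<lambda>l. of_real (w N l) :: complex) summable_on signatures N"
      by (rule summable_on_cong[THEN iffD1, rotated]) (simp add: nschur_one)
    then have "(\<lambda>l. norm (of_real (w N l) :: complex)) summable_on signatures N"
      by (rule summable_on_iff_abs_summable_on_complex[THEN iffD1])
    then have "(\<lambda>l. norm (w N l)) summable_on signatures N" by simp
    then show ?case by (rule abs_summable_summable)
  qed
  then show "\<forall>\<^sub>F N in sequentially. w N summable_on signatures N" .
  have "(\<lambda>N. gf N (w N) (\<lambda>_. 1)) \<longlonglongrightarrow> c"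
  proof (rule tendstoI)
    fix \<epsilon> :: real assume "\<epsilon> > 0"
    with \<delta>(4) have "unif_ev 1 \<delta> (\<lambda>N J u. norm (gf N (w N) u / S N u - c) < \<epsilon>)" by blast
    then show "\<forall>\<^sub>F N in sequentially. dist (gf N (w N) (\<lambda>_. 1)) c < \<epsilon>"
      unfolding unif_ev_def using eventually_ge_at_top[of 1]
    proof eventually_elim
      case (elim N)
      have "(\<lambda>_. 1) \<in> pdj {1} \<delta>" using \<delta> by (simp add: pdj_def)
      moreover have "{1} \<subseteq> {1..N}" "card {1::nat} = 1" using elim by auto
      ultimately have "norm (gf N (w N) (\<lambda>_. 1) / S N (\<lambda>_. 1) - c) < \<epsilon>" using elim(1) by blast
      then show ?case by (simp add: S_one dist_norm)
    qed
  qed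
  moreover have "\<forall>\<^sub>F N in sequentially. gf N (w N) (\<lambda>_. 1) = of_real (\<Sum>\<^sub>\<infinity>l\<in>signatures N. w N l)"
    using sm
  proof eventually_elim
    case (elim N)
    have "((\<lambda>l. of_real (w N l) :: complex) has_sum of_real (\<Sum>\<^sub>\<infinity>l\<in>signatures N. w N l)) (signatures N)"
      using elim by (intro has_sum_of_real has_sum_infsum)
    then show ?case unfolding gf1 by (rule infsumI)
  qed
  ultimately show "(\<lambda>N. of_real (\<Sum>\<^sub>\<infinity>l\<in>signatures N. w N l)) \<longlonglongrightarrow> c"
    by (rule Lim_transform_eventually)
qed

definition conv_prob :: "(nat \<Rightarrow> (nat \<Rightarrow> int) \<Rightarrow> real) \<Rightarrow> real \<Rightarrow> bool" where
  "conv_prob X x \<longleftrightarrow> (\<forall>e>0. (\<lambda>N. measure_pmf.prob (\<rho> N) {l. \<bar>X N l - x\<bar> > e}) \<longlonglongrightarrow> 0)"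

lemma prob_signatures: "measure_pmf.prob (\<rho> N) B = measure_pmf.prob (\<rho> N) (B \<inter> signatures N)"
proof (rule measure_pmf.finite_measure_eq_AE)
  show "AE x in measure_pmf (\<rho> N). (x \<in> B) = (x \<in> B \<inter> signatures N)"
    using supp[of N] by (auto simp: AE_measure_pmf_iff)
qed auto

text \<open>The bound is the expanded second moment of X - x about 0. Expectations are written as
  sums over signatures, which are exactly the quantities whose limits
  \<open>good_expectation\<close> provides.\<close>

lemma chebyshev:
  assumes X: "(\<lambda>l. pmf (\<rho> N) l * X l) summable_on signatures N" "(\<lambda>l. pmf (\<rho> N) l * X l * X l) summable_on signatures N" and e: "e > 0"
  shows "measure_pmf.prob (\<rho> N) {l. \<bar>X l - x\<bar> > e} \<le>
    ((\<Sum>\<^sub>\<infinity>l\<in>signatures N. pmf (\<rho> N) l * X l * X l) - 2 * x * (\<Sum>\<^sub>\<infinity>l\<in>signatures N. pmf (\<rho> N) l * X l) + x\<^sup>2) / e\<^sup>2"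
proof -
  let ?B = "{l. \<bar>X l - x\<bar> > e} \<inter> signatures N"
  let ?E1 = "\<Sum>\<^sub>\<infinity>l\<in>signatures N. pmf (\<rho> N) l * X l"
  let ?E2 = "\<Sum>\<^sub>\<infinity>l\<in>signatures N. pmf (\<rho> N) l * X l * X l"
  have p1: "(pmf (\<rho> N) has_sum 1) (signatures N)"
  proof -
    have "measure_pmf.prob (\<rho> N) (signatures N) = 1"
      using supp[of N] by (simp add: measure_pmf.prob_eq_1 AE_measure_pmf_iff subset_eq)
    then show ?thesis using pmf_has_sum[of "\<rho> N" "signatures N"] by simp
  qed
  have "((\<lambda>l. pmf (\<rho> N) l * X l * X l + (- 2 * x) * (pmf (\<rho> N) l * X l) + x\<^sup>2 * pmf (\<rho> N) l) has_sum (?E2 + (- 2 * x) * ?E1 + x\<^sup>2 * 1)) (signatures N)"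
    using X p1 by (intro has_sum_add has_sum_cmult_right has_sum_infsum)
  moreover have "(\<lambda>l. pmf (\<rho> N) l * X l * X l + (- 2 * x) * (pmf (\<rho> N) l * X l) + x\<^sup>2 * pmf (\<rho> N) l) = (\<lambda>l. pmf (\<rho> N) l * (X l - x)\<^sup>2)"
    by (auto simp: power2_eq_square algebra_simps)
  ultimately have v: "((\<lambda>l. pmf (\<rho> N) l * (X l - x)\<^sup>2) has_sum (?E2 - 2 * x * ?E1 + x\<^sup>2)) (signatures N)" by simp
  have "((\<lambda>l. e\<^sup>2 * pmf (\<rho> N) l) has_sum (e\<^sup>2 * measure_pmf.prob (\<rho> N) ?B)) ?B"
    by (intro has_sum_cmult_right pmf_has_sum)
  then have "e\<^sup>2 * measure_pmf.prob (\<rho> N) ?B \<le> ?E2 - 2 * x * ?E1 + x\<^sup>2"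
  proof (rule has_sum_mono_neutral[OF _ v])
    fix l assume "l \<in> ?B \<inter> signatures N"
    then have "e\<^sup>2 \<le> (X l - x)\<^sup>2" using e by (intro abs_le_square_iff[THEN iffD1]) auto
    then show "e\<^sup>2 * pmf (\<rho> N) l \<le> pmf (\<rho> N) l * (X l - x)\<^sup>2" using mult_left_mono[OF _ pmf_nonneg[of "\<rho> N" l], of "e\<^sup>2" "(X l - x)\<^sup>2"] by (simp only: mult.commute)
  qed (auto simp: pmf_nonneg)
  then show ?thesis using e unfolding prob_signatures[of N "{l. \<bar>X l - x\<bar> > e}"] by (simp add: le_divide_eq mult.commute)
qed

text \<open>Inserting the moment once gives the limit M of the means, inserting it twice gives M^2
  for the second moments, so the variance tends to 0. M is real as a limit of real numbers.\<close>

lemma ek_conv_prob: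
  shows "Mlim k = of_real (Re (Mlim k))" and "conv_prob (\<lambda>N l. ek N k l / real N ^ Suc k) (Re (Mlim k))"
proof -
  define X where "X = (\<lambda>N l. ek N k l / real N ^ Suc k)"
  have "good (\<lambda>N l. pmf (\<rho> N) l * ek N k l / real N ^ Suc k) (1 * Mlim k)" by (rule good_step[OF good_base])
  then have g1: "good (\<lambda>N l. pmf (\<rho> N) l * X N l) (Mlim k)" by (simp add: X_def)
  have "good (\<lambda>N l. pmf (\<rho> N) l * X N l * ek N k l / real N ^ Suc k) (Mlim k * Mlim k)" by (rule good_step[OF g1])
  then have g2: "good (\<lambda>N l. pmf (\<rho> N) l * X N l * X N l) (Mlim k * Mlim k)" by (simp add: X_def)
  define E1 where "E1 = (\<lambda>N. \<Sum>\<^sub>\<infinity>l\<in>signatures N. pmf (\<rho> N) l * X N l)"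
  define E2 where "E2 = (\<lambda>N. \<Sum>\<^sub>\<infinity>l\<in>signatures N. pmf (\<rho> N) l * X N l * X N l)"
  define \<mu> where "\<mu> = Re (Mlim k)"
  have l1: "(\<lambda>N. complex_of_real (E1 N)) \<longlonglongrightarrow> Mlim k" unfolding E1_def by (rule good_expectation(2)[OF g1])
  have l2: "(\<lambda>N. complex_of_real (E2 N)) \<longlonglongrightarrow> Mlim k * Mlim k" unfolding E2_def by (rule good_expectation(2)[OF g2])
  have "(\<lambda>N. Im (complex_of_real (E1 N))) \<longlonglongrightarrow> Im (Mlim k)" by (rule tendsto_Im[OF l1])
  then have im: "Im (Mlim k) = 0" by (simp add: LIMSEQ_const_iff)
  then show M: "Mlim k = of_real (Re (Mlim k))" by (simp add: complex_eq_iff)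
  have r1: "E1 \<longlonglongrightarrow> \<mu>" using tendsto_Re[OF l1] by (simp add: \<mu>_def)
  have r2: "E2 \<longlonglongrightarrow> \<mu> * \<mu>" using tendsto_Re[OF l2] im by (simp add: \<mu>_def)
  show "conv_prob (\<lambda>N l. ek N k l / real N ^ Suc k) (Re (Mlim k))"
    unfolding conv_prob_def X_def[symmetric] \<mu>_def[symmetric]
  proof (intro allI impI)
    fix e :: real assume e: "e > 0"
    have "(\<lambda>N. (E2 N - 2 * \<mu> * E1 N + \<mu>\<^sup>2) / e\<^sup>2) \<longlonglongrightarrow> (\<mu> * \<mu> - 2 * \<mu> * \<mu> + \<mu>\<^sup>2) / e\<^sup>2"
      by (intro tendsto_intros r1 r2) (use e in auto)
    then have lim: "(\<lambda>N. (E2 N - 2 * \<mu> * E1 N + \<mu>\<^sup>2) / e\<^sup>2) \<longlonglongrightarrow> 0" by (simp add: power2_eq_square)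
    show "(\<lambda>N. measure_pmf.prob (\<rho> N) {l. \<bar>X N l - \<mu>\<bar> > e}) \<longlonglongrightarrow> 0"
    proof (rule tendsto_sandwich[OF _ _ tendsto_const lim])
      show "\<forall>\<^sub>F N in sequentially. measure_pmf.prob (\<rho> N) {l. \<bar>X N l - \<mu>\<bar> > e} \<le> (E2 N - 2 * \<mu> * E1 N + \<mu>\<^sup>2) / e\<^sup>2"
        using good_expectation(1)[OF g1] good_expectation(1)[OF g2]
        by eventually_elim (unfold E1_def E2_def, rule chebyshev[OF _ _ e])
    qed simp
  qed
qed

text \<open>The common pattern of sums, products and eventual equality: a union bound transfers
  convergence once closeness of X and Y forces closeness of Z. This is demanded only for large N and
  on signatures, which carry all the mass.\<close>

lemma conv_prob_map2:
  assumes X: "conv_prob X x" and Y: "conv_prob Y y"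
    and cont: "\<And>e. e > 0 \<Longrightarrow> \<exists>d>0. \<forall>\<^sub>F N in sequentially. \<forall>l\<in>signatures N. \<bar>X N l - x\<bar> \<le> d \<longrightarrow> \<bar>Y N l - y\<bar> \<le> d \<longrightarrow> \<bar>Z N l - z\<bar> \<le> e"
  shows "conv_prob Z z"
  unfolding conv_prob_def
proof (intro allI impI)
  fix e :: real assume "e > 0"
  then obtain d where d: "d > 0" "\<forall>\<^sub>F N in sequentially. \<forall>l\<in>signatures N. \<bar>X N l - x\<bar> \<le> d \<longrightarrow> \<bar>Y N l - y\<bar> \<le> d \<longrightarrow> \<bar>Z N l - z\<bar> \<le> e"
    using cont by blast
  have lim: "(\<lambda>N. measure_pmf.prob (\<rho> N) {l. \<bar>X N l - x\<bar> > d} + measure_pmf.prob (\<rho> N) {l. \<bar>Y N l - y\<bar> > d}) \<longlonglongrightarrow> 0"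
    using X Y d(1) tendsto_add[of _ 0 _ _ 0] unfolding conv_prob_def by fastforce
  show "(\<lambda>N. measure_pmf.prob (\<rho> N) {l. \<bar>Z N l - z\<bar> > e}) \<longlonglongrightarrow> 0"
  proof (rule tendsto_sandwich[OF _ _ tendsto_const lim])
    show "\<forall>\<^sub>F N in sequentially. measure_pmf.prob (\<rho> N) {l. \<bar>Z N l - z\<bar> > e} \<le>
       measure_pmf.prob (\<rho> N) {l. \<bar>X N l - x\<bar> > d} + measure_pmf.prob (\<rho> N) {l. \<bar>Y N l - y\<bar> > d}"
      using d(2)
    proof eventually_elim
      case (elim N)
      have "measure_pmf.prob (\<rho> N) {l. \<bar>Z N l - z\<bar> > e} = measure_pmf.prob (\<rho> N) ({l. \<bar>Z N l - z\<bar> > e} \<inter> signatures N)"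
        by (rule prob_signatures)
      also have "\<dots> \<le> measure_pmf.prob (\<rho> N) ({l. \<bar>X N l - x\<bar> > d} \<union> {l. \<bar>Y N l - y\<bar> > d})"
        by (rule measure_pmf.finite_measure_mono) (use elim in force)+
      also have "\<dots> \<le> measure_pmf.prob (\<rho> N) {l. \<bar>X N l - x\<bar> > d} + measure_pmf.prob (\<rho> N) {l. \<bar>Y N l - y\<bar> > d}"
        by (rule measure_Un_le) auto
      finally show ?case .
    qed
  qed simp
qed

lemma conv_prob_cong:
  assumes "conv_prob X x" "\<forall>\<^sub>F N in sequentially. \<forall>l\<in>signatures N. X N l = Y N l"
  shows "conv_prob Y x"
proof (rule conv_prob_map2[OF assms(1) assms(1)])
  fix e :: real assume "e > 0"
  then show "\<exists>d>0. \<forall>\<^sub>F N in sequentially. \<forall>l\<in>signatures N. \<bar>X N l - x\<bar> \<le> d \<longrightarrow> \<bar>X N l - x\<bar> \<le> d \<longrightarrow> \<bar>Y N l - x\<bar> \<le> e"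
    by (intro exI[of _ e] conjI eventually_mono[OF assms(2)]) auto
qed

lemma conv_prob_det: "a \<longlonglongrightarrow> x \<Longrightarrow> conv_prob (\<lambda>N l. a N) x"
  unfolding conv_prob_def
proof (intro allI impI)
  fix e :: real assume a: "a \<longlonglongrightarrow> x" and "e > 0"
  then have "\<forall>\<^sub>F N in sequentially. dist (a N) x < e" by (intro tendstoD) auto
  then have "\<forall>\<^sub>F N in sequentially. 0 = measure_pmf.prob (\<rho> N) {l. \<bar>a N - x\<bar> > e}"
    by eventually_elim (simp add: dist_real_def)
  then show "(\<lambda>N. measure_pmf.prob (\<rho> N) {l. \<bar>a N - x\<bar> > e}) \<longlonglongrightarrow> 0" by (rule Lim_transform_eventually[OF tendsto_const])
qed

lemma conv_prob_add:
  assumes "conv_prob X x" "conv_prob Y y"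
  shows "conv_prob (\<lambda>N l. X N l + Y N l) (x + y)"
proof (rule conv_prob_map2[OF assms])
  fix e :: real assume "e > 0"
  then show "\<exists>d>0. \<forall>\<^sub>F N in sequentially. \<forall>l\<in>signatures N. \<bar>X N l - x\<bar> \<le> d \<longrightarrow> \<bar>Y N l - y\<bar> \<le> d \<longrightarrow> \<bar>X N l + Y N l - (x + y)\<bar> \<le> e"
    by (intro exI[of _ "e / 2"] conjI always_eventually allI ballI impI) linarith+
qed

lemma conv_prob_mult:
  assumes "conv_prob X x" "conv_prob Y y"
  shows "conv_prob (\<lambda>N l. X N l * Y N l) (x * y)"
proof (rule conv_prob_map2[OF assms])
  fix e :: real assume e: "e > 0"
  define K where "K = 1 + \<bar>x\<bar> + \<bar>y\<bar>"
  define d where "d = min 1 (e / K)"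
  have K: "K > 0" by (simp add: K_def add_pos_nonneg)
  have d: "d > 0" "d \<le> 1" "d * K \<le> e"
  proof -
    have "d * K \<le> e / K * K" using K by (intro mult_right_mono) (auto simp: d_def)
    then show "d * K \<le> e" using K by simp
  qed (use e K in \<open>auto simp: d_def\<close>)
  have "\<bar>a * b - x * y\<bar> \<le> e" if "\<bar>a - x\<bar> \<le> d" "\<bar>b - y\<bar> \<le> d" for a b
  proof -
    have "a * b - x * y = (a - x) * (b - y) + x * (b - y) + y * (a - x)" by (simp add: algebra_simps)
    then have "\<bar>a * b - x * y\<bar> \<le> \<bar>a - x\<bar> * \<bar>b - y\<bar> + \<bar>x\<bar> * \<bar>b - y\<bar> + \<bar>y\<bar> * \<bar>a - x\<bar>"
      using abs_triangle_ineq[of "(a - x) * (b - y) + x * (b - y)" "y * (a - x)"] abs_triangle_ineq[of "(a - x) * (b - y)" "x * (b - y)"]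
      by (simp add: abs_mult)
    also have "\<dots> \<le> d * 1 + \<bar>x\<bar> * d + \<bar>y\<bar> * d"
      using that d by (intro add_mono mult_mono) auto
    also have "\<dots> = d * K" by (simp add: K_def algebra_simps)
    finally show ?thesis using d by simp
  qed
  then show "\<exists>d>0. \<forall>\<^sub>F N in sequentially. \<forall>l\<in>signatures N. \<bar>X N l - x\<bar> \<le> d \<longrightarrow> \<bar>Y N l - y\<bar> \<le> d \<longrightarrow> \<bar>X N l * Y N l - x * y\<bar> \<le> e"
    using d by (intro exI[of _ d]) auto
qed

lemma conv_prob_sum:
  assumes "finite A" "\<And>a. a \<in> A \<Longrightarrow> conv_prob (X a) (x a)"
  shows "conv_prob (\<lambda>N l. \<Sum>a\<in>A. X a N l) (\<Sum>a\<in>A. x a)"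
  using assms
proof (induction A rule: finite_induct)
  case empty
  show ?case using conv_prob_det[OF tendsto_const[of 0]] by simp
next
  case (insert a A)
  then show ?case using conv_prob_add[of "X a" "x a"] by simp
qed

definition \<mu> :: "nat \<Rightarrow> real" where "\<mu> k = Re (Mlim k)"

text \<open>From \<open>x * fallfac b x = fallfac (b + 1) x + b * fallfac b x\<close>, where the
  second term has lower degree and vanishes after normalisation. The limit thus depends on a + b
  alone, and powers inherit the limits of falling factorials.\<close>

lemma mixed_power_conv_prob:
  "conv_prob (\<lambda>N l. (\<Sum>i\<in>{1..N}. real_of_int (ell N l i) ^ a * fallfac b (ell N l i)) / real N ^ Suc (a + b)) (\<mu> (a + b))"
proof (induction a arbitrary: b)
  case 0
  show ?case using ek_conv_prob(2)[of b] by (simp add: ek_def \<mu>_def)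
next
  case (Suc a)
  let ?Y = "\<lambda>a b N l. (\<Sum>i\<in>{1..N}. real_of_int (ell N l i) ^ a * fallfac b (ell N l i)) / real N ^ Suc (a + b)"
  have "(\<lambda>N. real b / real N) \<longlonglongrightarrow> 0" by real_asymp
  then have "conv_prob (\<lambda>N l. ?Y a (Suc b) N l + real b / real N * ?Y a b N l) (\<mu> (a + Suc b) + 0 * \<mu> (a + b))"
    by (intro conv_prob_add conv_prob_mult Suc.IH conv_prob_det)
  then have "conv_prob (\<lambda>N l. ?Y (Suc a) b N l) (\<mu> (a + Suc b) + 0 * \<mu> (a + b))"
  proof (rule conv_prob_cong, intro eventually_mono[OF eventually_ge_at_top[of 1]] ballI)
    fix N l assume N: "(1::nat) \<le> N"
    have "(\<Sum>i\<in>{1..N}. real_of_int (ell N l i) ^ Suc a * fallfac b (ell N l i))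
      = (\<Sum>i\<in>{1..N}. real_of_int (ell N l i) ^ a * fallfac (Suc b) (ell N l i)) + real b * (\<Sum>i\<in>{1..N}. real_of_int (ell N l i) ^ a * fallfac b (ell N l i))"
      unfolding sum_distrib_left sum.distrib[symmetric] by (intro sum.cong refl) (simp add: fallfac_def algebra_simps)
    then show "?Y a (Suc b) N l + real b / real N * ?Y a b N l = ?Y (Suc a) b N l"
      using N by (simp add: add_divide_distrib mult_ac)
  qed
  then show ?case by simp
qed

lemma power_sum_conv_prob:
  "conv_prob (\<lambda>N l. (\<Sum>i\<in>{1..N}. real_of_int (ell N l i) ^ a) / real N ^ Suc a) (\<mu> a)"
  using mixed_power_conv_prob[of a 0] by (simp add: fallfac_def)

end

section \<open>Moments of the Perelomov-Popov measure\<close>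

text \<open>The polynomial p, the difference of the monic polynomials with roots x j + q and x j,
  has degree below \<open>card I\<close> and is determined by its values at the x i. There the
  factor j = i contributes -q and the rest gives the weight. Substituting z = 1 / t and clearing
  denominators yields the identity.\<close>

lemma one_minus_prod_fps:
  fixes x :: "'i \<Rightarrow> real" and q :: real
  assumes "finite I" "inj_on x I"
  defines "w \<equiv> \<lambda>i. \<Prod>j\<in>I-{i}. (x i - x j - q) / (x i - x j)"
  shows "(\<Prod>j\<in>I. 1 - fps_const (x j + q) * fps_X) = (\<Prod>j\<in>I. 1 - fps_const (x j) * fps_X)
     - fps_X * (\<Sum>i\<in>I. fps_const (q * w i) * (\<Prod>j\<in>I-{i}. 1 - fps_const (x j) * fps_X))"
proof -
  define p where "p = (\<Prod>j\<in>I. [:- x j - q, 1:]) - (\<Prod>j\<in>I. [:- x j, 1:])"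
  have nz: "(\<Prod>j\<in>I-{i}. x i - x j) \<noteq> 0" if "i \<in> I" for i using assms(1,2) that by (auto simp: inj_on_def)
  have pz: "poly p z = - (\<Sum>i\<in>I. q * w i * (\<Prod>j\<in>I-{i}. z - x j))" for z
  proof (cases "I = {}")
    case True
    then show ?thesis by (simp add: p_def)
  next
    case False
    have deg1: "degree (\<Prod>j\<in>I. [:- x j - q, 1:]) = card I" "degree (\<Prod>j\<in>I. [:- x j, 1:]) = card I"
      by (subst degree_prod_sum_eq; simp)+
    have lc: "coeff (\<Prod>j\<in>I. [:- x j - q, 1:]) (card I) = 1" "coeff (\<Prod>j\<in>I. [:- x j, 1:]) (card I) = 1"
      using lead_coeff_prod[of "\<lambda>j. [:- x j - q, 1:]" I] lead_coeff_prod[of "\<lambda>j. [:- x j, 1:]" I] deg1 by simp_all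
    have "degree p \<le> card I" unfolding p_def using deg1 by (intro degree_diff_le) auto
    moreover have "coeff p (card I) = 0" using lc by (simp add: p_def)
    moreover have "card I > 0" using False assms(1) by (simp add: card_gt_0_iff)
    ultimately have deg: "degree p < card I" by (metis degree_0 leading_coeff_0_iff order_le_imp_less_or_eq)
    have pv: "poly p (x i) = - q * (\<Prod>j\<in>I-{i}. x i - x j - q)" if i: "i \<in> I" for i
    proof -
      have "(\<Prod>j\<in>I. x i - x j) = 0" using i assms(1) by (intro prod_zero) auto
      moreover have "(\<Prod>j\<in>I. x i - x j - q) = (x i - x i - q) * (\<Prod>j\<in>I-{i}. x i - x j - q)"
        by (rule prod.remove[OF assms(1) i])
      moreover have "poly p (x i) = (\<Prod>j\<in>I. x i - x j - q) - (\<Prod>j\<in>I. x i - x j)"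
        by (simp add: p_def poly_prod algebra_simps)
      ultimately show ?thesis by simp
    qed
    have "poly p z = (\<Sum>i\<in>I. poly p (x i) / (\<Prod>j\<in>I-{i}. x i - x j) * (\<Prod>j\<in>I-{i}. z - x j))"
      by (subst lagrange_interpolation[OF assms(1,2) deg]) (simp add: poly_sum poly_prod)
    also have "\<dots> = (\<Sum>i\<in>I. - (q * w i * (\<Prod>j\<in>I-{i}. z - x j)))"
      by (intro sum.cong refl) (simp add: pv w_def prod_dividef)
    finally show ?thesis by (simp add: sum_negf)
  qed
  define P1 where "P1 = (\<Prod>j\<in>I. [:1, - (x j + q):])"
  define P2 where "P2 = (\<Prod>j\<in>I. [:1, - x j:]) - [:0, 1:] * (\<Sum>i\<in>I. smult (q * w i) (\<Prod>j\<in>I-{i}. [:1, - x j:]))"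
  have "poly P1 t = poly P2 t" if t: "t \<noteq> 0" for t
  proof -
    have pr: "(\<Prod>j\<in>A. 1 - c j * t) = t ^ card A * (\<Prod>j\<in>A. 1 / t - c j)" if "finite A" for A and c :: "'i \<Rightarrow> real"
    proof -
      have "(\<Prod>j\<in>A. 1 - c j * t) = (\<Prod>j\<in>A. t * (1 / t - c j))" by (intro prod.cong refl) (use t in \<open>simp add: field_simps\<close>)
      then show ?thesis by (simp add: prod.distrib)
    qed
    have "poly P1 t - (\<Prod>j\<in>I. 1 - x j * t) = t ^ card I * ((\<Prod>j\<in>I. 1 / t - (x j + q)) - (\<Prod>j\<in>I. 1 / t - x j))"
      using pr[OF assms(1), of "\<lambda>j. x j + q"] pr[OF assms(1), of x] by (simp add: P1_def poly_prod algebra_simps)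
    also have "(\<Prod>j\<in>I. 1 / t - (x j + q)) - (\<Prod>j\<in>I. 1 / t - x j) = poly p (1 / t)"
      by (simp add: p_def poly_prod algebra_simps)
    also have "t ^ card I * \<dots> = - (\<Sum>i\<in>I. t * (q * w i * (\<Prod>j\<in>I-{i}. 1 - x j * t)))"
    proof -
      have "t ^ card I * (q * w i * (\<Prod>j\<in>I-{i}. 1 / t - x j)) = t * (q * w i * (\<Prod>j\<in>I-{i}. 1 - x j * t))" if i: "i \<in> I" for i
      proof -
        have "(\<Prod>j\<in>I-{i}. 1 - x j * t) = t ^ (card I - 1) * (\<Prod>j\<in>I-{i}. 1 / t - x j)" using pr[of "I - {i}" x] assms(1) i by simp
        moreover have "t ^ card I = t * t ^ (card I - 1)"
          using i assms(1) by (metis card_gt_0_iff empty_iff power_eq_if not_gr_zero)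
        ultimately show ?thesis by simp
      qed
      then have "(\<Sum>i\<in>I. t ^ card I * (q * w i * (\<Prod>j\<in>I-{i}. 1 / t - x j))) = (\<Sum>i\<in>I. t * (q * w i * (\<Prod>j\<in>I-{i}. 1 - x j * t)))"
        by (rule sum.cong[OF refl])
      then show ?thesis unfolding pz by (simp only: mult_minus_right sum_distrib_left)
    qed
    finally show ?thesis by (simp add: P2_def poly_prod poly_sum sum_distrib_left algebra_simps)
  qed
  then have "P1 = P2"
  proof -
    have "\<forall>t. t * poly (P1 - P2) t = 0" using \<open>\<And>t. t \<noteq> 0 \<Longrightarrow> poly P1 t = poly P2 t\<close> by auto
    then have "poly ([:0, 1:] * (P1 - P2)) = poly 0" by auto
    then have "[:0, 1:] * (P1 - P2) = 0" by (simp only: poly_eq_poly_eq_iff)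
    then show ?thesis by simp
  qed
  then have "fps_of_poly P1 = fps_of_poly P2" by simp
  moreover have c: "fps_of_poly [:1, - c:] = 1 - fps_const c * fps_X" for c :: real
    by (simp add: fps_of_poly_linear' fps_const_neg[symmetric] del: fps_const_neg)
  moreover have "fps_of_poly [:0, 1::real:] = fps_X" by (simp add: fps_of_poly_linear')
  ultimately show ?thesis
    by (simp only: P1_def P2_def fps_of_poly_prod fps_of_poly_diff fps_of_poly_mult fps_of_poly_sum fps_of_poly_smult c)
qed

text \<open>\<open>G = 1 - q X a\<close>, with a the generating series of A, is the quotient of two
  products, and the coefficients of its logarithmic derivative are differences of power sums of x
  and x + q. C b is the sum of the ((x j + q)^b - (x j)^b) / q, written as a polynomial in q by the
  binomial theorem, so that it makes sense at q = 0.\<close>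

lemma pp_power_sum_recurrence:
  fixes x :: "'i \<Rightarrow> real" and q :: real
  assumes I: "finite I" "inj_on x I"
  defines "w \<equiv> \<lambda>i. \<Prod>j\<in>I-{i}. (x i - x j - q) / (x i - x j)"
  defines "A \<equiv> \<lambda>k. \<Sum>i\<in>I. w i * x i ^ k"
  defines "C \<equiv> \<lambda>b. \<Sum>j\<in>I. \<Sum>s<b. real (b choose s) * x j ^ s * q ^ (b - 1 - s)"
  shows "real (Suc k) * A k = C (Suc k) - q * (\<Sum>b=1..k. A (k - b) * C b)"
proof (cases "q = 0")
  case True
  have "w i = 1" if "i \<in> I" for i
    unfolding w_def using True I that by (intro prod.neutral ballI) (auto simp: inj_on_def)
  moreover have "(\<Sum>s<Suc k. real (Suc k choose s) * y ^ s * q ^ (Suc k - 1 - s)) = real (Suc k) * y ^ k" for y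
  proof -
    have "(\<Sum>s<Suc k. real (Suc k choose s) * y ^ s * q ^ (Suc k - 1 - s)) = (\<Sum>s\<in>{k}. real (Suc k choose s) * y ^ s * q ^ (Suc k - 1 - s))"
      using True by (intro sum.mono_neutral_right) auto
    then show ?thesis using True by simp
  qed
  ultimately show ?thesis using True by (simp add: A_def C_def sum_distrib_left)
next
  case False
  let ?g = "\<lambda>c::real. Abs_fps (\<lambda>n. c ^ n)"
  have geo: "?g c * (1 - fps_const c * fps_X) = 1" for c
    by (rule fps_ext) (simp add: algebra_simps fps_X_mult_nth fps_mult_fps_X_commute[symmetric] fps_mult_left_const_nth power_eq_if)
  define E where "E = (\<Prod>j\<in>I. 1 - fps_const (x j) * fps_X)"
  define F where "F = (\<Prod>j\<in>I. 1 - fps_const (x j + q) * fps_X)"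
  define a where "a = Abs_fps A"
  define G where "G = 1 - fps_const q * fps_X * a"
  have dprod: "fps_deriv (\<Prod>j\<in>I. 1 - fps_const (y j) * fps_X) = (\<Prod>j\<in>I. 1 - fps_const (y j) * fps_X) * (- (\<Sum>j\<in>I. fps_const (y j) * ?g (y j)))" for y :: "'i \<Rightarrow> real"
    using I(1)
  proof (induction I rule: finite_induct)
    case (insert i I)
    let ?P = "\<Prod>j\<in>I. 1 - fps_const (y j) * fps_X"
    have "fps_deriv (\<Prod>j\<in>insert i I. 1 - fps_const (y j) * fps_X) = (1 - fps_const (y i) * fps_X) * fps_deriv ?P + fps_deriv (1 - fps_const (y i) * fps_X) * ?P"
      using insert.hyps by simp
    also have "fps_deriv (1 - fps_const (y i) * fps_X) = - fps_const (y i)" by simp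
    also have "- fps_const (y i) * ?P = (1 - fps_const (y i) * fps_X) * ?P * (- (fps_const (y i) * ?g (y i)))"
    proof -
      have "(1 - fps_const (y i) * fps_X) * ?P * (- (fps_const (y i) * ?g (y i))) = - (fps_const (y i) * ?P * (?g (y i) * (1 - fps_const (y i) * fps_X)))"
        by (simp only: mult_minus_right mult_minus_left) (simp only: mult_ac)
      then show ?thesis by (simp only: geo mult_1_right mult_minus_left)
    qed
    finally show ?case using insert by (simp add: algebra_simps)
  qed simp
  have FE: "F = E * G"
  proof -
    have "F = E - fps_X * (\<Sum>i\<in>I. fps_const (q * w i) * (\<Prod>j\<in>I-{i}. 1 - fps_const (x j) * fps_X))"
      unfolding F_def E_def w_def by (rule one_minus_prod_fps[OF I])
    also have "(\<Sum>i\<in>I. fps_const (q * w i) * (\<Prod>j\<in>I-{i}. 1 - fps_const (x j) * fps_X)) = (\<Sum>i\<in>I. fps_const (q * w i) * (E * ?g (x i)))"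
    proof (intro sum.cong refl)
      fix i assume i: "i \<in> I"
      have "E = (1 - fps_const (x i) * fps_X) * (\<Prod>j\<in>I-{i}. 1 - fps_const (x j) * fps_X)"
        unfolding E_def by (rule prod.remove[OF I(1) i])
      then have "E * ?g (x i) = (?g (x i) * (1 - fps_const (x i) * fps_X)) * (\<Prod>j\<in>I-{i}. 1 - fps_const (x j) * fps_X)"
        by (simp only: mult_ac)
      then show "fps_const (q * w i) * (\<Prod>j\<in>I-{i}. 1 - fps_const (x j) * fps_X) = fps_const (q * w i) * (E * ?g (x i))"
        by (simp only: geo mult_1_left)
    qed
    also have "\<dots> = E * (fps_const q * a)"
    proof -
      have "fps_const q * a = (\<Sum>i\<in>I. fps_const (q * w i) * ?g (x i))"
        by (rule fps_ext) (simp add: a_def A_def fps_sum_nth sum_distrib_left mult_ac)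
      then show ?thesis by (simp add: sum_distrib_left mult_ac)
    qed
    finally show ?thesis by (simp add: G_def algebra_simps)
  qed
  define ef where "ef = - (\<Sum>j\<in>I. fps_const (x j) * ?g (x j))"
  define ff where "ff = - (\<Sum>j\<in>I. fps_const (x j + q) * ?g (x j + q))"
  have dE: "fps_deriv E = E * ef" unfolding E_def ef_def by (rule dprod)
  have dF: "fps_deriv F = F * ff" unfolding F_def ff_def by (rule dprod)
  have "E * G * ff = E * fps_deriv G + E * ef * G" using dF unfolding FE by (simp add: dE)
  then have "E * (G * ff - ef * G - fps_deriv G) = 0" by (simp add: algebra_simps)
  moreover have "E \<noteq> 0"
  proof -
    have "fps_nth E 0 = 1" unfolding E_def using I(1) by (induction I rule: finite_induct) simp_all
    then show ?thesis by auto
  qed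
  ultimately have "G * ff - ef * G - fps_deriv G = 0" by (metis mult_eq_0_iff)
  then have dG: "fps_deriv G = G * (ff - ef)" by (simp add: algebra_simps)
  have qC: "q * C b = (\<Sum>j\<in>I. (x j + q) ^ b - x j ^ b)" for b
  proof -
    have "q * (\<Sum>s<b. real (b choose s) * y ^ s * q ^ (b - 1 - s)) = (y + q) ^ b - y ^ b" for y
    proof -
      have "(y + q) ^ b = (\<Sum>s\<le>b. real (b choose s) * y ^ s * q ^ (b - s))" by (rule binomial_ring)
      also have "\<dots> = (\<Sum>s<b. real (b choose s) * y ^ s * q ^ (b - s)) + y ^ b"
        by (simp add: lessThan_Suc_atMost[symmetric])
      also have "(\<Sum>s<b. real (b choose s) * y ^ s * q ^ (b - s)) = q * (\<Sum>s<b. real (b choose s) * y ^ s * q ^ (b - 1 - s))"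
        unfolding sum_distrib_left
      proof (intro sum.cong refl)
        fix s assume "s \<in> {..<b}"
        then have "b - s = Suc (b - 1 - s)" by auto
        then show "real (b choose s) * y ^ s * q ^ (b - s) = q * (real (b choose s) * y ^ s * q ^ (b - 1 - s))" by simp
      qed
      finally show ?thesis by simp
    qed
    then show ?thesis by (simp add: C_def sum_distrib_left[of q])
  qed
  have fe: "fps_nth (ff - ef) n = - (q * C (Suc n))" for n
    unfolding qC ff_def ef_def by (simp add: fps_sum_nth sum_subtractf)
  have Gn: "fps_nth G n = (if n = 0 then 1 else - q * A (n - 1))" for n
    by (simp add: G_def a_def mult.assoc fps_X_mult_nth)
  have "real (Suc k) * fps_nth G (Suc k) = (\<Sum>i=0..k. fps_nth G i * fps_nth (ff - ef) (k - i))"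
    using arg_cong[OF dG, of "\<lambda>f. fps_nth f k"] by (simp add: fps_mult_nth)
  also have "\<dots> = fps_nth G 0 * fps_nth (ff - ef) k + (\<Sum>i=1..k. fps_nth G i * fps_nth (ff - ef) (k - i))"
    by (simp add: sum.atLeast_Suc_atMost)
  also have "(\<Sum>i=1..k. fps_nth G i * fps_nth (ff - ef) (k - i)) = (\<Sum>i=1..k. q * q * (A (i - 1) * C (Suc (k - i))))"
    by (intro sum.cong refl) (auto simp: fe Gn simp del: fps_sub_nth)
  also have "\<dots> = (\<Sum>b=1..k. q * q * (A (k - b) * C b))"
    by (rule sum.reindex_bij_witness[of _ "\<lambda>b. Suc k - b" "\<lambda>i. Suc k - i"]) (auto simp: Suc_diff_le)
  finally have "real (Suc k) * (- q * A k) = - (q * C (Suc k)) + q * q * (\<Sum>b=1..k. A (k - b) * C b)"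
    unfolding fe Gn by (simp add: sum_distrib_left)
  \<comment> \<open>Both sides carry the factor -q, which is cancelled here; for q = 0 all weights
    are 1 and the claim was direct.\<close>
  then have "(- q) * (real (Suc k) * A k) = (- q) * (C (Suc k) - q * (\<Sum>b=1..k. A (k - b) * C b))" by (simp add: algebra_simps)
  then show ?thesis using False by simp
qed

section \<open>Lagrange inversion\<close>

lemma fps_nth_power_X_mult: "fps_nth (fps_X ^ i * (f :: complex fps)) n = (if n < i then 0 else fps_nth f (n - i))"
  by (simp add: fps_X_power_mult_nth)

text \<open>Residue calculus on coefficients. With A = X / a, the coefficient of order n - 1 of
  \<open>A^i * A' * a^n\<close> is the residue of A^(i-n) A', which is 1 for i = n - 1 and 0 for
  smaller i; expanding the derivative of the composite in powers of A picks out one coefficient of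
  \<Phi>'.\<close>

lemma fps_lagrange_inversion:
  fixes \<Phi> a :: "complex fps"
  assumes a0: "fps_nth a 0 \<noteq> 0" and n: "n \<ge> 1"
  shows "of_nat n * fps_nth \<Phi> n = fps_nth (fps_deriv (\<Phi> oo (fps_X * inverse a)) * a ^ n) (n - 1)"
proof -
  define A where "A = fps_X * inverse a"
  have A0: "fps_nth A 0 = 0" by (simp add: A_def)
  have aA: "a * A = fps_X" using a0 by (simp add: A_def inverse_mult_eq_1' mult_ac)
  have ai: "a * inverse a = 1" using a0 by (simp add: inverse_mult_eq_1')
  have dA: "a ^ 2 * fps_deriv A = a - fps_X * fps_deriv a"
  proof -
    have "fps_deriv (a * A) = 1" unfolding aA by simp
    then have "a * fps_deriv A + fps_deriv a * A = 1" by (simp add: mult_ac add.commute)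
    then have "a * (a * fps_deriv A + fps_deriv a * A) = a" by simp
    then have "a ^ 2 * fps_deriv A + fps_deriv a * (a * A) = a" by (simp add: algebra_simps power2_eq_square)
    then show ?thesis unfolding aA by (simp add: algebra_simps)
  qed
  have key: "fps_nth (A ^ i * fps_deriv A * a ^ n) (n - 1) = (if i = n - 1 then 1 else 0)" if i: "i \<le> n - 1" for i
  proof -
    define d where "d = n - 1 - i"
    have nd: "n = i + Suc d" using i n by (simp add: d_def)
    have e1: "A ^ i * fps_deriv A * a ^ n = fps_X ^ i * (a ^ Suc d * fps_deriv A)"
    proof -
      have "A ^ i * fps_deriv A * a ^ n = (a * A) ^ i * (a ^ Suc d * fps_deriv A)"
        unfolding nd power_add power_mult_distrib by (simp only: mult_ac)
      then show ?thesis unfolding aA .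
    qed
    have e2: "fps_nth (A ^ i * fps_deriv A * a ^ n) (n - 1) = fps_nth (a ^ Suc d * fps_deriv A) d"
      unfolding e1 fps_nth_power_X_mult using nd by simp
    show ?thesis
    proof (cases "d = 0")
      case True
      have "fps_nth (a ^ 2 * fps_deriv A) 0 = fps_nth a 0" unfolding dA by simp
      then have "fps_nth a 0 * (fps_nth a 0 * fps_nth (fps_deriv A) 0) = fps_nth a 0 * 1" by (simp add: power2_eq_square mult.assoc)
      then have "fps_nth a 0 * fps_nth (fps_deriv A) 0 = 1" by (simp only: mult_left_cancel[OF a0])
      then show ?thesis using e2 True nd by simp
    next
      case False
      \<comment> \<open>The residue vanishes for d > 0: \<open>a^(d+1) * A'\<close> is
        \<open>a^d - X * a^(d-1) * a'\<close>, and both parts have the same coefficient of order d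
        because \<open>(a^d)' = d * a^(d-1) * a'\<close>.\<close>
      then obtain c where c: "d = Suc c" by (cases d) auto
      have "a ^ Suc d * fps_deriv A = a ^ c * (a ^ 2 * fps_deriv A)" by (simp add: c power2_eq_square mult_ac)
      also have "\<dots> = a ^ d - fps_X * (a ^ c * fps_deriv a)" unfolding dA by (simp add: c algebra_simps)
      finally have e3: "fps_nth (a ^ Suc d * fps_deriv A) d = fps_nth (a ^ d) d - fps_nth (a ^ c * fps_deriv a) c"
        by (simp add: c fps_X_mult_nth)
      have "fps_deriv (a ^ d) = fps_const (of_nat d) * fps_deriv a * a ^ (d - 1)" by (rule fps_deriv_power)
      then have "fps_deriv (a ^ d) = fps_const (of_nat d) * (a ^ c * fps_deriv a)" unfolding c by (simp only: mult_ac diff_Suc_1)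
      then have "fps_nth (fps_deriv (a ^ d)) c = of_nat d * fps_nth (a ^ c * fps_deriv a) c" by (simp only: fps_mult_left_const_nth)
      then have "of_nat (Suc c) * fps_nth (a ^ d) d = of_nat (Suc c) * fps_nth (a ^ c * fps_deriv a) c"
        unfolding fps_deriv_nth by (simp only: c Suc_eq_plus1)
      then have "fps_nth (a ^ d) d = fps_nth (a ^ c * fps_deriv a) c" by (simp only: mult_left_cancel[OF of_nat_neq_0])
      then show ?thesis using e2 e3 False nd by simp
    qed
  qed
  have "fps_deriv (\<Phi> oo A) * a ^ n = (fps_deriv \<Phi> oo A) * (fps_deriv A * a ^ n)"
    by (simp add: fps_compose_deriv[OF A0] mult.assoc)
  then have "fps_nth (fps_deriv (\<Phi> oo A) * a ^ n) (n - 1) = (\<Sum>j=0..n-1. fps_nth (fps_deriv \<Phi> oo A) j * fps_nth (fps_deriv A * a ^ n) (n - 1 - j))"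
    by (simp only: fps_mult_nth)
  also have "\<dots> = (\<Sum>j=0..n-1. \<Sum>i=0..n-1. fps_nth (fps_deriv \<Phi>) i * (fps_nth (A ^ i) j * fps_nth (fps_deriv A * a ^ n) (n - 1 - j)))"
  proof (intro sum.cong refl)
    fix j assume j: "j \<in> {0..n-1}"
    have "fps_nth (fps_deriv \<Phi> oo A) j = (\<Sum>i=0..j. fps_nth (fps_deriv \<Phi>) i * fps_nth (A ^ i) j)" by (rule fps_compose_nth)
    also have "\<dots> = (\<Sum>i=0..n-1. fps_nth (fps_deriv \<Phi>) i * fps_nth (A ^ i) j)"
      by (rule sum.mono_neutral_left) (use j in \<open>auto simp: startsby_zero_power_prefix[OF A0]\<close>)
    finally show "fps_nth (fps_deriv \<Phi> oo A) j * fps_nth (fps_deriv A * a ^ n) (n - 1 - j) = (\<Sum>i=0..n-1. fps_nth (fps_deriv \<Phi>) i * (fps_nth (A ^ i) j * fps_nth (fps_deriv A * a ^ n) (n - 1 - j)))"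
      by (simp add: sum_distrib_right mult.assoc)
  qed
  also have "\<dots> = (\<Sum>i=0..n-1. fps_nth (fps_deriv \<Phi>) i * fps_nth (A ^ i * fps_deriv A * a ^ n) (n - 1))"
    by (subst sum.swap) (simp add: sum_distrib_left[symmetric] fps_mult_nth mult.assoc)
  also have "\<dots> = (\<Sum>i=0..n-1. fps_nth (fps_deriv \<Phi>) i * (if i = n - 1 then 1 else 0))"
    by (intro sum.cong refl arg_cong2[where f=times] key) simp
  also have "\<dots> = of_nat n * fps_nth \<Phi> n"
  proof -
    obtain p where p: "n = Suc p" using n by (cases n) auto
    have "(\<Sum>i=0..p. fps_nth (fps_deriv \<Phi>) i * (if i = p then 1 else 0)) = fps_nth (fps_deriv \<Phi>) p"
      by (subst sum.mono_neutral_cong_right[of _ "{p}"]) auto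
    then show ?thesis by (simp add: p)
  qed
  finally show ?thesis by (simp add: A_def)
qed

text \<open>The index m = k - i runs from the other end of the binomial sum, as in the moment
  formulas.\<close>

lemma fps_nth_binomial_expansion:
  fixes g \<phi> :: "complex fps"
  shows "fps_nth (g * (1 + fps_X * \<phi>) ^ Suc k) k = (\<Sum>m\<le>k. of_nat (Suc k choose Suc m) * fps_nth (g * \<phi> ^ (k - m)) m)"
proof -
  have "(1 + fps_X * \<phi>) ^ Suc k = (\<Sum>i\<le>Suc k. of_nat (Suc k choose i) * (fps_X ^ i * \<phi> ^ i))"
    using binomial_ring[of "fps_X * \<phi>" 1 "Suc k"] by (simp add: add.commute power_mult_distrib mult.assoc)
  then have "g * (1 + fps_X * \<phi>) ^ Suc k = (\<Sum>i\<le>Suc k. fps_const (of_nat (Suc k choose i)) * (fps_X ^ i * (g * \<phi> ^ i)))"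
    by (simp only: fps_of_nat sum_distrib_left mult_ac)
  then have "fps_nth (g * (1 + fps_X * \<phi>) ^ Suc k) k = (\<Sum>i\<le>Suc k. of_nat (Suc k choose i) * (if k < i then 0 else fps_nth (g * \<phi> ^ i) (k - i)))"
    by (simp only: fps_sum_nth fps_mult_left_const_nth fps_nth_power_X_mult)
  also have "\<dots> = (\<Sum>i\<le>k. of_nat (Suc k choose i) * fps_nth (g * \<phi> ^ i) (k - i))"
    by simp
  also have "\<dots> = (\<Sum>m\<le>k. of_nat (Suc k choose Suc m) * fps_nth (g * \<phi> ^ (k - m)) m)"
  proof (rule sum.reindex_bij_witness[of _ "\<lambda>m. k - m" "\<lambda>i. k - i"])
    fix i assume i: "i \<in> {..k}"
    have "Suc k choose i = (Suc k choose (Suc k - i))" using i by (intro binomial_symmetric) auto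
    moreover have "Suc k - i = Suc (k - i)" using i by auto
    ultimately show "of_nat (Suc k choose Suc (k - i)) * fps_nth (g * \<phi> ^ (k - (k - i))) (k - i) = of_nat (Suc k choose i) * fps_nth (g * \<phi> ^ i) (k - i)"
      using i by simp
  qed auto
  finally show ?thesis .
qed

text \<open>Both moment formulas are Lagrange inversions: with \<open>1 + Y\<close> the common inverse series,
  \<open>\<Lambda> = log (1 + Y)\<close> and \<open>E\<^sub>q (\<Omega>) = 1 + Y\<close>, so that \<open>\<Omega>' = (1 - q \<Omega>) \<Lambda>'\<close>.\<close>
lemma fps_moment_transform:
  fixes \<psi> Eq :: "complex fps" and q :: complex
  assumes Eq0: "fps_nth Eq 0 = 1" and ode: "fps_deriv Eq * (1 - fps_const q * fps_X) = Eq"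
  defines "b \<equiv> Eq * (1 + (Eq - 1) * (\<psi> oo (Eq - 1))) * inverse (fps_shift 1 (Eq - 1))"
  obtains \<Lambda> \<Omega> :: "complex fps" where
    "\<And>k. of_nat (Suc k) * fps_nth \<Lambda> (Suc k) = fps_nth ((1 + fps_X) ^ k * (1 + fps_X * \<psi>) ^ Suc k) k"
    "\<And>k. of_nat (Suc k) * fps_nth \<Omega> (Suc k) = fps_nth (b ^ Suc k) k"
    "fps_nth \<Omega> 0 = 0" "fps_deriv \<Omega> = (1 - fps_const q * \<Omega>) * fps_deriv \<Lambda>"
proof -
  define E where "E = Eq - 1"
  have E0: "fps_nth E 0 = 0" by (simp add: E_def Eq0)
  have E1: "fps_nth E 1 = 1"
  proof -
    have "fps_nth (fps_deriv Eq * (1 - fps_const q * fps_X)) 0 = 1" unfolding ode by (rule Eq0)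
    then show ?thesis by (simp add: E_def)
  qed
  \<comment> \<open>Chosen so that L' = 1 / (1 + X) times a^(k+1) is the series of the first
    formula.\<close>
  define a where "a = (1 + fps_X) * (1 + fps_X * \<psi>)"
  have a0: "fps_nth a 0 = 1" by (simp add: a_def)
  define A where "A = fps_X * inverse a"
  have A0: "fps_nth A 0 = 0" and A1: "fps_nth A 1 = 1" by (simp_all add: A_def a0)
  have Aa: "A * a = fps_X" using a0 by (simp add: A_def inverse_mult_eq_1 mult.assoc)
  define Y where "Y = fps_inv A"
  have Y0: "fps_nth Y 0 = 0" by (simp add: Y_def fps_inv_def)
  have YA: "Y oo A = fps_X" unfolding Y_def by (rule fps_inv) (use A0 A1 in simp_all)
  define L where "L = fps_integral0 (inverse (1 + fps_X :: complex fps))"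
  have dL: "fps_deriv L = inverse (1 + fps_X)" unfolding L_def by (rule fps_deriv_fps_integral)
  define \<Lambda> where "\<Lambda> = L oo Y"
  \<comment> \<open>B turns out to be X / b. Once b is written as 1 + X R, its inverse \<Omega> is
    the moment series attached to the R-transform R, each moment standing one index higher.\<close>
  define B where "B = A oo E"
  have B0: "fps_nth B 0 = 0" by (simp add: B_def A0)
  have B1: "fps_nth B 1 = 1" using A0 A1 E1 by (simp add: B_def fps_compose_nth)
  define \<Omega> where "\<Omega> = fps_inv B"
  have \<Omega>0: "fps_nth \<Omega> 0 = 0" by (simp add: \<Omega>_def fps_inv_def)
  have \<Omega>B: "\<Omega> oo B = fps_X" unfolding \<Omega>_def by (rule fps_inv) (use B0 B1 in simp_all)
  have B\<Omega>: "B oo \<Omega> = fps_X" unfolding \<Omega>_def by (rule fps_inv_right) (use B0 B1 in simp_all)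
  have E\<Omega>0: "fps_nth (E oo \<Omega>) 0 = 0" by (simp add: E0)
  \<comment> \<open>Both series are compositional inverses of A; this equality links the two moment
    formulas.\<close>
  have E\<Omega>: "E oo \<Omega> = Y"
  proof -
    have "A oo (E oo \<Omega>) = fps_X" using B\<Omega> unfolding B_def by (simp add: fps_compose_assoc[OF \<Omega>0 E0])
    then have "Y oo (A oo (E oo \<Omega>)) = Y" by simp
    moreover have "Y oo (A oo (E oo \<Omega>)) = (Y oo A) oo (E oo \<Omega>)" by (rule fps_compose_assoc[OF E\<Omega>0 A0])
    ultimately show ?thesis unfolding YA using E\<Omega>0 by simp
  qed
  show ?thesis
  proof (rule that[of \<Lambda> \<Omega>])
    fix k
    have "\<Lambda> oo A = L" unfolding \<Lambda>_def using fps_compose_assoc[OF A0 Y0, of L] by (simp add: YA)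
    then have "of_nat (Suc k) * fps_nth \<Lambda> (Suc k) = fps_nth (fps_deriv L * a ^ Suc k) k"
      using fps_lagrange_inversion[of a "Suc k" \<Lambda>] a0 by (simp add: A_def)
    also have "fps_deriv L * a ^ Suc k = (1 + fps_X) ^ k * (1 + fps_X * \<psi>) ^ Suc k"
    proof -
      have i: "inverse (1 + fps_X :: complex fps) * (1 + fps_X) = 1" by (rule inverse_mult_eq_1) simp
      have "fps_deriv L * a ^ Suc k = (inverse (1 + fps_X) * (1 + fps_X)) * ((1 + fps_X) ^ k * (1 + fps_X * \<psi>) ^ Suc k)"
        unfolding dL a_def power_mult_distrib power_Suc[of "1 + fps_X"] by (simp only: mult_ac)
      then show ?thesis by (simp only: i mult_1_left)
    qed
    finally show "of_nat (Suc k) * fps_nth \<Lambda> (Suc k) = fps_nth ((1 + fps_X) ^ k * (1 + fps_X * \<psi>) ^ Suc k) k" .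
  next
    fix k
    have bE: "b = Eq * (1 + E * (\<psi> oo E)) * inverse (fps_shift 1 E)" by (simp add: b_def E_def)
    have sh: "fps_X * fps_shift 1 E = E" by (rule fps_ext) (simp add: fps_X_mult_nth E0)
    have sh0: "fps_nth (fps_shift 1 E) 0 = 1" using E1 by simp
    have aE: "a oo E = Eq * (1 + E * (\<psi> oo E))"
      unfolding a_def by (simp add: fps_compose_mult_distrib[OF E0] fps_compose_add_distrib E0) (simp add: E_def)
    have BaE: "B * (Eq * (1 + E * (\<psi> oo E))) = E"
      using arg_cong[OF Aa, of "\<lambda>f. f oo E"] by (simp add: fps_compose_mult_distrib[OF E0] B_def aE E0)
    have Bb: "B * b = fps_X"
    proof -
      have "B * b = E * inverse (fps_shift 1 E)" unfolding bE mult.assoc[symmetric] using BaE by (simp add: mult.assoc)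
      also have "\<dots> = fps_X * (fps_shift 1 E * inverse (fps_shift 1 E))" using sh by (simp add: mult.assoc[symmetric])
      also have "fps_shift 1 E * inverse (fps_shift 1 E) = 1" by (rule inverse_mult_eq_1') (simp add: sh0[simplified])
      finally show ?thesis by simp
    qed
    have b0: "fps_nth b 0 = 1" unfolding bE using sh0 by (simp add: Eq0 E0)
    have "B = fps_X * inverse b"
    proof -
      have "b * inverse b = 1" using b0 by (intro inverse_mult_eq_1') simp
      then have "B = B * (b * inverse b)" by simp
      also have "\<dots> = fps_X * inverse b" unfolding mult.assoc[symmetric] Bb ..
      finally show ?thesis .
    qed
    then show "of_nat (Suc k) * fps_nth \<Omega> (Suc k) = fps_nth (b ^ Suc k) k"
      using fps_lagrange_inversion[of b "Suc k" \<Omega>] b0 \<Omega>B by simp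
  next
    show "fps_nth \<Omega> 0 = 0" by (rule \<Omega>0)
    define Z where "Z = 1 + Y"
    have ZE: "Eq oo \<Omega> = Z"
    proof -
      have "Eq = 1 + E" by (simp add: E_def)
      then show ?thesis using E\<Omega> by (simp add: Z_def fps_compose_add_distrib)
    qed
    \<comment> \<open>This expresses that \<Lambda> is the logarithm of Z. Comparison with Z as the
      composite of Eq with \<Omega>, through the differential equation of Eq, determines
      \<Omega>'.\<close>
    have dZ: "fps_deriv Z = fps_deriv \<Lambda> * Z"
    proof -
      have "(inverse (1 + fps_X) * (1 + fps_X :: complex fps)) oo Y = 1"
        by (subst inverse_mult_eq_1) simp_all
      then have "(fps_deriv L oo Y) * Z = 1" unfolding dL Z_def by (simp add: fps_compose_mult_distrib[OF Y0] fps_compose_add_distrib Y0)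
      moreover have "fps_deriv \<Lambda> = (fps_deriv L oo Y) * fps_deriv Y" unfolding \<Lambda>_def by (rule fps_compose_deriv[OF Y0])
      moreover have "fps_deriv Z = fps_deriv Y" by (simp add: Z_def)
      ultimately show ?thesis by (simp add: mult.assoc mult.commute[of "fps_deriv Y"])
    qed
    have c: "(fps_deriv Eq oo \<Omega>) * (1 - fps_const q * \<Omega>) = Z"
      using arg_cong[OF ode, of "\<lambda>f. f oo \<Omega>"] unfolding ZE
      by (simp add: fps_compose_mult_distrib[OF \<Omega>0] fps_compose_sub_distrib \<Omega>0)
    have "fps_deriv Z = (fps_deriv Eq oo \<Omega>) * fps_deriv \<Omega>" unfolding ZE[symmetric] by (rule fps_compose_deriv[OF \<Omega>0])
    then have "fps_deriv \<Lambda> * Z * (1 - fps_const q * \<Omega>) = ((fps_deriv Eq oo \<Omega>) * (1 - fps_const q * \<Omega>)) * fps_deriv \<Omega>"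
      unfolding dZ by (simp only: mult_ac)
    then have "fps_deriv \<Lambda> * Z * (1 - fps_const q * \<Omega>) = Z * fps_deriv \<Omega>" unfolding c .
    then have "Z * (fps_deriv \<Omega> - (1 - fps_const q * \<Omega>) * fps_deriv \<Lambda>) = 0" by (simp add: algebra_simps)
    moreover have "Z \<noteq> 0"
    proof
      assume "Z = 0"
      then have "fps_nth Z 0 = 0" by simp
      then show False by (simp add: Z_def Y0)
    qed
    ultimately have "fps_deriv \<Omega> - (1 - fps_const q * \<Omega>) * fps_deriv \<Lambda> = 0" by (metis mult_eq_0_iff)
    then show "fps_deriv \<Omega> = (1 - fps_const q * \<Omega>) * fps_deriv \<Lambda>" by simp
  qed
qed

section \<open>The limiting moments\<close>

text \<open>The zero series is separate, since its subdegree is 0 by convention while the shift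
  requires subdegree at least 1.\<close>

lemma has_fps_expansion_shift_1:
  fixes f :: "complex \<Rightarrow> complex"
  assumes f: "f has_fps_expansion F" and F0: "fps_nth F 0 = 0"
  shows "(\<lambda>x. if x = 0 then fps_nth F 1 else f x / x) has_fps_expansion fps_shift 1 F"
proof (cases "F = 0")
  case True
  have "\<forall>\<^sub>F x in nhds 0. f x = 0" using f unfolding True has_fps_expansion_0_iff .
  then have "\<forall>\<^sub>F x in nhds 0. (if x = 0 then fps_nth F 1 else f x / x) = 0"
    by eventually_elim (simp add: True)
  then show ?thesis unfolding True by (simp add: has_fps_expansion_0_iff)
next
  case False
  then have "1 \<le> subdegree F" using F0 by (intro subdegree_geI) auto
  then show ?thesis using has_fps_expansion_shift[OF f, of 1 "fps_nth F 1"] by (simp only: power_one_right simp_thms)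
qed

text \<open>The value 1 at 0 and the differential equation (1 - q u) e' = e describe both branches
  of \<open>e_q\<close> uniformly in q. For nonzero q the expansion is the binomial series with
  exponent -1 / q at -q u.\<close>

lemma e_q_has_fps_expansion:
  obtains E where "e_q q has_fps_expansion E" "fps_nth E 0 = 1"
    "fps_deriv E * (1 - fps_const (of_real q) * fps_X) = E"
proof (cases "q = 0")
  case True
  have "e_q q = exp" using True by (auto simp: e_q_def)
  then have "e_q q has_fps_expansion fps_exp 1" by (simp add: has_fps_expansion_exp1)
  then show ?thesis by (rule that) (simp_all add: True)
next
  case False
  define c :: complex where "c = - 1 / of_real q"
  define G :: "complex fps" where "G = fps_const (- of_real q) * fps_X"
  have G0: "fps_nth G 0 = 0" by (simp add: G_def)
  define B where "B = fps_binomial c"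
  have 1: "(\<lambda>x. - of_real q * x) has_fps_expansion G"
    unfolding G_def by (intro has_fps_expansion_cmult_left has_fps_expansion_fps_X)
  have "((\<lambda>x. (1 + x) powr c) \<circ> (\<lambda>x. - of_real q * x)) has_fps_expansion (B oo G)"
    unfolding B_def by (intro has_fps_expansion_compose has_fps_expansion_binomial_complex 1 G0)
  moreover have "(\<lambda>x. (1 + x) powr c) \<circ> (\<lambda>x. - of_real q * x) = e_q q"
    using False by (auto simp: e_q_def c_def)
  ultimately have "e_q q has_fps_expansion (B oo G)" by simp
  then show ?thesis
  proof (rule that)
    show "fps_nth (B oo G) 0 = 1" by (simp add: B_def)
    have "fps_deriv B = fps_const c * B / (1 + fps_X)" unfolding B_def by (rule fps_binomial_deriv)
    then have dB: "fps_deriv B * (1 + fps_X) = fps_const c * B" by simp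
    have dG: "fps_deriv G = fps_const (- of_real q)" by (simp add: G_def)
    have G': "1 - fps_const (of_real q) * fps_X = (1 + fps_X) oo G"
      by (simp add: fps_compose_add_distrib G0) (simp add: G_def fps_const_neg[symmetric] del: fps_const_neg)
    have "fps_deriv (B oo G) * (1 - fps_const (of_real q) * fps_X) = ((fps_deriv B * (1 + fps_X)) oo G) * fps_const (- of_real q)"
      unfolding fps_compose_deriv[OF G0] G' fps_compose_mult_distrib[OF G0] dG by (simp only: mult_ac)
    also have "\<dots> = fps_const (c * (- of_real q)) * (B oo G)"
      unfolding dB fps_compose_mult_distrib[OF G0] fps_const_compose fps_const_mult[symmetric] by (simp only: mult_ac)
    also have "c * (- of_real q) = 1" using False by (simp add: c_def)
    finally show "fps_deriv (B oo G) * (1 - fps_const (of_real q) * fps_X) = B oo G" by simp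
  qed
qed

text \<open>Over a common denominator, 1 + u * Rfun is e (1 + (e - 1) \<Psi>'(e)) / s, where e is
  the value of \<open>e_q\<close> and s = (e - 1) / u tends to 1. This is analytic at 0 with value
  1, so the two poles in \<open>Rfun\<close> cancel.\<close>

lemma Rfun_ext_has_fps_expansion:
  assumes anal: "\<Psi> analytic_on {1}"
    and E: "e_q q has_fps_expansion E" "fps_nth E 0 = 1" "fps_nth E 1 = 1"
  defines "\<psi> \<equiv> fps_expansion (deriv \<Psi>) 1"
  defines "b \<equiv> E * (1 + (E - 1) * (\<psi> oo (E - 1))) * inverse (fps_shift 1 (E - 1))"
  obtains R where "Rfun_ext \<Psi> q has_fps_expansion R" "b = 1 + fps_X * R"
proof -
  define s where "s = (\<lambda>u. if u = 0 then fps_nth (E - 1) 1 else (e_q q u - 1) / u)"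
  have E1: "(\<lambda>u. e_q q u - 1) has_fps_expansion E - 1" by (intro has_fps_expansion_diff E has_fps_expansion_1)
  have E10: "fps_nth (E - 1) 0 = 0" using E by simp
  have s: "s has_fps_expansion fps_shift 1 (E - 1)" unfolding s_def by (rule has_fps_expansion_shift_1[OF E1 E10])
  have s0: "fps_nth (fps_shift 1 (E - 1)) 0 = 1" using E by simp
  have "deriv \<Psi> analytic_on {1}" by (rule analytic_deriv[OF anal])
  then have "(\<lambda>x. deriv \<Psi> (1 + x)) has_fps_expansion \<psi>" unfolding \<psi>_def by (rule analytic_at_imp_has_fps_expansion)
  then have "((\<lambda>x. deriv \<Psi> (1 + x)) \<circ> (\<lambda>u. e_q q u - 1)) has_fps_expansion (\<psi> oo (E - 1))"
    by (intro has_fps_expansion_compose E1 E10)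
  then have d: "(\<lambda>u. deriv \<Psi> (e_q q u)) has_fps_expansion (\<psi> oo (E - 1))" by (simp add: o_def)
  define h where "h = (\<lambda>u. e_q q u * (1 + (e_q q u - 1) * deriv \<Psi> (e_q q u)) * inverse (s u) - 1)"
  have h: "h has_fps_expansion b - 1"
    unfolding h_def b_def using s0
    by (intro has_fps_expansion_diff has_fps_expansion_mult has_fps_expansion_add has_fps_expansion_inverse has_fps_expansion_1 E E1 d s) auto
  have b0: "fps_nth (b - 1) 0 = 0" unfolding b_def using E s0 by simp
  define R where "R = fps_shift 1 (b - 1)"
  define g where "g = (\<lambda>u. if u = 0 then fps_nth (b - 1) 1 else h u / u)"
  have g: "g has_fps_expansion R" unfolding g_def R_def by (rule has_fps_expansion_shift_1[OF h b0])
  have "(s \<longlongrightarrow> 1) (nhds 0)" using has_fps_expansion_imp_tendsto_0[OF s] s0 by simp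
  then have "\<forall>\<^sub>F u in nhds 0. s u \<noteq> 0" by (rule tendsto_imp_eventually_ne) simp
  then have Rg: "\<forall>\<^sub>F u in nhds 0. u \<noteq> 0 \<longrightarrow> Rfun \<Psi> q u = g u"
  proof eventually_elim
    case (elim u)
    show ?case
    proof
      assume u: "u \<noteq> 0"
      then have "e_q q u - 1 \<noteq> 0" using elim by (simp add: s_def)
      then show "Rfun \<Psi> q u = g u" using u by (simp add: Rfun_def g_def h_def s_def field_simps)
    qed
  qed
  have "(g \<longlongrightarrow> fps_nth R 0) (at 0)"
    using has_fps_expansion_imp_tendsto_0[OF g] by (rule tendsto_mono[rotated]) (simp add: at_within_le_nhds)
  moreover have "\<forall>\<^sub>F u in at 0. g u = Rfun \<Psi> q u"
    using Rg unfolding eventually_at_filter by eventually_elim auto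
  ultimately have "(Rfun \<Psi> q \<longlongrightarrow> fps_nth R 0) (at 0)" by (rule Lim_transform_eventually)
  then have Lim: "Lim (at 0) (Rfun \<Psi> q) = fps_nth R 0" by (intro tendsto_Lim) auto
  have "\<forall>\<^sub>F u in nhds 0. g u = Rfun_ext \<Psi> q u"
    using Rg by eventually_elim (use Lim in \<open>auto simp: Rfun_ext_def g_def R_def\<close>)
  then have "Rfun_ext \<Psi> q has_fps_expansion R" using g by (subst has_fps_expansion_cong[symmetric]) auto
  moreover have "b = 1 + fps_X * R"
  proof -
    have "fps_X * R = b - 1" unfolding R_def by (rule fps_ext) (use b0 in \<open>simp add: fps_X_mult_nth\<close>)
    then show ?thesis by simp
  qed
  ultimately show ?thesis by (rule that)
qed

lemma binomial_Suc_Suc_fact: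
  assumes "m \<le> k"
  shows "real (Suc k choose Suc m) = real (Suc k) * (fact k / (fact (Suc m) * fact (k - m)))"
  using binomial_fact[of "Suc m" "Suc k", where 'a = real] assms by (simp add: field_simps)

text \<open>The expansion has one more term, m = k: the coefficient of order k of the constant
  series 1, which vanishes for k at least 1.\<close>

lemma limit_moment_fps_nth:
  assumes R: "Rfun_ext \<Psi> q has_fps_expansion R" and k: "k \<ge> 1"
  shows "of_nat (Suc k) * limit_moment \<Psi> q k = fps_nth ((1 + fps_X * R) ^ Suc k) k"
proof -
  have "fps_nth ((1 + fps_X * R) ^ Suc k) k = (\<Sum>m\<le>k. of_nat (Suc k choose Suc m) * fps_nth (R ^ (k - m)) m)"
    using fps_nth_binomial_expansion[of 1 R k] by simp
  also have "\<dots> = (\<Sum>m<k. of_nat (Suc k choose Suc m) * fps_nth (R ^ (k - m)) m)"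
    using k by (intro sum.mono_neutral_right) (auto simp: not_less)
  also have "\<dots> = (\<Sum>m<k. of_nat (Suc k) * (of_real (fact k / (fact m * fact (m + 1) * fact (k - m))) * (deriv ^^ m) (\<lambda>u. Rfun_ext \<Psi> q u ^ (k - m)) 0))"
  proof (intro sum.cong refl)
    fix m assume m: "m \<in> {..<k}"
    have n: "fps_nth (R ^ (k - m)) m = (deriv ^^ m) (\<lambda>u. Rfun_ext \<Psi> q u ^ (k - m)) 0 / fact m"
      by (rule fps_nth_fps_expansion[OF has_fps_expansion_power[OF R]])
    have "of_nat (Suc k choose Suc m) = complex_of_real (real (Suc k choose Suc m))" by simp
    also have "\<dots> = of_nat (Suc k) * of_real (fact k / (fact (Suc m) * fact (k - m)))"
      using m by (subst binomial_Suc_Suc_fact) (auto simp del: fact_Suc of_nat_Suc)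
    finally show "of_nat (Suc k choose Suc m) * fps_nth (R ^ (k - m)) m =
      of_nat (Suc k) * (of_real (fact k / (fact m * fact (m + 1) * fact (k - m))) * (deriv ^^ m) (\<lambda>u. Rfun_ext \<Psi> q u ^ (k - m)) 0)"
      unfolding n by (simp add: mult_ac del: fact_Suc of_nat_Suc)
  qed
  finally show ?thesis by (simp only: limit_moment_def sum_distrib_left)
qed

context schur_lln begin

text \<open>The Taylor coefficients at 1 of z^k \<Psi>'(z)^(k-m) are those at 0 of (1 + X)^k
  \<psi>^(k-m), so the limiting power sums are of the form produced by Lagrange inversion.\<close>

lemma Mlim_fps_nth:
  "of_nat (Suc k) * Mlim k = fps_nth ((1 + fps_X) ^ k * (1 + fps_X * fps_expansion (deriv \<Psi>) 1) ^ Suc k) k"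
proof -
  define \<psi> where "\<psi> = fps_expansion (deriv \<Psi>) 1"
  have an: "deriv \<Psi> analytic_on {1}" by (rule analytic_deriv[OF anal])
  then have d: "(\<lambda>x. deriv \<Psi> (1 + x)) has_fps_expansion \<psi>" unfolding \<psi>_def by (rule analytic_at_imp_has_fps_expansion)
  have n: "(deriv ^^ m) (\<lambda>z. z ^ k * deriv \<Psi> z ^ (k - m)) 1 / fact m = fps_nth ((1 + fps_X) ^ k * \<psi> ^ (k - m)) m" for m
  proof -
    let ?f = "\<lambda>z. z ^ k * deriv \<Psi> z ^ (k - m)"
    have "?f analytic_on {1}" by (intro analytic_intros an)
    then have "(\<lambda>x. ?f (1 + x)) has_fps_expansion fps_expansion ?f 1" by (rule analytic_at_imp_has_fps_expansion)
    moreover have "(\<lambda>x. ?f (1 + x)) has_fps_expansion (1 + fps_X) ^ k * \<psi> ^ (k - m)"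
      by (intro has_fps_expansion_mult has_fps_expansion_power has_fps_expansion_add has_fps_expansion_1 has_fps_expansion_fps_X d)
    ultimately have "fps_expansion ?f 1 = (1 + fps_X) ^ k * \<psi> ^ (k - m)" by (rule fps_expansion_unique_complex)
    then have "fps_nth (fps_expansion ?f 1) m = fps_nth ((1 + fps_X) ^ k * \<psi> ^ (k - m)) m" by (rule arg_cong)
    then show ?thesis unfolding fps_expansion_def fps_nth_Abs_fps .
  qed
  have "fps_nth ((1 + fps_X) ^ k * (1 + fps_X * \<psi>) ^ Suc k) k = (\<Sum>m\<le>k. of_nat (Suc k choose Suc m) * fps_nth ((1 + fps_X) ^ k * \<psi> ^ (k - m)) m)"
    by (rule fps_nth_binomial_expansion)
  also have "\<dots> = (\<Sum>m\<le>k. of_nat (Suc k) * (of_real (fact k / fact (k - m)) * (fps_nth ((1 + fps_X) ^ k * \<psi> ^ (k - m)) m / of_real (fact (Suc m)))))"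
  proof (intro sum.cong refl)
    fix m assume m: "m \<in> {..k}"
    have "of_nat (Suc k choose Suc m) = complex_of_real (real (Suc k choose Suc m))" by simp
    also have "\<dots> = of_nat (Suc k) * of_real (fact k / (fact (Suc m) * fact (k - m)))"
      using m by (subst binomial_Suc_Suc_fact) (auto simp del: fact_Suc of_nat_Suc)
    finally show "of_nat (Suc k choose Suc m) * fps_nth ((1 + fps_X) ^ k * \<psi> ^ (k - m)) m =
      of_nat (Suc k) * (of_real (fact k / fact (k - m)) * (fps_nth ((1 + fps_X) ^ k * \<psi> ^ (k - m)) m / of_real (fact (Suc m))))"
      by (simp add: mult_ac del: fact_Suc of_nat_Suc)
  qed
  finally show ?thesis by (simp only: Mlim_def n[symmetric] sum_distrib_left \<psi>_def[symmetric])
qed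

text \<open>After normalisation the term s carries 1 / N^(b-1-s). Only s = b - 1 survives, with
  coefficient b.\<close>

lemma shifted_power_sum_conv_prob:
  assumes b: "b \<ge> 1"
  shows "conv_prob (\<lambda>N l. (\<Sum>j\<in>{1..N}. \<Sum>s<b. real (b choose s) * real_of_int (ell N l j) ^ s * q ^ (b - 1 - s)) / real N ^ b)
    (real b * \<mu> (b - 1))"
proof -
  let ?c = "\<lambda>s N. real (b choose s) * q ^ (b - 1 - s) * (1 / real N) ^ (b - 1 - s)"
  let ?d = "\<lambda>s. real (b choose s) * q ^ (b - 1 - s) * (if s = b - 1 then 1 else 0)"
  let ?Y = "\<lambda>s N l. (\<Sum>i\<in>{1..N}. real_of_int (ell N l i) ^ s) / real N ^ Suc s"
  have c: "?c s \<longlonglongrightarrow> ?d s" if s: "s \<in> {..<b}" for s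
  proof (cases "s = b - 1")
    case False
    have "(\<lambda>N. 1 / real N) \<longlonglongrightarrow> 0" by real_asymp
    then have "(\<lambda>N. (1 / real N) ^ (b - 1 - s)) \<longlonglongrightarrow> 0 ^ (b - 1 - s)" by (rule tendsto_power)
    moreover have "b - 1 - s \<noteq> 0" using s False by auto
    ultimately have "(\<lambda>N. (1 / real N) ^ (b - 1 - s)) \<longlonglongrightarrow> 0" by (simp add: power_0_left)
    then show ?thesis using False by (simp only: if_False) (intro tendsto_mult tendsto_const)
  qed simp
  have "conv_prob (\<lambda>N l. \<Sum>s<b. ?c s N * ?Y s N l) (\<Sum>s<b. ?d s * \<mu> s)"
    by (intro conv_prob_sum conv_prob_mult conv_prob_det power_sum_conv_prob c) auto
  moreover have "(\<Sum>s<b. ?d s * \<mu> s) = real b * \<mu> (b - 1)"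
  proof -
    have "(\<Sum>s<b. ?d s * \<mu> s) = (\<Sum>s\<in>{b - 1}. ?d s * \<mu> s)" using b by (intro sum.mono_neutral_right) auto
    moreover have "b choose (b - 1) = b" using b by (cases b) auto
    ultimately show ?thesis by simp
  qed
  ultimately have "conv_prob (\<lambda>N l. \<Sum>s<b. ?c s N * ?Y s N l) (real b * \<mu> (b - 1))" by simp
  then show ?thesis
  proof (rule conv_prob_cong, intro eventually_mono[OF eventually_ge_at_top[of 1]] ballI)
    fix N :: nat and l assume N: "1 \<le> N"
    have "?c s N * ?Y s N l = (\<Sum>j\<in>{1..N}. real (b choose s) * real_of_int (ell N l j) ^ s * q ^ (b - 1 - s)) / real N ^ b" if s: "s \<in> {..<b}" for s
    proof -
      have e: "real N ^ b = real N ^ (b - 1 - s) * real N ^ Suc s" using s by (simp flip: power_add power_Suc)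
      have "(\<Sum>j\<in>{1..N}. real (b choose s) * real_of_int (ell N l j) ^ s * q ^ (b - 1 - s)) = real (b choose s) * q ^ (b - 1 - s) * (\<Sum>i\<in>{1..N}. real_of_int (ell N l i) ^ s)"
        unfolding sum_distrib_left by (intro sum.cong refl) (simp only: mult_ac)
      then show ?thesis unfolding e by (simp add: power_one_over)
    qed
    then have "(\<Sum>s<b. ?c s N * ?Y s N l) = (\<Sum>s<b. (\<Sum>j\<in>{1..N}. real (b choose s) * real_of_int (ell N l j) ^ s * q ^ (b - 1 - s)) / real N ^ b)"
      by (rule sum.cong[OF refl])
    also have "\<dots> = (\<Sum>j\<in>{1..N}. \<Sum>s<b. real (b choose s) * real_of_int (ell N l j) ^ s * q ^ (b - 1 - s)) / real N ^ b"
      unfolding sum_divide_distrib[symmetric] by (subst sum.swap) (rule refl)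
    finally show "(\<Sum>s<b. ?c s N * ?Y s N l) = (\<Sum>j\<in>{1..N}. \<Sum>s<b. real (b choose s) * real_of_int (ell N l j) ^ s * q ^ (b - 1 - s)) / real N ^ b" .
  qed
qed

text \<open>Strong induction on k: the exact recurrence at finite N expresses a moment by lower ones
  and by sums with known limits, and \<open>rec\<close> is the limit of that recurrence.\<close>

lemma pp_moment_conv_prob:
  assumes rec: "\<And>k. real (Suc k) * y k = real (Suc k) * \<mu> k - q * (\<Sum>b=1..k. y (k - b) * (real b * \<mu> (b - 1)))"
  shows "conv_prob (\<lambda>N l. pp_moment N q l k) (y k)"
proof (induction k rule: less_induct)
  case (less k)
  let ?C = "\<lambda>b N l. (\<Sum>j\<in>{1..N}. \<Sum>s<b. real (b choose s) * real_of_int (ell N l j) ^ s * q ^ (b - 1 - s))"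
  let ?c = "\<lambda>b N l. ?C b N l / real N ^ b"
  let ?p = "\<lambda>k N l. pp_moment N q l k"
  have "conv_prob (\<lambda>N l. ?c (Suc k) N l + - q * (\<Sum>b=1..k. ?p (k - b) N l * ?c b N l))
     (real (Suc k) * \<mu> (Suc k - 1) + - q * (\<Sum>b=1..k. y (k - b) * (real b * \<mu> (b - 1))))"
    by (intro conv_prob_add conv_prob_mult conv_prob_sum conv_prob_det[OF tendsto_const] shifted_power_sum_conv_prob less.IH) auto
  then have "conv_prob (\<lambda>N l. 1 / real (Suc k) * (?c (Suc k) N l + - q * (\<Sum>b=1..k. ?p (k - b) N l * ?c b N l))) (1 / real (Suc k) * (real (Suc k) * y k))"
    unfolding rec by (intro conv_prob_mult conv_prob_det[OF tendsto_const]) simp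
  then have "conv_prob (\<lambda>N l. 1 / real (Suc k) * (?c (Suc k) N l + - q * (\<Sum>b=1..k. ?p (k - b) N l * ?c b N l))) (y k)" by simp
  then show ?case
  proof (rule conv_prob_cong, intro eventually_mono[OF eventually_ge_at_top[of 1]] ballI)
    fix N :: nat and l assume N: "1 \<le> N" and l: "l \<in> signatures N"
    define x where "x = (\<lambda>i. real_of_int (ell N l i))"
    define w where "w = (\<lambda>i. \<Prod>j\<in>{1..N}-{i}. (x i - x j - q) / (x i - x j))"
    \<comment> \<open>The shifted coordinates decrease strictly even where the signature is
      constant, so the nodes are distinct.\<close>
    have dec: "x j < x i" if "1 \<le> i" "i < j" "j \<le> N" for i j
    proof -
      have "l j \<le> l i" using l that by (auto simp: signatures_def)
      then show ?thesis using that by (simp add: x_def ell_def)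
    qed
    have inj: "inj_on x {1..N}"
    proof (rule inj_onI, rule ccontr)
      fix i j assume "i \<in> {1..N}" "j \<in> {1..N}" "x i = x j" "i \<noteq> j"
      then show False using dec[of i j] dec[of j i] by (cases "i < j") auto
    qed
    have pw: "pp_weight N q l i = w i" for i
      unfolding pp_weight_def w_def by (intro prod.cong refl) (simp add: x_def ell_def algebra_simps)
    have p: "?p a N l = (\<Sum>i\<in>{1..N}. w i * x i ^ a) / real N ^ Suc a" for a
    proof -
      have "?p a N l = 1 / real N * (\<Sum>i\<in>{1..N}. w i * x i ^ a / real N ^ a)"
        unfolding pp_moment_def pw by (simp add: x_def ell_def power_divide)
      then show ?thesis unfolding sum_divide_distrib[symmetric] by simp
    qed
    have "real (Suc k) * (\<Sum>i\<in>{1..N}. w i * x i ^ k) = ?C (Suc k) N l - q * (\<Sum>b=1..k. (\<Sum>i\<in>{1..N}. w i * x i ^ (k - b)) * ?C b N l)"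
      using pp_power_sum_recurrence[OF _ inj, where q = q and k = k] unfolding w_def x_def by simp
    then have "real (Suc k) * (\<Sum>i\<in>{1..N}. w i * x i ^ k) / real N ^ Suc k
       = (?C (Suc k) N l - q * (\<Sum>b=1..k. (\<Sum>i\<in>{1..N}. w i * x i ^ (k - b)) * ?C b N l)) / real N ^ Suc k" by (rule arg_cong)
    also have "\<dots> = ?c (Suc k) N l + - q * (\<Sum>b=1..k. (\<Sum>i\<in>{1..N}. w i * x i ^ (k - b)) * ?C b N l / real N ^ Suc k)"
      unfolding sum_divide_distrib[symmetric] by (simp add: diff_divide_distrib)
    also have "(\<Sum>b=1..k. (\<Sum>i\<in>{1..N}. w i * x i ^ (k - b)) * ?C b N l / real N ^ Suc k) = (\<Sum>b=1..k. ?p (k - b) N l * ?c b N l)"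
    proof (intro sum.cong refl)
      fix b assume "b \<in> {1..k}"
      then have "real N ^ Suc k = real N ^ Suc (k - b) * real N ^ b" by (simp flip: power_add)
      then show "(\<Sum>i\<in>{1..N}. w i * x i ^ (k - b)) * ?C b N l / real N ^ Suc k = ?p (k - b) N l * ?c b N l"
        unfolding p by simp
    qed
    finally have m: "real (Suc k) * ?p k N l = ?c (Suc k) N l + - q * (\<Sum>b=1..k. ?p (k - b) N l * ?c b N l)"
      unfolding p[of k] by simp
    show "1 / real (Suc k) * (?c (Suc k) N l + - q * (\<Sum>b=1..k. ?p (k - b) N l * ?c b N l)) = ?p k N l"
      unfolding m[symmetric] by simp
  qed
qed

text \<open>Comparing coefficients in \<Omega>' = (1 - q \<Omega>) \<Lambda>' gives the limiting
  recurrence. Its data are real, so the coefficients of \<Omega>, defined through complex series,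
  are real by induction.\<close>

lemma pp_moment_limit:
  obtains y where "\<And>k. k \<ge> 1 \<Longrightarrow> limit_moment \<Psi> q k = of_real (y k)"
    "\<And>k. conv_prob (\<lambda>N l. pp_moment N q l k) (y k)"
proof -
  define \<psi> where "\<psi> = fps_expansion (deriv \<Psi>) 1"
  obtain E where E: "e_q q has_fps_expansion E" "fps_nth E 0 = 1" "fps_deriv E * (1 - fps_const (of_real q) * fps_X) = E"
    by (rule e_q_has_fps_expansion)
  have "fps_nth (fps_deriv E * (1 - fps_const (of_real q) * fps_X)) 0 = 1" unfolding E(3) by (rule E(2))
  then have E1: "fps_nth E 1 = 1" by simp
  define b where "b = E * (1 + (E - 1) * (\<psi> oo (E - 1))) * inverse (fps_shift 1 (E - 1))"
  obtain R where R: "Rfun_ext \<Psi> q has_fps_expansion R" "b = 1 + fps_X * R"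
    using Rfun_ext_has_fps_expansion[OF anal E(1,2) E1] unfolding b_def \<psi>_def .
  obtain \<Lambda> \<Omega> :: "complex fps" where
    \<Lambda>: "\<And>k. of_nat (Suc k) * fps_nth \<Lambda> (Suc k) = fps_nth ((1 + fps_X) ^ k * (1 + fps_X * \<psi>) ^ Suc k) k" and
    \<Omega>: "\<And>k. of_nat (Suc k) * fps_nth \<Omega> (Suc k) = fps_nth (b ^ Suc k) k" and
    \<Omega>0: "fps_nth \<Omega> 0 = 0" and d: "fps_deriv \<Omega> = (1 - fps_const (of_real q) * \<Omega>) * fps_deriv \<Lambda>"
    by (rule fps_moment_transform[OF E(2,3), of \<psi>, folded b_def]) (rule that, simp_all only:)
  have \<Lambda>\<mu>: "fps_nth \<Lambda> (Suc k) = of_real (\<mu> k)" for k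
  proof -
    have "of_nat (Suc k) * fps_nth \<Lambda> (Suc k) = of_nat (Suc k) * Mlim k" unfolding \<Lambda> Mlim_fps_nth \<psi>_def ..
    then have "fps_nth \<Lambda> (Suc k) = Mlim k" by (simp only: mult_left_cancel[OF of_nat_neq_0])
    then show ?thesis using ek_conv_prob(1)[of k] by (simp add: \<mu>_def)
  qed
  have rec: "of_nat (Suc k) * fps_nth \<Omega> (Suc k) = of_real (real (Suc k) * \<mu> k) - of_real q * (\<Sum>b=1..k. fps_nth \<Omega> (Suc (k - b)) * of_real (real b * \<mu> (b - 1)))" for k
  proof -
    define D where "D = 1 - fps_const (complex_of_real q) * \<Omega>"
    have D: "fps_nth D i = (if i = 0 then 1 else - of_real q * fps_nth \<Omega> i)" for i by (simp add: D_def \<Omega>0)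
    have L: "fps_nth (fps_deriv \<Lambda>) i = of_real (real (Suc i) * \<mu> i)" for i using \<Lambda>\<mu>[of i] by simp
    have "of_nat (Suc k) * fps_nth \<Omega> (Suc k) = fps_nth (fps_deriv \<Omega>) k" by simp
    also have "\<dots> = (\<Sum>i=0..k. fps_nth D i * fps_nth (fps_deriv \<Lambda>) (k - i))" unfolding d D_def[symmetric] by (rule fps_mult_nth)
    also have "\<dots> = fps_nth D 0 * fps_nth (fps_deriv \<Lambda>) k + (\<Sum>i=1..k. fps_nth D i * fps_nth (fps_deriv \<Lambda>) (k - i))"
      by (simp add: sum.atLeast_Suc_atMost del: fps_deriv_nth)
    also have "(\<Sum>i=1..k. fps_nth D i * fps_nth (fps_deriv \<Lambda>) (k - i)) = (\<Sum>i=1..k. - of_real q * (fps_nth \<Omega> i * of_real (real (Suc (k - i)) * \<mu> (k - i))))"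
      by (intro sum.cong refl) (simp only: D L, auto)
    also have "\<dots> = (\<Sum>b=1..k. - of_real q * (fps_nth \<Omega> (Suc (k - b)) * of_real (real b * \<mu> (b - 1))))"
      by (rule sum.reindex_bij_witness[of _ "\<lambda>b. Suc k - b" "\<lambda>i. Suc k - i"]) (auto simp: Suc_diff_le)
    finally show ?thesis unfolding L D by (simp add: sum_distrib_left sum_negf)
  qed
  define y where "y = (\<lambda>k. Re (fps_nth \<Omega> (Suc k)))"
  have y: "fps_nth \<Omega> (Suc k) = of_real (y k)" for k
  proof (induction k rule: less_induct)
    case (less k)
    have "(\<Sum>b=1..k. fps_nth \<Omega> (Suc (k - b)) * complex_of_real (real b * \<mu> (b - 1))) = (\<Sum>b=1..k. of_real (y (k - b)) * of_real (real b * \<mu> (b - 1)))"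
      by (intro sum.cong refl) (subst less.IH, auto)
    then have e: "of_nat (Suc k) * fps_nth \<Omega> (Suc k) = of_real (real (Suc k) * \<mu> k - q * (\<Sum>b=1..k. y (k - b) * (real b * \<mu> (b - 1))))"
      unfolding rec by simp
    have "real (Suc k) * Im (fps_nth \<Omega> (Suc k)) = Im (of_nat (Suc k) * fps_nth \<Omega> (Suc k))" by simp
    also have "\<dots> = 0" unfolding e by (rule Im_complex_of_real)
    finally show ?case by (simp add: y_def complex_eq_iff)
  qed
  have yr: "real (Suc k) * y k = real (Suc k) * \<mu> k - q * (\<Sum>b=1..k. y (k - b) * (real b * \<mu> (b - 1)))" for k
  proof -
    have "complex_of_real (real (Suc k) * y k) = of_real (real (Suc k) * \<mu> k - q * (\<Sum>b=1..k. y (k - b) * (real b * \<mu> (b - 1))))"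
      using rec[of k] unfolding y by simp
    then show ?thesis by (simp only: of_real_eq_iff)
  qed
  show ?thesis
  proof (rule that)
    fix k :: nat assume "k \<ge> 1"
    then have "of_nat (Suc k) * limit_moment \<Psi> q k = of_nat (Suc k) * fps_nth \<Omega> (Suc k)"
      unfolding \<Omega> R(2) by (rule limit_moment_fps_nth[OF R(1)])
    then show "limit_moment \<Psi> q k = of_real (y k)" unfolding y by (simp only: mult_left_cancel[OF of_nat_neq_0])
  next
    show "conv_prob (\<lambda>N l. pp_moment N q l k) (y k)" for k by (rule pp_moment_conv_prob[OF yr])
  qed
qed

end

theorem theorem16:
  fixes q :: real and \<rho> :: "nat \<Rightarrow> (nat \<Rightarrow> int) pmf" and \<Psi> :: "complex \<Rightarrow> complex"
  assumes q: "-1 \<le> q" "q \<le> 1"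
    and supp: "\<And>N. set_pmf (\<rho> N) \<subseteq> signatures N"
    and conv: "\<And>N. N \<ge> 1 \<Longrightarrow> sgf_unif_conv N (\<rho> N)"
    and anal: "\<Psi> analytic_on {1}"
    and hyp: "\<And>r. r \<ge> 1 \<Longrightarrow> \<exists>d>0. \<exists>L :: nat \<Rightarrow> (nat \<Rightarrow> complex) \<Rightarrow> complex.
               (\<forall>\<^sub>F N in sequentially. continuous_on (polydisc r d) (L N) \<and> L N (\<lambda>_. 1) = 0 \<and>
                   (\<forall>u\<in>polydisc r d. exp (L N u) = sgf N (\<rho> N) u)) \<and>
               (\<forall>e>0. \<forall>\<^sub>F N in sequentially. \<forall>u\<in>polydisc r d.
                   cmod (L N u / of_nat N - (\<Sum>i=1..r. \<Psi> (u i))) < e)"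
    and k: "k \<ge> 1"
  shows "\<forall>e>0. (\<lambda>N. measure_pmf.prob (\<rho> N)
                 {l. cmod (of_real (pp_moment N q l k) - limit_moment \<Psi> q k) > e}) \<longlonglongrightarrow> 0"
proof -
  interpret schur_lln \<rho> \<Psi> using supp conv anal hyp by unfold_locales
  obtain y where y: "\<And>k. k \<ge> 1 \<Longrightarrow> limit_moment \<Psi> q k = of_real (y k)"
    "\<And>k. conv_prob (\<lambda>N l. pp_moment N q l k) (y k)"
    by (rule pp_moment_limit[of q]) (rule that, simp_all only:)
  \<comment> \<open>Since the claimed limit is the real number y k, the complex distance is an
    ordinary absolute value.\<close>
  have "cmod (of_real (pp_moment N q l k) - limit_moment \<Psi> q k) = \<bar>pp_moment N q l k - y k\<bar>" for N l
    unfolding y(1)[OF k] of_real_diff[symmetric] norm_of_real ..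
  then show ?thesis using y(2)[of k] unfolding conv_prob_def by simp
qed

end
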